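(* Let $k$ be an arbitrary field and let $G$ be an arbitrary group such that $\mathrm{soc}(G)$ is essential in $G$ and $\mathrm{char}(k)\notin\Pi(\mathrm{soc}(G))$. Then $G$ has a faithful irreducible representation over $k$ if and only if there is a subgroup $C$ of $\mathrm{A}(G)$ such that $\mathrm{A}(G)/C$ is locally cyclic and $\mathrm{core}_G(C)=1$.
   Context: Groups may be infinite and representations may be infinite dimensional; a representation of $G$ over $k$ corresponds to a left $kG$-module, where $kG$ is the group algebra. It is faithful if only the identity of $G$ acts trivially, and irreducible if the module is nonzero and has no submodules other than $0$ and itself. $\mathrm{soc}(G)$ is the subgroup of $G$ generated by all minimal normal subgroups of $G$ (minimal among the nontrivial normal subgroups). $\mathrm{A}(G)$ is the subgroup of $G$ generated by all minimal normal subgroups of $G$ that are torsion abelian. A normal subgroup $N$ of $G$ is essential if every nontrivial normal subgroup of $G$ intersects $N$ nontrivially. A group is locally cyclic if every finitely generated subgroup of it is cyclic. For a subgroup $C$ of $G$, $\mathrm{core}_G(C)$ is the largest normal subgroup of $G$ contained in $C$, i.e. $\bigcap_{g\in G} gCg^{-1}$. For a group $H$, $\Pi(H)$ is the set of all primes $p$ such that $a^p=1$ for some $a\in H$, $a\neq 1$. *)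

theory Defs
  imports "HOL-Algebra.Algebra"
begin

section \<open>Socle, essential subgroups, cores\<close>

definition minimal_normal :: "('g, 'm) monoid_scheme \<Rightarrow> 'g set \<Rightarrow> bool" where
  "minimal_normal G N \<longleftrightarrow> N \<lhd> G \<and> N \<noteq> {\<one>\<^bsub>G\<^esub>} \<and>
     (\<forall>M. M \<lhd> G \<longrightarrow> M \<subseteq> N \<longrightarrow> M \<noteq> {\<one>\<^bsub>G\<^esub>} \<longrightarrow> M = N)"

definition torsion_abelian :: "('g, 'm) monoid_scheme \<Rightarrow> bool" where
  "torsion_abelian H \<longleftrightarrow> comm_group H \<and>
     (\<forall>x\<in>carrier H. \<exists>n::nat. n > 0 \<and> x [^]\<^bsub>H\<^esub> n = \<one>\<^bsub>H\<^esub>)"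

definition soc :: "('g, 'm) monoid_scheme \<Rightarrow> 'g set" where
  "soc G = generate G (\<Union>{N. minimal_normal G N})"

definition A_sub :: "('g, 'm) monoid_scheme \<Rightarrow> 'g set" where
  "A_sub G = generate G
     (\<Union>{N. minimal_normal G N \<and> torsion_abelian (G\<lparr>carrier := N\<rparr>)})"

definition essential :: "('g, 'm) monoid_scheme \<Rightarrow> 'g set \<Rightarrow> bool" where
  "essential G N \<longleftrightarrow> N \<lhd> G \<and>
     (\<forall>M. M \<lhd> G \<longrightarrow> M \<noteq> {\<one>\<^bsub>G\<^esub>} \<longrightarrow> M \<inter> N \<noteq> {\<one>\<^bsub>G\<^esub>})"

definition locally_cyclic :: "('g, 'm) monoid_scheme \<Rightarrow> bool" where
  "locally_cyclic H \<longleftrightarrow>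
     (\<forall>S. finite S \<longrightarrow> S \<subseteq> carrier H \<longrightarrow> cyclic_group (subgroup_generated H S))"

definition core :: "('g, 'm) monoid_scheme \<Rightarrow> 'g set \<Rightarrow> 'g set" where
  "core G C = (\<Inter>g\<in>carrier G. (g <#\<^bsub>G\<^esub> C) #>\<^bsub>G\<^esub> inv\<^bsub>G\<^esub> g)"

definition torsion_primes :: "('g, 'm) monoid_scheme \<Rightarrow> nat set" where
  "torsion_primes H =
     {p. Factorial_Ring.prime p \<and> (\<exists>a\<in>carrier H. a \<noteq> \<one>\<^bsub>H\<^esub> \<and> a [^]\<^bsub>H\<^esub> p = \<one>\<^bsub>H\<^esub>)}"

text \<open>The order of an element of infinite order is \<open>0\<close>, so this is the usual characteristic.\<close>

definition ring_char :: "('k, 'm) ring_scheme \<Rightarrow> nat" where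
  "ring_char K = group.ord (add_monoid K) \<one>\<^bsub>K\<^esub>"


section \<open>Linear representations\<close>

text \<open>
  A left module over the group algebra of \<open>G\<close> over \<open>K\<close>, given as a \<open>K\<close>-vector space \<open>V\<close>
  (of any dimension) on which \<open>G\<close> acts by \<open>K\<close>-linear bijections.
\<close>

locale group_representation = field K + module K V + group_action G "carrier V" \<rho>
  for G :: "('g, 'm) monoid_scheme" (structure) and K :: "('k, 'l) ring_scheme" (structure)
    and V :: "('k, 'v, 'n) module_scheme" (structure) and \<rho> +
  assumes rep_add: "\<lbrakk>g \<in> carrier G; v \<in> carrier V; w \<in> carrier V\<rbrakk>
      \<Longrightarrow> \<rho> g (v \<oplus>\<^bsub>V\<^esub> w) = \<rho> g v \<oplus>\<^bsub>V\<^esub> \<rho> g w"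
    and rep_smult: "\<lbrakk>g \<in> carrier G; a \<in> carrier K; v \<in> carrier V\<rbrakk>
      \<Longrightarrow> \<rho> g (a \<odot>\<^bsub>V\<^esub> v) = a \<odot>\<^bsub>V\<^esub> \<rho> g v"

definition faithful_rep ::
  "('g, 'm) monoid_scheme \<Rightarrow> ('k, 'v, 'n) module_scheme \<Rightarrow> ('g \<Rightarrow> 'v \<Rightarrow> 'v) \<Rightarrow> bool" where
  "faithful_rep G V \<rho> \<longleftrightarrow>
     (\<forall>g\<in>carrier G. (\<forall>v\<in>carrier V. \<rho> g v = v) \<longrightarrow> g = \<one>\<^bsub>G\<^esub>)"

definition irreducible_rep ::
  "('g, 'm) monoid_scheme \<Rightarrow> ('k, 'l) ring_scheme \<Rightarrow> ('k, 'v, 'n) module_scheme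
    \<Rightarrow> ('g \<Rightarrow> 'v \<Rightarrow> 'v) \<Rightarrow> bool" where
  "irreducible_rep G K V \<rho> \<longleftrightarrow> carrier V \<noteq> {\<zero>\<^bsub>V\<^esub>} \<and>
     (\<forall>W. submodule W K V \<longrightarrow> (\<forall>g\<in>carrier G. \<rho> g ` W \<subseteq> W)
        \<longrightarrow> W = {\<zero>\<^bsub>V\<^esub>} \<or> W = carrier V)"

text \<open>
  HOL cannot quantify existentially over the type of vectors. An irreducible module is a
  quotient of the group algebra, whose elements are functions \<open>'g \<Rightarrow> 'k\<close>, so vectors can be
  taken to be cosets, i.e. of type \<open>('g \<Rightarrow> 'k) set\<close>. The lemma \<open>has_faithful_irreducible_repI\<close>
  below shows that a representation on any other type would do as well.
\<close>

definition has_faithful_irreducible_rep ::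
  "('g, 'm) monoid_scheme \<Rightarrow> ('k, 'l) ring_scheme \<Rightarrow> bool" where
  "has_faithful_irreducible_rep G K \<longleftrightarrow>
     (\<exists>(V :: ('k, ('g \<Rightarrow> 'k) set) module) \<rho>.
        group_representation G K V \<rho> \<and> faithful_rep G V \<rho> \<and> irreducible_rep G K V \<rho>)"


subsection \<open>Independence of the type of vectors\<close>

lemma (in group_action) action_closed:
  "g \<in> carrier G \<Longrightarrow> x \<in> E \<Longrightarrow> \<phi> g x \<in> E"
  using surj_prop by blast

context group_representation
begin

inductive_set orbit_span for v where
  zero: "\<zero>\<^bsub>V\<^esub> \<in> orbit_span v"
| step: "\<lbrakk>x \<in> orbit_span v; g \<in> carrier G; a \<in> carrier K\<rbrakk>
    \<Longrightarrow> x \<oplus>\<^bsub>V\<^esub> a \<odot>\<^bsub>V\<^esub> \<rho> g v \<in> orbit_span v"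

lemma orbit_span_carrier:
  assumes "v \<in> carrier V" "x \<in> orbit_span v"
  shows "x \<in> carrier V"
  using assms(2) by induction (auto simp: assms(1) action_closed)

lemma orbit_span_add:
  assumes v: "v \<in> carrier V" and x: "x \<in> orbit_span v" and y: "y \<in> orbit_span v"
  shows "x \<oplus>\<^bsub>V\<^esub> y \<in> orbit_span v"
  using y
proof induction
  case zero
  then show ?case using x orbit_span_carrier[OF v] by simp
next
  case (step y g a)
  then have "(x \<oplus>\<^bsub>V\<^esub> y) \<oplus>\<^bsub>V\<^esub> a \<odot>\<^bsub>V\<^esub> \<rho> g v \<in> orbit_span v"
    by (intro orbit_span.step)
  then show ?case
    using step x orbit_span_carrier[OF v] v by (simp add: M.a_assoc action_closed)
qed

lemma orbit_span_smult:
  assumes v: "v \<in> carrier V" and b: "b \<in> carrier K" and y: "y \<in> orbit_span v"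
  shows "b \<odot>\<^bsub>V\<^esub> y \<in> orbit_span v"
  using y
proof induction
  case zero
  then show ?case using b by (simp add: orbit_span.zero)
next
  case (step y g a)
  then have "b \<odot>\<^bsub>V\<^esub> y \<oplus>\<^bsub>V\<^esub> (b \<otimes>\<^bsub>K\<^esub> a) \<odot>\<^bsub>V\<^esub> \<rho> g v \<in> orbit_span v"
    using b by (intro orbit_span.step) auto
  then show ?case
    using step b orbit_span_carrier[OF v] v
    by (simp add: smult_r_distr smult_assoc1 action_closed)
qed

lemma rep_zero: "g \<in> carrier G \<Longrightarrow> \<rho> g \<zero>\<^bsub>V\<^esub> = \<zero>\<^bsub>V\<^esub>"
  using rep_smult[of g "\<zero>\<^bsub>K\<^esub>" "\<zero>\<^bsub>V\<^esub>"] by (simp add: action_closed)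

lemma orbit_span_rep:
  assumes v: "v \<in> carrier V" and h: "h \<in> carrier G" and y: "y \<in> orbit_span v"
  shows "\<rho> h y \<in> orbit_span v"
  using y
proof induction
  case zero
  then show ?case using h by (simp add: rep_zero orbit_span.zero)
next
  case (step y g a)
  interpret G: group G
    using group_hom group_hom.axioms(1) by blast
  have "\<rho> h y \<oplus>\<^bsub>V\<^esub> a \<odot>\<^bsub>V\<^esub> \<rho> (h \<otimes>\<^bsub>G\<^esub> g) v \<in> orbit_span v"
    using h step by (intro orbit_span.step) auto
  then show ?case
    using step h orbit_span_carrier[OF v] v
    by (simp add: rep_add rep_smult composition_rule action_closed)
qed

lemma orbit_span_submodule:
  assumes v: "v \<in> carrier V"
  shows "submodule (orbit_span v) K V"
proof (rule submoduleI)
  show "\<ominus>\<^bsub>V\<^esub> a \<in> orbit_span v" if "a \<in> orbit_span v" for a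
  proof -
    have "(\<ominus>\<^bsub>K\<^esub> \<one>\<^bsub>K\<^esub>) \<odot>\<^bsub>V\<^esub> a = \<ominus>\<^bsub>V\<^esub> a"
      using that orbit_span_carrier[OF v] by (simp add: smult_l_minus)
    then show ?thesis
      using orbit_span_smult[OF v _ that, of "\<ominus>\<^bsub>K\<^esub> \<one>\<^bsub>K\<^esub>"] by simp
  qed
qed (auto intro: orbit_span.zero orbit_span_carrier[OF v] orbit_span_add[OF v]
    orbit_span_smult[OF v])

lemma orbit_span_base:
  assumes v: "v \<in> carrier V"
  shows "v \<in> orbit_span v"
proof -
  interpret G: group G
    using group_hom group_hom.axioms(1) by blast
  have "\<rho> \<one>\<^bsub>G\<^esub> v = v"
    using id_eq_one v by (metis restrict_apply')
  then show ?thesis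
    using orbit_span.step[OF orbit_span.zero[of v] G.one_closed one_closed] v by simp
qed

definition orbit_eval :: "_ \<Rightarrow> (_ \<Rightarrow> _) \<Rightarrow> _" where
  "orbit_eval v f = finsum V (\<lambda>g. f g \<odot>\<^bsub>V\<^esub> \<rho> g v) {g \<in> carrier G. f g \<noteq> \<zero>\<^bsub>K\<^esub>}"

lemma orbit_eval_split:
  assumes v: "v \<in> carrier V" and f: "f \<in> carrier G \<rightarrow> carrier K"
    and fin: "finite {g \<in> carrier G. f g \<noteq> \<zero>\<^bsub>K\<^esub>}" and g: "g \<in> carrier G"
  shows "orbit_eval v f = f g \<odot>\<^bsub>V\<^esub> \<rho> g v \<oplus>\<^bsub>V\<^esub>
     finsum V (\<lambda>g. f g \<odot>\<^bsub>V\<^esub> \<rho> g v) ({g \<in> carrier G. f g \<noteq> \<zero>\<^bsub>K\<^esub>} - {g})"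
proof -
  let ?T = "{g \<in> carrier G. f g \<noteq> \<zero>\<^bsub>K\<^esub>}"
  let ?s = "\<lambda>g. f g \<odot>\<^bsub>V\<^esub> \<rho> g v"
  have s: "?s h \<in> carrier V" if "h \<in> carrier G" for h
    using that f v by (auto simp: action_closed Pi_def)
  then have sP: "?s \<in> ?T - {g} \<rightarrow> carrier V" by auto
  show ?thesis
  proof (cases "f g = \<zero>\<^bsub>K\<^esub>")
    case True
    then have "?T - {g} = ?T" by auto
    moreover have "finsum V ?s ?T \<in> carrier V"
      using s by (intro M.finsum_closed) auto
    ultimately show ?thesis
      using True g v by (simp add: orbit_eval_def action_closed)
  next
    case False
    then have T: "insert g (?T - {g}) = ?T" using g by auto
    have "finsum V ?s (insert g (?T - {g})) = ?s g \<oplus>\<^bsub>V\<^esub> finsum V ?s (?T - {g})"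
      using fin s[OF g] sP by (intro M.finsum_insert) auto
    then show ?thesis unfolding orbit_eval_def T .
  qed
qed

lemma orbit_span_eval:
  assumes v: "v \<in> carrier V" and x: "x \<in> orbit_span v"
  shows "\<exists>f. f \<in> carrier G \<rightarrow> carrier K \<and> finite {g \<in> carrier G. f g \<noteq> \<zero>\<^bsub>K\<^esub>} \<and>
    orbit_eval v f = x"
  using x
proof induction
  case zero
  show ?case
    by (rule exI[of _ "\<lambda>_. \<zero>\<^bsub>K\<^esub>"]) (simp add: orbit_eval_def)
next
  case (step x g a)
  then obtain f where f: "f \<in> carrier G \<rightarrow> carrier K"
    and fin: "finite {g \<in> carrier G. f g \<noteq> \<zero>\<^bsub>K\<^esub>}" and ev: "orbit_eval v f = x" by blast
  define f' where "f' = f(g := f g \<oplus>\<^bsub>K\<^esub> a)"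
  have fg: "f g \<in> carrier K" using f step by auto
  have f': "f' \<in> carrier G \<rightarrow> carrier K"
    using f step fg by (auto simp: f'_def)
  have fin': "finite {g \<in> carrier G. f' g \<noteq> \<zero>\<^bsub>K\<^esub>}"
    by (rule finite_subset[OF _ finite.insertI[OF fin, of g]]) (auto simp: f'_def)
  let ?S = "finsum V (\<lambda>g. f g \<odot>\<^bsub>V\<^esub> \<rho> g v) ({g \<in> carrier G. f g \<noteq> \<zero>\<^bsub>K\<^esub>} - {g})"
  have S: "?S \<in> carrier V"
    using f v by (intro M.finsum_closed) (auto simp: action_closed Pi_def)
  have T: "{g \<in> carrier G. f' g \<noteq> \<zero>\<^bsub>K\<^esub>} - {g} = {g \<in> carrier G. f g \<noteq> \<zero>\<^bsub>K\<^esub>} - {g}"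
    by (auto simp: f'_def)
  have "finsum V (\<lambda>g. f' g \<odot>\<^bsub>V\<^esub> \<rho> g v) ({g \<in> carrier G. f' g \<noteq> \<zero>\<^bsub>K\<^esub>} - {g}) = ?S"
    unfolding T using f v
    by (intro M.finsum_cong') (auto simp: f'_def action_closed Pi_def)
  moreover have "f' g = f g \<oplus>\<^bsub>K\<^esub> a" by (simp add: f'_def)
  ultimately have "orbit_eval v f' = (f g \<oplus>\<^bsub>K\<^esub> a) \<odot>\<^bsub>V\<^esub> \<rho> g v \<oplus>\<^bsub>V\<^esub> ?S"
    using orbit_eval_split[OF v f' fin' step.hyps(2)] by argo
  also have "\<dots> = x \<oplus>\<^bsub>V\<^esub> a \<odot>\<^bsub>V\<^esub> \<rho> g v"
    using orbit_eval_split[OF v f fin, of g] step S fg v ev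
    by (simp add: smult_l_distr action_closed M.a_ac)
  finally show ?case using f' fin' by blast
qed

text \<open>Transport of structure along an injection of the vectors into another type.\<close>

lemma transport:
  fixes h :: "'v \<Rightarrow> 'w"
  assumes h: "inj_on h (carrier V)"
    and faith: "faithful_rep G V \<rho>" and irr: "irreducible_rep G K V \<rho>"
  shows "\<exists>(V' :: ('k, 'w) module) \<rho>'. group_representation G K V' \<rho>' \<and>
    faithful_rep G V' \<rho>' \<and> irreducible_rep G K V' \<rho>'"
proof -
  interpret G: group G
    using group_hom group_hom.axioms(1) by blast
  define i where "i = inv_into (carrier V) h"
  define V' :: "('k, 'w) module" where
    "V' = \<lparr>carrier = h ` carrier V, monoid.mult = undefined, monoid.one = undefined,
      ring.zero = h \<zero>\<^bsub>V\<^esub>,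
      ring.add = \<lambda>x y. h (i x \<oplus>\<^bsub>V\<^esub> i y), module.smult = \<lambda>a x. h (a \<odot>\<^bsub>V\<^esub> i x)\<rparr>"
  define \<rho>' where "\<rho>' g = (\<lambda>x\<in>h ` carrier V. h (\<rho> g (i x)))" for g
  have ih [simp]: "i (h x) = x" if "x \<in> carrier V" for x
    using that h by (simp add: i_def)
  have heq: "h x = h y \<longleftrightarrow> x = y" if "x \<in> carrier V" "y \<in> carrier V" for x y
    using that h by (auto simp: inj_on_def)
  have [simp]: "carrier V' = h ` carrier V" "\<zero>\<^bsub>V'\<^esub> = h \<zero>\<^bsub>V\<^esub>"
    "x \<oplus>\<^bsub>V'\<^esub> y = h (i x \<oplus>\<^bsub>V\<^esub> i y)" "a \<odot>\<^bsub>V'\<^esub> x = h (a \<odot>\<^bsub>V\<^esub> i x)" for x y a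
    by (simp_all add: V'_def)
  have \<rho>'h [simp]: "\<rho>' g (h x) = h (\<rho> g x)" if "x \<in> carrier V" for g x
    using that by (simp add: \<rho>'_def)
  have ab: "abelian_group V'"
  proof (rule abelian_groupI)
    fix x assume "x \<in> carrier V'"
    then obtain y where y: "y \<in> carrier V" "x = h y" by auto
    have "h (\<ominus>\<^bsub>V\<^esub> y) \<oplus>\<^bsub>V'\<^esub> x = \<zero>\<^bsub>V'\<^esub>"
      using y by (simp add: M.l_neg)
    then show "\<exists>y\<in>carrier V'. y \<oplus>\<^bsub>V'\<^esub> x = \<zero>\<^bsub>V'\<^esub>"
      using y(1) by (intro bexI[of _ "h (\<ominus>\<^bsub>V\<^esub> y)"]) auto
  qed (auto simp: M.a_ac)
  have "module K V'"
    by (rule moduleI[OF is_cring ab])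
      (auto simp: smult_l_distr smult_r_distr smult_assoc1)
  moreover have "group_action G (carrier V') \<rho>'"
    unfolding group_action_def group_hom_def group_hom_axioms_def hom_def
  proof (intro conjI G.group_axioms group_BijGroup CollectI ballI funcsetI)
    have bij: "\<rho>' g \<in> Bij (carrier V')" if g: "g \<in> carrier G" for g
    proof -
      have "inj_on (\<rho>' g) (h ` carrier V)"
        using inj_prop[OF g] g by (auto simp: inj_on_def heq action_closed)
      moreover have "\<rho>' g ` (h ` carrier V) = h ` (\<rho> g ` carrier V)"
        by (simp add: image_image)
      ultimately show ?thesis
        using surj_prop[OF g] by (simp add: Bij_def bij_betw_def \<rho>'_def)
    qed
    show "\<rho>' g \<in> carrier (BijGroup (carrier V'))" if "g \<in> carrier G" for g
      using bij[OF that] by (simp add: BijGroup_def)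
    fix a b assume ab: "a \<in> carrier G" "b \<in> carrier G"
    have "\<rho>' (a \<otimes>\<^bsub>G\<^esub> b) = compose (carrier V') (\<rho>' a) (\<rho>' b)"
    proof
      fix x
      show "\<rho>' (a \<otimes>\<^bsub>G\<^esub> b) x = compose (carrier V') (\<rho>' a) (\<rho>' b) x"
      proof (cases "x \<in> h ` carrier V")
        case True
        then obtain y where "y \<in> carrier V" "x = h y" by auto
        then show ?thesis
          using ab by (simp add: compose_def composition_rule action_closed)
      qed (simp add: compose_def \<rho>'_def)
    qed
    then show "\<rho>' (a \<otimes>\<^bsub>G\<^esub> b) = \<rho>' a \<otimes>\<^bsub>BijGroup (carrier V')\<^esub> \<rho>' b"
      using bij[OF ab(1)] bij[OF ab(2)] by (simp add: BijGroup_def)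
  qed
  ultimately have "group_representation G K V' \<rho>'"
    unfolding group_representation_def group_representation_axioms_def
    using field_axioms by (auto simp: rep_add rep_smult action_closed)
  moreover have "faithful_rep G V' \<rho>'"
    unfolding faithful_rep_def
  proof (intro ballI impI)
    fix g assume g: "g \<in> carrier G" and fix_all: "\<forall>v\<in>carrier V'. \<rho>' g v = v"
    have "\<rho> g v = v" if "v \<in> carrier V" for v
      using fix_all that g by (simp add: heq action_closed)
    then show "g = \<one>\<^bsub>G\<^esub>"
      using faith g by (auto simp: faithful_rep_def)
  qed
  moreover have "irreducible_rep G K V' \<rho>'"
    unfolding irreducible_rep_def
  proof (intro conjI allI impI)
    show "carrier V' \<noteq> {\<zero>\<^bsub>V'\<^esub>}"
    proof
      assume triv: "carrier V' = {\<zero>\<^bsub>V'\<^esub>}"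
      have "v = \<zero>\<^bsub>V\<^esub>" if v: "v \<in> carrier V" for v
      proof -
        have "h v \<in> carrier V'" using v by simp
        then have "h v = h \<zero>\<^bsub>V\<^esub>" unfolding triv by simp
        then show ?thesis using v by (simp add: heq)
      qed
      then show False
        using irr M.zero_closed unfolding irreducible_rep_def by blast
    qed
    fix W assume W: "submodule W K V'" and inv: "\<forall>g\<in>carrier G. \<rho>' g ` W \<subseteq> W"
    note WE = module.submoduleE[OF \<open>module K V'\<close> W]
    define U where "U = {x \<in> carrier V. h x \<in> W}"
    have WU: "W = h ` U" using WE(1) by (auto simp: U_def)
    have sm: "h (a \<odot>\<^bsub>V\<^esub> x) \<in> W" if "a \<in> carrier K" "x \<in> carrier V" "h x \<in> W" for a x
      using WE(4)[OF that(1,3)] that(2) by simp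
    have "submodule U K V"
    proof (rule submoduleI)
      obtain w where "w \<in> U" using WE(2) WU by auto
      then show "\<zero>\<^bsub>V\<^esub> \<in> U"
        using sm[of "\<zero>\<^bsub>K\<^esub>" w] by (auto simp: U_def)
      show "\<ominus>\<^bsub>V\<^esub> a \<in> U" if "a \<in> U" for a
        using that sm[of "\<ominus>\<^bsub>K\<^esub> \<one>\<^bsub>K\<^esub>" a] by (simp add: U_def smult_l_minus)
      show "a \<oplus>\<^bsub>V\<^esub> b \<in> U" if "a \<in> U" "b \<in> U" for a b
        using that WE(5)[of "h a" "h b"] by (simp add: U_def)
    qed (auto simp: U_def sm)
    moreover have "\<rho> g ` U \<subseteq> U" if g: "g \<in> carrier G" for g
    proof
      fix y assume "y \<in> \<rho> g ` U"
      then obtain u where u: "u \<in> carrier V" "h u \<in> W" "y = \<rho> g u" by (auto simp: U_def)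
      have "\<rho>' g (h u) \<in> W" using inv g u(2) by blast
      then show "y \<in> U" using u g by (simp add: U_def action_closed)
    qed
    ultimately have "U = {\<zero>\<^bsub>V\<^esub>} \<or> U = carrier V"
      using irr unfolding irreducible_rep_def by blast
    then show "W = {\<zero>\<^bsub>V'\<^esub>} \<or> W = carrier V'"
      using WU by auto
  qed
  ultimately show ?thesis by blast
qed

lemma has_faithful_irreducible_repI:
  assumes faith: "faithful_rep G V \<rho>" and irr: "irreducible_rep G K V \<rho>"
  shows "has_faithful_irreducible_rep G K"
proof -
  obtain v where v: "v \<in> carrier V" "v \<noteq> \<zero>\<^bsub>V\<^esub>"
    using irr M.zero_closed unfolding irreducible_rep_def by blast
  have "orbit_span v = {\<zero>\<^bsub>V\<^esub>} \<or> orbit_span v = carrier V"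
    using irr orbit_span_submodule[OF v(1)] orbit_span_rep[OF v(1)]
    unfolding irreducible_rep_def by blast
  then have span: "orbit_span v = carrier V"
    using orbit_span_base[OF v(1)] v(2) by auto
  have ex: "\<exists>f. orbit_eval v f = x" if "x \<in> carrier V" for x
    using orbit_span_eval[OF v(1), of x] that span by blast
  have "inj_on (\<lambda>x. {f. orbit_eval v f = x}) (carrier V)"
  proof (rule inj_onI)
    fix x y assume x: "x \<in> carrier V"
      and eq: "{f. orbit_eval v f = x} = {f. orbit_eval v f = y}"
    obtain f where "orbit_eval v f = x" using ex[OF x] by blast
    then show "x = y" using eq by blast
  qed
  from transport[OF this faith irr] show ?thesis
    unfolding has_faithful_irreducible_rep_def .
qed

end

end

(*
  Only if: let V be faithful and irreducible, v a nonzero vector and A = A(G). For a finite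
  subgroup H of A write N_H for the sum of its elements, acting on V. Choose a subgroup C of A
  which is maximal such that N_H v is nonzero for arbitrarily large finite H in C. The norms of a
  nontrivial normal subgroup of G inside A eventually kill v, so C has trivial core. If x and m generated a
  subgroup of type (p, p) modulo C, then comparing the sums over its p + 1 subgroups of order p
  with the sum over the whole group would show that p N_H v = 0, so A/C is locally cyclic.

  If: let F be an algebraic closure of K. Suppose that every minimal normal subgroup M has a
  certificate, a pair of a formal sum of elements g(m - 1) with m in M and of a nonzero constant c
  of K, such that for finitely many M at a time some character D -> F of a subgroup D maps each of
  these sums to its c. Extended by zero, the characters form a vector u in a product of copies of
  the functions G -> F, and modulo the functions vanishing at all large finite sets of certificates,
  u is nonzero and satisfies all relations "sum = c". If M acted trivially on an irreducible
  subquotient generated by u, then c u = 0. Hence the kernel contains no M, and it is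
  trivial as soc(G) is essential.

  The certificate of M depends on its type. If some character takes a nontrivial r-th root of unity
  as value at m, take 1 + m + ... + m^(r-1) = 0, written in terms of m^i - 1. This
  covers M torsion abelian, by characters of A with kernel C, and M nonabelian, where partial
  characters extend freely because the center of M is trivial. The torsion-free abelian M generate a
  commutative group; if it has finite rank, it has enough characters with values in the roots of unity. If it has
  infinite rank, there are enough independent elements to reserve two of them, x and y, for each
  element s, and one takes (x + y)(s - 1) = 1, where the values of x and y are chosen after that of s.
*)

theory Submission
  imports Defs
begin

hide_const (open) Ring_Divisibility.mult_of

section \<open>Minimal normal subgroups\<close>

text \<open>The field is arbitrary and V may be infinite dimensional, so a subgroup of A(G) need not
  have eigenvectors in V; an infinite C has no norm element in the group algebra either.
  Nonvanishing of N_H v for arbitrarily large H replaces the existence of a nonzero C-fixed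
  component of v. The identity p N_H v = 0 is a contradiction because p is a torsion prime of the
  socle, hence invertible in k. In the converse, the irreducible module comes from Zorn's lemma and
  is not under control, so faithfulness has to be encoded in relations that pass to every quotient
  in which u survives. The reduced product needs only finitely many relations at a time, but the
  certificate of M must be fixed before the finite set is known. A root certificate fixes in advance
  an order for the value at m, and such choices may clash for different M. In finite rank one
  character serves all torsion-free abelian M together and dictates these orders. In infinite rank
  the relation (x + y)(s - 1) = 1 asks of the value at s only that it is not 1.\<close>

context group begin

lemma mem_set_mult: "x \<in> H <#> K \<longleftrightarrow> (\<exists>h\<in>H. \<exists>k\<in>K. x = h \<otimes> k)"
  by (auto simp: set_mult_def)

lemma inv_mult_cancel:
  assumes "x \<in> carrier G" "y \<in> carrier G"
  shows "x \<otimes> (inv x \<otimes> y) = y" "inv x \<otimes> (x \<otimes> y) = y"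
  using assms by (simp_all flip: m_assoc)

lemma exists_prime_order_pow:
  assumes x: "x \<in> carrier G" "x \<noteq> \<one>" "ord x \<noteq> 0"
  obtains p k :: nat where "Factorial_Ring.prime p" "x [^] k \<noteq> \<one>" "(x [^] k) [^] p = \<one>"
proof -
  have "ord x \<noteq> 1" using x ord_eq_1 by metis
  then obtain p where p: "Factorial_Ring.prime p" "p dvd ord x" using prime_factor_nat by blast
  then obtain q where q: "ord x = p * q" by blast
  have "\<not> p * q dvd q"
    using x(3) q prime_gt_1_nat[OF p(1)] by (auto dest!: dvd_imp_le)
  then have "x [^] q \<noteq> \<one>" using x(1) q by (simp add: pow_eq_id)
  moreover have "(x [^] q) [^] p = \<one>"
    using x(1) q by (simp add: nat_pow_pow mult.commute pow_eq_id)
  ultimately show thesis using p(1) that by blast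
qed

lemma nat_pow_conj:
  assumes "g \<in> carrier G" "h \<in> carrier G"
  shows "(g \<otimes> h \<otimes> inv g) [^] (k::nat) = g \<otimes> h [^] k \<otimes> inv g"
  using assms by (induction k) (simp_all add: m_assoc inv_mult_cancel)

lemma generate_commute:
  assumes "S \<subseteq> carrier G" "z \<in> carrier G" "\<And>s. s \<in> S \<Longrightarrow> s \<otimes> z = z \<otimes> s" "x \<in> generate G S"
  shows "x \<otimes> z = z \<otimes> x"
  using assms(4)
proof induction
  case one
  then show ?case using assms(2) by simp
next
  case (incl h)
  then show ?case using assms(3) by simp
next
  case (inv h)
  then have h: "h \<in> carrier G" "h \<otimes> z = z \<otimes> h" using assms(1,3) by auto
  have "inv h \<otimes> z = inv h \<otimes> (z \<otimes> h) \<otimes> inv h"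
    using h(1) assms(2) by (simp add: m_assoc)
  also have "\<dots> = inv h \<otimes> (h \<otimes> z) \<otimes> inv h" by (simp only: h(2))
  also have "\<dots> = z \<otimes> inv h" using h(1) assms(2) by (simp flip: m_assoc)
  finally show ?case .
next
  case (eng a b)
  then have "a \<in> carrier G" "b \<in> carrier G"
    using generate_in_carrier[OF assms(1)] by auto
  then show ?case using eng assms(2) by (metis m_assoc)
qed

lemma generate_commute2:
  assumes S: "S \<subseteq> carrier G" and T: "T \<subseteq> carrier G"
    and "\<And>s t. s \<in> S \<Longrightarrow> t \<in> T \<Longrightarrow> s \<otimes> t = t \<otimes> s" "x \<in> generate G S" "y \<in> generate G T"
  shows "x \<otimes> y = y \<otimes> x"
proof -
  have y: "y \<in> carrier G" using generate_in_carrier[OF T assms(5)] .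
  have "s \<otimes> y = y \<otimes> s" if s: "s \<in> S" for s
  proof -
    have "y \<otimes> s = s \<otimes> y"
      by (rule generate_commute[OF T _ _ assms(5)]) (use s S assms(3) in \<open>force+\<close>)
    then show ?thesis by simp
  qed
  then show ?thesis by (rule generate_commute[OF S y _ assms(4)])
qed

lemma generate_finite_support:
  assumes "x \<in> generate G S"
  shows "\<exists>T. finite T \<and> T \<subseteq> S \<and> x \<in> generate G T"
  using assms
proof induction
  case one
  then show ?case by (intro exI[of _ "{}"]) (auto intro: generate.one)
next
  case (incl h)
  then show ?case by (intro exI[of _ "{h}"]) (auto intro: generate.incl)
next
  case (inv h)
  then show ?case by (intro exI[of _ "{h}"]) (auto intro: generate.inv)
next
  case (eng a b)
  then obtain T U where "finite T" "T \<subseteq> S" "a \<in> generate G T" "finite U" "U \<subseteq> S" "b \<in> generate G U"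
    by blast
  then show ?case
    using mono_generate[of T "T \<union> U"] mono_generate[of U "T \<union> U"]
    by (intro exI[of _ "T \<union> U"]) (auto intro!: generate.eng)
qed

text \<open>An element of the socle involves finitely many minimal normal subgroups, which can be
  added one at a time with \<open>generate_Union_insert\<close>.\<close>

lemma generate_Union_finite_support:
  assumes "x \<in> generate G (\<Union>F)"
  shows "\<exists>F'. finite F' \<and> F' \<subseteq> F \<and> x \<in> generate G (\<Union>F')"
proof -
  obtain T where T: "finite T" "T \<subseteq> \<Union>F" "x \<in> generate G T"
    using generate_finite_support[OF assms] by blast
  then obtain F' where "finite F'" "F' \<subseteq> F" "T \<subseteq> \<Union>F'"
    using finite_subset_Union by metis
  then show ?thesis using T mono_generate[of T "\<Union>F'"] by blast
qed

lemma normal_conj_closed: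
  "N \<lhd> G \<Longrightarrow> x \<in> N \<Longrightarrow> g \<in> carrier G \<Longrightarrow> g \<otimes> x \<otimes> inv g \<in> N"
  by (simp add: normal.inv_op_closed2)

lemma normal_subset_carrier: "N \<lhd> G \<Longrightarrow> N \<subseteq> carrier G"
  by (simp add: normal_imp_subgroup subgroup.subset)

lemma generate_Union_normal:
  assumes "\<And>N. N \<in> F \<Longrightarrow> N \<lhd> G"
  shows "generate G (\<Union>F) \<lhd> G"
proof (rule normal_generateI)
  show "\<Union>F \<subseteq> carrier G" using assms normal_subset_carrier by blast
  show "g \<otimes> h \<otimes> inv g \<in> \<Union>F" if "h \<in> \<Union>F" "g \<in> carrier G" for h g
    using that assms normal_conj_closed by blast
qed

text \<open>Both factors are normal, so their product is already a subgroup. This is the induction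
  step for finite families of normal subgroups.\<close>

lemma generate_Union_insert:
  assumes "\<And>N. N \<in> F \<Longrightarrow> N \<lhd> G" "M \<lhd> G"
  shows "generate G (\<Union>(insert M F)) = generate G (\<Union>F) <#> M"
proof
  note P = generate_Union_normal[OF assms(1)]
  have F: "\<Union>F \<subseteq> carrier G" "M \<subseteq> carrier G" using assms normal_subset_carrier by blast+
  have sub: "subgroup (generate G (\<Union>F) <#> M) G"
    using normal_subgroup_set_mult_closed[OF P assms(2)] normal_imp_subgroup by blast
  have "\<Union>(insert M F) \<subseteq> generate G (\<Union>F) <#> M"
  proof
    fix x assume x: "x \<in> \<Union>(insert M F)"
    then have xc: "x \<in> carrier G" using F by auto
    show "x \<in> generate G (\<Union>F) <#> M"
    proof (cases "x \<in> M")
      case True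
      then have "x = \<one> \<otimes> x" using xc by simp
      then show ?thesis using True generate.one unfolding mem_set_mult by blast
    next
      case False
      then have "x \<in> generate G (\<Union>F)" using x by (auto intro: generate.incl)
      moreover have "\<one> \<in> M" using assms(2) normal_imp_subgroup subgroup.one_closed by blast
      moreover have "x = x \<otimes> \<one>" using xc by simp
      ultimately show ?thesis unfolding mem_set_mult by blast
    qed
  qed
  then show "generate G (\<Union>(insert M F)) \<subseteq> generate G (\<Union>F) <#> M"
    using sub generate_subgroup_incl by blast
  show "generate G (\<Union>F) <#> M \<subseteq> generate G (\<Union>(insert M F))"
  proof
    fix x assume "x \<in> generate G (\<Union>F) <#> M"
    then obtain p m where "p \<in> generate G (\<Union>F)" "m \<in> M" "x = p \<otimes> m" by (auto simp: mem_set_mult)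
    then show "x \<in> generate G (\<Union>(insert M F))"
      using mono_generate[of "\<Union>F" "\<Union>(insert M F)"]
      by (auto intro!: generate.eng[of p] generate.incl[of m])
  qed
qed

lemma minimal_normal_normal: "minimal_normal G M \<Longrightarrow> M \<lhd> G"
  by (simp add: minimal_normal_def)

lemma normal_one_mem: "N \<lhd> G \<Longrightarrow> \<one> \<in> N"
  using normal_imp_subgroup subgroup.one_closed by blast

lemma minimal_normal_Int:
  assumes "minimal_normal G M" "N \<lhd> G"
  shows "M \<inter> N = {\<one>} \<or> M \<subseteq> N"
proof -
  have "M \<inter> N \<lhd> G" using assms normal_subgroup_intersect minimal_normal_normal by blast
  then show ?thesis using assms(1) unfolding minimal_normal_def by blast
qed

lemma minimal_normal_distinct_Int:
  assumes "minimal_normal G M" "minimal_normal G N" "M \<noteq> N"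
  shows "M \<inter> N = {\<one>}"
  using assms minimal_normal_Int[of M N] unfolding minimal_normal_def by blast

lemma minimal_normal_commute:
  assumes "minimal_normal G M" "minimal_normal G N" "M \<noteq> N" "x \<in> M" "y \<in> N"
  shows "x \<otimes> y = y \<otimes> x"
proof -
  have "M \<inter> N \<subseteq> {\<one>}" using minimal_normal_distinct_Int[OF assms(1-3)] by simp
  then show ?thesis
    using normal_imp_commuting[OF minimal_normal_normal[OF assms(1)]
        minimal_normal_normal[OF assms(2)] _ assms(4,5)] by blast
qed

text \<open>If \<open>n = q k\<close> lies in \<open>N\<close> but not in \<open>Q\<close>, then
  \<open>k\<close> is a nontrivial element of \<open>M\<close> in the normal subgroup
  \<open>QN\<close>, so minimality gives \<open>M\<close> inside \<open>QN\<close>. Thus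
  \<open>N\<close> projects onto \<open>M\<close> modulo \<open>Q\<close>.\<close>

lemma minimal_normal_project:
  assumes M: "minimal_normal G M" and Q: "Q \<lhd> G" and N: "N \<lhd> G"
    and sub: "N \<subseteq> Q <#> M" and nsub: "\<not> N \<subseteq> Q" and m: "m \<in> M"
  shows "\<exists>q\<in>Q. q \<otimes> m \<in> N"
proof -
  have sQ: "subgroup Q G" and sN: "subgroup N G" and sM: "subgroup M G"
    using Q N minimal_normal_normal[OF M] normal_imp_subgroup by auto
  obtain n where n: "n \<in> N" "n \<notin> Q" using nsub by blast
  obtain q k where qk: "q \<in> Q" "k \<in> M" "n = q \<otimes> k" using sub n by (auto simp: mem_set_mult subset_iff)
  have c: "q \<in> carrier G" "k \<in> carrier G" "n \<in> carrier G"
    using qk n sQ sN sM subgroup.mem_carrier by metis+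
  have "k = inv q \<otimes> n" using qk c by (simp add: inv_solve_left)
  then have "k \<in> Q <#> N" unfolding mem_set_mult
    using qk n subgroup.m_inv_closed[OF sQ] by blast
  moreover have "k \<noteq> \<one>" using qk n c by auto
  ultimately have "M \<subseteq> Q <#> N"
    using minimal_normal_Int[OF M normal_subgroup_set_mult_closed[OF Q N]] qk by blast
  then obtain r l where rl: "r \<in> Q" "l \<in> N" "m = r \<otimes> l" using m by (auto simp: mem_set_mult subset_iff)
  then have "inv r \<otimes> m = l"
    using sQ sN subgroup.mem_carrier by (metis inv_solve_left m_closed)
  then show ?thesis using rl subgroup.m_inv_closed[OF sQ] by blast
qed

text \<open>A normal subgroup of the socle may contain none of the chosen generators, only a
  diagonal subgroup. The induction finds the first factor \<open>M\<close> whose addition makes the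
  product meet \<open>N\<close>; the intersection is then itself minimal normal.\<close>

lemma normal_subset_soc_contains_minimal:
  assumes N: "N \<lhd> G" "N \<noteq> {\<one>}" "N \<subseteq> soc G"
  shows "\<exists>M. minimal_normal G M \<and> M \<subseteq> N"
proof -
  obtain x where x: "x \<in> N" "x \<noteq> \<one>" using N normal_one_mem by blast
  then obtain F where F: "finite F" "F \<subseteq> {M. minimal_normal G M}" "x \<in> generate G (\<Union>F)"
    using N(3) generate_Union_finite_support[of x "{M. minimal_normal G M}"]
    unfolding soc_def by (meson subsetD)
  then have "N \<inter> generate G (\<Union>F) \<noteq> {\<one>}" using x by blast
  with F(1,2) show ?thesis
  proof (induction F)
    case empty
    have "generate G {} = {\<one>}" by (rule generate_empty)
    moreover have "\<one> \<in> N" using normal_one_mem[OF N(1)] .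
    ultimately show ?case using empty by auto
  next
    case (insert M F)
    let ?P = "generate G (\<Union>F)"
    have M: "minimal_normal G M" and Fn: "\<And>N. N \<in> F \<Longrightarrow> N \<lhd> G"
      using insert minimal_normal_normal by blast+
    have P: "?P \<lhd> G" using generate_Union_normal[OF Fn] .
    have PM: "generate G (\<Union>(insert M F)) = ?P <#> M"
      by (rule generate_Union_insert[OF Fn minimal_normal_normal[OF M]])
    show ?case
    proof (cases "N \<inter> ?P = {\<one>}")
      case False
      then show ?thesis using insert by blast
    next
      case True
      \<comment> \<open>Modulo \<open>?P\<close>, this group embeds into \<open>M\<close>, since
        \<open>N\<close> meets \<open>?P\<close> trivially. Every nontrivial normal subgroup of G
        inside \<open>D\<close> projects onto \<open>M\<close>, so it cannot be smaller than
        \<open>D\<close>.\<close>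
      define D where "D = N \<inter> (?P <#> M)"
      have D: "D \<lhd> G" unfolding D_def
        by (rule normal_subgroup_intersect[OF N(1) normal_subgroup_set_mult_closed[OF P minimal_normal_normal[OF M]]])
      have "D' = D" if D': "D' \<lhd> G" "D' \<subseteq> D" "D' \<noteq> {\<one>}" for D'
      proof
        show "D \<subseteq> D'"
        proof
          fix d assume d: "d \<in> D"
          then obtain q m where qm: "q \<in> ?P" "m \<in> M" "d = q \<otimes> m"
            by (auto simp: D_def mem_set_mult)
          have "\<not> D' \<subseteq> ?P" using D' True normal_one_mem[OF D'(1)] D_def by blast
          moreover have "D' \<subseteq> ?P <#> M" using D' D_def by blast
          ultimately obtain r where r: "r \<in> ?P" "r \<otimes> m \<in> D'"
            using minimal_normal_project[OF M P D'(1)] qm(2) by blast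
          have c: "q \<in> carrier G" "r \<in> carrier G" "m \<in> carrier G"
            using qm r normal_subset_carrier[OF P] normal_subset_carrier[OF minimal_normal_normal[OF M]]
            by auto
          have "d \<otimes> inv (r \<otimes> m) = q \<otimes> inv r"
            using c qm by (simp add: inv_mult_group m_assoc inv_mult_cancel)
          moreover have "q \<otimes> inv r \<in> ?P"
            using qm r P normal_imp_subgroup subgroup.m_closed subgroup.m_inv_closed by metis
          moreover have "d \<otimes> inv (r \<otimes> m) \<in> N"
            using d r D' N(1) normal_imp_subgroup subgroup.m_closed subgroup.m_inv_closed D_def
            by (metis Int_iff subsetD)
          ultimately have "q \<otimes> inv r = \<one>" using True by auto
          then have "q = r" using c by (metis inv_equality inv_inv inv_closed)
          then show "d \<in> D'" using qm r by simp
        qed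
      qed (use D' in blast)
      moreover have "D \<noteq> {\<one>}" using insert.prems unfolding D_def PM by blast
      ultimately have "minimal_normal G D"
        using D unfolding minimal_normal_def by blast
      moreover have "D \<subseteq> N" by (simp add: D_def)
      ultimately show ?thesis by blast
    qed
  qed
qed

lemma commuting_set_mult_subgroup:
  assumes U: "subgroup U G" and D: "subgroup D G"
    and comm: "\<And>x d. x \<in> U \<Longrightarrow> d \<in> D \<Longrightarrow> x \<otimes> d = d \<otimes> x"
  shows "subgroup (U <#> D) G"
proof
  note c = subgroup.mem_carrier[OF U] subgroup.mem_carrier[OF D]
  show "U <#> D \<subseteq> carrier G" using c by (auto simp: mem_set_mult)
  show "\<one> \<in> U <#> D"
    unfolding mem_set_mult using subgroup.one_closed[OF U] subgroup.one_closed[OF D] by force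
  fix x assume "x \<in> U <#> D"
  then obtain a b where ab: "a \<in> U" "b \<in> D" "x = a \<otimes> b" by (auto simp: mem_set_mult)
  have "inv x = inv (b \<otimes> a)" using comm[OF ab(1,2)] ab(3) by simp
  then have "inv x = inv a \<otimes> inv b" using ab c by (simp add: inv_mult_group)
  then show "inv x \<in> U <#> D"
    unfolding mem_set_mult using ab subgroup.m_inv_closed[OF U] subgroup.m_inv_closed[OF D] by blast
  fix y assume "y \<in> U <#> D"
  then obtain a' b' where ab': "a' \<in> U" "b' \<in> D" "y = a' \<otimes> b'" by (auto simp: mem_set_mult)
  have "x \<otimes> y = a \<otimes> ((b \<otimes> a') \<otimes> b')" using ab ab' c by (simp add: m_assoc)
  also have "b \<otimes> a' = a' \<otimes> b" by (rule comm[OF ab'(1) ab(2), symmetric])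
  also have "a \<otimes> ((a' \<otimes> b) \<otimes> b') = (a \<otimes> a') \<otimes> (b \<otimes> b')" using ab ab' c by (simp add: m_assoc)
  finally show "x \<otimes> y \<in> U <#> D"
    unfolding mem_set_mult using ab ab' subgroup.m_closed[OF U] subgroup.m_closed[OF D] by blast
qed

lemma subset_set_mult:
  assumes "subgroup U G" "subgroup D G"
  shows "U \<subseteq> U <#> D" "D \<subseteq> U <#> D"
proof -
  note c = subgroup.mem_carrier[OF assms(1)] subgroup.mem_carrier[OF assms(2)]
  have "x = x \<otimes> \<one>" if "x \<in> U" for x using that c by simp
  moreover have "x = \<one> \<otimes> x" if "x \<in> D" for x using that c by simp
  ultimately show "U \<subseteq> U <#> D" "D \<subseteq> U <#> D"
    using subgroup.one_closed[OF assms(1)] subgroup.one_closed[OF assms(2)]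
    unfolding subset_iff mem_set_mult by blast+
qed

lemma finite_generate_torsion:
  assumes "finite S" "S \<subseteq> A" "subgroup A G"
    and comm: "\<And>x y. x \<in> A \<Longrightarrow> y \<in> A \<Longrightarrow> x \<otimes> y = y \<otimes> x"
    and tors: "\<And>x. x \<in> A \<Longrightarrow> \<exists>n::nat. n > 0 \<and> x [^] n = \<one>"
  shows "finite (generate G S)"
  using assms(1,2)
proof (induction S)
  case empty
  then show ?case by (simp add: generate_empty)
next
  case (insert z S)
  have A: "A \<subseteq> carrier G" by (rule subgroup.subset[OF assms(3)])
  have z: "z \<in> A" "z \<in> carrier G" using insert A by auto
  have SA: "generate G S \<subseteq> A" "generate G {z} \<subseteq> A"
    using insert assms(3) z by (intro generate_subgroup_incl; simp)+
  have sub: "subgroup (generate G S) G" "subgroup (generate G {z}) G"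
    using insert A z by (intro generate_is_subgroup; auto)+
  have "subgroup (generate G S <#> generate G {z}) G"
    using sub SA comm by (intro commuting_set_mult_subgroup) blast+
  moreover have "insert z S \<subseteq> generate G S <#> generate G {z}"
    using subset_set_mult[OF sub] generate.incl[of _ S] generate.incl[of z "{z}"] by blast
  ultimately have "generate G (insert z S) \<subseteq> generate G S <#> generate G {z}"
    by (intro generate_subgroup_incl)
  moreover have "finite (generate G {z})"
    using finite_cyclic_subgroup[OF z(2)] tors[OF z(1)] z(2)
    by (auto simp: carrier_subgroup_generated)
  moreover have "finite (generate G S <#> generate G {z})"
    using insert calculation(2) unfolding set_mult_def by auto
  ultimately show ?case using finite_subset by blast
qed

text \<open>Finite subgroups of a torsion abelian group form a directed family, so finitely many
  conditions of the form "for all large enough \<open>H\<close>" can be combined.\<close>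

lemma finite_subgroup_join:
  assumes "finite S" "S \<subseteq> C" "subgroup C G" "C \<subseteq> A" "subgroup A G"
    and comm: "\<And>x y. x \<in> A \<Longrightarrow> y \<in> A \<Longrightarrow> x \<otimes> y = y \<otimes> x"
    and tors: "\<And>x. x \<in> A \<Longrightarrow> \<exists>n::nat. n > 0 \<and> x [^] n = \<one>"
  obtains H where "finite H" "subgroup H G" "S \<subseteq> H" "H \<subseteq> C"
proof
  show "finite (generate G S)"
    using assms by (intro finite_generate_torsion[of S A]) auto
  show "subgroup (generate G S) G"
    using assms subgroup.subset by (intro generate_is_subgroup) blast
  show "S \<subseteq> generate G S" by (auto intro: generate.incl)
  show "generate G S \<subseteq> C" using assms by (intro generate_subgroup_incl)
qed

lemma pow_mem_coprime:
  assumes C: "subgroup C G" and z: "z \<in> carrier G" and "z [^] (n::nat) \<in> C" "z [^] (k::nat) \<in> C"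
    "coprime n k"
  shows "z \<in> C"
proof -
  obtain a b :: int where ab: "a * int n + b * int k = 1"
    using assms(5) bezout_int[of "int n" "int k"] by (auto simp: coprime_iff_gcd_eq_1)
  have "(z [^] int n) [^] a \<in> C" "(z [^] int k) [^] b \<in> C"
    using assms(3,4) subgroup_int_pow_closed[OF C] by (auto simp: int_pow_int)
  then have "z [^] (int n * a) \<otimes> z [^] (int k * b) \<in> C"
    using C z by (simp add: int_pow_pow subgroup.m_closed)
  then have "z [^] (int n * a + int k * b) \<in> C" using z by (simp add: int_pow_mult)
  then show ?thesis using ab z by (simp add: mult.commute)
qed

end

lemma (in abelian_group) minus_eq_zero_iff:
  assumes "x \<in> carrier G" "y \<in> carrier G"
  shows "x \<ominus> y = \<zero> \<longleftrightarrow> x = y"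
proof
  assume "x \<ominus> y = \<zero>"
  then have "x \<oplus> \<ominus> y \<oplus> y = y" using assms by (simp add: a_minus_def)
  then show "x = y" using assms by (simp add: a_assoc l_neg)
qed (use assms in \<open>simp add: a_minus_def r_neg\<close>)

section \<open>Norms over finite subgroups\<close>

lemma (in abelian_monoid) finsum_swap:
  assumes "finite A" "finite B" "\<And>i j. i \<in> A \<Longrightarrow> j \<in> B \<Longrightarrow> f i j \<in> carrier G"
  shows "finsum G (\<lambda>i. finsum G (f i) B) A = finsum G (\<lambda>j. finsum G (\<lambda>i. f i j) A) B"
  using assms(1,3)
proof (induction A)
  case empty
  then show ?case by simp
next
  case (insert a A)
  have "finsum G (\<lambda>j. finsum G (\<lambda>i. f i j) (insert a A)) B
      = finsum G (\<lambda>j. f a j \<oplus> finsum G (\<lambda>i. f i j) A) B"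
    using insert by (intro finsum_cong') auto
  also have "\<dots> = finsum G (f a) B \<oplus> finsum G (\<lambda>j. finsum G (\<lambda>i. f i j) A) B"
    using insert by (intro finsum_addf) auto
  finally show ?case using insert by (auto simp: Pi_def)
qed

context group_representation
begin

lemma group_G: "group G"
  using group_hom group_hom.axioms(1) by blast

lemma rep_mult:
  "\<lbrakk>g \<in> carrier G; h \<in> carrier G; v \<in> carrier V\<rbrakk> \<Longrightarrow> \<rho> (g \<otimes>\<^bsub>G\<^esub> h) v = \<rho> g (\<rho> h v)"
  by (simp add: composition_rule)

lemma rep_one: "v \<in> carrier V \<Longrightarrow> \<rho> \<one>\<^bsub>G\<^esub> v = v"
  using id_eq_one by (metis restrict_apply')

lemma rep_inv_cancel: "\<lbrakk>g \<in> carrier G; v \<in> carrier V\<rbrakk> \<Longrightarrow> \<rho> (inv\<^bsub>G\<^esub> g) (\<rho> g v) = v"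
  using rep_mult[of "inv\<^bsub>G\<^esub> g" g v] group.inv_closed[OF group_G] group.l_inv[OF group_G]
  by (simp add: rep_one)

lemma rep_minus: "\<lbrakk>g \<in> carrier G; v \<in> carrier V\<rbrakk> \<Longrightarrow> \<rho> g (\<ominus>\<^bsub>V\<^esub> v) = \<ominus>\<^bsub>V\<^esub> \<rho> g v"
  by (rule M.minus_equality[symmetric])
    (simp_all add: action_closed rep_zero M.l_neg flip: rep_add)

lemma rep_diff: "\<lbrakk>g \<in> carrier G; v \<in> carrier V; w \<in> carrier V\<rbrakk>
    \<Longrightarrow> \<rho> g (v \<ominus>\<^bsub>V\<^esub> w) = \<rho> g v \<ominus>\<^bsub>V\<^esub> \<rho> g w"
  by (simp add: a_minus_def rep_add rep_minus)

lemma rep_finsum: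
  assumes "finite S" "g \<in> carrier G" "\<And>i. i \<in> S \<Longrightarrow> f i \<in> carrier V"
  shows "\<rho> g (finsum V f S) = finsum V (\<lambda>i. \<rho> g (f i)) S"
  using assms(1,3)
proof (induction S)
  case empty
  then show ?case using assms(2) by (simp add: rep_zero)
next
  case (insert a S)
  then show ?case using assms(2) by (auto simp: rep_add action_closed Pi_def)
qed

definition norm_sum :: "_ set \<Rightarrow> _ \<Rightarrow> _" where
  "norm_sum H v = finsum V (\<lambda>h. \<rho> h v) H"

lemma norm_sum_closed: "\<lbrakk>H \<subseteq> carrier G; v \<in> carrier V\<rbrakk> \<Longrightarrow> norm_sum H v \<in> carrier V"
  unfolding norm_sum_def by (intro M.finsum_closed) (auto simp: action_closed)

lemma norm_sum_add:
  "\<lbrakk>H \<subseteq> carrier G; v \<in> carrier V; w \<in> carrier V\<rbrakk>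
    \<Longrightarrow> norm_sum H (v \<oplus>\<^bsub>V\<^esub> w) = norm_sum H v \<oplus>\<^bsub>V\<^esub> norm_sum H w"
  unfolding norm_sum_def
  by (subst M.finsum_addf[symmetric]) (auto simp: action_closed rep_add intro!: M.finsum_cong')

lemma norm_sum_smult:
  assumes "finite H" "H \<subseteq> carrier G" "v \<in> carrier V" "a \<in> carrier K"
  shows "norm_sum H (a \<odot>\<^bsub>V\<^esub> v) = a \<odot>\<^bsub>V\<^esub> norm_sum H v"
  unfolding norm_sum_def
  using assms
  by (subst finsum_smult_ldistr) (auto simp: action_closed rep_smult intro!: M.finsum_cong')

lemma norm_sum_shift:
  assumes H: "subgroup H G" and z: "z \<in> H" and v: "v \<in> carrier V"
  shows "norm_sum H (\<rho> z v) = norm_sum H v"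
proof -
  interpret G: group G by (rule group_G)
  note c = subgroup.mem_carrier[OF H]
  have img: "(\<lambda>h. h \<otimes>\<^bsub>G\<^esub> z) ` H = H"
  proof
    show "H \<subseteq> (\<lambda>h. h \<otimes>\<^bsub>G\<^esub> z) ` H"
    proof
      fix h assume h: "h \<in> H"
      then have "h = (h \<otimes>\<^bsub>G\<^esub> inv\<^bsub>G\<^esub> z) \<otimes>\<^bsub>G\<^esub> z" using z c by (simp add: G.m_assoc)
      moreover have "h \<otimes>\<^bsub>G\<^esub> inv\<^bsub>G\<^esub> z \<in> H"
        using h z H by (simp add: subgroup.m_closed subgroup.m_inv_closed)
      ultimately show "h \<in> (\<lambda>h. h \<otimes>\<^bsub>G\<^esub> z) ` H" by blast
    qed
  qed (auto intro: subgroup.m_closed[OF H] z)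
  have inj: "inj_on (\<lambda>h. h \<otimes>\<^bsub>G\<^esub> z) H"
    using z by (intro inj_onI) (simp add: c)
  have "norm_sum H v = finsum V (\<lambda>h. \<rho> h v) ((\<lambda>h. h \<otimes>\<^bsub>G\<^esub> z) ` H)"
    unfolding norm_sum_def img ..
  also have "\<dots> = finsum V (\<lambda>h. \<rho> (h \<otimes>\<^bsub>G\<^esub> z) v) H"
    using v c z by (intro M.finsum_reindex inj) (auto simp: action_closed)
  also have "\<dots> = norm_sum H (\<rho> z v)"
    unfolding norm_sum_def using v c z
    by (intro M.finsum_cong') (auto simp: action_closed rep_mult)
  finally show ?thesis ..
qed

text \<open>Translation by \<open>z\<close> permutes \<open>H\<close>, so the norm annihilates the
  image of \<open>z - 1\<close>.\<close>

lemma norm_sum_diff_zero: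
  assumes "subgroup H G" "z \<in> H" "v \<in> carrier V"
  shows "norm_sum H (\<rho> z v \<ominus>\<^bsub>V\<^esub> v) = \<zero>\<^bsub>V\<^esub>"
proof -
  have z: "z \<in> carrier G" and H: "H \<subseteq> carrier G"
    using subgroup.mem_carrier[OF assms(1)] assms(2) by auto
  let ?d = "\<rho> z v \<ominus>\<^bsub>V\<^esub> v"
  have d: "?d \<in> carrier V" using z assms by (simp add: action_closed)
  have "?d \<oplus>\<^bsub>V\<^esub> v = \<rho> z v"
    using z assms by (simp add: action_closed a_minus_def M.a_assoc M.l_neg)
  then have "norm_sum H ?d \<oplus>\<^bsub>V\<^esub> norm_sum H v = norm_sum H v"
    using norm_sum_add[OF H d assms(3)] norm_sum_shift[OF assms] by simp
  then show ?thesis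
    using norm_sum_closed[OF H] d assms(3) by (metis M.add.l_cancel_one' M.a_comm)
qed

text \<open>As \<open>C\<close> may be infinite, "the norm of \<open>C\<close> kills
  \<open>v\<close>" is expressed along the directed family of its finite subgroups.\<close>

definition vanishing :: "_ set \<Rightarrow> _ \<Rightarrow> bool" where
  "vanishing C v \<longleftrightarrow> (\<exists>H0. finite H0 \<and> subgroup H0 G \<and> H0 \<subseteq> C \<and>
     (\<forall>H. finite H \<longrightarrow> subgroup H G \<longrightarrow> H0 \<subseteq> H \<longrightarrow> H \<subseteq> C \<longrightarrow> norm_sum H v = \<zero>\<^bsub>V\<^esub>))"

text \<open>The vectors fixed by \<open>N\<close> form a submodule, which is zero by faithfulness.
  So some \<open>u = m v - v\<close> is nonzero and generates V, and \<open>v\<close> is a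
  combination of vectors \<open>g u = z (g v) - g v\<close> with \<open>z\<close> a conjugate of
  \<open>m\<close>, hence in \<open>N\<close>. A subgroup containing the finitely many
  \<open>z\<close> has a norm that kills them all.\<close>

lemma eventually_vanishing_normal:
  assumes irr: "irreducible_rep G K V \<rho>" and faith: "faithful_rep G V \<rho>"
    and N: "N \<lhd> G" "N \<noteq> {\<one>\<^bsub>G\<^esub>}"
    and comm: "\<And>x y. x \<in> N \<Longrightarrow> y \<in> N \<Longrightarrow> x \<otimes>\<^bsub>G\<^esub> y = y \<otimes>\<^bsub>G\<^esub> x"
    and tors: "\<And>x. x \<in> N \<Longrightarrow> \<exists>n::nat. n > 0 \<and> x [^]\<^bsub>G\<^esub> n = \<one>\<^bsub>G\<^esub>"
    and v: "v \<in> carrier V" "v \<noteq> \<zero>\<^bsub>V\<^esub>"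
  shows "\<exists>H0. finite H0 \<and> subgroup H0 G \<and> H0 \<subseteq> N \<and>
    (\<forall>H. finite H \<longrightarrow> subgroup H G \<longrightarrow> H0 \<subseteq> H \<longrightarrow> norm_sum H v = \<zero>\<^bsub>V\<^esub>)"
proof -
  interpret G: group G by (rule group_G)
  note sN = normal_imp_subgroup[OF N(1)]
  note cN = subgroup.mem_carrier[OF sN]
  obtain m where m: "m \<in> N" "\<rho> m v \<noteq> v"
  proof (rule ccontr)
    assume nt: "\<not> thesis"
    note ex = that
    have fixv: "\<rho> n v = v" if "n \<in> N" for n using that ex nt by blast
    define W where "W = {w \<in> carrier V. \<forall>n\<in>N. \<rho> n w = w}"
    have "submodule W K V"
    proof (rule submoduleI)
      show "\<ominus>\<^bsub>V\<^esub> a \<in> W" if "a \<in> W" for a using that cN by (auto simp: W_def rep_minus)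
      show "a \<odot>\<^bsub>V\<^esub> w \<in> W" if "a \<in> carrier K" "w \<in> W" for a w
        using that cN by (auto simp: W_def rep_smult)
      show "a \<oplus>\<^bsub>V\<^esub> b \<in> W" if "a \<in> W" "b \<in> W" for a b
        using that cN by (auto simp: W_def rep_add)
    qed (use cN in \<open>auto simp: W_def rep_zero\<close>)
    moreover have "\<rho> g ` W \<subseteq> W" if g: "g \<in> carrier G" for g
    proof
      fix y assume "y \<in> \<rho> g ` W"
      then obtain w where w: "w \<in> carrier V" "\<And>n. n \<in> N \<Longrightarrow> \<rho> n w = w" "y = \<rho> g w"
        by (auto simp: W_def)
      have "\<rho> n y = y" if n: "n \<in> N" for n
      proof -
        have "inv\<^bsub>G\<^esub> g \<otimes>\<^bsub>G\<^esub> n \<otimes>\<^bsub>G\<^esub> g \<in> N" using N(1) n g by (simp add: normal.inv_op_closed1)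
        then have "\<rho> (g \<otimes>\<^bsub>G\<^esub> (inv\<^bsub>G\<^esub> g \<otimes>\<^bsub>G\<^esub> n \<otimes>\<^bsub>G\<^esub> g)) w = \<rho> g w"
          using w g cN by (simp add: rep_mult)
        moreover have "g \<otimes>\<^bsub>G\<^esub> (inv\<^bsub>G\<^esub> g \<otimes>\<^bsub>G\<^esub> n \<otimes>\<^bsub>G\<^esub> g) = n \<otimes>\<^bsub>G\<^esub> g"
          using g n cN by (simp add: G.m_assoc G.inv_mult_cancel)
        ultimately show ?thesis using w g n cN by (simp add: rep_mult)
      qed
      then show "y \<in> W" using w g by (auto simp: W_def action_closed)
    qed
    ultimately have "W = {\<zero>\<^bsub>V\<^esub>} \<or> W = carrier V"
      using irr unfolding irreducible_rep_def by blast
    moreover have "v \<in> W" using v fixv by (auto simp: W_def)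
    ultimately have "W = carrier V" using v by auto
    then have "\<forall>n\<in>N. n = \<one>\<^bsub>G\<^esub>"
      using faith cN unfolding faithful_rep_def W_def by blast
    then show False using N(2) subgroup.one_closed[OF sN] by blast
  qed
  define u where "u = \<rho> m v \<ominus>\<^bsub>V\<^esub> v"
  have mG: "m \<in> carrier G" using m cN by blast
  have u: "u \<in> carrier V" using mG v by (simp add: u_def action_closed)
  have "u \<noteq> \<zero>\<^bsub>V\<^esub>"
    using m(2) mG v(1) by (simp add: u_def action_closed M.minus_eq_zero_iff)
  then have "orbit_span u = carrier V"
    using irr orbit_span_submodule[OF u] orbit_span_rep[OF u] orbit_span_base[OF u]
    unfolding irreducible_rep_def by blast
  then have "v \<in> orbit_span u" using v by simp
  then show ?thesis
  proof induction
    case zero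
    have "norm_sum H \<zero>\<^bsub>V\<^esub> = \<zero>\<^bsub>V\<^esub>" if "subgroup H G" for H
    proof -
      have "norm_sum H \<zero>\<^bsub>V\<^esub> = finsum V (\<lambda>h. \<zero>\<^bsub>V\<^esub>) H"
        unfolding norm_sum_def
        by (intro M.finsum_cong') (auto simp: rep_zero subgroup.mem_carrier[OF that])
      then show ?thesis by simp
    qed
    then show ?case
      using G.triv_subgroup subgroup.one_closed[OF sN] by (intro exI[of _ "{\<one>\<^bsub>G\<^esub>}"]) auto
  next
    case (step x g a)
    then obtain H0 where H0: "finite H0" "subgroup H0 G" "H0 \<subseteq> N"
      "\<And>H. finite H \<Longrightarrow> subgroup H G \<Longrightarrow> H0 \<subseteq> H \<Longrightarrow> norm_sum H x = \<zero>\<^bsub>V\<^esub>"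
      by blast
    define z where "z = g \<otimes>\<^bsub>G\<^esub> m \<otimes>\<^bsub>G\<^esub> inv\<^bsub>G\<^esub> g"
    have z: "z \<in> N" using G.normal_conj_closed[OF N(1) m(1)] step by (simp add: z_def)
    have x: "x \<in> carrier V" using orbit_span_carrier[OF u] step by blast
    obtain H1 where H1: "finite H1" "subgroup H1 G" "insert z H0 \<subseteq> H1" "H1 \<subseteq> N"
      using G.finite_subgroup_join[of "insert z H0" N N] H0 z sN comm tors by auto
    have gu: "\<rho> g u = \<rho> z (\<rho> g v) \<ominus>\<^bsub>V\<^esub> \<rho> g v"
    proof -
      have "z \<otimes>\<^bsub>G\<^esub> g = g \<otimes>\<^bsub>G\<^esub> m" using step mG by (simp add: z_def G.m_assoc)
      then have "\<rho> z (\<rho> g v) = \<rho> g (\<rho> m v)"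
        using step mG v z cN by (metis rep_mult)
      then show ?thesis using step mG v by (simp add: u_def rep_diff action_closed)
    qed
    have "norm_sum H (x \<oplus>\<^bsub>V\<^esub> a \<odot>\<^bsub>V\<^esub> \<rho> g u) = \<zero>\<^bsub>V\<^esub>"
      if H: "finite H" "subgroup H G" "H1 \<subseteq> H" for H
    proof -
      have HG: "H \<subseteq> carrier G" using H subgroup.subset by blast
      have "norm_sum H (\<rho> g u) = \<zero>\<^bsub>V\<^esub>"
        unfolding gu using H H1 v step by (intro norm_sum_diff_zero) (auto simp: action_closed)
      moreover have "norm_sum H x = \<zero>\<^bsub>V\<^esub>" using H0(4) H H1 by blast
      ultimately show ?thesis
        using H HG x step u by (simp add: norm_sum_add norm_sum_smult action_closed)
    qed
    then show ?case using H1 by blast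
  qed
qed

text \<open>Zorn's lemma applies because a witness \<open>H0\<close> of vanishing is finite: for the
  union of a chain it already lies in one member. The trivial subgroup qualifies, its norm being the
  identity.\<close>

lemma exists_maximal_nonvanishing:
  assumes A: "subgroup A G"
    and comm: "\<And>x y. x \<in> A \<Longrightarrow> y \<in> A \<Longrightarrow> x \<otimes>\<^bsub>G\<^esub> y = y \<otimes>\<^bsub>G\<^esub> x"
    and tors: "\<And>x. x \<in> A \<Longrightarrow> \<exists>n::nat. n > 0 \<and> x [^]\<^bsub>G\<^esub> n = \<one>\<^bsub>G\<^esub>"
    and v: "v \<in> carrier V" "v \<noteq> \<zero>\<^bsub>V\<^esub>"
  obtains C where "subgroup C G" "C \<subseteq> A" "\<not> vanishing C v"
    "\<And>D. subgroup D G \<Longrightarrow> C \<subset> D \<Longrightarrow> D \<subseteq> A \<Longrightarrow> vanishing D v"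
proof -
  interpret G: group G by (rule group_G)
  define \<C> where "\<C> = {C. subgroup C G \<and> C \<subseteq> A \<and> \<not> vanishing C v}"
  have "norm_sum {\<one>\<^bsub>G\<^esub>} v = v"
    using v by (simp add: norm_sum_def rep_one)
  then have "\<not> vanishing {\<one>\<^bsub>G\<^esub>} v"
    using v G.triv_subgroup unfolding vanishing_def by (metis finite.emptyI finite.insertI order_refl)
  then have "{\<one>\<^bsub>G\<^esub>} \<in> \<C>"
    using G.triv_subgroup subgroup.one_closed[OF A] by (auto simp: \<C>_def)
  then have ne: "\<C> \<noteq> {}" by blast
  have "\<Union>\<K> \<in> \<C>" if ch: "\<K> \<noteq> {}" "subset.chain \<C> \<K>" for \<K>
  proof -
    have sub: "subgroup C G" "C \<subseteq> A" "\<not> vanishing C v" if "C \<in> \<K>" for C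
      using that ch(2) unfolding subset.chain_def \<C>_def by auto
    have dir: "\<exists>C\<in>\<K>. S \<subseteq> C" if "finite S" "S \<subseteq> \<Union>\<K>" for S
      using finite_subset_Union_chain[OF that ch] by blast
    have sg: "subgroup (\<Union>\<K>) G"
    proof (rule G.subgroupI)
      show "\<Union>\<K> \<subseteq> carrier G" using sub subgroup.subset by blast
      show "\<Union>\<K> \<noteq> {}" using ch(1) sub(1) subgroup.one_closed by blast
      show "inv\<^bsub>G\<^esub> a \<in> \<Union>\<K>" if "a \<in> \<Union>\<K>" for a
        using that sub(1) subgroup.m_inv_closed by (metis Union_iff)
      show "a \<otimes>\<^bsub>G\<^esub> b \<in> \<Union>\<K>" if "a \<in> \<Union>\<K>" "b \<in> \<Union>\<K>" for a b
        using dir[of "{a, b}"] that sub(1) subgroup.m_closed by (metis Union_iff finite.emptyI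
            finite.insertI insert_subset empty_subsetI)
    qed
    have "\<not> vanishing (\<Union>\<K>) v"
    proof
      assume "vanishing (\<Union>\<K>) v"
      then obtain H0 where H0: "finite H0" "subgroup H0 G" "H0 \<subseteq> \<Union>\<K>"
        "\<And>H. finite H \<Longrightarrow> subgroup H G \<Longrightarrow> H0 \<subseteq> H \<Longrightarrow> H \<subseteq> \<Union>\<K> \<Longrightarrow> norm_sum H v = \<zero>\<^bsub>V\<^esub>"
        unfolding vanishing_def by blast
      obtain C where C: "C \<in> \<K>" "H0 \<subseteq> C" using dir[OF H0(1,3)] by blast
      then have "vanishing C v" unfolding vanishing_def
        using H0 by (intro exI[of _ H0]) blast
      then show False using sub(3) C by blast
    qed
    then show ?thesis using sg sub(2) by (auto simp: \<C>_def)
  qed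
  then obtain C where C: "C \<in> \<C>" "\<And>D. D \<in> \<C> \<Longrightarrow> C \<subseteq> D \<Longrightarrow> D = C"
    using subset_Zorn_nonempty[OF ne] by meson
  show thesis
    by (rule that[of C]) (use C in \<open>auto simp: \<C>_def\<close>)
qed

text \<open>The powers of \<open>z\<close> below \<open>p\<close> represent the cosets of
  \<open>H\<close>. They are distinct: a power prime to \<open>p\<close> in \<open>H\<close>,
  together with \<open>z^p\<close>, would put \<open>z\<close> into \<open>C\<close> by
  Bezout.\<close>

lemma norm_sum_cyclic_extension:
  assumes H: "subgroup H G" "finite H" "H \<subseteq> C" and C: "subgroup C G"
    and z: "z \<in> carrier G" "z \<notin> C" "z [^]\<^bsub>G\<^esub> (p::nat) \<in> H" and p: "Factorial_Ring.prime p"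
    and comm: "\<And>h. h \<in> H \<Longrightarrow> h \<otimes>\<^bsub>G\<^esub> z = z \<otimes>\<^bsub>G\<^esub> h" and v: "v \<in> carrier V"
  shows "norm_sum (H <#>\<^bsub>G\<^esub> generate G {z}) v
    = finsum V (\<lambda>i. \<rho> (z [^]\<^bsub>G\<^esub> i) (norm_sum H v)) {..<p}"
    "finite (H <#>\<^bsub>G\<^esub> generate G {z})"
proof -
  interpret G: group G by (rule group_G)
  note cH = subgroup.mem_carrier[OF H(1)]
  define L where "L i = (\<lambda>h. z [^]\<^bsub>G\<^esub> i \<otimes>\<^bsub>G\<^esub> h) ` H" for i :: nat
  have commz: "h \<otimes>\<^bsub>G\<^esub> z [^]\<^bsub>G\<^esub> (i::nat) = z [^]\<^bsub>G\<^esub> i \<otimes>\<^bsub>G\<^esub> h" if "h \<in> H" for h i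
    using comm[OF that] cH[OF that] z(1) by (metis G.group_commutes_pow)
  have K: "H <#>\<^bsub>G\<^esub> generate G {z} = (\<Union>i\<in>{..<p}. L i)"
  proof
    show "(\<Union>i\<in>{..<p}. L i) \<subseteq> H <#>\<^bsub>G\<^esub> generate G {z}"
    proof
      fix x assume "x \<in> (\<Union>i\<in>{..<p}. L i)"
      then obtain i :: nat and h where "h \<in> H" "x = z [^]\<^bsub>G\<^esub> i \<otimes>\<^bsub>G\<^esub> h" by (auto simp: L_def)
      then have "x = h \<otimes>\<^bsub>G\<^esub> z [^]\<^bsub>G\<^esub> int i" "h \<in> H" using commz by (auto simp: int_pow_int)
      then show "x \<in> H <#>\<^bsub>G\<^esub> generate G {z}"
        unfolding G.mem_set_mult G.generate_pow[OF z(1)] by blast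
    qed
    show "H <#>\<^bsub>G\<^esub> generate G {z} \<subseteq> (\<Union>i\<in>{..<p}. L i)"
    proof
      fix x assume "x \<in> H <#>\<^bsub>G\<^esub> generate G {z}"
      then obtain h and k :: int where h: "h \<in> H" "x = h \<otimes>\<^bsub>G\<^esub> z [^]\<^bsub>G\<^esub> k"
        unfolding G.mem_set_mult G.generate_pow[OF z(1)] by blast
      define i where "i = nat (k mod int p)"
      have i: "int i = k mod int p" "i < p"
        using prime_gt_0_nat[OF p] by (auto simp: i_def nat_less_iff)
      have "k = int p * (k div int p) + int i" by (simp add: i)
      then have "z [^]\<^bsub>G\<^esub> k = z [^]\<^bsub>G\<^esub> (int p * (k div int p)) \<otimes>\<^bsub>G\<^esub> z [^]\<^bsub>G\<^esub> int i"
        using z(1) by (metis G.int_pow_mult)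
      then have "z [^]\<^bsub>G\<^esub> k = (z [^]\<^bsub>G\<^esub> p) [^]\<^bsub>G\<^esub> (k div int p) \<otimes>\<^bsub>G\<^esub> z [^]\<^bsub>G\<^esub> i"
        using z(1) by (simp add: G.int_pow_pow[symmetric] int_pow_int)
      moreover define h' where "h' = (z [^]\<^bsub>G\<^esub> p) [^]\<^bsub>G\<^esub> (k div int p)"
      ultimately have e: "z [^]\<^bsub>G\<^esub> k = h' \<otimes>\<^bsub>G\<^esub> z [^]\<^bsub>G\<^esub> i" by simp
      have h': "h' \<in> H" unfolding h'_def by (rule G.subgroup_int_pow_closed[OF H(1) z(3)])
      have hh: "h \<otimes>\<^bsub>G\<^esub> h' \<in> H" using h h' H(1) by (simp add: subgroup.m_closed)
      have "x = (h \<otimes>\<^bsub>G\<^esub> h') \<otimes>\<^bsub>G\<^esub> z [^]\<^bsub>G\<^esub> i" using e h h' cH z(1) by (simp add: G.m_assoc)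
      then have "x = z [^]\<^bsub>G\<^esub> i \<otimes>\<^bsub>G\<^esub> (h \<otimes>\<^bsub>G\<^esub> h')" using commz[OF hh] by simp
      then show "x \<in> (\<Union>i\<in>{..<p}. L i)" using i hh by (auto simp: L_def)
    qed
  qed
  have ndiff: False if "i < j" "j < p" "x \<in> L i" "x \<in> L j" for i j x
  proof -
    obtain h h' where h: "h \<in> H" "h' \<in> H" "z [^]\<^bsub>G\<^esub> i \<otimes>\<^bsub>G\<^esub> h = z [^]\<^bsub>G\<^esub> j \<otimes>\<^bsub>G\<^esub> h'"
      using \<open>x \<in> L i\<close> \<open>x \<in> L j\<close> by (auto simp: L_def)
    have "z [^]\<^bsub>G\<^esub> j = z [^]\<^bsub>G\<^esub> i \<otimes>\<^bsub>G\<^esub> z [^]\<^bsub>G\<^esub> (j - i)"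
      using \<open>i < j\<close> z(1) by (simp add: G.nat_pow_mult)
    then have "h = z [^]\<^bsub>G\<^esub> (j - i) \<otimes>\<^bsub>G\<^esub> h'"
      using h z(1) cH by (simp add: G.m_assoc)
    then have "z [^]\<^bsub>G\<^esub> (j - i) = h \<otimes>\<^bsub>G\<^esub> inv\<^bsub>G\<^esub> h'"
      using h z(1) cH by (simp add: G.m_assoc)
    then have "z [^]\<^bsub>G\<^esub> (j - i) \<in> H"
      using h H(1) by (simp add: subgroup.m_closed subgroup.m_inv_closed)
    moreover have "coprime p (j - i)"
      using p that by (intro prime_imp_coprime) (auto dest: dvd_imp_le)
    ultimately have "z \<in> C"
      using G.pow_mem_coprime[OF C z(1), of p "j - i"] z(3) H(3) by blast
    then show False using z(2) by blast
  qed
  have fin: "finite (L i)" for i using H(2) by (simp add: L_def)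
  then show "finite (H <#>\<^bsub>G\<^esub> generate G {z})" unfolding K by blast
  have LG: "L i \<subseteq> carrier G" for i using cH z(1) by (auto simp: L_def)
  have "norm_sum (H <#>\<^bsub>G\<^esub> generate G {z}) v = finsum V (\<lambda>i. finsum V (\<lambda>h. \<rho> h v) (L i)) {..<p}"
    unfolding K norm_sum_def
  proof (rule M.add.finprod_UN_disjoint)
    have "disjnt (L i) (L j)" if "i < p" "j < p" "i \<noteq> j" for i j
      using that ndiff[of i j] ndiff[of j i] by (cases i j rule: linorder_cases) (auto simp: disjnt_iff)
    then show "pairwise (\<lambda>i j. disjnt (L i) (L j)) {..<p}" by (simp add: pairwise_def)
  qed (use fin LG v in \<open>auto simp: action_closed subset_iff\<close>)
  also have "\<dots> = finsum V (\<lambda>i. \<rho> (z [^]\<^bsub>G\<^esub> i) (norm_sum H v)) {..<p}"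
  proof (rule M.finsum_cong')
    fix i
    have "finsum V (\<lambda>h. \<rho> h v) (L i) = finsum V (\<lambda>h. \<rho> (z [^]\<^bsub>G\<^esub> i \<otimes>\<^bsub>G\<^esub> h) v) H"
      unfolding L_def using z(1) v
      by (intro M.finsum_reindex inj_onI) (auto simp: cH action_closed)
    also have "\<dots> = finsum V (\<lambda>h. \<rho> (z [^]\<^bsub>G\<^esub> i) (\<rho> h v)) H"
      using z(1) v cH by (intro M.finsum_cong') (auto simp: rep_mult action_closed)
    also have "\<dots> = \<rho> (z [^]\<^bsub>G\<^esub> i) (norm_sum H v)"
      unfolding norm_sum_def using H(2) z(1) v cH
      by (intro rep_finsum[symmetric]) (auto simp: action_closed)
    finally show "finsum V (\<lambda>h. \<rho> h v) (L i) = \<rho> (z [^]\<^bsub>G\<^esub> i) (norm_sum H v)" .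
  qed (use z(1) v norm_sum_closed[of H] subgroup.subset[OF H(1)] in \<open>auto simp: action_closed\<close>)
  finally show "norm_sum (H <#>\<^bsub>G\<^esub> generate G {z}) v
    = finsum V (\<lambda>i. \<rho> (z [^]\<^bsub>G\<^esub> i) (norm_sum H v)) {..<p}" .
qed

lemma add_pow_smult:
  "w \<in> carrier V \<Longrightarrow> add_pow V (n::nat) w = (add_pow K n \<one>\<^bsub>K\<^esub>) \<odot>\<^bsub>V\<^esub> w"
  by (induction n) (simp_all add: smult_l_distr)

lemma add_pow_eq_zeroD:
  assumes "w \<in> carrier V" "add_pow V (n::nat) w = \<zero>\<^bsub>V\<^esub>" "add_pow K n \<one>\<^bsub>K\<^esub> \<noteq> \<zero>\<^bsub>K\<^esub>"
  shows "w = \<zero>\<^bsub>V\<^esub>"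
proof -
  let ?a = "add_pow K n \<one>\<^bsub>K\<^esub>"
  have a: "?a \<in> Units K" using assms(3) by (simp add: field_Units)
  have "w = (inv\<^bsub>K\<^esub> ?a \<otimes>\<^bsub>K\<^esub> ?a) \<odot>\<^bsub>V\<^esub> w" by (subst Units_l_inv[OF a]) (simp add: assms(1))
  also have "\<dots> = inv\<^bsub>K\<^esub> ?a \<odot>\<^bsub>V\<^esub> (?a \<odot>\<^bsub>V\<^esub> w)" using a assms(1) by (intro smult_assoc1) auto
  also have "\<dots> = \<zero>\<^bsub>V\<^esub>" using a assms(2) add_pow_smult[OF assms(1), of n] by simp
  finally show ?thesis .
qed

text \<open>
  If \<open>m\<close> and \<open>x\<close> are independent modulo \<open>C\<close>, then \<open>E = \<langle>x, m\<rangle>C/C\<close> is a union of \<open>p + 1\<close> subgroups of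
  order \<open>p\<close> which meet trivially, so that \<open>\<Sum>N(L) = p + N(E)\<close>, the sum running over these \<open>L\<close>.
  By maximality all the norms in this identity eventually kill \<open>N(H)v\<close>, for \<open>H \<subseteq> C\<close>.
\<close>

lemma maximal_nonvanishing_rank:
  assumes A: "subgroup A G"
    and comm: "\<And>x y. x \<in> A \<Longrightarrow> y \<in> A \<Longrightarrow> x \<otimes>\<^bsub>G\<^esub> y = y \<otimes>\<^bsub>G\<^esub> x"
    and tors: "\<And>x. x \<in> A \<Longrightarrow> \<exists>n::nat. n > 0 \<and> x [^]\<^bsub>G\<^esub> n = \<one>\<^bsub>G\<^esub>"
    and v: "v \<in> carrier V"
    and C: "subgroup C G" "C \<subseteq> A" "\<not> vanishing C v"
    and max: "\<And>D. subgroup D G \<Longrightarrow> C \<subset> D \<Longrightarrow> D \<subseteq> A \<Longrightarrow> vanishing D v"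
    and p: "Factorial_Ring.prime (p::nat)" "add_pow K p \<one>\<^bsub>K\<^esub> \<noteq> \<zero>\<^bsub>K\<^esub>"
    and x: "x \<in> A" "x \<notin> C" "x [^]\<^bsub>G\<^esub> p \<in> C"
    and m: "m \<in> A" "m [^]\<^bsub>G\<^esub> p \<in> C"
  shows "\<exists>c\<in>C. \<exists>k::int. m = c \<otimes>\<^bsub>G\<^esub> x [^]\<^bsub>G\<^esub> k"
proof (rule ccontr)
  assume neg: "\<not> ?thesis"
  interpret G: group G by (rule group_G)
  note cA = subgroup.mem_carrier[OF A]
  have xm: "x \<in> carrier G" "m \<in> carrier G" using x m cA by auto
  have Anat: "y [^]\<^bsub>G\<^esub> (i::nat) \<in> A" if "y \<in> A" for y i
    using G.subgroup_int_pow_closed[OF A that, of "int i"] by (simp add: int_pow_int)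
  have Cnat: "y [^]\<^bsub>G\<^esub> (i::nat) \<in> C" if "y \<in> C" for y i
    using G.subgroup_int_pow_closed[OF C(1) that, of "int i"] by (simp add: int_pow_int)
  \<comment> \<open>Modulo \<open>C\<close>, the elements \<open>x^i m\<close> generate
    \<open>p\<close> of the subgroups of order \<open>p\<close>. The remaining one is listed with
    all its generators \<open>x^k\<close>, because the sums that occur below run over the powers of
    each of them.\<close>
  define Z where "Z = (\<lambda>k. x [^]\<^bsub>G\<^esub> k) ` {1..<p} \<union> (\<lambda>i. x [^]\<^bsub>G\<^esub> i \<otimes>\<^bsub>G\<^esub> m) ` {..<p}"
  have ZA: "z \<in> A \<and> z \<notin> C \<and> z [^]\<^bsub>G\<^esub> p \<in> C" if zZ: "z \<in> Z" for z
  proof -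
    consider k where "1 \<le> k" "k < p" "z = x [^]\<^bsub>G\<^esub> k" | i where "z = x [^]\<^bsub>G\<^esub> i \<otimes>\<^bsub>G\<^esub> m" "i < p"
      using zZ unfolding Z_def by force
    then show ?thesis
    proof cases
      case 1
      have "coprime p k" using p 1 by (intro prime_imp_coprime) (auto dest: dvd_imp_le)
      then have "z \<notin> C" using G.pow_mem_coprime[OF C(1) xm(1) x(3), of k] x(2) 1 by auto
      moreover have "z [^]\<^bsub>G\<^esub> p = (x [^]\<^bsub>G\<^esub> p) [^]\<^bsub>G\<^esub> k"
        using 1 xm by (simp add: G.nat_pow_pow mult.commute)
      ultimately show ?thesis using Anat[OF x(1)] Cnat[OF x(3)] 1 by simp
    next
      case 2
      have "z \<notin> C"
      proof
        assume z: "z \<in> C"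
        have "m = inv\<^bsub>G\<^esub> (x [^]\<^bsub>G\<^esub> i) \<otimes>\<^bsub>G\<^esub> z" using 2 xm by (simp add: G.inv_mult_cancel)
        also have "\<dots> = z \<otimes>\<^bsub>G\<^esub> inv\<^bsub>G\<^esub> (x [^]\<^bsub>G\<^esub> i)"
          using comm z C(2) Anat[OF x(1)] A by (meson subgroup.m_inv_closed subsetD)
        also have "\<dots> = z \<otimes>\<^bsub>G\<^esub> x [^]\<^bsub>G\<^esub> (- int i)" using xm by (simp add: G.int_pow_neg int_pow_int)
        finally show False using neg z by blast
      qed
      moreover have "z [^]\<^bsub>G\<^esub> p = (x [^]\<^bsub>G\<^esub> p) [^]\<^bsub>G\<^esub> i \<otimes>\<^bsub>G\<^esub> m [^]\<^bsub>G\<^esub> p"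
        using G.pow_mult_distrib[OF comm[OF Anat[OF x(1)] m(1)], of i p] 2 xm
        by (simp add: G.nat_pow_pow mult.commute)
      moreover have "(x [^]\<^bsub>G\<^esub> p) [^]\<^bsub>G\<^esub> i \<otimes>\<^bsub>G\<^esub> m [^]\<^bsub>G\<^esub> p \<in> C"
        using Cnat[OF x(3)] m(2) C(1) by (simp add: subgroup.m_closed)
      ultimately show ?thesis using Anat[OF x(1)] m(1) A 2 by (simp add: subgroup.m_closed)
    qed
  qed
  have finZ: "finite Z" by (simp add: Z_def)
  define E where "E z = C <#>\<^bsub>G\<^esub> generate G {z}" for z
  have gen: "subgroup (generate G {z}) G" "generate G {z} \<subseteq> A" "z \<in> generate G {z}" if "z \<in> A" for z
    using G.generate_is_subgroup[of "{z}"] G.generate_subgroup_incl[OF _ A, of "{z}"] that cA[OF that]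
    by (simp_all add: generate.incl)
  have E: "subgroup (E z) G" "E z \<subseteq> A" "C \<subset> E z" if "z \<in> Z" for z
  proof -
    have z: "z \<in> A" "z \<notin> C" using ZA[OF that] by auto
    show "subgroup (E z) G" unfolding E_def
      by (rule G.commuting_set_mult_subgroup[OF C(1) gen(1)[OF z(1)]])
        (use comm C(2) gen(2)[OF z(1)] in blast)
    show "E z \<subseteq> A"
      using C(2) gen(2)[OF z(1)] by (auto simp: E_def G.mem_set_mult intro!: subgroup.m_closed[OF A])
    show "C \<subset> E z"
      using G.subset_set_mult[OF C(1) gen(1)[OF z(1)]] gen(3)[OF z(1)] z(2) unfolding E_def by blast
  qed
  have "\<exists>H0. finite H0 \<and> subgroup H0 G \<and> H0 \<subseteq> E z \<and>
     (\<forall>H. finite H \<longrightarrow> subgroup H G \<longrightarrow> H0 \<subseteq> H \<longrightarrow> H \<subseteq> E z \<longrightarrow> norm_sum H v = \<zero>\<^bsub>V\<^esub>)" if "z \<in> Z" for z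
    using max[OF E(1)[OF that] E(3)[OF that] E(2)[OF that]] unfolding vanishing_def .
  then obtain H0 where H0: "\<And>z. z \<in> Z \<Longrightarrow> finite (H0 z)" "\<And>z. z \<in> Z \<Longrightarrow> H0 z \<subseteq> E z"
    "\<And>z H. z \<in> Z \<Longrightarrow> finite H \<Longrightarrow> subgroup H G \<Longrightarrow> H0 z \<subseteq> H \<Longrightarrow> H \<subseteq> E z \<Longrightarrow> norm_sum H v = \<zero>\<^bsub>V\<^esub>"
    by metis
  have "\<forall>z\<in>Z. \<forall>h\<in>H0 z. \<exists>c. c \<in> C \<and> (\<exists>d\<in>generate G {z}. h = c \<otimes>\<^bsub>G\<^esub> d)"
    using H0(2) unfolding E_def by (force simp: G.mem_set_mult)
  then obtain c where c: "\<And>z h. z \<in> Z \<Longrightarrow> h \<in> H0 z \<Longrightarrow> c z h \<in> C"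
    "\<And>z h. z \<in> Z \<Longrightarrow> h \<in> H0 z \<Longrightarrow> \<exists>d\<in>generate G {z}. h = c z h \<otimes>\<^bsub>G\<^esub> d"
    by metis
  \<comment> \<open>One \<open>H\<close> must serve all \<open>z\<close> in \<open>Z\<close>. With
    the \<open>C\<close>-components of \<open>H0 z\<close> it makes \<open>H<z>\<close> large enough
    in \<open>E z\<close> for the norm to vanish, and with the powers \<open>z^p\<close> it has
    index \<open>p\<close> in \<open>H<z>\<close>.\<close>
  define S where "S = (\<Union>z\<in>Z. c z ` H0 z) \<union> (\<lambda>z. z [^]\<^bsub>G\<^esub> p) ` Z"
  have S: "finite S" "S \<subseteq> C" using finZ H0(1) c(1) ZA by (auto simp: S_def)
  obtain H1 where H1: "finite H1" "subgroup H1 G" "S \<subseteq> H1" "H1 \<subseteq> C"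
    using G.finite_subgroup_join[OF S C(1,2) A comm tors] by blast
  then obtain H where H: "finite H" "subgroup H G" "H1 \<subseteq> H" "H \<subseteq> C" "norm_sum H v \<noteq> \<zero>\<^bsub>V\<^esub>"
    using C(3) unfolding vanishing_def by blast
  define w where "w = norm_sum H v"
  have w: "w \<in> carrier V" "w \<noteq> \<zero>\<^bsub>V\<^esub>"
    using H(5) norm_sum_closed[OF subgroup.subset[OF H(2)] v] unfolding w_def by auto
  have zsum: "finsum V (\<lambda>i. \<rho> (z [^]\<^bsub>G\<^esub> i) w) {..<p} = \<zero>\<^bsub>V\<^esub>" if z: "z \<in> Z" for z
  proof -
    have zA: "z \<in> A" "z \<notin> C" "z \<in> carrier G" using ZA[OF z] cA by auto
    have zp: "z [^]\<^bsub>G\<^esub> p \<in> H" using z H1 H by (auto simp: S_def)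
    have ch: "h \<otimes>\<^bsub>G\<^esub> z = z \<otimes>\<^bsub>G\<^esub> h" if "h \<in> H" for h using comm[of h z] that H C(2) zA by blast
    note L = norm_sum_cyclic_extension[OF H(2,1,4) C(1) zA(3,2) zp p(1) ch v]
    have "subgroup (H <#>\<^bsub>G\<^esub> generate G {z}) G"
      by (rule G.commuting_set_mult_subgroup[OF H(2) gen(1)[OF zA(1)]])
        (use comm C(2) H(4) gen(2)[OF zA(1)] in blast)
    moreover have "H0 z \<subseteq> H <#>\<^bsub>G\<^esub> generate G {z}"
    proof
      fix h assume h: "h \<in> H0 z"
      then obtain d where d: "d \<in> generate G {z}" "h = c z h \<otimes>\<^bsub>G\<^esub> d" using c(2)[OF z h] by blast
      moreover have "c z h \<in> H" using H1(3) H(3) z h by (auto simp: S_def)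
      ultimately show "h \<in> H <#>\<^bsub>G\<^esub> generate G {z}" unfolding G.mem_set_mult by blast
    qed
    moreover have "H <#>\<^bsub>G\<^esub> generate G {z} \<subseteq> E z" using H(4) unfolding E_def by (intro mono_set_mult) auto
    ultimately have "norm_sum (H <#>\<^bsub>G\<^esub> generate G {z}) v = \<zero>\<^bsub>V\<^esub>" using H0(3)[OF z L(2)] by blast
    then show ?thesis using L(1) unfolding w_def by simp
  qed
  \<comment> \<open>The double sum of \<open>(x^i m)^k w\<close> over \<open>i\<close> and
    \<open>k\<close> is computed in both orders. Summing over \<open>k\<close> first gives zero for
    each \<open>i\<close>. Summing over \<open>i\<close> first gives \<open>m^k\<close> applied to a
    sum over the powers of \<open>x^k\<close>, which is zero for \<open>k > 0\<close>, and
    \<open>p w\<close> for \<open>k = 0\<close>.\<close>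
  define f where "f i k = \<rho> ((x [^]\<^bsub>G\<^esub> i \<otimes>\<^bsub>G\<^esub> m) [^]\<^bsub>G\<^esub> k) w" for i k :: nat
  have fV: "f i k \<in> carrier V" for i k using xm w by (simp add: f_def action_closed)
  have f: "f i k = \<rho> (m [^]\<^bsub>G\<^esub> k) (\<rho> ((x [^]\<^bsub>G\<^esub> k) [^]\<^bsub>G\<^esub> i) w)" for i k
  proof -
    have "(x [^]\<^bsub>G\<^esub> i \<otimes>\<^bsub>G\<^esub> m) [^]\<^bsub>G\<^esub> k = (x [^]\<^bsub>G\<^esub> k) [^]\<^bsub>G\<^esub> i \<otimes>\<^bsub>G\<^esub> m [^]\<^bsub>G\<^esub> k"
      using G.pow_mult_distrib[OF comm[OF Anat[OF x(1)] m(1)], of i k] xm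
      by (simp add: G.nat_pow_pow mult.commute)
    also have "\<dots> = m [^]\<^bsub>G\<^esub> k \<otimes>\<^bsub>G\<^esub> (x [^]\<^bsub>G\<^esub> k) [^]\<^bsub>G\<^esub> i"
      by (rule comm[OF Anat[OF Anat[OF x(1)]] Anat[OF m(1)]])
    finally show ?thesis using xm w by (simp add: f_def rep_mult)
  qed
  have "finsum V (\<lambda>i. finsum V (f i) {..<p}) {..<p} = finsum V (\<lambda>i. \<zero>\<^bsub>V\<^esub>) {..<p}"
    unfolding f_def by (intro M.finsum_cong') (auto simp: zsum Z_def)
  then have z0: "finsum V (\<lambda>k. finsum V (\<lambda>i. f i k) {..<p}) {..<p} = \<zero>\<^bsub>V\<^esub>"
    using M.finsum_swap[of "{..<p}" "{..<p}" f] fV by simp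
  define g where "g k = finsum V (\<lambda>i. f i k) {..<p}" for k
  have gV: "g k \<in> carrier V" for k using fV by (simp add: g_def)
  have g: "g k = \<zero>\<^bsub>V\<^esub>" if "k \<in> {1..<p}" for k
  proof -
    have "g k = \<rho> (m [^]\<^bsub>G\<^esub> k) (finsum V (\<lambda>i. \<rho> ((x [^]\<^bsub>G\<^esub> k) [^]\<^bsub>G\<^esub> i) w) {..<p})"
      unfolding g_def f using xm w by (intro rep_finsum[symmetric]) (auto simp: action_closed)
    also have "finsum V (\<lambda>i. \<rho> ((x [^]\<^bsub>G\<^esub> k) [^]\<^bsub>G\<^esub> i) w) {..<p} = \<zero>\<^bsub>V\<^esub>"
      by (rule zsum) (use that in \<open>auto simp: Z_def\<close>)
    finally show ?thesis using xm by (simp add: rep_zero)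
  qed
  have g0: "g 0 = add_pow V p w"
  proof -
    have "g 0 = finsum V (\<lambda>i. w) {..<p}"
      unfolding g_def using w by (intro M.finsum_cong') (auto simp: f rep_one)
    then show ?thesis using w by (simp add: M.add.finprod_const)
  qed
  have "{..<p} = insert 0 {1..<p}" using prime_gt_0_nat[OF p(1)] by auto
  then have "finsum V g {..<p} = g 0 \<oplus>\<^bsub>V\<^esub> finsum V g {1..<p}"
    using gV by simp
  moreover have "finsum V g {1..<p} = finsum V (\<lambda>k. \<zero>\<^bsub>V\<^esub>) {1..<p}"
    by (intro M.finsum_cong') (auto simp: g)
  ultimately have "add_pow V p w = \<zero>\<^bsub>V\<^esub>"
    using z0 g0 w gV by (simp add: g_def[symmetric])
  then show False using add_pow_eq_zeroD[OF w(1) _ p(2)] w(2) by blast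
qed

end

section \<open>Cores and locally cyclic quotients\<close>

lemma (in group) mem_core:
  assumes "C \<subseteq> carrier G"
  shows "x \<in> core G C \<longleftrightarrow> x \<in> carrier G \<and> (\<forall>g\<in>carrier G. inv g \<otimes> x \<otimes> g \<in> C)"
proof -
  have "x \<in> (g <#\<^bsub>G\<^esub> C) #> inv g \<longleftrightarrow> x \<in> carrier G \<and> inv g \<otimes> x \<otimes> g \<in> C" if g: "g \<in> carrier G" for g
  proof
    assume "x \<in> (g <#\<^bsub>G\<^esub> C) #> inv g"
    then obtain c where c: "c \<in> C" "x = g \<otimes> c \<otimes> inv g" by (auto simp: l_coset_def r_coset_def)
    then have cG: "c \<in> carrier G" using assms by blast
    have "inv g \<otimes> x \<otimes> g = c" using c cG g by (simp add: m_assoc inv_mult_cancel)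
    then show "x \<in> carrier G \<and> inv g \<otimes> x \<otimes> g \<in> C" using c cG g by simp
  next
    assume a: "x \<in> carrier G \<and> inv g \<otimes> x \<otimes> g \<in> C"
    then have "x = g \<otimes> (inv g \<otimes> x \<otimes> g) \<otimes> inv g" using g by (simp add: m_assoc inv_mult_cancel)
    then show "x \<in> (g <#\<^bsub>G\<^esub> C) #> inv g" using a unfolding l_coset_def r_coset_def by blast
  qed
  then show ?thesis unfolding core_def using one_closed by blast
qed

lemma (in group) core_subset:
  assumes "C \<subseteq> carrier G"
  shows "core G C \<subseteq> C"
proof
  fix x assume "x \<in> core G C"
  then have "x \<in> carrier G" "inv \<one> \<otimes> x \<otimes> \<one> \<in> C"
    unfolding mem_core[OF assms] using one_closed by blast+
  then show "x \<in> C" by simp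
qed

lemma (in group) normal_subset_core:
  assumes "C \<subseteq> carrier G" "N \<lhd> G" "N \<subseteq> C"
  shows "N \<subseteq> core G C"
  using assms normal.inv_op_closed1 by (fastforce simp: mem_core)

lemma (in group) core_normal:
  assumes C: "subgroup C G"
  shows "core G C \<lhd> G"
proof (rule normal_invI)
  note m = mem_core[OF subgroup.subset[OF C]]
  show "subgroup (core G C) G"
  proof
    show "\<one> \<in> core G C" by (simp add: m subgroup.one_closed[OF C])
    fix x assume x: "x \<in> core G C"
    show "inv x \<in> core G C" unfolding m
    proof (intro conjI ballI)
      fix g assume g: "g \<in> carrier G"
      have "inv (inv g \<otimes> x \<otimes> g) \<in> C"
        using x g C unfolding m by (simp add: subgroup.m_inv_closed)
      then show "inv g \<otimes> inv x \<otimes> g \<in> C" using x g by (simp add: m inv_mult_group m_assoc)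
    qed (use x m in simp)
    fix y assume y: "y \<in> core G C"
    show "x \<otimes> y \<in> core G C" unfolding m
    proof (intro conjI ballI)
      fix g assume g: "g \<in> carrier G"
      have "(inv g \<otimes> x \<otimes> g) \<otimes> (inv g \<otimes> y \<otimes> g) \<in> C"
        using x y g C unfolding m by (simp add: subgroup.m_closed)
      then show "inv g \<otimes> (x \<otimes> y) \<otimes> g \<in> C"
        using x y g by (simp add: m m_assoc inv_mult_cancel)
    qed (use x y m in simp)
  qed (auto simp: m)
  fix h x assume h: "h \<in> carrier G" and x: "x \<in> core G C"
  show "h \<otimes> x \<otimes> inv h \<in> core G C" unfolding m
  proof (intro conjI ballI)
    fix g assume g: "g \<in> carrier G"
    have "inv (inv h \<otimes> g) \<otimes> x \<otimes> (inv h \<otimes> g) \<in> C" using x h g unfolding m by simp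
    then show "inv g \<otimes> (h \<otimes> x \<otimes> inv h) \<otimes> g \<in> C"
      using x h g by (simp add: m inv_mult_group m_assoc)
  qed (use x h m in simp)
qed

text \<open>The least positive exponent of \<open>z\<close> that occurs in the subgroup yields a
  generator, by division with remainder; if there is none, the subgroup is trivial.\<close>

lemma (in group) cyclic_subgroup_generated_subset:
  assumes z: "z \<in> carrier G" and S: "S \<subseteq> range (\<lambda>k::int. z [^] k)"
  shows "cyclic_group (subgroup_generated G S)"
proof -
  have SG: "S \<subseteq> carrier G" using S z by auto
  define H where "H = generate G S"
  have H: "subgroup H G" unfolding H_def by (rule generate_is_subgroup[OF SG])
  have "subgroup (generate G {z}) G" using z by (intro generate_is_subgroup) auto
  moreover have "S \<subseteq> generate G {z}" using S unfolding generate_pow[OF z] by blast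
  ultimately have Hz: "H \<subseteq> generate G {z}" unfolding H_def by (rule generate_subgroup_incl[rotated])
  have "\<exists>y\<in>H. \<forall>h\<in>H. \<exists>k::int. h = y [^] k"
  proof (cases "\<exists>k::nat. k > 0 \<and> z [^] k \<in> H")
    case True
    define d where "d = (LEAST k::nat. k > 0 \<and> z [^] k \<in> H)"
    have d: "d > 0" "z [^] d \<in> H" using LeastI_ex[OF True] by (auto simp: d_def)
    have "\<exists>k::int. h = (z [^] d) [^] k" if h: "h \<in> H" for h
    proof -
      obtain j :: int where j: "h = z [^] j" using Hz h unfolding generate_pow[OF z] by blast
      define r where "r = nat (j mod int d)"
      have r: "int r = j mod int d" "r < d" using d by (auto simp: r_def nat_less_iff)
      have j': "j = int d * (j div int d) + int r" by (simp add: r)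
      have dk: "z [^] (int d * k) = (z [^] d) [^] k" for k
        using z by (simp add: int_pow_pow[symmetric] int_pow_int)
      have "h = z [^] (int d * (j div int d)) \<otimes> z [^] int r"
        unfolding j using z j' by (metis int_pow_mult)
      then have hr: "h = (z [^] d) [^] (j div int d) \<otimes> z [^] r" using dk by (simp add: int_pow_int)
      then have "z [^] r = inv ((z [^] d) [^] (j div int d)) \<otimes> h"
        using z by (simp add: inv_mult_cancel)
      then have "z [^] r \<in> H"
        using h subgroup_int_pow_closed[OF H d(2)] H by (simp add: subgroup.m_closed subgroup.m_inv_closed)
      then have "r = 0"
        using r(2) not_less_Least[of r "\<lambda>k. k > 0 \<and> z [^] k \<in> H"] unfolding d_def by auto
      then show ?thesis using hr z by auto
    qed
    then show ?thesis using d by blast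
  next
    case False
    have "h = \<one>" if h: "h \<in> H" for h
    proof -
      obtain j :: int where j: "h = z [^] j" using Hz h unfolding generate_pow[OF z] by blast
      have "inv h \<in> H" using H h by (simp add: subgroup.m_inv_closed)
      then have "z [^] nat \<bar>j\<bar> \<in> H"
        using h j z by (cases "j \<ge> 0") (auto simp: int_pow_neg[symmetric] simp flip: int_pow_int)
      then have "j = 0" using False by (metis zero_less_nat_eq zero_less_abs_iff)
      then show ?thesis using j by simp
    qed
    then show ?thesis using subgroup.one_closed[OF H] by (metis int_pow_0 one_closed)
  qed
  then obtain y where y: "y \<in> H" "\<And>h. h \<in> H \<Longrightarrow> \<exists>k::int. h = y [^] k" by blast
  have c: "carrier (subgroup_generated G S) = H"
    using SG by (simp add: carrier_subgroup_generated H_def Int_absorb1)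
  have "H = range (\<lambda>k::int. y [^] k)"
    using y subgroup_int_pow_closed[OF H] by blast
  then show ?thesis
    unfolding group.cyclic_group[OF group_subgroup_generated] c
    using y(1) c by (intro bexI[of _ y]) (auto simp: int_pow_subgroup_generated)
qed

text \<open>A form without cosets. The element \<open>z\<close> may lie outside the subgroup
  generated by \<open>S\<close> modulo \<open>C\<close>; subgroups of cyclic groups being cyclic,
  this is no loss.\<close>

lemma (in comm_group) locally_cyclic_Mod_iff:
  assumes C: "subgroup C G"
  shows "locally_cyclic (G Mod C) \<longleftrightarrow>
    (\<forall>S. finite S \<longrightarrow> S \<subseteq> carrier G \<longrightarrow> (\<exists>z\<in>carrier G. \<forall>s\<in>S. \<exists>c\<in>C. \<exists>k::int. s = c \<otimes> z [^] k))"
proof -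
  interpret N: normal C G using C by (simp add: normal_iff_subgroup)
  interpret Q: group "G Mod C" by (rule N.factorgroup_is_group)
  have hom: "(\<lambda>a. C #> a) \<in> hom G (G Mod C)" by (rule N.r_coset_hom_Mod)
  have pow: "(C #> z) [^]\<^bsub>G Mod C\<^esub> (k::int) = C #> z [^] k" if "z \<in> carrier G" for z k
    using hom_int_pow[OF hom that is_group Q.is_group] by simp
  have carr: "carrier (G Mod C) = (\<lambda>a. C #> a) ` carrier G"
    by (auto simp: FactGroup_def RCOSETS_def)
  have cos: "C #> s = C #> t \<longleftrightarrow> (\<exists>c\<in>C. s = c \<otimes> t)" if "s \<in> carrier G" "t \<in> carrier G" for s t
  proof -
    have "C #> s = C #> t \<longleftrightarrow> s \<in> C #> t"
      using repr_independence[OF _ that(2) C] rcos_self[OF that(1) C] by metis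
    then show ?thesis by (auto simp: r_coset_def)
  qed
  show ?thesis
  proof
    assume lc: "locally_cyclic (G Mod C)"
    show "\<forall>S. finite S \<longrightarrow> S \<subseteq> carrier G \<longrightarrow> (\<exists>z\<in>carrier G. \<forall>s\<in>S. \<exists>c\<in>C. \<exists>k::int. s = c \<otimes> z [^] k)"
    proof (intro allI impI)
      fix S assume S: "finite S" "S \<subseteq> carrier G"
      let ?S = "(\<lambda>a. C #> a) ` S"
      have S': "?S \<subseteq> carrier (G Mod C)" using S carr by auto
      have "finite ?S" using S(1) by simp
      then have "cyclic_group (subgroup_generated (G Mod C) ?S)"
        using lc S' unfolding locally_cyclic_def by simp
      from iffD1[OF group.cyclic_group[OF Q.group_subgroup_generated] this]
      obtain Z where Z: "Z \<in> carrier (subgroup_generated (G Mod C) ?S)"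
        "carrier (subgroup_generated (G Mod C) ?S)
          = range (\<lambda>n::int. Z [^]\<^bsub>subgroup_generated (G Mod C) ?S\<^esub> n)" ..
      have "Z \<in> carrier (G Mod C)" using Z(1) Q.carrier_subgroup_generated_subset by blast
      then obtain z where z: "z \<in> carrier G" "Z = C #> z" unfolding carr by blast
      have "\<exists>c\<in>C. \<exists>k::int. s = c \<otimes> z [^] k" if s: "s \<in> S" for s
      proof -
        have "C #> s \<in> carrier (subgroup_generated (G Mod C) ?S)"
          using s S' by (auto simp: carrier_subgroup_generated intro!: generate.incl)
        then obtain k :: int where "C #> s = Z [^]\<^bsub>subgroup_generated (G Mod C) ?S\<^esub> k"
          unfolding Z(2) by blast
        then have "C #> s = C #> z [^] k"
          using Z(1) z pow by (simp add: Q.int_pow_subgroup_generated)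
        then show ?thesis using cos[of s "z [^] k"] s S z by auto
      qed
      then show "\<exists>z\<in>carrier G. \<forall>s\<in>S. \<exists>c\<in>C. \<exists>k::int. s = c \<otimes> z [^] k" using z by blast
    qed
  next
    assume r: "\<forall>S. finite S \<longrightarrow> S \<subseteq> carrier G \<longrightarrow> (\<exists>z\<in>carrier G. \<forall>s\<in>S. \<exists>c\<in>C. \<exists>k::int. s = c \<otimes> z [^] k)"
    show "locally_cyclic (G Mod C)" unfolding locally_cyclic_def
    proof (intro allI impI)
      fix S assume S: "finite S" "S \<subseteq> carrier (G Mod C)"
      then obtain T where T: "finite T" "T \<subseteq> carrier G" "S = (\<lambda>a. C #> a) ` T"
        unfolding carr by (metis finite_subset_image)
      obtain z where z: "z \<in> carrier G" "\<And>t. t \<in> T \<Longrightarrow> \<exists>c\<in>C. \<exists>k::int. t = c \<otimes> z [^] k"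
        using r T by meson
      have "C #> t \<in> range (\<lambda>k::int. (C #> z) [^]\<^bsub>G Mod C\<^esub> k)" if t: "t \<in> T" for t
      proof -
        obtain c and k :: int where "c \<in> C" "t = c \<otimes> z [^] k" using z(2)[OF t] by blast
        then have "C #> t = C #> z [^] k" using cos[of t "z [^] k"] t T z by auto
        then show ?thesis using pow[OF z(1)] by simp
      qed
      then show "cyclic_group (subgroup_generated (G Mod C) S)"
        unfolding T(3) using z carr by (intro Q.cyclic_subgroup_generated_subset[of "C #> z"]) auto
    qed
  qed
qed

section \<open>Torsion abelian minimal normal subgroups and the group A(G)\<close>

context group begin

text \<open>For a prime \<open>p\<close> dividing the order of some element, the solutions of
  \<open>x^p = 1\<close> in \<open>M\<close> form a nontrivial normal subgroup of G, which is
  \<open>M\<close> by minimality.\<close>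

lemma torsion_abelian_minimal_normal:
  assumes M: "minimal_normal G M" and ta: "torsion_abelian (G\<lparr>carrier := M\<rparr>)"
  shows "x \<in> M \<Longrightarrow> y \<in> M \<Longrightarrow> x \<otimes> y = y \<otimes> x"
    and "\<exists>p. Factorial_Ring.prime p \<and> (\<forall>x\<in>M. x [^] (p::nat) = \<one>)"
proof -
  note sM = normal_imp_subgroup[OF minimal_normal_normal[OF M]]
  note cM = subgroup.mem_carrier[OF sM]
  show comm: "x \<otimes> y = y \<otimes> x" if "x \<in> M" "y \<in> M" for x y
    using comm_groupE(4)[of "G\<lparr>carrier := M\<rparr>"] ta that by (simp add: torsion_abelian_def)
  obtain x where x: "x \<in> M" "x \<noteq> \<one>"
    using M subgroup.one_closed[OF sM] unfolding minimal_normal_def by blast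
  then have xG: "x \<in> carrier G" using cM by blast
  obtain n :: nat where "n > 0" "x [^] n = \<one>"
    using ta x(1) by (auto simp: torsion_abelian_def nat_pow_consistent[symmetric])
  then have "ord x \<noteq> 0" using xG by (auto simp: ord_eq_0)
  then obtain p k :: nat where p: "Factorial_Ring.prime p" and k: "x [^] k \<noteq> \<one>" "(x [^] k) [^] p = \<one>"
    by (rule exists_prime_order_pow[OF xG x(2)])
  define N where "N = {z \<in> M. z [^] p = \<one>}"
  have "N \<lhd> G"
  proof (rule normal_invI)
    show "subgroup N G"
    proof
      show "inv a \<in> N" if "a \<in> N" for a
        using that cM sM by (simp add: N_def nat_pow_inv subgroup.m_inv_closed)
      show "a \<otimes> b \<in> N" if "a \<in> N" "b \<in> N" for a b
        using that cM sM comm[of a b] by (simp add: N_def pow_mult_distrib subgroup.m_closed)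
    qed (use cM sM in \<open>auto simp: N_def subgroup.one_closed\<close>)
    show "g \<otimes> h \<otimes> inv g \<in> N" if g: "g \<in> carrier G" and h: "h \<in> N" for g h
    proof -
      have hM: "h \<in> M" "h \<in> carrier G" using h cM by (auto simp: N_def)
      show ?thesis
        using g h hM normal_conj_closed[OF minimal_normal_normal[OF M]] by (simp add: N_def nat_pow_conj)
    qed
  qed
  moreover have "x [^] k \<in> N"
    using subgroup_int_pow_closed[OF sM x(1), of "int k"] k(2) by (simp add: N_def int_pow_int)
  ultimately have "N = M" using M k(1) unfolding minimal_normal_def N_def by blast
  then show "\<exists>p. Factorial_Ring.prime p \<and> (\<forall>x\<in>M. x [^] (p::nat) = \<one>)" using p(1) by (auto simp: N_def)
qed

abbreviation torsion_minimals :: "'a set set" where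
  "torsion_minimals \<equiv> {N. minimal_normal G N \<and> torsion_abelian (G\<lparr>carrier := N\<rparr>)}"

lemma torsion_minimals_subset: "\<Union>torsion_minimals \<subseteq> carrier G"
  using minimal_normal_normal normal_subset_carrier by blast

lemma A_sub_normal: "A_sub G \<lhd> G"
  unfolding A_sub_def using minimal_normal_normal by (intro generate_Union_normal) blast

lemma A_sub_subset_soc: "A_sub G \<subseteq> soc G"
  unfolding A_sub_def soc_def by (intro mono_generate) blast

lemma A_sub_commute:
  assumes "x \<in> A_sub G" "y \<in> A_sub G"
  shows "x \<otimes> y = y \<otimes> x"
  using assms unfolding A_sub_def
proof (rule generate_commute2[OF torsion_minimals_subset torsion_minimals_subset, rotated])
  fix s t assume "s \<in> \<Union>torsion_minimals" "t \<in> \<Union>torsion_minimals"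
  then obtain M N where MN: "minimal_normal G M" "torsion_abelian (G\<lparr>carrier := M\<rparr>)" "s \<in> M"
    "minimal_normal G N" "t \<in> N" by blast
  then show "s \<otimes> t = t \<otimes> s"
    using torsion_abelian_minimal_normal(1)[OF MN(1,2)] minimal_normal_commute[OF MN(1,4)]
    by (cases "M = N") auto
qed

lemma A_sub_torsion:
  assumes "x \<in> A_sub G"
  shows "\<exists>n::nat. n > 0 \<and> x [^] n = \<one>"
proof -
  have prime_power: "\<exists>n::nat. n > 0 \<and> h [^] n = \<one>" if "h \<in> \<Union>torsion_minimals" for h
    using that torsion_abelian_minimal_normal(2) prime_gt_0_nat by blast
  show ?thesis
    using assms unfolding A_sub_def
  proof induction
    case one
    then show ?case by (intro exI[of _ 1]) simp
  next
    case (incl h)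
    then show ?case using prime_power by blast
  next
    case (inv h)
    then obtain n :: nat where "n > 0" "h [^] n = \<one>" using prime_power by blast
    moreover have "h \<in> carrier G" using inv torsion_minimals_subset by blast
    ultimately show ?case by (intro exI[of _ n]) (simp add: nat_pow_inv)
  next
    case (eng a b)
    then obtain n m :: nat where nm: "n > 0" "a [^] n = \<one>" "m > 0" "b [^] m = \<one>" by blast
    have c: "a \<in> carrier G" "b \<in> carrier G"
      using eng generate_in_carrier[OF torsion_minimals_subset] by blast+
    have "a \<otimes> b = b \<otimes> a" using eng A_sub_commute unfolding A_sub_def by blast
    then have "(a \<otimes> b) [^] (n * m) = (a [^] n) [^] m \<otimes> (b [^] m) [^] n"
      using c pow_mult_distrib[of a b "n * m"] by (simp add: nat_pow_pow mult.commute[of m n])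
    then show ?case using nm by (intro exI[of _ "n * m"]) simp
  qed
qed

lemma A_sub_comm_group: "comm_group (G\<lparr>carrier := A_sub G\<rparr>)"
  using subgroup.subgroup_is_group[OF normal_imp_subgroup[OF A_sub_normal]] A_sub_commute
  by (intro group.group_comm_groupI) (auto simp: is_group)

end

section \<open>From representations to subgroups\<close>

lemma (in field) prime_multiple_nonzero:
  assumes p: "Factorial_Ring.prime (p::nat)" and "p \<noteq> ring_char R"
  shows "add_pow R p \<one> \<noteq> \<zero>"
proof
  assume "add_pow R p \<one> = \<zero>"
  then have "ring_char R dvd p"
    using add.pow_eq_id[of \<one> p] by (simp add: ring_char_def add_pow_def)
  then have "ring_char R = 1" using p assms(2) by (metis prime_nat_iff)
  then show False
    using add.ord_eq_1[of \<one>] one_not_zero by (simp add: ring_char_def)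
qed

context group begin

text \<open>Generators are merged one at a time. If \<open>m\<close> of order \<open>p\<close> is
  not yet covered by \<open>z\<close>, then \<open>p\<close> does not divide the order of
  \<open>z\<close> modulo \<open>C\<close>, and with coprime orders the product \<open>z m\<close>
  generates both modulo \<open>C\<close>.\<close>

lemma prime_order_elements_cyclic_mod:
  assumes A: "subgroup A G"
    and comm: "\<And>x y. x \<in> A \<Longrightarrow> y \<in> A \<Longrightarrow> x \<otimes> y = y \<otimes> x"
    and tors: "\<And>x. x \<in> A \<Longrightarrow> \<exists>n::nat. n > 0 \<and> x [^] n = \<one>"
    and C: "subgroup C G" "C \<subseteq> A"
    and rank: "\<And>p x m. Factorial_Ring.prime (p::nat) \<Longrightarrow> x \<in> A \<Longrightarrow> x \<notin> C \<Longrightarrow> x [^] p \<in> C \<Longrightarrow>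
       m \<in> A \<Longrightarrow> m \<noteq> \<one> \<Longrightarrow> m [^] p = \<one> \<Longrightarrow> \<exists>c\<in>C. \<exists>k::int. m = c \<otimes> x [^] k"
    and T: "finite T" "T \<subseteq> A" "\<And>t. t \<in> T \<Longrightarrow> \<exists>p. Factorial_Ring.prime (p::nat) \<and> t [^] p = \<one>"
  shows "\<exists>z\<in>A. \<forall>t\<in>T. \<exists>c\<in>C. \<exists>k::int. t = c \<otimes> z [^] k"
  using T
proof (induction T)
  case empty
  then show ?case using subgroup.one_closed[OF A] by auto
next
  case (insert m T)
  note cA = subgroup.mem_carrier[OF A] and cC = subgroup.mem_carrier[OF C(1)]
  have CA: "c \<in> A" if "c \<in> C" for c using that C by blast
  obtain z where z: "z \<in> A" "\<And>t. t \<in> T \<Longrightarrow> \<exists>c\<in>C. \<exists>k::int. t = c \<otimes> z [^] k"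
    using insert by (metis insert_iff insert_subset)
  obtain p where p: "Factorial_Ring.prime (p::nat)" "m [^] p = \<one>" using insert by blast
  have m: "m \<in> A" using insert by blast
  have zpow: "z [^] (k::nat) \<in> A" for k
    using subgroup_int_pow_closed[OF A z(1), of "int k"] by (simp add: int_pow_int)
  show ?case
  proof (cases "\<exists>c\<in>C. \<exists>k::int. m = c \<otimes> z [^] k")
    case True
    then show ?thesis using z by blast
  next
    case False
    have "m = \<one> \<otimes> z [^] (0::int)" if "m = \<one>" using that by simp
    then have m1: "m \<noteq> \<one>" using False subgroup.one_closed[OF C(1)] by blast
    obtain N :: nat where N: "N > 0" "z [^] N = \<one>" using tors z by blast
    define n where "n = (LEAST n::nat. n > 0 \<and> z [^] n \<in> C)"
    have ex: "\<exists>n::nat. n > 0 \<and> z [^] n \<in> C" using N subgroup.one_closed[OF C(1)] by auto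
    have n: "n > 0" "z [^] n \<in> C" using LeastI_ex[OF ex] by (auto simp: n_def)
    \<comment> \<open>Otherwise \<open>z^(n/p)\<close> has order \<open>p\<close> modulo
      \<open>C\<close>, and \<open>rank\<close> makes \<open>m\<close> a power of it modulo
      \<open>C\<close>.\<close>
    have "\<not> p dvd n"
    proof
      assume "p dvd n"
      then obtain q where q: "n = p * q" by blast
      then have q': "0 < q" "q < n" using n prime_gt_1_nat[OF p(1)] by auto
      then have "z [^] q \<notin> C"
        using not_less_Least[of q "\<lambda>n. n > 0 \<and> z [^] n \<in> C"] unfolding n_def by auto
      moreover have "(z [^] q) [^] p \<in> C" using n q z cA by (simp add: nat_pow_pow mult.commute)
      ultimately obtain c and k :: int where "c \<in> C" "m = c \<otimes> (z [^] q) [^] k"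
        using rank[OF p(1) zpow _ _ m m1 p(2)] by blast
      then have "m = c \<otimes> z [^] (int q * k)" using z cA by (simp add: int_pow_pow[symmetric] int_pow_int)
      then show False using False \<open>c \<in> C\<close> by blast
    qed
    then have cop: "coprime (int p) (int n)" using p(1) by (simp add: prime_imp_coprime)
    then obtain a b where ab: "a * int p + b * int n = 1"
      using bezout_int[of "int p" "int n"] by (auto simp: coprime_iff_gcd_eq_1)
    define y where "y = z \<otimes> m"
    have zm: "z \<in> carrier G" "m \<in> carrier G" "z \<otimes> m = m \<otimes> z" using z m cA comm by auto
    have y: "y \<in> A" "y \<in> carrier G" using z m A cA by (auto simp: y_def subgroup.m_closed)
    have ypow: "y [^] (k::int) = z [^] k \<otimes> m [^] k" for k
      unfolding y_def by (rule int_pow_mult_distrib[OF zm(3,1,2)])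
    have mp: "m [^] (int p * k) = \<one>" for k :: int
      using zm p by (simp add: int_pow_pow[symmetric] int_pow_int)
    have zn: "z [^] (int n * k) \<in> C" for k :: int
      using zm subgroup_int_pow_closed[OF C(1) n(2)] by (simp add: int_pow_pow[symmetric] int_pow_int)
    \<comment> \<open>By Bezout \<open>1 = n b + p a\<close>. The factor \<open>z^(n b)\<close> lies
      in \<open>C\<close>, and \<open>z^(p a)\<close> equals \<open>y^(p a)\<close> because
      \<open>m^p = 1\<close>. The roles are exchanged for \<open>m\<close> below.\<close>
    have zc: "\<exists>c\<in>C. \<exists>k::int. z = c \<otimes> y [^] k"
    proof -
      have "z [^] (int n * b) \<otimes> y [^] (int p * a) = z [^] (int n * b) \<otimes> z [^] (int p * a)"
        using zm by (simp add: ypow mp)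
      also have "\<dots> = z [^] (int n * b + int p * a)" using zm by (simp add: int_pow_mult)
      also have "int n * b + int p * a = 1" using ab by (simp add: mult.commute)
      finally have "z = z [^] (int n * b) \<otimes> y [^] (int p * a)" using zm by (simp add: int_pow_1)
      then show ?thesis using zn by blast
    qed
    have mc: "\<exists>c\<in>C. \<exists>k::int. m = c \<otimes> y [^] k"
    proof -
      have "m [^] (int n * b) = m [^] (int n * b + int p * a)"
        using zm mp by (simp add: int_pow_mult)
      also have "int n * b + int p * a = 1" using ab by (simp add: mult.commute)
      finally have "m = m [^] (int n * b)" using zm by (simp add: int_pow_1)
      also have "\<dots> = inv (z [^] (int n * b)) \<otimes> y [^] (int n * b)"
        using zm by (simp add: ypow inv_mult_cancel)
      finally show ?thesis using subgroup.m_inv_closed[OF C(1) zn] by blast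
    qed
    have "\<exists>c\<in>C. \<exists>k::int. t = c \<otimes> y [^] k" if t: "t \<in> T" for t
    proof -
      obtain c and k :: int where ck: "c \<in> C" "t = c \<otimes> z [^] k" using z(2)[OF t] by blast
      obtain d and l :: int where dl: "d \<in> C" "z = d \<otimes> y [^] l" using zc by blast
      have "d \<otimes> y [^] l = y [^] l \<otimes> d"
        using comm[OF CA[OF dl(1)] subgroup_int_pow_closed[OF A y(1)]] .
      then have "z [^] k = d [^] k \<otimes> (y [^] l) [^] k"
        using int_pow_mult_distrib[of d "y [^] l" k] dl cC[OF dl(1)] y by simp
      then have "t = (c \<otimes> d [^] k) \<otimes> y [^] (l * k)"
        using ck dl y cC by (simp add: int_pow_pow m_assoc)
      moreover have "c \<otimes> d [^] k \<in> C"
        using ck dl subgroup_int_pow_closed[OF C(1)] C(1) by (simp add: subgroup.m_closed)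
      ultimately show ?thesis by blast
    qed
    then show ?thesis using mc y by blast
  qed
qed

end

theorem (in group_representation) faithful_irreducible_imp_locally_cyclic:
  assumes faith: "faithful_rep G V \<rho>" and irr: "irreducible_rep G K V \<rho>"
    and char: "ring_char K \<notin> torsion_primes (G\<lparr>carrier := soc G\<rparr>)"
  shows "\<exists>C. subgroup C (G\<lparr>carrier := A_sub G\<rparr>) \<and>
         locally_cyclic ((G\<lparr>carrier := A_sub G\<rparr>) Mod C) \<and> core G C = {\<one>\<^bsub>G\<^esub>}"
proof -
  interpret G: group G by (rule group_G)
  define A where "A = A_sub G"
  note A_normal = G.A_sub_normal[folded A_def]
  note A = normal_imp_subgroup[OF A_normal]
  note comm = G.A_sub_commute[folded A_def] and tors = G.A_sub_torsion[folded A_def]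
  note cA = subgroup.mem_carrier[OF A]
  obtain v where v: "v \<in> carrier V" "v \<noteq> \<zero>\<^bsub>V\<^esub>"
    using irr M.zero_closed unfolding irreducible_rep_def by blast
  obtain C where C: "subgroup C G" "C \<subseteq> A" "\<not> vanishing C v"
    and max: "\<And>D. subgroup D G \<Longrightarrow> C \<subset> D \<Longrightarrow> D \<subseteq> A \<Longrightarrow> vanishing D v"
    using exists_maximal_nonvanishing[OF A comm tors v] by blast
  have CG: "C \<subseteq> carrier G" by (rule subgroup.subset[OF C(1)])
  have "core G C = {\<one>\<^bsub>G\<^esub>}"
  proof (rule ccontr)
    assume ne: "core G C \<noteq> {\<one>\<^bsub>G\<^esub>}"
    have sub: "core G C \<subseteq> C" by (rule G.core_subset[OF CG])
    then have coreA: "x \<in> A" if "x \<in> core G C" for x using that C(2) by blast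
    have "\<exists>H0. finite H0 \<and> subgroup H0 G \<and> H0 \<subseteq> core G C \<and>
        (\<forall>H. finite H \<longrightarrow> subgroup H G \<longrightarrow> H0 \<subseteq> H \<longrightarrow> norm_sum H v = \<zero>\<^bsub>V\<^esub>)"
      by (rule eventually_vanishing_normal[OF irr faith G.core_normal[OF C(1)] ne _ _ v])
        (simp_all add: comm tors coreA)
    then obtain H0 where H0: "finite H0" "subgroup H0 G" "H0 \<subseteq> core G C"
      "\<And>H. finite H \<Longrightarrow> subgroup H G \<Longrightarrow> H0 \<subseteq> H \<Longrightarrow> norm_sum H v = \<zero>\<^bsub>V\<^esub>" by auto
    have "H0 \<subseteq> C" using H0(3) sub by simp
    then have "vanishing C v"
      unfolding vanishing_def by (intro exI[of _ H0]) (simp add: H0)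
    then show False using C(3) by blast
  qed
  moreover have "locally_cyclic ((G\<lparr>carrier := A\<rparr>) Mod C)"
  proof -
    interpret A: comm_group "G\<lparr>carrier := A\<rparr>" using G.A_sub_comm_group by (simp add: A_def)
    have CA: "subgroup C (G\<lparr>carrier := A\<rparr>)" by (rule G.subgroup_incl[OF C(1) A C(2)])
    have pow: "x [^]\<^bsub>G\<lparr>carrier := A\<rparr>\<^esub> (k::int) = x [^]\<^bsub>G\<^esub> k" if "x \<in> A" for x k
      using G.int_pow_consistent[OF A that] by simp
    have rank: "\<exists>c\<in>C. \<exists>k::int. m = c \<otimes>\<^bsub>G\<^esub> x [^]\<^bsub>G\<^esub> k"
      if "Factorial_Ring.prime (p::nat)" "x \<in> A" "x \<notin> C" "x [^]\<^bsub>G\<^esub> p \<in> C"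
        "m \<in> A" "m \<noteq> \<one>\<^bsub>G\<^esub>" "m [^]\<^bsub>G\<^esub> p = \<one>\<^bsub>G\<^esub>" for p x m
    proof (rule maximal_nonvanishing_rank[OF A comm tors v(1) C max that(1) _ that(2-5)])
      \<comment> \<open>The element \<open>m\<close> itself shows that \<open>p\<close> is a torsion
        prime of the socle, hence not the characteristic. This is why \<open>rank\<close> speaks of
        \<open>m\<close> of order \<open>p\<close> in G and not only modulo
        \<open>C\<close>.\<close>
      have "p \<in> torsion_primes (G\<lparr>carrier := soc G\<rparr>)"
        using that G.A_sub_subset_soc unfolding A_def torsion_primes_def
        by (auto simp: G.nat_pow_consistent[symmetric])
      then show "add_pow K p \<one>\<^bsub>K\<^esub> \<noteq> \<zero>\<^bsub>K\<^esub>"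
        using char prime_multiple_nonzero[OF that(1)] by metis
      show "m [^]\<^bsub>G\<^esub> p \<in> C" using that(7) subgroup.one_closed[OF C(1)] by simp
    qed
    show ?thesis
      unfolding A.locally_cyclic_Mod_iff[OF CA]
    proof (intro allI impI)
      fix S assume S: "finite S" "S \<subseteq> carrier (G\<lparr>carrier := A\<rparr>)"
      \<comment> \<open>A(G) is generated by elements of prime order. So a finite \<open>S\<close>
        lies in the subgroup generated by finitely many of them, and it suffices to make those
        cyclic modulo \<open>C\<close>.\<close>
      define U where "U = \<Union>{N. minimal_normal G N \<and> torsion_abelian (G\<lparr>carrier := N\<rparr>)}"
      have AU: "A = generate G U" by (simp add: A_def A_sub_def U_def)
      have U_prime: "\<exists>p. Factorial_Ring.prime (p::nat) \<and> t [^]\<^bsub>G\<^esub> p = \<one>\<^bsub>G\<^esub>" if "t \<in> U" for t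
        using that G.torsion_abelian_minimal_normal(2) unfolding U_def by blast
      have "\<forall>s\<in>S. \<exists>T. finite T \<and> T \<subseteq> U \<and> s \<in> generate G T"
        using S(2) G.generate_finite_support[of _ U] by (auto simp: AU)
      then obtain T where T: "\<And>s. s \<in> S \<Longrightarrow> finite (T s) \<and> T s \<subseteq> U \<and> s \<in> generate G (T s)"
        by metis
      define W where "W = (\<Union>s\<in>S. T s)"
      have W: "finite W" using S(1) T by (simp add: W_def)
      have WU: "W \<subseteq> U" using T unfolding W_def by (intro UN_least) simp
      have UA: "U \<subseteq> A" unfolding AU by (auto intro: generate.incl)
      have "\<exists>z\<in>A. \<forall>t\<in>W. \<exists>c\<in>C. \<exists>k::int. t = c \<otimes>\<^bsub>G\<^esub> z [^]\<^bsub>G\<^esub> k"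
        using WU UA U_prime
        by (intro G.prime_order_elements_cyclic_mod[OF A comm tors C(1,2) rank W]) (simp_all add: subset_iff)
      then obtain z where z: "z \<in> A" "\<And>t. t \<in> W \<Longrightarrow> \<exists>c\<in>C. \<exists>k::int. t = c \<otimes>\<^bsub>G\<^esub> z [^]\<^bsub>G\<^esub> k"
        by auto
      have gz: "subgroup (generate G {z}) G" "generate G {z} \<subseteq> A"
        using z cA[OF z(1)] G.generate_subgroup_incl[OF _ A, of "{z}"]
        by (auto intro!: G.generate_is_subgroup)
      have sub: "subgroup (C <#>\<^bsub>G\<^esub> generate G {z}) G"
        by (rule G.commuting_set_mult_subgroup[OF C(1) gz(1)]) (use comm C(2) gz(2) in blast)
      have "W \<subseteq> C <#>\<^bsub>G\<^esub> generate G {z}"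
        using z(2) unfolding subset_iff G.mem_set_mult G.generate_pow[OF cA[OF z(1)]] by blast
      then have gW: "generate G W \<subseteq> C <#>\<^bsub>G\<^esub> generate G {z}" using sub by (rule G.generate_subgroup_incl)
      have "\<exists>c\<in>C. \<exists>k::int. s = c \<otimes>\<^bsub>G\<^esub> z [^]\<^bsub>G\<^esub> k" if s: "s \<in> S" for s
      proof -
        have "T s \<subseteq> W" using s by (auto simp: W_def)
        then have "s \<in> generate G W" using T[OF s] G.mono_generate by blast
        then have "s \<in> C <#>\<^bsub>G\<^esub> generate G {z}" using gW by blast
        then show ?thesis unfolding G.mem_set_mult G.generate_pow[OF cA[OF z(1)]] by blast
      qed
      then show "\<exists>z\<in>carrier (G\<lparr>carrier := A\<rparr>). \<forall>s\<in>S. \<exists>c\<in>C. \<exists>k::int.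
          s = c \<otimes>\<^bsub>G\<lparr>carrier := A\<rparr>\<^esub> z [^]\<^bsub>G\<lparr>carrier := A\<rparr>\<^esub> k"
        using z(1) by (intro bexI[of _ z]) (auto simp: pow)
    qed
  qed
  ultimately show ?thesis
    using G.subgroup_incl[OF C(1) A C(2)] unfolding A_def by blast
qed

section \<open>Irreducible subquotients generated by a vector\<close>

lemma (in abelian_group) minus_minus_minus:
  assumes "x \<in> carrier G" "y \<in> carrier G" "z \<in> carrier G"
  shows "(z \<ominus> y) \<ominus> (x \<ominus> y) = z \<ominus> x"
proof -
  have "\<ominus> y \<oplus> (\<ominus> x \<oplus> y) = \<ominus> x"
    using assms by (subst a_comm[of "\<ominus> x"]) (simp_all add: r_neg1)
  then show ?thesis using assms by (simp add: a_minus_def minus_add a_assoc)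
qed

lemma (in abelian_group) minus_plus_minus:
  assumes "x \<in> carrier G" "y \<in> carrier G" "z \<in> carrier G"
  shows "(z \<ominus> x) \<oplus> (x \<ominus> y) = z \<ominus> y"
  using assms by (simp add: a_minus_def a_assoc r_neg1)

lemma (in abelian_group) minus_zero_right:
  assumes "x \<in> carrier G"
  shows "x \<ominus> \<zero> = x"
proof -
  have "\<ominus> \<zero> = \<zero>" by (rule minus_equality) simp_all
  then show ?thesis using assms by (simp add: a_minus_def)
qed

lemma (in module) submodule_facts:
  assumes "submodule W R M"
  shows "W \<subseteq> carrier M" "\<zero>\<^bsub>M\<^esub> \<in> W"
    "\<And>a. a \<in> W \<Longrightarrow> \<ominus>\<^bsub>M\<^esub> a \<in> W"
    "\<And>a b. a \<in> W \<Longrightarrow> b \<in> W \<Longrightarrow> a \<oplus>\<^bsub>M\<^esub> b \<in> W"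
    "\<And>a b. a \<in> W \<Longrightarrow> b \<in> W \<Longrightarrow> a \<ominus>\<^bsub>M\<^esub> b \<in> W"
    "\<And>r a. r \<in> carrier R \<Longrightarrow> a \<in> W \<Longrightarrow> r \<odot>\<^bsub>M\<^esub> a \<in> W"
proof -
  note E = submoduleE[OF assms]
  show 1: "W \<subseteq> carrier M" by (rule E(1))
  show neg: "\<ominus>\<^bsub>M\<^esub> a \<in> W" if "a \<in> W" for a by (rule E(3)[OF that])
  show sm: "r \<odot>\<^bsub>M\<^esub> a \<in> W" if "r \<in> carrier R" "a \<in> W" for r a by (rule E(4)[OF that])
  show add: "a \<oplus>\<^bsub>M\<^esub> b \<in> W" if "a \<in> W" "b \<in> W" for a b by (rule E(5)[OF that])
  show "a \<ominus>\<^bsub>M\<^esub> b \<in> W" if "a \<in> W" "b \<in> W" for a b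
    unfolding a_minus_def by (rule add[OF that(1) neg[OF that(2)]])
  obtain w where w: "w \<in> W" using E(2) by blast
  have "w \<oplus>\<^bsub>M\<^esub> \<ominus>\<^bsub>M\<^esub> w \<in> W" by (rule add[OF w neg[OF w]])
  then show "\<zero>\<^bsub>M\<^esub> \<in> W" using w 1 by (simp add: M.r_neg subset_iff)
qed

context group_representation
begin

text \<open>Avoiding one vector is preserved by unions of chains. Keeping \<open>W0\<close> inside
  \<open>W\<close> keeps the relations that hold modulo \<open>W0\<close>.\<close>

lemma exists_maximal_invariant_submodule:
  assumes W0: "submodule W0 K V" "\<And>g. g \<in> carrier G \<Longrightarrow> \<rho> g ` W0 \<subseteq> W0" "u \<notin> W0"
  obtains W where "submodule W K V" "\<And>g. g \<in> carrier G \<Longrightarrow> \<rho> g ` W \<subseteq> W" "W0 \<subseteq> W" "u \<notin> W"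
    "\<And>Y. submodule Y K V \<Longrightarrow> (\<And>g. g \<in> carrier G \<Longrightarrow> \<rho> g ` Y \<subseteq> Y) \<Longrightarrow> W \<subseteq> Y \<Longrightarrow> u \<notin> Y \<Longrightarrow> Y = W"
proof -
  define \<W> where "\<W> = {W. submodule W K V \<and> (\<forall>g\<in>carrier G. \<rho> g ` W \<subseteq> W) \<and> W0 \<subseteq> W \<and> u \<notin> W}"
  have "W0 \<in> \<W>" using W0 by (simp add: \<W>_def)
  then have ne: "\<W> \<noteq> {}" by blast
  have "\<Union>\<K> \<in> \<W>" if ch: "\<K> \<noteq> {}" "subset.chain \<W> \<K>" for \<K>
  proof -
    have sub: "submodule W K V" "\<And>g. g \<in> carrier G \<Longrightarrow> \<rho> g ` W \<subseteq> W" "W0 \<subseteq> W" "u \<notin> W" if "W \<in> \<K>" for W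
    proof -
      have "W \<in> \<W>" using that ch(2) unfolding subset.chain_def by blast
      then show "submodule W K V" "\<And>g. g \<in> carrier G \<Longrightarrow> \<rho> g ` W \<subseteq> W" "W0 \<subseteq> W" "u \<notin> W"
        by (simp_all add: \<W>_def)
    qed
    have dir: "\<exists>W\<in>\<K>. S \<subseteq> W" if "finite S" "S \<subseteq> \<Union>\<K>" for S
      using finite_subset_Union_chain[OF that ch] by blast
    have "submodule (\<Union>\<K>) K V"
    proof (rule submoduleI)
      show "\<Union>\<K> \<subseteq> carrier V" using submodule_facts(1)[OF sub(1)] by auto
      obtain W where "W \<in> \<K>" using ch(1) by blast
      then show "\<zero>\<^bsub>V\<^esub> \<in> \<Union>\<K>" using submodule_facts(2)[OF sub(1)] by auto
      show "\<ominus>\<^bsub>V\<^esub> a \<in> \<Union>\<K>" if "a \<in> \<Union>\<K>" for a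
        using that submodule_facts(3)[OF sub(1)] by auto
      show "a \<oplus>\<^bsub>V\<^esub> b \<in> \<Union>\<K>" if "a \<in> \<Union>\<K>" "b \<in> \<Union>\<K>" for a b
      proof -
        obtain W where "W \<in> \<K>" "{a, b} \<subseteq> W" using dir[of "{a, b}"] \<open>a \<in> \<Union>\<K>\<close> \<open>b \<in> \<Union>\<K>\<close> by auto
        then show ?thesis using submodule_facts(4)[OF sub(1)] by auto
      qed
      show "a \<odot>\<^bsub>V\<^esub> x \<in> \<Union>\<K>" if "a \<in> carrier K" "x \<in> \<Union>\<K>" for a x
        using that submodule_facts(6)[OF sub(1)] by auto
    qed
    moreover have "\<rho> g ` (\<Union>\<K>) \<subseteq> \<Union>\<K>" if "g \<in> carrier G" for g
      using sub(2)[OF _ that] by blast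
    moreover have "W0 \<subseteq> \<Union>\<K>" using sub(3) ch(1) by blast
    moreover have "u \<notin> \<Union>\<K>" using sub(4) by blast
    ultimately show ?thesis by (simp add: \<W>_def)
  qed
  then obtain W where W: "W \<in> \<W>" "\<And>Y. Y \<in> \<W> \<Longrightarrow> W \<subseteq> Y \<Longrightarrow> Y = W"
    using subset_Zorn_nonempty[OF ne] by meson
  show thesis
  proof (rule that[of W])
    show "Y = W" if "submodule Y K V" "\<And>g. g \<in> carrier G \<Longrightarrow> \<rho> g ` Y \<subseteq> Y" "W \<subseteq> Y" "u \<notin> Y" for Y
      using that W by (intro W(2)) (auto simp: \<W>_def)
  qed (use W(1) in \<open>auto simp: \<W>_def\<close>)
qed

text \<open>In the image of the submodule generated by \<open>u\<close> modulo \<open>W\<close>, a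
  nonzero submodule lifts to one strictly above \<open>W\<close>; by maximality it contains
  \<open>u\<close> and hence everything. The last clause turns trivial action on this quotient into
  a congruence for \<open>u\<close> alone.\<close>

lemma irreducible_subquotient:
  assumes W0: "submodule W0 K V" "\<And>g. g \<in> carrier G \<Longrightarrow> \<rho> g ` W0 \<subseteq> W0" "u \<notin> W0"
    and u: "u \<in> carrier V"
  obtains W and V' :: "('k, 'v set) module" and \<rho>'
  where "submodule W K V" "\<And>g. g \<in> carrier G \<Longrightarrow> \<rho> g ` W \<subseteq> W" "W0 \<subseteq> W" "u \<notin> W"
    "group_representation G K V' \<rho>'" "irreducible_rep G K V' \<rho>'"
    "\<And>g. g \<in> carrier G \<Longrightarrow> (\<forall>x\<in>carrier V'. \<rho>' g x = x) \<Longrightarrow> \<rho> g u \<ominus>\<^bsub>V\<^esub> u \<in> W"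
proof -
  interpret G: group G by (rule group_G)
  obtain W where W: "submodule W K V" "\<And>g. g \<in> carrier G \<Longrightarrow> \<rho> g ` W \<subseteq> W" "W0 \<subseteq> W" "u \<notin> W"
    and max: "\<And>Y. submodule Y K V \<Longrightarrow> (\<And>g. g \<in> carrier G \<Longrightarrow> \<rho> g ` Y \<subseteq> Y) \<Longrightarrow> W \<subseteq> Y \<Longrightarrow> u \<notin> Y \<Longrightarrow> Y = W"
    using exists_maximal_invariant_submodule[OF W0] by blast
  note Wf = submodule_facts[OF W(1)]
  define Q where "Q = orbit_span u"
  have Qf: "submodule Q K V" unfolding Q_def by (rule orbit_span_submodule[OF u])
  note Qf = submodule_facts[OF Qf]
  have Q\<rho>: "\<rho> g x \<in> Q" if "g \<in> carrier G" "x \<in> Q" for g x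
    using orbit_span_rep[OF u] that by (simp add: Q_def)
  have uQ: "u \<in> Q" unfolding Q_def by (rule orbit_span_base[OF u])
  have QV: "x \<in> carrier V" if "x \<in> Q" for x using Qf(1) that by blast
  \<comment> \<open>The coset of \<open>x\<close> modulo \<open>W\<close>, formed in all of V rather
    than in \<open>Q\<close>; the quotient consists of the cosets of elements of
    \<open>Q\<close>.\<close>
  define q where "q x = {y \<in> carrier V. y \<ominus>\<^bsub>V\<^esub> x \<in> W}" for x
  have qeq: "q x = q y \<longleftrightarrow> x \<ominus>\<^bsub>V\<^esub> y \<in> W" if xy: "x \<in> carrier V" "y \<in> carrier V" for x y
  proof
    assume "q x = q y"
    moreover have "x \<in> q x" using xy Wf(2) by (simp add: q_def M.minus_eq_zero_iff[THEN iffD2])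
    ultimately show "x \<ominus>\<^bsub>V\<^esub> y \<in> W" by (simp add: q_def)
  next
    assume d: "x \<ominus>\<^bsub>V\<^esub> y \<in> W"
    have "z \<ominus>\<^bsub>V\<^esub> x \<in> W \<longleftrightarrow> z \<ominus>\<^bsub>V\<^esub> y \<in> W" if "z \<in> carrier V" for z
      using M.minus_plus_minus[OF xy that] M.minus_minus_minus[OF xy that] d Wf(4,5) by metis
    then show "q x = q y" by (auto simp: q_def)
  qed
  \<comment> \<open>Operations on cosets are defined through representatives in \<open>Q\<close>; by
    \<open>iW\<close>, another representative changes the result only by an element of
    \<open>W\<close>.\<close>
  define i where "i = inv_into Q q"
  have i: "i (q x) \<in> Q" "q (i (q x)) = q x" if "x \<in> Q" for x
    unfolding i_def using that by (simp_all add: inv_into_into f_inv_into_f)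
  have iW: "i (q x) \<ominus>\<^bsub>V\<^esub> x \<in> W" if "x \<in> Q" for x
    using qeq[of "i (q x)" x] i[OF that] that QV by simp
  define V' :: "('k, 'v set) module" where
    "V' = \<lparr>carrier = q ` Q, monoid.mult = undefined, monoid.one = undefined,
      ring.zero = q \<zero>\<^bsub>V\<^esub>,
      ring.add = \<lambda>x y. q (i x \<oplus>\<^bsub>V\<^esub> i y), module.smult = \<lambda>a x. q (a \<odot>\<^bsub>V\<^esub> i x)\<rparr>"
  define \<rho>' where "\<rho>' g = (\<lambda>x\<in>q ` Q. q (\<rho> g (i x)))" for g
  have V'_simps [simp]: "carrier V' = q ` Q" "\<zero>\<^bsub>V'\<^esub> = q \<zero>\<^bsub>V\<^esub>"
    by (simp_all add: V'_def)
  have qadd [simp]: "q x \<oplus>\<^bsub>V'\<^esub> q y = q (x \<oplus>\<^bsub>V\<^esub> y)" if xy: "x \<in> Q" "y \<in> Q" for x y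
  proof -
    have c: "i (q x) \<in> carrier V" "i (q y) \<in> carrier V" "x \<in> carrier V" "y \<in> carrier V"
      using xy i QV by auto
    have "(i (q x) \<oplus>\<^bsub>V\<^esub> i (q y)) \<ominus>\<^bsub>V\<^esub> (x \<oplus>\<^bsub>V\<^esub> y)
      = (i (q x) \<ominus>\<^bsub>V\<^esub> x) \<oplus>\<^bsub>V\<^esub> (i (q y) \<ominus>\<^bsub>V\<^esub> y)"
      using c by (simp add: a_minus_def M.a_ac M.minus_add)
    then show ?thesis using Wf(4)[OF iW[OF xy(1)] iW[OF xy(2)]] c by (simp add: V'_def qeq)
  qed
  have qsm [simp]: "a \<odot>\<^bsub>V'\<^esub> q x = q (a \<odot>\<^bsub>V\<^esub> x)" if ax: "a \<in> carrier K" "x \<in> Q" for a x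
  proof -
    have c: "i (q x) \<in> carrier V" "x \<in> carrier V" using ax i QV by auto
    have "a \<odot>\<^bsub>V\<^esub> i (q x) \<ominus>\<^bsub>V\<^esub> a \<odot>\<^bsub>V\<^esub> x = a \<odot>\<^bsub>V\<^esub> (i (q x) \<ominus>\<^bsub>V\<^esub> x)"
      using c ax by (simp add: a_minus_def smult_r_distr smult_r_minus)
    then show ?thesis using Wf(6)[OF ax(1) iW[OF ax(2)]] c ax by (simp add: V'_def qeq)
  qed
  have q\<rho> [simp]: "\<rho>' g (q x) = q (\<rho> g x)" if gx: "g \<in> carrier G" "x \<in> Q" for g x
  proof -
    have c: "i (q x) \<in> carrier V" "x \<in> carrier V" using gx i QV by auto
    have "\<rho> g (i (q x)) \<ominus>\<^bsub>V\<^esub> \<rho> g x = \<rho> g (i (q x) \<ominus>\<^bsub>V\<^esub> x)" using c gx by (simp add: rep_diff)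
    then have "\<rho> g (i (q x)) \<ominus>\<^bsub>V\<^esub> \<rho> g x \<in> W" using W(2)[OF gx(1)] iW[OF gx(2)] by auto
    then show ?thesis using c gx by (simp add: \<rho>'_def qeq action_closed)
  qed
  have ab: "abelian_group V'"
  proof (rule abelian_groupI)
    fix x assume "x \<in> carrier V'"
    then obtain y where y: "y \<in> Q" "x = q y" by auto
    have "q (\<ominus>\<^bsub>V\<^esub> y) \<oplus>\<^bsub>V'\<^esub> x = \<zero>\<^bsub>V'\<^esub>"
      using y Qf QV by (simp add: M.l_neg)
    then show "\<exists>y\<in>carrier V'. y \<oplus>\<^bsub>V'\<^esub> x = \<zero>\<^bsub>V'\<^esub>"
      using y(1) Qf(3) by (intro bexI[of _ "q (\<ominus>\<^bsub>V\<^esub> y)"]) auto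
  qed (use Qf QV in \<open>auto simp: M.a_ac\<close>)
  have mod: "module K V'"
    by (rule moduleI[OF is_cring ab])
      (use Qf QV in \<open>auto simp: smult_l_distr smult_r_distr smult_assoc1\<close>)
  interpret V': module K V' by (rule mod)
  have act: "group_action G (carrier V') \<rho>'"
    unfolding group_action_def group_hom_def group_hom_axioms_def hom_def
  proof (intro conjI G.group_axioms group_BijGroup CollectI ballI funcsetI)
    have bij: "\<rho>' g \<in> Bij (carrier V')" if g: "g \<in> carrier G" for g
    proof -
      have inv: "\<rho>' (inv\<^bsub>G\<^esub> g) (\<rho>' g x) = x" if "x \<in> q ` Q" "g \<in> carrier G" for g x
        using that by (auto simp: Q\<rho> rep_inv_cancel QV)
      have "bij_betw (\<rho>' g) (q ` Q) (q ` Q)"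
        by (rule bij_betw_byWitness[where f' = "\<rho>' (inv\<^bsub>G\<^esub> g)"])
          (use inv[OF _ g] inv[of _ "inv\<^bsub>G\<^esub> g"] g Q\<rho> in auto)
      then show ?thesis by (simp add: Bij_def \<rho>'_def)
    qed
    show "\<rho>' g \<in> carrier (BijGroup (carrier V'))" if "g \<in> carrier G" for g
      using bij[OF that] by (simp add: BijGroup_def)
    fix a b assume ab: "a \<in> carrier G" "b \<in> carrier G"
    have "\<rho>' (a \<otimes>\<^bsub>G\<^esub> b) = compose (carrier V') (\<rho>' a) (\<rho>' b)"
    proof
      fix x
      show "\<rho>' (a \<otimes>\<^bsub>G\<^esub> b) x = compose (carrier V') (\<rho>' a) (\<rho>' b) x"
      proof (cases "x \<in> q ` Q")
        case True
        then obtain y where "y \<in> Q" "x = q y" by auto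
        then show ?thesis
          using ab by (simp add: compose_def rep_mult QV Q\<rho>)
      qed (simp add: compose_def \<rho>'_def)
    qed
    then show "\<rho>' (a \<otimes>\<^bsub>G\<^esub> b) = \<rho>' a \<otimes>\<^bsub>BijGroup (carrier V')\<^esub> \<rho>' b"
      using bij[OF ab(1)] bij[OF ab(2)] by (simp add: BijGroup_def)
  qed
  have rep: "group_representation G K V' \<rho>'"
    unfolding group_representation_def group_representation_axioms_def
    using field_axioms mod act by (auto simp: rep_add rep_smult Qf Q\<rho> QV)
  have irr: "irreducible_rep G K V' \<rho>'"
    unfolding irreducible_rep_def
  proof (intro conjI allI impI)
    have "q u \<noteq> q \<zero>\<^bsub>V\<^esub>" using qeq[OF u M.zero_closed] W(4) u by (simp add: M.minus_zero_right)
    then show "carrier V' \<noteq> {\<zero>\<^bsub>V'\<^esub>}" using uQ by auto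
    fix Y assume Y: "submodule Y K V'" and inv: "\<forall>g\<in>carrier G. \<rho>' g ` Y \<subseteq> Y"
    note Yf = V'.submodule_facts[OF Y]
    define Y' where "Y' = {x \<in> Q. q x \<in> Y}"
    have YY: "Y = q ` Y'" using Yf(1) by (auto simp: Y'_def)
    have Y'sm: "a \<odot>\<^bsub>V\<^esub> x \<in> Y'" if "a \<in> carrier K" "x \<in> Y'" for a x
      using that Yf(6)[of a "q x"] Qf(6) by (simp add: Y'_def)
    have Y'add: "x \<oplus>\<^bsub>V\<^esub> y \<in> Y'" if "x \<in> Y'" "y \<in> Y'" for x y
      using that Yf(4)[of "q x" "q y"] Qf(4) by (simp add: Y'_def)
    have Y'\<rho>: "\<rho> g x \<in> Y'" if "g \<in> carrier G" "x \<in> Y'" for g x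
    proof -
      have "\<rho>' g (q x) \<in> Y" using inv that unfolding Y'_def by blast
      then show ?thesis using that Q\<rho> by (simp add: Y'_def)
    qed
    have Y'0: "\<zero>\<^bsub>V\<^esub> \<in> Y'" using Yf(2) Qf(2) by (simp add: Y'_def)
    have Y'neg: "\<ominus>\<^bsub>V\<^esub> x \<in> Y'" if "x \<in> Y'" for x
      using Y'sm[of "\<ominus>\<^bsub>K\<^esub> \<one>\<^bsub>K\<^esub>" x] that QV by (simp add: Y'_def smult_l_minus)
    have Y'V: "x \<in> carrier V" if "x \<in> Y'" for x using that QV by (simp add: Y'_def)
    \<comment> \<open>This is the sum of \<open>W\<close> and the lift \<open>Y'\<close>. Either it
      avoids \<open>u\<close>, and maximality makes it \<open>W\<close>, so \<open>Y\<close> is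
      zero; or it contains \<open>u\<close>, and then \<open>u\<close> lies in \<open>Y'\<close>,
      which is all of \<open>Q\<close>.\<close>
    define W1 where "W1 = {w \<oplus>\<^bsub>V\<^esub> y |w y. w \<in> W \<and> y \<in> Y'}"
    have WV: "w \<in> carrier V" if "w \<in> W" for w using that Wf(1) by blast
    have sub: "submodule W1 K V"
    proof (rule submoduleI)
      show "W1 \<subseteq> carrier V" using WV Y'V by (auto simp: W1_def)
      show "\<zero>\<^bsub>V\<^esub> \<in> W1" unfolding W1_def using Wf(2) Y'0 M.l_zero[OF M.zero_closed] by force
      show "\<ominus>\<^bsub>V\<^esub> a \<in> W1" if "a \<in> W1" for a
      proof -
        obtain w y where a: "w \<in> W" "y \<in> Y'" "a = w \<oplus>\<^bsub>V\<^esub> y" using \<open>a \<in> W1\<close> by (auto simp: W1_def)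
        then have "\<ominus>\<^bsub>V\<^esub> a = \<ominus>\<^bsub>V\<^esub> w \<oplus>\<^bsub>V\<^esub> \<ominus>\<^bsub>V\<^esub> y" using WV Y'V by (simp add: M.minus_add)
        then show ?thesis unfolding W1_def using Wf(3)[OF a(1)] Y'neg[OF a(2)] by blast
      qed
      show "a \<oplus>\<^bsub>V\<^esub> b \<in> W1" if "a \<in> W1" "b \<in> W1" for a b
      proof -
        obtain w y where a: "w \<in> W" "y \<in> Y'" "a = w \<oplus>\<^bsub>V\<^esub> y" using \<open>a \<in> W1\<close> by (auto simp: W1_def)
        obtain w' y' where b: "w' \<in> W" "y' \<in> Y'" "b = w' \<oplus>\<^bsub>V\<^esub> y'" using \<open>b \<in> W1\<close> by (auto simp: W1_def)
        have "a \<oplus>\<^bsub>V\<^esub> b = (w \<oplus>\<^bsub>V\<^esub> w') \<oplus>\<^bsub>V\<^esub> (y \<oplus>\<^bsub>V\<^esub> y')" using a b WV Y'V by (simp add: M.a_ac)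
        then show ?thesis unfolding W1_def using Wf(4)[OF a(1) b(1)] Y'add[OF a(2) b(2)] by blast
      qed
      show "r \<odot>\<^bsub>V\<^esub> a \<in> W1" if "r \<in> carrier K" "a \<in> W1" for r a
      proof -
        obtain w y where a: "w \<in> W" "y \<in> Y'" "a = w \<oplus>\<^bsub>V\<^esub> y" using \<open>a \<in> W1\<close> by (auto simp: W1_def)
        then have "r \<odot>\<^bsub>V\<^esub> a = r \<odot>\<^bsub>V\<^esub> w \<oplus>\<^bsub>V\<^esub> r \<odot>\<^bsub>V\<^esub> y"
          using WV Y'V that(1) by (simp add: smult_r_distr)
        then show ?thesis unfolding W1_def using Wf(6)[OF that(1) a(1)] Y'sm[OF that(1) a(2)] by blast
      qed
    qed
    have W1\<rho>: "\<rho> g ` W1 \<subseteq> W1" if g: "g \<in> carrier G" for g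
    proof
      fix x assume "x \<in> \<rho> g ` W1"
      then obtain w y where a: "w \<in> W" "y \<in> Y'" "x = \<rho> g (w \<oplus>\<^bsub>V\<^esub> y)" by (auto simp: W1_def)
      then have "x = \<rho> g w \<oplus>\<^bsub>V\<^esub> \<rho> g y" using WV Y'V g by (simp add: rep_add)
      moreover have "\<rho> g w \<in> W" using W(2)[OF g] a(1) by blast
      ultimately show "x \<in> W1" unfolding W1_def using Y'\<rho>[OF g a(2)] by blast
    qed
    have WW1: "W \<subseteq> W1"
    proof
      fix w assume w: "w \<in> W"
      then have "w = w \<oplus>\<^bsub>V\<^esub> \<zero>\<^bsub>V\<^esub>" using WV by simp
      then show "w \<in> W1" unfolding W1_def using w Y'0 by blast
    qed
    show "Y = {\<zero>\<^bsub>V'\<^esub>} \<or> Y = carrier V'"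
    proof (cases "u \<in> W1")
      case False
      have "W1 = W" by (rule max[OF sub W1\<rho> WW1 False])
      have q0: "q y = q \<zero>\<^bsub>V\<^esub>" if y: "y \<in> Y'" for y
      proof -
        have "y = \<zero>\<^bsub>V\<^esub> \<oplus>\<^bsub>V\<^esub> y" using Y'V[OF y] by simp
        then have "y \<in> W1" unfolding W1_def using Wf(2) y by blast
        then show ?thesis using \<open>W1 = W\<close> Y'V[OF y] by (simp add: qeq M.minus_zero_right)
      qed
      have "Y \<subseteq> {q \<zero>\<^bsub>V\<^esub>}" unfolding YY by (rule image_subsetI) (simp only: singleton_iff q0)
      moreover have "q \<zero>\<^bsub>V\<^esub> \<in> Y" using YY Y'0 by blast
      ultimately show ?thesis by auto
    next
      case True
      then obtain w y where a: "w \<in> W" "y \<in> Y'" "u = w \<oplus>\<^bsub>V\<^esub> y" unfolding W1_def by blast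
      have "(w \<oplus>\<^bsub>V\<^esub> y) \<ominus>\<^bsub>V\<^esub> y = w"
        using WV[OF a(1)] Y'V[OF a(2)] by (simp add: a_minus_def M.a_assoc M.r_neg)
      then have "q u = q y" using a qeq[OF u Y'V[OF a(2)]] by simp
      then have uY: "u \<in> Y'" using a(2) uQ by (simp add: Y'_def)
      have "x \<in> Y'" if "x \<in> orbit_span u" for x
        using that by induction (auto intro!: Y'0 Y'add Y'sm Y'\<rho> uY)
      then have "Y' = Q" by (auto simp: Q_def Y'_def)
      then show ?thesis using YY by simp
    qed
  qed
  have ker: "\<rho> g u \<ominus>\<^bsub>V\<^esub> u \<in> W" if g: "g \<in> carrier G" and triv: "\<forall>x\<in>carrier V'. \<rho>' g x = x" for g
  proof -
    have "q (\<rho> g u) = q u" using triv uQ g by force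
    then show ?thesis using qeq[of "\<rho> g u" u] u g by (simp add: action_closed)
  qed
  show thesis by (rule that[OF W rep irr ker])
qed

end

section \<open>Representations from certificates\<close>

text \<open>Values lie in the larger field \<open>F\<close> because the characters need them, but
  scalars act only through \<open>h\<close> from \<open>K\<close>, since irreducibility is wanted
  over \<open>K\<close>. The multiplicative fields come from the record type of modules, which
  extends that of rings.\<close>

definition fun_module ::
  "('k, 'l) ring_scheme \<Rightarrow> ('f, 'o) ring_scheme \<Rightarrow> ('k \<Rightarrow> 'f) \<Rightarrow> ('k, 'p \<Rightarrow> 'f) module" where
  "fun_module K F h = \<lparr>carrier = {f. \<forall>p. f p \<in> carrier F}, monoid.mult = undefined, monoid.one = undefined,
      ring.zero = (\<lambda>p. \<zero>\<^bsub>F\<^esub>), ring.add = (\<lambda>f g p. f p \<oplus>\<^bsub>F\<^esub> g p),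
      module.smult = (\<lambda>a f p. h a \<otimes>\<^bsub>F\<^esub> f p)\<rparr>"

lemma fun_module_simps [simp]:
  "f \<in> carrier (fun_module K F h) \<longleftrightarrow> (\<forall>p. f p \<in> carrier F)"
  "\<zero>\<^bsub>fun_module K F h\<^esub> = (\<lambda>p. \<zero>\<^bsub>F\<^esub>)"
  "f \<oplus>\<^bsub>fun_module K F h\<^esub> g = (\<lambda>p. f p \<oplus>\<^bsub>F\<^esub> g p)"
  "a \<odot>\<^bsub>fun_module K F h\<^esub> f = (\<lambda>p. h a \<otimes>\<^bsub>F\<^esub> f p)"
  by (simp_all add: fun_module_def)

lemma module_fun_module:
  assumes "field K" "field F" "h \<in> ring_hom K F"
  shows "module K (fun_module K F h)"
proof -
  interpret K: field K by fact
  interpret F: field F by fact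
  note h = ring_hom_closed[OF assms(3)] ring_hom_add[OF assms(3)] ring_hom_mult[OF assms(3)]
    ring_hom_one[OF assms(3)]
  have "abelian_group (fun_module K F h)"
  proof (rule abelian_groupI)
    fix f assume f: "f \<in> carrier (fun_module K F h)"
    then show "\<exists>g\<in>carrier (fun_module K F h). g \<oplus>\<^bsub>fun_module K F h\<^esub> f = \<zero>\<^bsub>fun_module K F h\<^esub>"
      by (intro bexI[of _ "\<lambda>p. \<ominus>\<^bsub>F\<^esub> f p"]) (auto simp: F.l_neg)
  qed (auto simp: F.a_ac)
  then show ?thesis
    by (intro moduleI K.is_cring) (auto simp: h F.l_distr F.r_distr F.m_assoc)
qed

lemma fun_module_minus:
  assumes "field K" "field F" "h \<in> ring_hom K F"
    and "f \<in> carrier (fun_module K F h)" "g \<in> carrier (fun_module K F h)"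
  shows "f \<ominus>\<^bsub>fun_module K F h\<^esub> g = (\<lambda>p. f p \<ominus>\<^bsub>F\<^esub> g p)"
proof -
  interpret F: field F by fact
  interpret M: module K "fun_module K F h" using assms by (intro module_fun_module)
  have "\<ominus>\<^bsub>fun_module K F h\<^esub> g = (\<lambda>p. \<ominus>\<^bsub>F\<^esub> g p)"
    using assms by (intro M.minus_equality) (auto simp: F.l_neg)
  then show ?thesis by (simp add: a_minus_def)
qed

text \<open>
  The points \<open>(s, x)\<close> with \<open>x \<notin> carrier G\<close> are junk, which no element of \<open>G\<close> moves.
\<close>

definition translation_rep where
  "translation_rep G E g = (\<lambda>f\<in>E. \<lambda>(s, x). if x \<in> carrier G then f (s, x \<otimes>\<^bsub>G\<^esub> g) else f (s, x))"

lemma group_representation_fun_module: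
  assumes "group G" "field K" "field F" "h \<in> ring_hom K F"
  defines "V \<equiv> fun_module K F h"
  shows "group_representation G K V (translation_rep G (carrier V))"
proof -
  interpret G: group G by fact
  interpret F: field F by fact
  interpret M: module K V unfolding V_def using assms by (intro module_fun_module)
  define \<rho> where "\<rho> = translation_rep G (carrier V)"
  have \<rho>: "\<rho> g f = (\<lambda>(s, x). if x \<in> carrier G then f (s, x \<otimes>\<^bsub>G\<^esub> g) else f (s, x))"
    if "f \<in> carrier V" for g f using that by (simp add: \<rho>_def translation_rep_def)
  have closed: "\<rho> g f \<in> carrier V" if "f \<in> carrier V" for g f
    using that unfolding \<rho>[OF that] by (auto simp: V_def)
  have mult: "\<rho> (a \<otimes>\<^bsub>G\<^esub> b) f = \<rho> a (\<rho> b f)" if "f \<in> carrier V" "a \<in> carrier G" "b \<in> carrier G" for a b f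
    using that closed[OF that(1)] by (auto simp: \<rho> G.m_assoc)
  have one: "\<rho> \<one>\<^bsub>G\<^esub> f = f" if "f \<in> carrier V" for f
    using that by (auto simp: \<rho>)
  have bij: "\<rho> g \<in> Bij (carrier V)" if g: "g \<in> carrier G" for g
  proof -
    have inv: "\<rho> (inv\<^bsub>G\<^esub> g) (\<rho> g f) = f" "\<rho> g (\<rho> (inv\<^bsub>G\<^esub> g) f) = f" if "f \<in> carrier V" for f
      using that g mult[of f "inv\<^bsub>G\<^esub> g" g] mult[of f g "inv\<^bsub>G\<^esub> g"] one by simp_all
    have "bij_betw (\<rho> g) (carrier V) (carrier V)"
      by (rule bij_betw_byWitness[where f' = "\<rho> (inv\<^bsub>G\<^esub> g)"]) (use inv closed in auto)
    moreover have "\<rho> g \<in> extensional (carrier V)" by (simp add: \<rho>_def translation_rep_def)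
    ultimately show ?thesis by (simp add: Bij_def)
  qed
  have "group_action G (carrier V) \<rho>"
    unfolding group_action_def group_hom_def group_hom_axioms_def hom_def
  proof (intro conjI G.group_axioms group_BijGroup CollectI ballI funcsetI)
    show "\<rho> g \<in> carrier (BijGroup (carrier V))" if "g \<in> carrier G" for g
      using bij[OF that] by (simp add: BijGroup_def)
    fix a b assume ab: "a \<in> carrier G" "b \<in> carrier G"
    have "\<rho> (a \<otimes>\<^bsub>G\<^esub> b) = compose (carrier V) (\<rho> a) (\<rho> b)"
    proof
      fix f
      show "\<rho> (a \<otimes>\<^bsub>G\<^esub> b) f = compose (carrier V) (\<rho> a) (\<rho> b) f"
      proof (cases "f \<in> carrier V")
        case True
        then show ?thesis using ab by (simp add: compose_def mult)
      next
        case False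
        then show ?thesis by (simp add: compose_def \<rho>_def translation_rep_def)
      qed
    qed
    then show "\<rho> (a \<otimes>\<^bsub>G\<^esub> b) = \<rho> a \<otimes>\<^bsub>BijGroup (carrier V)\<^esub> \<rho> b"
      using bij[OF ab(1)] bij[OF ab(2)] by (simp add: BijGroup_def)
  qed
  moreover have "\<rho> g (f \<oplus>\<^bsub>V\<^esub> f') = \<rho> g f \<oplus>\<^bsub>V\<^esub> \<rho> g f'"
    if "f \<in> carrier V" "f' \<in> carrier V" for g f f'
    using that M.M.a_closed[OF that] by (auto simp: \<rho>) (auto simp: V_def)
  moreover have "\<rho> g (a \<odot>\<^bsub>V\<^esub> f) = a \<odot>\<^bsub>V\<^esub> \<rho> g f" if "f \<in> carrier V" "a \<in> carrier K" for g a f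
    using that M.smult_closed[OF that(2,1)] by (auto simp: \<rho>) (auto simp: V_def)
  ultimately show ?thesis
    unfolding group_representation_def group_representation_axioms_def \<rho>_def[symmetric]
    using assms(2) M.module_axioms by auto
qed

text \<open>The value of the formal sum of the terms \<open>g(m - 1)\<close> under the linear
  extension of \<open>\<chi>\<close>.\<close>

fun cert_sum :: "('f, 'o) ring_scheme \<Rightarrow> ('g \<Rightarrow> 'f) \<Rightarrow> ('g \<times> 'g) list \<Rightarrow> 'f" where
  "cert_sum F \<chi> [] = \<zero>\<^bsub>F\<^esub>"
| "cert_sum F \<chi> ((g, m) # l) = \<chi> g \<otimes>\<^bsub>F\<^esub> (\<chi> m \<ominus>\<^bsub>F\<^esub> \<one>\<^bsub>F\<^esub>) \<oplus>\<^bsub>F\<^esub> cert_sum F \<chi> l"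

text \<open>
  A certificate \<open>(l, c)\<close> stands for the relation \<open>\<Sum>g(m - 1) = c\<close> of the group algebra, the sum
  running over the pairs \<open>(g, m)\<close> in \<open>l\<close>. In a module generated by a vector satisfying it, and
  with \<open>c \<noteq> 0\<close>, the elements \<open>m\<close> cannot all act trivially.
\<close>

definition satisfies ::
  "('g, 'm) monoid_scheme \<Rightarrow> ('f, 'o) ring_scheme \<Rightarrow> ('k \<Rightarrow> 'f) \<Rightarrow> 'g set \<Rightarrow> ('g \<Rightarrow> 'f)
    \<Rightarrow> ('g \<times> 'g) list \<times> 'k \<Rightarrow> bool" where
  "satisfies G F h D \<chi> \<kappa> \<longleftrightarrow> subgroup D G \<and> \<chi> \<in> hom (G\<lparr>carrier := D\<rparr>) (mult_of F) \<and>
     set (fst \<kappa>) \<subseteq> D \<times> D \<and> cert_sum F \<chi> (fst \<kappa>) = h (snd \<kappa>)"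

fun (in group_representation) cert_vec where
  "cert_vec u [] = \<zero>\<^bsub>V\<^esub>"
| "cert_vec u ((g, m) # l) = \<rho> g (\<rho> m u \<ominus>\<^bsub>V\<^esub> u) \<oplus>\<^bsub>V\<^esub> cert_vec u l"

lemma (in group_representation) cert_vec_mem:
  assumes W: "submodule W K V" "\<And>g. g \<in> carrier G \<Longrightarrow> \<rho> g ` W \<subseteq> W"
    and "set l \<subseteq> carrier G \<times> carrier G" "\<And>g m. (g, m) \<in> set l \<Longrightarrow> \<rho> m u \<ominus>\<^bsub>V\<^esub> u \<in> W"
  shows "cert_vec u l \<in> W"
  using assms(3,4)
proof (induction l)
  case Nil
  then show ?case using submodule_facts(2)[OF W(1)] by simp
next
  case (Cons gm l)
  obtain g m where gm: "gm = (g, m)" by (cases gm)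
  have "\<rho> g (\<rho> m u \<ominus>\<^bsub>V\<^esub> u) \<in> W" using W(2)[of g] Cons(2,3) gm by auto
  moreover have "cert_vec u l \<in> W" using Cons by auto
  ultimately show ?case using submodule_facts(4)[OF W(1)] gm by simp
qed

text \<open>
  A reduced product: for every finite set \<open>S\<close> of certificates, the vector \<open>u\<close> restricts to the copy \<open>S\<close> as the
  extension by zero of a character \<open>\<chi> S\<close> satisfying \<open>S\<close>, and \<open>W0\<close> consists of the functions
  vanishing at all large enough \<open>S\<close>. Modulo \<open>W0\<close>, the vector \<open>u\<close> is nonzero and satisfies all
  certificates.
\<close>

theorem certificates_imp_representation:
  fixes G :: "('g, 'm) monoid_scheme" and K :: "('k, 'l) ring_scheme" and F :: "('f, 'o) ring_scheme"
    and I :: "'i set" and \<kappa> :: "'i \<Rightarrow> ('g \<times> 'g) list \<times> 'k"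
  assumes "group G" "field K" "field F" and h: "h \<in> ring_hom K F"
    and \<kappa>: "\<And>i. i \<in> I \<Longrightarrow> set (fst (\<kappa> i)) \<subseteq> carrier G \<times> carrier G \<and> snd (\<kappa> i) \<in> carrier K - {\<zero>\<^bsub>K\<^esub>}"
    and sat: "\<And>S. finite S \<Longrightarrow> S \<subseteq> I \<Longrightarrow> \<exists>D \<chi>. subgroup D G \<and> \<chi> \<in> hom (G\<lparr>carrier := D\<rparr>) (mult_of F) \<and>
      (\<forall>i\<in>S. satisfies G F h D \<chi> (\<kappa> i))"
  obtains V :: "('k, ('i set \<times> 'g \<Rightarrow> 'f) set) module" and \<rho>
  where "group_representation G K V \<rho>" "irreducible_rep G K V \<rho>"
    "\<And>i. i \<in> I \<Longrightarrow> \<exists>(g, m)\<in>set (fst (\<kappa> i)). \<exists>x\<in>carrier V. \<rho> m x \<noteq> x"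
proof -
  interpret G: group G by fact
  interpret K: field K by fact
  interpret F: field F by fact
  obtain D \<chi> where "\<forall>S. finite S \<longrightarrow> S \<subseteq> I \<longrightarrow> subgroup (D S) G \<and> \<chi> S \<in> hom (G\<lparr>carrier := D S\<rparr>) (mult_of F) \<and>
      (\<forall>i\<in>S. satisfies G F h (D S) (\<chi> S) (\<kappa> i))"
    using sat by metis
  then have D: "subgroup (D S) G" and \<chi>: "\<chi> S \<in> hom (G\<lparr>carrier := D S\<rparr>) (mult_of F)"
    and sat': "\<And>i. i \<in> S \<Longrightarrow> satisfies G F h (D S) (\<chi> S) (\<kappa> i)" if "finite S" "S \<subseteq> I" for S
    using that by auto
  have \<chi>c: "\<chi> S x \<in> carrier F" "\<chi> S x \<noteq> \<zero>\<^bsub>F\<^esub>" if "finite S" "S \<subseteq> I" "x \<in> D S" for S x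
    using hom_in_carrier[OF \<chi>[OF that(1,2)], of x] that(3) by simp_all
  have \<chi>m: "\<chi> S (x \<otimes>\<^bsub>G\<^esub> y) = \<chi> S x \<otimes>\<^bsub>F\<^esub> \<chi> S y" if "finite S" "S \<subseteq> I" "x \<in> D S" "y \<in> D S" for S x y
    using hom_mult[OF \<chi>[OF that(1,2)], of x y] that(3,4) by simp
  define V where "V = (fun_module K F h :: ('k, 'i set \<times> 'g \<Rightarrow> 'f) module)"
  define \<rho> where "\<rho> = translation_rep G (carrier V)"
  interpret R: group_representation G K V \<rho>
    unfolding V_def \<rho>_def using assms(1-4) by (rule group_representation_fun_module)
  have \<rho>: "\<rho> g f (s, x) = (if x \<in> carrier G then f (s, x \<otimes>\<^bsub>G\<^esub> g) else f (s, x))"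
    if "f \<in> carrier V" for g f s x
    using that by (simp add: \<rho>_def translation_rep_def)
  have minus: "(f \<ominus>\<^bsub>V\<^esub> g) p = f p \<ominus>\<^bsub>F\<^esub> g p" if "f \<in> carrier V" "g \<in> carrier V" for f g p
    using that fun_module_minus[OF assms(2-4), of f g] by (simp add: V_def)
  have V_simps: "\<zero>\<^bsub>V\<^esub> p = \<zero>\<^bsub>F\<^esub>" "(f \<oplus>\<^bsub>V\<^esub> g) p = f p \<oplus>\<^bsub>F\<^esub> g p" for p f g
    by (simp_all add: V_def)
  define u where "u = (\<lambda>(S, x). if finite S \<and> S \<subseteq> I \<and> x \<in> D S then \<chi> S x else \<zero>\<^bsub>F\<^esub>)"
  have u: "u \<in> carrier V" using \<chi>c by (auto simp: V_def u_def)
  define W0 where "W0 = {f \<in> carrier V. \<exists>S0. finite S0 \<and> S0 \<subseteq> I \<and>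
    (\<forall>S. finite S \<longrightarrow> S0 \<subseteq> S \<longrightarrow> S \<subseteq> I \<longrightarrow> (\<forall>x. f (S, x) = \<zero>\<^bsub>F\<^esub>))}"
  have W0I: "f \<in> W0" if "f \<in> carrier V" "finite S0" "S0 \<subseteq> I"
    "\<And>S x. finite S \<Longrightarrow> S0 \<subseteq> S \<Longrightarrow> S \<subseteq> I \<Longrightarrow> f (S, x) = \<zero>\<^bsub>F\<^esub>" for f S0
    using that by (auto simp: W0_def)
  have h0: "h \<zero>\<^bsub>K\<^esub> = \<zero>\<^bsub>F\<^esub>" by (rule ring_hom_zero[OF h K.is_ring F.is_ring])
  have sub: "submodule W0 K V"
  proof (rule R.submoduleI)
    show "W0 \<subseteq> carrier V" by (auto simp: W0_def)
    show "\<zero>\<^bsub>V\<^esub> \<in> W0" by (rule W0I[of _ "{}"]) (auto simp: V_def)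
    show sm: "a \<odot>\<^bsub>V\<^esub> f \<in> W0" if "a \<in> carrier K" "f \<in> W0" for a f
    proof -
      obtain S0 where f: "f \<in> carrier V" "finite S0" "S0 \<subseteq> I"
        "\<And>S x. finite S \<Longrightarrow> S0 \<subseteq> S \<Longrightarrow> S \<subseteq> I \<Longrightarrow> f (S, x) = \<zero>\<^bsub>F\<^esub>"
        using \<open>f \<in> W0\<close> by (auto simp: W0_def)
      have "(a \<odot>\<^bsub>V\<^esub> f) (S, x) = \<zero>\<^bsub>F\<^esub>" if "finite S" "S0 \<subseteq> S" "S \<subseteq> I" for S x
        using f(4)[OF that] ring_hom_closed[OF h \<open>a \<in> carrier K\<close>] by (simp add: V_def)
      then show ?thesis using f that(1) by (intro W0I[of _ S0]) auto
    qed
    show "\<ominus>\<^bsub>V\<^esub> f \<in> W0" if f: "f \<in> W0" for f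
    proof -
      have "f \<in> carrier V" using f by (simp add: W0_def)
      then have "\<ominus>\<^bsub>V\<^esub> f = (\<ominus>\<^bsub>K\<^esub> \<one>\<^bsub>K\<^esub>) \<odot>\<^bsub>V\<^esub> f" by (simp add: R.smult_l_minus)
      then show ?thesis using sm[OF _ f, of "\<ominus>\<^bsub>K\<^esub> \<one>\<^bsub>K\<^esub>"] by simp
    qed
    show "f \<oplus>\<^bsub>V\<^esub> f' \<in> W0" if "f \<in> W0" "f' \<in> W0" for f f'
    proof -
      obtain S0 where f: "f \<in> carrier V" "finite S0" "S0 \<subseteq> I"
        "\<And>S x. finite S \<Longrightarrow> S0 \<subseteq> S \<Longrightarrow> S \<subseteq> I \<Longrightarrow> f (S, x) = \<zero>\<^bsub>F\<^esub>"
        using \<open>f \<in> W0\<close> by (auto simp: W0_def)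
      obtain S1 where f': "f' \<in> carrier V" "finite S1" "S1 \<subseteq> I"
        "\<And>S x. finite S \<Longrightarrow> S1 \<subseteq> S \<Longrightarrow> S \<subseteq> I \<Longrightarrow> f' (S, x) = \<zero>\<^bsub>F\<^esub>"
        using \<open>f' \<in> W0\<close> by (auto simp: W0_def)
      have "(f \<oplus>\<^bsub>V\<^esub> f') (S, x) = \<zero>\<^bsub>F\<^esub>" if "finite S" "S0 \<union> S1 \<subseteq> S" "S \<subseteq> I" for S x
        using f(4)[of S x] f'(4)[of S x] that by (simp add: V_def)
      then show ?thesis using f f' by (intro W0I[of _ "S0 \<union> S1"]) auto
    qed
  qed
  have inv: "\<rho> g ` W0 \<subseteq> W0" if g: "g \<in> carrier G" for g
  proof
    fix f' assume "f' \<in> \<rho> g ` W0"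
    then obtain f where "f \<in> W0" and f': "f' = \<rho> g f" by blast
    then obtain S0 where f: "f \<in> carrier V" "finite S0" "S0 \<subseteq> I"
      "\<And>S x. finite S \<Longrightarrow> S0 \<subseteq> S \<Longrightarrow> S \<subseteq> I \<Longrightarrow> f (S, x) = \<zero>\<^bsub>F\<^esub>"
      by (auto simp: W0_def)
    show "f' \<in> W0" unfolding f'
      using f g by (intro W0I[of _ S0]) (auto simp: \<rho> R.action_closed)
  qed
  \<comment> \<open>At the point \<open>(S0, 1)\<close> the function \<open>u\<close> takes the
    value of a character at the identity, which is nonzero, for every candidate bound
    \<open>S0\<close>.\<close>
  have u0: "u \<notin> W0"
  proof
    assume "u \<in> W0"
    then obtain S0 where S0: "finite S0" "S0 \<subseteq> I" "u (S0, \<one>\<^bsub>G\<^esub>) = \<zero>\<^bsub>F\<^esub>" by (auto simp: W0_def)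
    have "\<one>\<^bsub>G\<^esub> \<in> D S0" using D S0 subgroup.one_closed by blast
    then show False using S0 \<chi>c(2) by (simp add: u_def)
  qed
  \<comment> \<open>Right translation by an element of \<open>D S\<close> preserves both the
    subgroup and its complement, so this eigenvector equation holds off the subgroup as well, where
    both sides are zero.\<close>
  have ux: "u (S, x \<otimes>\<^bsub>G\<^esub> m) = \<chi> S m \<otimes>\<^bsub>F\<^esub> u (S, x)"
    if S: "finite S" "S \<subseteq> I" and x: "x \<in> carrier G" and m: "m \<in> D S" for S x m
  proof (cases "x \<in> D S")
    case True
    then show ?thesis
      using S m \<chi>m[OF S True m] \<chi>c[OF S m] \<chi>c[OF S True] subgroup.m_closed[OF D[OF S] True m]
      by (simp add: u_def F.m_comm)
  next
    case False
    have mG: "m \<in> carrier G" using subgroup.mem_carrier[OF D[OF S] m] .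
    have "x \<otimes>\<^bsub>G\<^esub> m \<notin> D S"
    proof
      assume "x \<otimes>\<^bsub>G\<^esub> m \<in> D S"
      then have "(x \<otimes>\<^bsub>G\<^esub> m) \<otimes>\<^bsub>G\<^esub> inv\<^bsub>G\<^esub> m \<in> D S"
        using D[OF S] m by (simp add: subgroup.m_closed subgroup.m_inv_closed)
      then show False using False x mG by (simp add: G.m_assoc)
    qed
    then show ?thesis using False \<chi>c[OF S m] by (simp add: u_def)
  qed
  have uF: "u p \<in> carrier F" for p using u by (cases p) (simp add: V_def)
  \<comment> \<open>On the copy \<open>S\<close>, the formal sum therefore acts on \<open>u\<close>
    as multiplication by its character value. The condition on \<open>l\<close> puts all elements
    into the domain of that character.\<close>
  have cv: "R.cert_vec u l \<in> carrier V \<and> (\<forall>S x. finite S \<longrightarrow> S \<subseteq> I \<longrightarrow> set l \<subseteq> D S \<times> D S \<longrightarrow>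
      cert_sum F (\<chi> S) l \<in> carrier F \<and> R.cert_vec u l (S, x) = cert_sum F (\<chi> S) l \<otimes>\<^bsub>F\<^esub> u (S, x))"
    if "set l \<subseteq> carrier G \<times> carrier G" for l
    using that
  proof (induction l)
    case Nil
    have "(\<lambda>p. \<zero>\<^bsub>F\<^esub>) \<in> carrier V" by (simp add: V_def)
    then show ?case using uF by (simp add: V_simps)
  next
    case (Cons gm l)
    obtain g m where gm: "gm = (g, m)" by (cases gm)
    then have c: "g \<in> carrier G" "m \<in> carrier G" using Cons by auto
    define d where "d = \<rho> m u \<ominus>\<^bsub>V\<^esub> u"
    have mu: "\<rho> m u \<in> carrier V" using c u by (simp add: R.action_closed)
    then have d: "d \<in> carrier V" using u by (simp add: d_def)
    have dp: "d p = \<rho> m u p \<ominus>\<^bsub>F\<^esub> u p" for p by (simp add: d_def minus[OF mu u])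
    have gd: "\<rho> g d \<in> carrier V" using c d by (simp add: R.action_closed)
    have IH: "R.cert_vec u l \<in> carrier V" using Cons by simp
    have "cert_sum F (\<chi> S) (gm # l) \<in> carrier F \<and>
        R.cert_vec u (gm # l) (S, x) = cert_sum F (\<chi> S) (gm # l) \<otimes>\<^bsub>F\<^esub> u (S, x)"
      if S: "finite S" "S \<subseteq> I" and sl: "set (gm # l) \<subseteq> D S \<times> D S" for S x
    proof -
      have IH': "cert_sum F (\<chi> S) l \<in> carrier F"
        "R.cert_vec u l (S, x) = cert_sum F (\<chi> S) l \<otimes>\<^bsub>F\<^esub> u (S, x)"
        using Cons S sl by auto
      have gX: "g \<in> D S" "m \<in> D S" using sl gm by auto
      note cc = \<chi>c(1)[OF S gX(1)] \<chi>c(1)[OF S gX(2)]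
      have "\<rho> g d (S, x) = \<chi> S g \<otimes>\<^bsub>F\<^esub> (\<chi> S m \<ominus>\<^bsub>F\<^esub> \<one>\<^bsub>F\<^esub>) \<otimes>\<^bsub>F\<^esub> u (S, x)"
      proof (cases "x \<in> carrier G")
        case True
        have xg: "x \<otimes>\<^bsub>G\<^esub> g \<in> carrier G" using True c by simp
        have "\<rho> g d (S, x) = \<rho> m u (S, x \<otimes>\<^bsub>G\<^esub> g) \<ominus>\<^bsub>F\<^esub> u (S, x \<otimes>\<^bsub>G\<^esub> g)"
          using True by (simp add: \<rho>[OF d] dp)
        also have "\<dots> = \<chi> S m \<otimes>\<^bsub>F\<^esub> (\<chi> S g \<otimes>\<^bsub>F\<^esub> u (S, x)) \<ominus>\<^bsub>F\<^esub> \<chi> S g \<otimes>\<^bsub>F\<^esub> u (S, x)"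
          using xg by (simp add: \<rho>[OF u] ux[OF S xg gX(2)] ux[OF S True gX(1)])
        also have "\<dots> = \<chi> S g \<otimes>\<^bsub>F\<^esub> (\<chi> S m \<ominus>\<^bsub>F\<^esub> \<one>\<^bsub>F\<^esub>) \<otimes>\<^bsub>F\<^esub> u (S, x)"
          using cc uF[of "(S, x)"] by algebra
        finally show ?thesis .
      next
        case False
        then have "x \<notin> D S" using subgroup.mem_carrier[OF D[OF S]] by blast
        then have ux0: "u (S, x) = \<zero>\<^bsub>F\<^esub>" by (simp add: u_def)
        have "\<rho> g d (S, x) = \<zero>\<^bsub>F\<^esub> \<ominus>\<^bsub>F\<^esub> \<zero>\<^bsub>F\<^esub>"
          using False by (simp add: \<rho>[OF d] dp \<rho>[OF u] ux0)
        then show ?thesis using cc by (simp add: ux0)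
      qed
      then show ?thesis
        using IH' cc uF[of "(S, x)"] gm by (simp add: V_simps d_def[symmetric] F.l_distr)
    qed
    then show ?case using IH gd gm by (simp add: d_def)
  qed
  \<comment> \<open>The bound \<open>{i}\<close> is enough: on every copy indexed by a set
    containing \<open>i\<close>, the relation holds exactly.\<close>
  have cert: "R.cert_vec u (fst (\<kappa> i)) \<ominus>\<^bsub>V\<^esub> snd (\<kappa> i) \<odot>\<^bsub>V\<^esub> u \<in> W0" if i: "i \<in> I" for i
  proof (rule W0I[of _ "{i}"])
    have cG: "set (fst (\<kappa> i)) \<subseteq> carrier G \<times> carrier G" and cK: "snd (\<kappa> i) \<in> carrier K" using \<kappa>[OF i] by auto
    have 1: "R.cert_vec u (fst (\<kappa> i)) \<in> carrier V" using cv[OF cG] by blast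
    have 2: "snd (\<kappa> i) \<odot>\<^bsub>V\<^esub> u \<in> carrier V" by (rule R.smult_closed[OF cK u])
    show "R.cert_vec u (fst (\<kappa> i)) \<ominus>\<^bsub>V\<^esub> snd (\<kappa> i) \<odot>\<^bsub>V\<^esub> u \<in> carrier V" using 1 2 by simp
    fix S x assume S: "finite S" "{i} \<subseteq> S" "S \<subseteq> I"
    have s: "satisfies G F h (D S) (\<chi> S) (\<kappa> i)" using sat'[OF S(1,3)] S(2) by blast
    have "R.cert_vec u (fst (\<kappa> i)) (S, x) = h (snd (\<kappa> i)) \<otimes>\<^bsub>F\<^esub> u (S, x)"
      using cv[OF cG] S s by (auto simp: satisfies_def)
    moreover have "(snd (\<kappa> i) \<odot>\<^bsub>V\<^esub> u) (S, x) = h (snd (\<kappa> i)) \<otimes>\<^bsub>F\<^esub> u (S, x)"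
      by (simp add: V_def)
    ultimately show "(R.cert_vec u (fst (\<kappa> i)) \<ominus>\<^bsub>V\<^esub> snd (\<kappa> i) \<odot>\<^bsub>V\<^esub> u) (S, x) = \<zero>\<^bsub>F\<^esub>"
      using minus[OF 1 2] uF ring_hom_closed[OF h cK] by simp
  qed (use i in auto)
  obtain W and V' :: "('k, ('i set \<times> 'g \<Rightarrow> 'f) set) module" and \<rho>' where
    W: "submodule W K V" "\<And>g. g \<in> carrier G \<Longrightarrow> \<rho> g ` W \<subseteq> W" "W0 \<subseteq> W" "u \<notin> W"
    and V': "group_representation G K V' \<rho>'" "irreducible_rep G K V' \<rho>'"
    and ker: "\<And>g. g \<in> carrier G \<Longrightarrow> (\<forall>x\<in>carrier V'. \<rho>' g x = x) \<Longrightarrow> \<rho> g u \<ominus>\<^bsub>V\<^esub> u \<in> W"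
    using R.irreducible_subquotient[OF sub inv u0 u] by blast
  note Wf = R.submodule_facts[OF W(1)]
  show thesis
  proof (rule that[OF V'])
    fix i assume i: "i \<in> I"
    define c where "c = snd (\<kappa> i)"
    have cG: "set (fst (\<kappa> i)) \<subseteq> carrier G \<times> carrier G" and cK: "c \<in> carrier K" "c \<noteq> \<zero>\<^bsub>K\<^esub>"
      using \<kappa>[OF i] by (auto simp: c_def)
    show "\<exists>(g, m)\<in>set (fst (\<kappa> i)). \<exists>x\<in>carrier V'. \<rho>' m x \<noteq> x"
    proof (rule ccontr)
      assume "\<not> ?thesis"
      then have triv: "\<rho>' m x = x" if "(g, m) \<in> set (fst (\<kappa> i))" "x \<in> carrier V'" for g m x
        using that by blast
      have "R.cert_vec u (fst (\<kappa> i)) \<in> W"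
        using triv ker cG by (intro R.cert_vec_mem[OF W(1,2) cG]) auto
      moreover have "R.cert_vec u (fst (\<kappa> i)) \<ominus>\<^bsub>V\<^esub> c \<odot>\<^bsub>V\<^esub> u \<in> W" using cert[OF i] W(3) by (auto simp: c_def)
      ultimately have "R.cert_vec u (fst (\<kappa> i)) \<ominus>\<^bsub>V\<^esub> (R.cert_vec u (fst (\<kappa> i)) \<ominus>\<^bsub>V\<^esub> c \<odot>\<^bsub>V\<^esub> u) \<in> W"
        by (rule Wf(5))
      moreover have "R.cert_vec u (fst (\<kappa> i)) \<ominus>\<^bsub>V\<^esub> (R.cert_vec u (fst (\<kappa> i)) \<ominus>\<^bsub>V\<^esub> c \<odot>\<^bsub>V\<^esub> u) = c \<odot>\<^bsub>V\<^esub> u"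
        using cv[OF cG] R.smult_closed[OF cK(1) u]
        by (simp add: a_minus_def R.M.minus_add R.M.r_neg2)
      ultimately have cu: "c \<odot>\<^bsub>V\<^esub> u \<in> W" by simp
      have cU: "c \<in> Units K" using cK by (simp add: K.field_Units)
      have "inv\<^bsub>K\<^esub> c \<odot>\<^bsub>V\<^esub> (c \<odot>\<^bsub>V\<^esub> u) = (inv\<^bsub>K\<^esub> c \<otimes>\<^bsub>K\<^esub> c) \<odot>\<^bsub>V\<^esub> u"
        using cU u cK by (intro R.smult_assoc1[symmetric]) auto
      also have "\<dots> = u" using cU u by (simp add: K.Units_l_inv)
      finally show False using Wf(6)[OF K.Units_inv_closed[OF cU] cu] W(4) by simp
    qed
  qed
qed

section \<open>Monomial equations over algebraically closed fields\<close>

context algebraically_closed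
begin

lemma exists_root_of_positive_degree:
  assumes "p \<in> carrier (poly_ring L)" "degree p > 0"
  shows "\<exists>x\<in>carrier L. eval p x = \<zero>"
proof -
  have "size (roots p) > 0" using roots_over_carrier[OF assms(1)] assms(2) by (simp add: splitted_def)
  then obtain x where "x \<in># roots p" by (cases "roots p") auto
  then show ?thesis using roots_mem_iff_is_root[OF assms(1)] unfolding is_root_def by blast
qed

text \<open>The list of \<open>n\<close> ones is the polynomial
  \<open>1 + X + ... + X^(n-1)\<close>, and the identity is the geometric sum.\<close>

lemma eval_replicate_one:
  assumes "x \<in> carrier L"
  shows "eval (replicate n \<one>) x \<in> carrier L"
    and "(x \<ominus> \<one>) \<otimes> eval (replicate n \<one>) x = x [^] n \<ominus> \<one>"
proof -
  show c: "eval (replicate n \<one>) x \<in> carrier L" for n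
    using assms by (induction n) auto
  show "(x \<ominus> \<one>) \<otimes> eval (replicate n \<one>) x = x [^] n \<ominus> \<one>"
  proof (induction n)
    case 0
    then show ?case using assms by (simp add: a_minus_def r_neg)
  next
    case (Suc n)
    have xn: "x [^] n \<in> carrier L" using assms by simp
    have "(x \<ominus> \<one>) \<otimes> eval (replicate (Suc n) \<one>) x
      = (x \<ominus> \<one>) \<otimes> x [^] n \<oplus> (x \<ominus> \<one>) \<otimes> eval (replicate n \<one>) x"
      using assms c[of n] xn by (simp add: r_distr)
    also have "\<dots> = (x \<ominus> \<one>) \<otimes> x [^] n \<oplus> (x [^] n \<ominus> \<one>)" by (simp only: Suc)
    also have "\<dots> = x \<otimes> x [^] n \<ominus> \<one>" using assms xn by algebra
    also have "x \<otimes> x [^] n = x [^] Suc n" using assms by (simp add: m_comm)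
    finally show ?case .
  qed
qed

lemma eval_replicate_one_at_one: "eval (replicate n \<one>) \<one> = add_pow L n \<one>"
  by (induction n) (simp_all add: a_comm)

text \<open>A root of \<open>1 + X + ... + X^(r-1)\<close> is an \<open>r\<close>-th root of unity,
  and it is not 1 because the value of the polynomial at 1 is \<open>r\<close>, which is nonzero in
  the field.\<close>

lemma exists_primitive_root_of_unity:
  assumes r: "Factorial_Ring.prime (r::nat)" "add_pow L r \<one> \<noteq> \<zero>"
  shows "\<exists>\<zeta>\<in>carrier L. \<zeta> \<noteq> \<zero> \<and> \<zeta> \<noteq> \<one> \<and> \<zeta> [^] r = \<one>"
proof -
  have r1: "r > 1" using prime_gt_1_nat[OF r(1)] .
  have "replicate r \<one> \<in> carrier (poly_ring L)"
    using r1 one_not_zero unfolding univ_poly_carrier[symmetric] polynomial_def by (cases r) auto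
  then obtain \<zeta> where z: "\<zeta> \<in> carrier L" "eval (replicate r \<one>) \<zeta> = \<zero>"
    using exists_root_of_positive_degree[of "replicate r \<one>"] r1 by auto
  have "\<zeta> [^] r \<ominus> \<one> = \<zero>" using eval_replicate_one(2)[OF z(1), of r] z by simp
  then have zr: "\<zeta> [^] r = \<one>" using z(1) by simp
  moreover have "\<zeta> \<noteq> \<one>" using z(2) r(2) eval_replicate_one_at_one by metis
  moreover have "\<zeta> \<noteq> \<zero>" using zr r1 one_not_zero by (auto simp: nat_pow_zero)
  ultimately show ?thesis using z(1) by blast
qed

lemma infinite_carrier: "infinite (carrier L)"
proof
  assume fin: "finite (carrier L)"
  interpret M: group "mult_of L" by (rule field_mult_group)
  let ?n = "order (mult_of L)"
  have fm: "finite (carrier (mult_of L))" using fin by simp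
  then have n: "?n > 0" using M.order_gt_0_iff_finite by simp
  \<comment> \<open>The polynomial \<open>X^(n+1) - X + 1\<close>, with \<open>n\<close> the number
    of nonzero elements. Since \<open>x^(n+1) = x\<close> for all \<open>x\<close>, it is constantly
    1 and has no root.\<close>
  define p where "p = \<one> # replicate (?n - 1) \<zero> @ [\<ominus> \<one>, \<one>]"
  have pc: "set p \<subseteq> carrier L" by (auto simp: p_def)
  have "p \<in> carrier (poly_ring L)"
    using one_not_zero pc unfolding univ_poly_carrier[symmetric] polynomial_def by (simp add: p_def)
  moreover have "degree p > 0" by (simp add: p_def)
  ultimately obtain x where x: "x \<in> carrier L" "eval p x = \<zero>" using exists_root_of_positive_degree by blast
  have xn: "x [^] Suc ?n = x"
  proof (cases "x = \<zero>")
    case False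
    then have "x [^]\<^bsub>mult_of L\<^esub> ?n = \<one>" using M.pow_order_eq_1[of x] x by simp
    then show ?thesis using x by (simp add: Multiplicative_Group.nat_pow_mult_of)
  qed simp
  have "eval (replicate (?n - 1) \<zero> @ [\<ominus> \<one>, \<one>]) x = \<ominus> x \<oplus> \<one>"
    using eval_replicate[of "[\<ominus> \<one>, \<one>]" x "?n - 1"] x by (simp add: l_minus)
  then have "eval p x = x [^] Suc ?n \<oplus> (\<ominus> x \<oplus> \<one>)"
    using x n by (simp add: p_def)
  then have "\<one> = \<zero>" using x(2) r_neg2[OF x(1) one_closed] unfolding xn by simp
  then show False using one_not_zero by simp
qed

text \<open>Lets a function be recognised as polynomial from its expression, without coefficient
  lists; only the finiteness of the zeros is wanted.\<close>

definition polyfun :: "('a \<Rightarrow> 'a) \<Rightarrow> bool" where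
  "polyfun f \<longleftrightarrow> (\<exists>p\<in>carrier (poly_ring L). \<forall>c\<in>carrier L. f c = eval p c)"

lemma polyfun_const: assumes "a \<in> carrier L" shows "polyfun (\<lambda>c. a)"
proof (cases "a = \<zero>")
  case True
  have "[] \<in> carrier (poly_ring L)" unfolding univ_poly_carrier[symmetric] polynomial_def by simp
  then show ?thesis using True unfolding polyfun_def by (intro bexI[of _ "[]"]) auto
next
  case False
  then have "[a] \<in> carrier (poly_ring L)"
    using assms unfolding univ_poly_carrier[symmetric] polynomial_def by simp
  then show ?thesis using assms unfolding polyfun_def by (intro bexI[of _ "[a]"]) auto
qed

lemma polyfun_id: "polyfun (\<lambda>c. c)"
proof -
  have "[\<one>, \<zero>] \<in> carrier (poly_ring L)"
    using one_not_zero unfolding univ_poly_carrier[symmetric] polynomial_def by simp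
  then show ?thesis unfolding polyfun_def by (intro bexI[of _ "[\<one>, \<zero>]"]) auto
qed

lemma polyfun_closed:
  assumes "polyfun f" "c \<in> carrier L"
  shows "f c \<in> carrier L"
proof -
  obtain p where p: "p \<in> carrier (poly_ring L)" "f c = eval p c"
    using assms unfolding polyfun_def by auto
  then show ?thesis
    using ring_hom_closed[OF eval_is_hom[OF carrier_is_subring assms(2)] p(1)] by simp
qed

lemma polyfun_cong: "polyfun f \<Longrightarrow> (\<And>c. c \<in> carrier L \<Longrightarrow> g c = f c) \<Longrightarrow> polyfun g"
  unfolding polyfun_def by simp

lemma polyfun_add: "polyfun f \<Longrightarrow> polyfun g \<Longrightarrow> polyfun (\<lambda>c. f c \<oplus> g c)"
  unfolding polyfun_def
proof (elim bexE)
  interpret P: domain "poly_ring L" using univ_poly_is_domain[OF carrier_is_subring] .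
  fix p q assume p: "p \<in> carrier (poly_ring L)" "\<forall>c\<in>carrier L. f c = eval p c"
    and q: "q \<in> carrier (poly_ring L)" "\<forall>c\<in>carrier L. g c = eval q c"
  show "\<exists>p\<in>carrier (poly_ring L). \<forall>c\<in>carrier L. f c \<oplus> g c = eval p c"
    using p q ring_hom_add[OF eval_is_hom[OF carrier_is_subring] p(1) q(1)] P.a_closed[OF p(1) q(1)]
    by (intro bexI[of _ "p \<oplus>\<^bsub>poly_ring L\<^esub> q"]) auto
qed

lemma polyfun_mult: "polyfun f \<Longrightarrow> polyfun g \<Longrightarrow> polyfun (\<lambda>c. f c \<otimes> g c)"
  unfolding polyfun_def
proof (elim bexE)
  interpret P: domain "poly_ring L" using univ_poly_is_domain[OF carrier_is_subring] .
  fix p q assume p: "p \<in> carrier (poly_ring L)" "\<forall>c\<in>carrier L. f c = eval p c"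
    and q: "q \<in> carrier (poly_ring L)" "\<forall>c\<in>carrier L. g c = eval q c"
  show "\<exists>p\<in>carrier (poly_ring L). \<forall>c\<in>carrier L. f c \<otimes> g c = eval p c"
    using p q ring_hom_mult[OF eval_is_hom[OF carrier_is_subring] p(1) q(1)] P.m_closed[OF p(1) q(1)]
    by (intro bexI[of _ "p \<otimes>\<^bsub>poly_ring L\<^esub> q"]) auto
qed

lemma polyfun_minus: 
  assumes f: "polyfun f" and g: "polyfun g"
  shows "polyfun (\<lambda>c. f c \<ominus> g c)"
proof -
  have "polyfun (\<lambda>c. f c \<oplus> (\<ominus> \<one>) \<otimes> g c)"
    by (intro polyfun_add polyfun_mult polyfun_const f g) simp
  then show ?thesis
    by (rule polyfun_cong) (simp add: a_minus_def l_minus polyfun_closed[OF g])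
qed

lemma polyfun_pow: "polyfun f \<Longrightarrow> polyfun (\<lambda>c. f c [^] (n::nat))"
  by (induction n) (auto intro: polyfun_const polyfun_mult)

lemma polyfun_finite_zeros:
  assumes "polyfun f" "a \<in> carrier L" "f a \<noteq> \<zero>"
  shows "finite {c \<in> carrier L. f c = \<zero>}"
proof -
  obtain p where p: "p \<in> carrier (poly_ring L)" "\<And>c. c \<in> carrier L \<Longrightarrow> f c = eval p c"
    using assms(1) unfolding polyfun_def by blast
  have "p \<noteq> []" using p assms(2,3) by auto
  then have "{c \<in> carrier L. f c = \<zero>} \<subseteq> {x. is_root p x}" using p by (auto simp: is_root_def)
  then show ?thesis by (rule finite_subset[OF _ finite_number_of_roots[OF p(1)]])
qed

text \<open>Multiplying by the negative powers turns the equation into the vanishing of a polynomial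
  \<open>f\<close> in \<open>c\<close>. It remains to see that \<open>f\<close> is not zero
  everywhere.\<close>

lemma finite_monomial_solutions:
  fixes a b :: int
  assumes u: "u \<in> carrier L" "u \<noteq> \<zero>" and k: "k \<in> carrier L" "k \<noteq> \<zero>" and ab: "a \<noteq> 0 \<or> b \<noteq> 0"
  shows "finite {c \<in> carrier L. c \<noteq> \<zero> \<and> c \<noteq> u \<and>
    k \<otimes> (c [^]\<^bsub>mult_of L\<^esub> a \<otimes> (u \<ominus> c) [^]\<^bsub>mult_of L\<^esub> b) = \<one>}"
proof -
  interpret M: group "mult_of L" by (rule field_mult_group)
  define i i' j j' where "i = nat a" and "i' = nat (- a)" and "j = nat b" and "j' = nat (- b)"
  define f where "f c = k \<otimes> (c [^] i \<otimes> (u \<ominus> c) [^] j) \<ominus> c [^] i' \<otimes> (u \<ominus> c) [^] j'" for c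
  have "polyfun f" unfolding f_def
    by (intro polyfun_minus polyfun_mult polyfun_pow polyfun_const polyfun_id u k)
  moreover have "\<exists>d\<in>carrier L. f d \<noteq> \<zero>"
  proof -
    have un: "u [^] (n::nat) \<noteq> \<zero>" for n
      using u by (induction n) (auto simp: integral_iff one_not_zero)
    have u0: "u \<ominus> \<zero> = u" using u by (simp add: minus_zero_right)
    have uu: "u \<ominus> u = \<zero>" using u by simp
    have z: "\<zero> [^] (n::nat) = (if n = 0 then \<one> else \<zero>)" for n by (simp add: nat_pow_zero)
    have u1: "u [^] (n::nat) \<in> carrier L" for n using u by simp
    \<comment> \<open>If \<open>a\<close> is nonzero, \<open>f\<close> is evaluated at 0, otherwise
      at \<open>u\<close>, where \<open>u - c\<close> vanishes. In each case exactly one of its two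
      terms is zero there.\<close>
    consider "a > 0" | "a < 0" | "a = 0" "b > 0" | "a = 0" "b < 0" using ab by linarith
    then show ?thesis
    proof cases
      case 1
      then have "i > 0" "i' = 0" by (simp_all add: i_def i'_def j_def j'_def)
      then have "f \<zero> = \<zero> \<ominus> u [^] j'" using u1 k(1) by (simp add: f_def u0 z)
      then show ?thesis using un[of j'] u1[of j'] by (intro bexI[of _ \<zero>]) (auto dest: sym)
    next
      case 2
      then have "i = 0" "i' > 0" by (simp_all add: i_def i'_def j_def j'_def)
      then have "f \<zero> = k \<otimes> u [^] j" using u1 k(1) by (simp add: f_def u0 z minus_zero_right)
      then show ?thesis using un[of j] u1[of j] k by (intro bexI[of _ \<zero>]) (auto simp: integral_iff)
    next
      case 3
      then have "i = 0" "i' = 0" "j > 0" "j' = 0" by (simp_all add: i_def i'_def j_def j'_def)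
      then have "f u = \<zero> \<ominus> \<one>" using k(1) by (simp add: f_def uu z)
      then show ?thesis using one_not_zero u(1) by (intro bexI[of _ u]) (auto dest: sym)
    next
      case 4
      then have "i = 0" "i' = 0" "j = 0" "j' > 0" by (simp_all add: i_def i'_def j_def j'_def)
      then have "f u = k" using k(1) by (simp add: f_def uu z minus_zero_right)
      then show ?thesis using u k by (intro bexI[of _ u]) auto
    qed
  qed
  ultimately have fin: "finite {c \<in> carrier L. f c = \<zero>}" using polyfun_finite_zeros by blast
  have pw: "x [^]\<^bsub>mult_of L\<^esub> i \<otimes> x [^] nat (- i) = x [^] nat i" if "x \<in> carrier L" "x \<noteq> \<zero>" for x and i :: int
  proof -
    have x: "x \<in> carrier (mult_of L)" using that by simp
    have "x [^]\<^bsub>mult_of L\<^esub> i \<otimes>\<^bsub>mult_of L\<^esub> x [^]\<^bsub>mult_of L\<^esub> int (nat (- i)) = x [^]\<^bsub>mult_of L\<^esub> int (nat i)"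
    proof -
      have e: "i + int (nat (- i)) = int (nat i)" by simp
      show ?thesis using M.int_pow_mult[OF x, of i "int (nat (- i))"] unfolding e by simp
    qed
    then show ?thesis
      by (simp only: int_pow_int Multiplicative_Group.nat_pow_mult_of Multiplicative_Group.mult_mult_of)
  qed
  have "{c \<in> carrier L. c \<noteq> \<zero> \<and> c \<noteq> u \<and>
    k \<otimes> (c [^]\<^bsub>mult_of L\<^esub> a \<otimes> (u \<ominus> c) [^]\<^bsub>mult_of L\<^esub> b) = \<one>} \<subseteq> {c \<in> carrier L. f c = \<zero>}"
  proof
    fix c assume "c \<in> {c \<in> carrier L. c \<noteq> \<zero> \<and> c \<noteq> u \<and>
      k \<otimes> (c [^]\<^bsub>mult_of L\<^esub> a \<otimes> (u \<ominus> c) [^]\<^bsub>mult_of L\<^esub> b) = \<one>}"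
    then have c: "c \<in> carrier L" "c \<noteq> \<zero>" "c \<noteq> u"
      and e: "k \<otimes> (c [^]\<^bsub>mult_of L\<^esub> a \<otimes> (u \<ominus> c) [^]\<^bsub>mult_of L\<^esub> b) = \<one>" by auto
    have d: "u \<ominus> c \<in> carrier L" "u \<ominus> c \<noteq> \<zero>" using c u by auto
    define A where "A = c [^]\<^bsub>mult_of L\<^esub> a"
    define B where "B = (u \<ominus> c) [^]\<^bsub>mult_of L\<^esub> b"
    have AB: "A \<in> carrier L" "B \<in> carrier L"
      using M.int_pow_closed[of c a] M.int_pow_closed[of "u \<ominus> c" b] c d by (auto simp: A_def B_def)
    define A' where "A' = c [^] i'"
    define B' where "B' = (u \<ominus> c) [^] j'"
    have AB': "A' \<in> carrier L" "B' \<in> carrier L" using c d by (auto simp: A'_def B'_def)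
    have "f c = k \<otimes> ((A \<otimes> A') \<otimes> (B \<otimes> B')) \<ominus> A' \<otimes> B'"
      using pw[OF c(1,2), of a] pw[OF d, of b]
      by (simp add: f_def A_def B_def A'_def B'_def i_def i'_def j_def j'_def)
    also have "\<dots> = (k \<otimes> (A \<otimes> B) \<ominus> \<one>) \<otimes> (A' \<otimes> B')" using AB AB' k by algebra simp
    also have "\<dots> = \<zero>" using e AB' by (simp add: A_def B_def a_minus_def r_neg)
    finally show "c \<in> {c \<in> carrier L. f c = \<zero>}" using c by simp
  qed
  then show ?thesis by (rule finite_subset[OF _ fin])
qed

end

section \<open>Integer powers and membership in subgroups\<close>

context group begin

lemma pow_int_mem_coprime:
  assumes C: "subgroup C G" and z: "z \<in> carrier G" and "z [^] (n::int) \<in> C" "z [^] (k::int) \<in> C"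
    "coprime n k"
  shows "z \<in> C"
proof -
  obtain a b where ab: "a * n + b * k = 1"
    using assms(5) bezout_int[of n k] by (auto simp: coprime_iff_gcd_eq_1)
  have "(z [^] n) [^] a \<in> C" "(z [^] k) [^] b \<in> C"
    using assms(3,4) subgroup_int_pow_closed[OF C] by auto
  then have "z [^] (n * a) \<otimes> z [^] (k * b) \<in> C"
    using C z by (simp add: int_pow_pow subgroup.m_closed)
  then have "z [^] (n * a + k * b) \<in> C" using z by (simp add: int_pow_mult)
  then show ?thesis using ab z by (simp add: mult.commute)
qed

lemma prime_power_not_mem:
  assumes C: "subgroup C G" and z: "z \<in> carrier G" "z \<notin> C" "z [^] p \<in> C"
    and p: "Factorial_Ring.prime (p::nat)" and k: "z [^] (k::int) \<in> C"
  shows "int p dvd k"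
proof (rule ccontr)
  assume "\<not> int p dvd k"
  then have "coprime (int p) k" using p by (simp add: prime_imp_coprime)
  moreover have "z [^] int p \<in> C" using z(3) by (simp add: int_pow_int)
  ultimately show False using pow_int_mem_coprime[OF C z(1) _ k] z(2) by blast
qed

lemma int_pow_dvd_eq_one:
  assumes "x \<in> carrier G" "x [^] (n::nat) = \<one>" "int n dvd k"
  shows "x [^] (k::int) = \<one>"
proof -
  obtain j where "k = int n * j" using assms(3) by blast
  then show ?thesis using assms(1,2) by (simp add: int_pow_pow[symmetric] int_pow_int)
qed

lemma root_of_unity_pow_eq_one:
  assumes x: "x \<in> carrier G" "x [^] p = \<one>" "x \<noteq> \<one>" and p: "Factorial_Ring.prime (p::nat)"
  shows "x [^] (k::int) = \<one> \<longleftrightarrow> int p dvd k"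
proof
  assume "x [^] k = \<one>"
  then show "int p dvd k"
    using prime_power_not_mem[OF triv_subgroup x(1) _ _ p, of k] x by simp
qed (rule int_pow_dvd_eq_one[OF x(1,2)])

end

section \<open>Extension of partial characters\<close>

lemma hom_restrict_carrier_iff:
  "\<chi> \<in> hom (G\<lparr>carrier := D\<rparr>) H \<longleftrightarrow>
    (\<forall>x\<in>D. \<chi> x \<in> carrier H) \<and> (\<forall>x\<in>D. \<forall>y\<in>D. \<chi> (x \<otimes>\<^bsub>G\<^esub> y) = \<chi> x \<otimes>\<^bsub>H\<^esub> \<chi> y)"
  by (auto simp: hom_def)

locale partial_hom = group G + H: comm_group H for G (structure) and H
begin

lemma subgroup_hom_one:
  assumes "subgroup D G" "\<chi> \<in> hom (G\<lparr>carrier := D\<rparr>) H"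
  shows "\<chi> \<one> = \<one>\<^bsub>H\<^esub>"
  using hom_one[OF assms(2) subgroup_imp_group[OF assms(1)] H.is_group] by simp

lemma subgroup_hom_int_pow:
  assumes "subgroup D G" "\<chi> \<in> hom (G\<lparr>carrier := D\<rparr>) H" "x \<in> D"
  shows "\<chi> (x [^] (k::int)) = \<chi> x [^]\<^bsub>H\<^esub> k"
  using hom_int_pow[OF assms(2) _ subgroup_imp_group[OF assms(1)] H.is_group, of x k] assms(3)
    int_pow_consistent[OF assms(1,3), of k] by simp

lemma subgroup_hom_pow:
  assumes "subgroup D G" "\<chi> \<in> hom (G\<lparr>carrier := D\<rparr>) H" "x \<in> D"
  shows "\<chi> (x [^] (k::nat)) = \<chi> x [^]\<^bsub>H\<^esub> k"
  using subgroup_hom_int_pow[OF assms, of "int k"] by (simp add: int_pow_int)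

text \<open>Two factorisations of the same element differ by an element of the intersection, on
  which the two characters agree. Commutation of the factors makes the product map a
  homomorphism.\<close>

lemma extend_hom_product:
  assumes D: "subgroup D G" "\<chi> \<in> hom (G\<lparr>carrier := D\<rparr>) H"
    and E: "subgroup E G" "\<delta> \<in> hom (G\<lparr>carrier := E\<rparr>) H"
    and comm: "\<And>x y. x \<in> D \<Longrightarrow> y \<in> E \<Longrightarrow> x \<otimes> y = y \<otimes> x"
    and agree: "\<And>x. x \<in> D \<Longrightarrow> x \<in> E \<Longrightarrow> \<chi> x = \<delta> x"
  obtains \<psi> where "subgroup (D <#> E) G" "\<psi> \<in> hom (G\<lparr>carrier := D <#> E\<rparr>) H"
    "\<And>x. x \<in> D \<Longrightarrow> \<psi> x = \<chi> x" "\<And>y. y \<in> E \<Longrightarrow> \<psi> y = \<delta> y"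
proof -
  note c = subgroup.mem_carrier[OF D(1)] subgroup.mem_carrier[OF E(1)]
  have \<chi>: "\<chi> x \<in> carrier H" "y \<in> D \<Longrightarrow> \<chi> (x \<otimes> y) = \<chi> x \<otimes>\<^bsub>H\<^esub> \<chi> y" if "x \<in> D" for x y
    using D(2) that by (auto simp: hom_restrict_carrier_iff)
  have \<delta>: "\<delta> x \<in> carrier H" "y \<in> E \<Longrightarrow> \<delta> (x \<otimes> y) = \<delta> x \<otimes>\<^bsub>H\<^esub> \<delta> y" if "x \<in> E" for x y
    using E(2) that by (auto simp: hom_restrict_carrier_iff)
  have wd: "\<chi> x \<otimes>\<^bsub>H\<^esub> \<delta> y = \<chi> x' \<otimes>\<^bsub>H\<^esub> \<delta> y'"
    if x: "x \<in> D" "x' \<in> D" and y: "y \<in> E" "y' \<in> E" and e: "x \<otimes> y = x' \<otimes> y'" for x x' y y'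
  proof -
    define w where "w = inv x' \<otimes> x"
    have w: "w \<in> D" using x D(1) by (simp add: w_def subgroup.m_closed subgroup.m_inv_closed)
    have xw: "x = x' \<otimes> w" using x c by (simp add: w_def inv_mult_cancel)
    have "x' \<otimes> (w \<otimes> y) = x' \<otimes> y'" using e xw x y w c by (simp add: m_assoc)
    then have wy: "w \<otimes> y = y'" using x y w c by simp
    then have "w = y' \<otimes> inv y" using w y c by (metis inv_solve_right)
    then have wE: "w \<in> E" using y E(1) by (simp add: subgroup.m_closed subgroup.m_inv_closed)
    have "\<chi> x \<otimes>\<^bsub>H\<^esub> \<delta> y = \<chi> x' \<otimes>\<^bsub>H\<^esub> (\<chi> w \<otimes>\<^bsub>H\<^esub> \<delta> y)"
      using x y w by (simp add: xw \<chi> \<delta> H.m_assoc)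
    also have "\<chi> w \<otimes>\<^bsub>H\<^esub> \<delta> y = \<delta> y'" using agree[OF w wE] \<delta>(2)[OF wE y(1)] wy by simp
    finally show ?thesis .
  qed
  define \<psi> where "\<psi> z = (SOME h. \<exists>x\<in>D. \<exists>y\<in>E. z = x \<otimes> y \<and> h = \<chi> x \<otimes>\<^bsub>H\<^esub> \<delta> y)" for z
  have \<psi>: "\<psi> (x \<otimes> y) = \<chi> x \<otimes>\<^bsub>H\<^esub> \<delta> y" if xy: "x \<in> D" "y \<in> E" for x y
  proof -
    have "\<exists>h. \<exists>a\<in>D. \<exists>b\<in>E. x \<otimes> y = a \<otimes> b \<and> h = \<chi> a \<otimes>\<^bsub>H\<^esub> \<delta> b" using xy by blast
    then have "\<exists>a\<in>D. \<exists>b\<in>E. x \<otimes> y = a \<otimes> b \<and> \<psi> (x \<otimes> y) = \<chi> a \<otimes>\<^bsub>H\<^esub> \<delta> b"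
      unfolding \<psi>_def by (rule someI_ex)
    then show ?thesis using wd xy by metis
  qed
  have one: "\<one> \<in> D" "\<one> \<in> E" "\<chi> \<one> = \<one>\<^bsub>H\<^esub>" "\<delta> \<one> = \<one>\<^bsub>H\<^esub>"
    using subgroup.one_closed[OF D(1)] subgroup.one_closed[OF E(1)] subgroup_hom_one[OF D] subgroup_hom_one[OF E]
    by simp_all
  show thesis
  proof (rule that[of \<psi>])
    show "subgroup (D <#> E) G" by (rule commuting_set_mult_subgroup[OF D(1) E(1) comm])
    show "\<psi> x = \<chi> x" if "x \<in> D" for x
      using \<psi>[OF that one(2)] that one c \<chi> by simp
    show "\<psi> y = \<delta> y" if "y \<in> E" for y
      using \<psi>[OF one(1) that] that one c \<delta> by simp
    show "\<psi> \<in> hom (G\<lparr>carrier := D <#> E\<rparr>) H"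
      unfolding hom_restrict_carrier_iff
    proof (intro conjI ballI)
      fix z assume "z \<in> D <#> E"
      then obtain x y where z: "x \<in> D" "y \<in> E" "z = x \<otimes> y" by (auto simp: mem_set_mult)
      then show "\<psi> z \<in> carrier H" using \<psi> \<chi> \<delta> by simp
      fix z' assume "z' \<in> D <#> E"
      then obtain x' y' where z': "x' \<in> D" "y' \<in> E" "z' = x' \<otimes> y'" by (auto simp: mem_set_mult)
      have "z \<otimes> z' = x \<otimes> ((y \<otimes> x') \<otimes> y')" using z z' c by (simp add: m_assoc)
      also have "y \<otimes> x' = x' \<otimes> y" by (rule comm[OF z'(1) z(2), symmetric])
      also have "x \<otimes> ((x' \<otimes> y) \<otimes> y') = (x \<otimes> x') \<otimes> (y \<otimes> y')" using z z' c by (simp add: m_assoc)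
      finally have "\<psi> (z \<otimes> z') = (\<chi> x \<otimes>\<^bsub>H\<^esub> \<chi> x') \<otimes>\<^bsub>H\<^esub> (\<delta> y \<otimes>\<^bsub>H\<^esub> \<delta> y')"
        using \<psi>[of "x \<otimes> x'" "y \<otimes> y'"] z z' D(1) E(1) \<chi> \<delta> by (simp add: subgroup.m_closed)
      then show "\<psi> (z \<otimes> z') = \<psi> z \<otimes>\<^bsub>H\<^esub> \<psi> z'"
        using z z' \<psi> \<chi> \<delta> by (simp add: H.m_ac)
    qed
  qed
qed

text \<open>The case of a cyclic second factor. As the identity lies in \<open>D\<close>, the
  hypothesis on powers also says that \<open>c^k = 1\<close> whenever \<open>z^k = 1\<close>, so
  that \<open>z^k\<close> can be sent to \<open>c^k\<close>.\<close>

lemma extend_hom_cyclic: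
  assumes D: "subgroup D G" "\<chi> \<in> hom (G\<lparr>carrier := D\<rparr>) H"
    and z: "z \<in> carrier G" and comm: "\<And>x. x \<in> D \<Longrightarrow> x \<otimes> z = z \<otimes> x"
    and c: "c \<in> carrier H" and agree: "\<And>k::int. z [^] k \<in> D \<Longrightarrow> \<chi> (z [^] k) = c [^]\<^bsub>H\<^esub> k"
  obtains \<psi> where "subgroup (D <#> generate G {z}) G" "\<psi> \<in> hom (G\<lparr>carrier := D <#> generate G {z}\<rparr>) H"
    "\<And>x. x \<in> D \<Longrightarrow> \<psi> x = \<chi> x" "\<psi> z = c" "z \<in> D <#> generate G {z}" "D \<subseteq> D <#> generate G {z}"
proof -
  define \<delta> where "\<delta> x = c [^]\<^bsub>H\<^esub> (SOME k::int. x = z [^] k)" for x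
  have wd: "c [^]\<^bsub>H\<^esub> k = c [^]\<^bsub>H\<^esub> l" if "z [^] k = z [^] l" for k l :: int
  proof -
    have "z [^] (k - l) = \<one>" using that z by (simp add: int_pow_diff)
    then have "c [^]\<^bsub>H\<^esub> (k - l) = \<one>\<^bsub>H\<^esub>"
      using agree[of "k - l"] subgroup.one_closed[OF D(1)] subgroup_hom_one[OF D] by simp
    then have "c [^]\<^bsub>H\<^esub> (k - l) \<otimes>\<^bsub>H\<^esub> c [^]\<^bsub>H\<^esub> l = c [^]\<^bsub>H\<^esub> l" using c by simp
    moreover have "c [^]\<^bsub>H\<^esub> (k - l) \<otimes>\<^bsub>H\<^esub> c [^]\<^bsub>H\<^esub> l = c [^]\<^bsub>H\<^esub> k"
      using H.int_pow_mult[OF c, of "k - l" l] by simp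
    ultimately show ?thesis by simp
  qed
  have \<delta>: "\<delta> (z [^] k) = c [^]\<^bsub>H\<^esub> k" for k :: int
  proof -
    have "z [^] k = z [^] (SOME l::int. z [^] k = z [^] l)" by (rule someI) (rule refl)
    then show ?thesis unfolding \<delta>_def using wd by metis
  qed
  note gz = generate_pow[OF z]
  have E: "subgroup (generate G {z}) G" using z by (intro generate_is_subgroup) simp
  have \<delta>h: "\<delta> \<in> hom (G\<lparr>carrier := generate G {z}\<rparr>) H"
    unfolding hom_restrict_carrier_iff
  proof (intro conjI ballI)
    fix x assume "x \<in> generate G {z}"
    then obtain k :: int where k: "x = z [^] k" unfolding gz by blast
    then show "\<delta> x \<in> carrier H" using c by (simp add: \<delta>)
    fix y assume "y \<in> generate G {z}"
    then obtain l :: int where l: "y = z [^] l" unfolding gz by blast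
    show "\<delta> (x \<otimes> y) = \<delta> x \<otimes>\<^bsub>H\<^esub> \<delta> y"
      using z c by (simp add: k l \<delta> int_pow_mult[symmetric] H.int_pow_mult)
  qed
  have comm': "x \<otimes> y = y \<otimes> x" if x: "x \<in> D" and y: "y \<in> generate G {z}" for x y
  proof -
    have "y \<otimes> x = x \<otimes> y"
      by (rule generate_commute[OF _ subgroup.mem_carrier[OF D(1) x] _ y]) (use z comm[OF x] in auto)
    then show ?thesis by simp
  qed
  have ag: "\<chi> x = \<delta> x" if "x \<in> D" "x \<in> generate G {z}" for x
    using that agree unfolding gz by (auto simp: \<delta>)
  obtain \<psi> where \<psi>: "subgroup (D <#> generate G {z}) G" "\<psi> \<in> hom (G\<lparr>carrier := D <#> generate G {z}\<rparr>) H"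
    "\<And>x. x \<in> D \<Longrightarrow> \<psi> x = \<chi> x" "\<And>y. y \<in> generate G {z} \<Longrightarrow> \<psi> y = \<delta> y"
    using extend_hom_product[OF D E \<delta>h comm' ag] by blast
  have zz: "z \<in> generate G {z}" by (simp add: generate.incl)
  have "\<psi> z = c" using \<psi>(4)[OF zz] \<delta>[of 1] z c by simp
  then show thesis
    using that[OF \<psi>(1,2,3)] subset_set_mult[OF D(1) E] zz by blast
qed

text \<open>A character of a finite part of A/C which is faithful modulo \<open>C\<close>. A new
  element \<open>m\<close> of prime order \<open>p\<close> is sent to a nontrivial
  \<open>p\<close>-th root of unity. The kernel does not grow, because \<open>D\<close> has no
  elements of order \<open>p\<close> modulo \<open>C\<close>: local cyclicity would put
  \<open>m\<close> into \<open>D\<close>. Only pairs are needed for this, hence the form of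
  \<open>cyc\<close>.\<close>

lemma exists_hom_with_kernel:
  assumes A: "subgroup A G" and comm: "\<And>x y. x \<in> A \<Longrightarrow> y \<in> A \<Longrightarrow> x \<otimes> y = y \<otimes> x"
    and C: "subgroup C G" "C \<subseteq> A"
    and cyc: "\<And>x m. x \<in> A \<Longrightarrow> m \<in> A \<Longrightarrow>
      \<exists>z\<in>A. (\<exists>c\<in>C. \<exists>k::int. x = c \<otimes> z [^] k) \<and> (\<exists>c\<in>C. \<exists>k::int. m = c \<otimes> z [^] k)"
    and T: "finite T" "T \<subseteq> A"
    and prim: "\<And>t. t \<in> T \<Longrightarrow> \<exists>p. Factorial_Ring.prime (p::nat) \<and> t [^] p = \<one> \<and>
      (\<exists>\<zeta>\<in>carrier H. \<zeta> \<noteq> \<one>\<^bsub>H\<^esub> \<and> \<zeta> [^]\<^bsub>H\<^esub> p = \<one>\<^bsub>H\<^esub>)"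
  shows "\<exists>D \<chi>. subgroup D G \<and> C \<subseteq> D \<and> D \<subseteq> A \<and> T \<subseteq> D \<and> \<chi> \<in> hom (G\<lparr>carrier := D\<rparr>) H \<and>
    (\<forall>d\<in>D. \<chi> d = \<one>\<^bsub>H\<^esub> \<longleftrightarrow> d \<in> C)"
  using T prim
proof (induction T)
  case empty
  have "(\<lambda>x. \<one>\<^bsub>H\<^esub>) \<in> hom (G\<lparr>carrier := C\<rparr>) H" by (auto simp: hom_def)
  then show ?case using C by (intro exI[of _ C] exI[of _ "\<lambda>x. \<one>\<^bsub>H\<^esub>"]) auto
next
  case (insert m T)
  note cA = subgroup.mem_carrier[OF A] and cC = subgroup.mem_carrier[OF C(1)]
  obtain D \<chi> where D: "subgroup D G" "C \<subseteq> D" "D \<subseteq> A" "T \<subseteq> D" "\<chi> \<in> hom (G\<lparr>carrier := D\<rparr>) H"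
    "\<And>d. d \<in> D \<Longrightarrow> \<chi> d = \<one>\<^bsub>H\<^esub> \<longleftrightarrow> d \<in> C"
    using insert by (metis insert_iff insert_subset)
  obtain p \<zeta> where p: "Factorial_Ring.prime (p::nat)" "m [^] p = \<one>"
    and \<zeta>: "\<zeta> \<in> carrier H" "\<zeta> \<noteq> \<one>\<^bsub>H\<^esub>" "\<zeta> [^]\<^bsub>H\<^esub> p = \<one>\<^bsub>H\<^esub>"
    using insert.prems(2)[of m] by blast
  have m: "m \<in> A" "m \<in> carrier G" using insert cA by auto
  note cD = subgroup.mem_carrier[OF D(1)]
  show ?case
  proof (cases "m \<in> D")
    case True
    then show ?thesis using D by blast
  next
    case False
    have torsion_free: "x \<in> C" if x: "x \<in> D" "x [^] p \<in> C" for x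
    proof (rule ccontr)
      assume xC: "x \<notin> C"
      obtain z where z: "z \<in> A" "\<exists>c\<in>C. \<exists>k::int. x = c \<otimes> z [^] k" "\<exists>c\<in>C. \<exists>k::int. m = c \<otimes> z [^] k"
        using cyc[of x m] x(1) D(3) m(1) by blast
      obtain c a where xa: "c \<in> C" "x = c \<otimes> z [^] (a::int)" using z(2) by blast
      obtain c' b where mb: "c' \<in> C" "m = c' \<otimes> z [^] (b::int)" using z(3) by blast
      have zG: "z \<in> carrier G" using cA z by blast
      have comz: "c \<otimes> z [^] k = z [^] k \<otimes> c" if "c \<in> C" for c and k :: int
        using comm[of c "z [^] k"] that C(2) subgroup_int_pow_closed[OF A z(1)] by blast
      have nz: "\<not> (a = 0 \<and> b = 0)" using xa xC cC by auto
      \<comment> \<open>Replacing \<open>z\<close> by \<open>w = z^g\<close> makes the exponents of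
        \<open>x\<close> and \<open>m\<close> coprime, so \<open>w^p\<close> lies in
        \<open>C\<close>. As \<open>x\<close> is not in \<open>C\<close>, \<open>p\<close> does not
        divide \<open>a'\<close>. Then \<open>w^p\<close> and \<open>w^a'\<close> in
        \<open>D\<close> give \<open>w\<close> in \<open>D\<close>, and \<open>m\<close> lies in
        \<open>D\<close> too.\<close>
      define g where "g = gcd a b"
      obtain a' b' where ab': "a = g * a'" "b = g * b'" "coprime a' b'"
        using gcd_coprime_exists[of a b] nz unfolding g_def
        by (metis gcd_eq_0_iff mult.commute)
      define w where "w = z [^] g"
      have w: "w \<in> carrier G" "z [^] a = w [^] a'" "z [^] b = w [^] b'"
        using zG ab' by (simp_all add: w_def int_pow_pow)
      have pow_mem: "w [^] (j * int p) \<in> C"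
        if y: "y \<in> A" "y [^] p \<in> C" "e \<in> C" "y = e \<otimes> w [^] j" for y e and j :: int
      proof -
        have "e \<otimes> w [^] j = w [^] j \<otimes> e" using comz[OF y(3), of "g * j"] zG by (simp add: w_def int_pow_pow)
        then have "y [^] p = e [^] p \<otimes> (w [^] j) [^] p"
          using y w cC pow_mult_distrib[of e "w [^] j" p] by simp
        then have "(w [^] j) [^] p = inv (e [^] p) \<otimes> y [^] p"
          using y w cC by (simp add: inv_mult_cancel)
        moreover have "e [^] p \<in> C" using subgroup_int_pow_closed[OF C(1) y(3), of "int p"] by (simp add: int_pow_int)
        ultimately have "(w [^] j) [^] p \<in> C" using y C(1) by (simp add: subgroup.m_closed subgroup.m_inv_closed)
        then show ?thesis using w by (simp add: int_pow_pow[symmetric] int_pow_int)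
      qed
      have "w [^] (a' * int p) \<in> C"
        using pow_mem[of x c a'] x D(3) xa w(2) by auto
      moreover have "w [^] (b' * int p) \<in> C"
        using pow_mem[of m c' b'] m p(2) subgroup.one_closed[OF C(1)] mb w(3) by auto
      ultimately have "w [^] int p \<in> C"
        using pow_int_mem_coprime[OF C(1) _ _ _ ab'(3), of "w [^] int p"] w(1)
        by (simp add: int_pow_pow mult.commute)
      moreover have "\<not> int p dvd a'"
      proof
        assume "int p dvd a'"
        then obtain j where "a' = int p * j" by blast
        then have "w [^] a' = (w [^] int p) [^] j" using w by (simp add: int_pow_pow)
        then have "w [^] a' \<in> C" using calculation subgroup_int_pow_closed[OF C(1)] by simp
        then show False using xa w xC C(1) by (simp add: subgroup.m_closed)
      qed
      moreover have "w [^] a' \<in> D"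
      proof -
        have "w [^] a' = inv c \<otimes> x" using xa w cC by (simp add: inv_mult_cancel)
        then show ?thesis using xa x D by (simp add: subgroup.m_closed subgroup.m_inv_closed subset_iff)
      qed
      moreover have "coprime (int p) a'" using p calculation(2) by (simp add: prime_imp_coprime)
      ultimately have "w \<in> D" using pow_int_mem_coprime[OF D(1) w(1), of "int p" a'] D(2) by blast
      then have "m \<in> D" using mb w D subgroup_int_pow_closed[OF D(1)]
        by (simp add: subgroup.m_closed subset_iff)
      then show False using False by blast
    qed
    have mk: "int p dvd k" if "m [^] k \<in> D" for k :: int
      using prime_power_not_mem[OF D(1) m(2) False _ p(1) that] p(2) subgroup.one_closed[OF D(1)] by simp
    have agree: "\<chi> (m [^] k) = \<zeta> [^]\<^bsub>H\<^esub> k" if "m [^] k \<in> D" for k :: int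
      using int_pow_dvd_eq_one[OF m(2) p(2) mk[OF that]] H.int_pow_dvd_eq_one[OF \<zeta>(1,3) mk[OF that]]
        subgroup_hom_one[OF D(1,5)] by simp
    have Dm: "x \<otimes> m = m \<otimes> x" if "x \<in> D" for x using that D(3) m comm by blast
    let ?E = "D <#> generate G {m}"
    obtain \<psi> where \<psi>: "subgroup ?E G" "\<psi> \<in> hom (G\<lparr>carrier := ?E\<rparr>) H"
      "\<And>x. x \<in> D \<Longrightarrow> \<psi> x = \<chi> x" "\<psi> m = \<zeta>" "m \<in> ?E" "D \<subseteq> ?E"
      using extend_hom_cyclic[OF D(1,5) m(2) Dm \<zeta>(1) agree] by blast
    have gA: "generate G {m} \<subseteq> A" using m by (intro generate_subgroup_incl[OF _ A]) simp
    have EA: "?E \<subseteq> A" using D(3) gA A by (auto simp: mem_set_mult intro!: subgroup.m_closed[OF A])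
    have ker: "\<psi> e = \<one>\<^bsub>H\<^esub> \<longleftrightarrow> e \<in> C" if e: "e \<in> ?E" for e
    proof
      assume "e \<in> C"
      then show "\<psi> e = \<one>\<^bsub>H\<^esub>" using D \<psi> by auto
    next
      assume e1: "\<psi> e = \<one>\<^bsub>H\<^esub>"
      obtain d and k :: int where dk: "d \<in> D" "e = d \<otimes> m [^] k"
        using e unfolding mem_set_mult generate_pow[OF m(2)] by blast
      have mkE: "m [^] k \<in> ?E" by (rule subgroup_int_pow_closed[OF \<psi>(1,5)])
      have "\<psi> e = \<psi> d \<otimes>\<^bsub>H\<^esub> \<psi> (m [^] k)"
        using \<psi>(2) dk mkE \<psi>(6) unfolding hom_restrict_carrier_iff by blast
      then have e2: "\<chi> d \<otimes>\<^bsub>H\<^esub> \<zeta> [^]\<^bsub>H\<^esub> k = \<one>\<^bsub>H\<^esub>"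
        using e1 \<psi>(3)[OF dk(1)] subgroup_hom_int_pow[OF \<psi>(1,2,5), of k] \<psi>(4) by simp
      have \<chi>d: "\<chi> d \<in> carrier H" using D(5) dk(1) unfolding hom_restrict_carrier_iff by blast
      have zk: "\<zeta> [^]\<^bsub>H\<^esub> k \<in> carrier H" using \<zeta> by simp
      have "(\<zeta> [^]\<^bsub>H\<^esub> k) [^]\<^bsub>H\<^esub> p = \<one>\<^bsub>H\<^esub>"
        using \<zeta> H.int_pow_dvd_eq_one[OF \<zeta>(1,3), of "k * int p"]
        by (simp add: H.int_pow_pow[symmetric] int_pow_int)
      moreover have "(\<chi> d \<otimes>\<^bsub>H\<^esub> \<zeta> [^]\<^bsub>H\<^esub> k) [^]\<^bsub>H\<^esub> p
        = \<chi> d [^]\<^bsub>H\<^esub> p \<otimes>\<^bsub>H\<^esub> (\<zeta> [^]\<^bsub>H\<^esub> k) [^]\<^bsub>H\<^esub> p"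
        using \<chi>d zk by (intro H.nat_pow_distrib)
      ultimately have "\<chi> d [^]\<^bsub>H\<^esub> p = \<one>\<^bsub>H\<^esub>" using e2 \<chi>d by simp
      then have "\<chi> (d [^] p) = \<one>\<^bsub>H\<^esub>" using subgroup_hom_pow[OF D(1,5) dk(1)] by simp
      moreover have "d [^] p \<in> D"
        using subgroup_int_pow_closed[OF D(1) dk(1), of "int p"] by (simp add: int_pow_int)
      ultimately have "d [^] p \<in> C" using D(6) by blast
      then have dC: "d \<in> C" using torsion_free dk by blast
      then have "\<zeta> [^]\<^bsub>H\<^esub> k = \<one>\<^bsub>H\<^esub>" using e2 D(6)[OF dk(1)] zk by simp
      then have "int p dvd k" using H.root_of_unity_pow_eq_one[OF \<zeta>(1,3,2) p(1)] by simp
      then have "m [^] k = \<one>" using int_pow_dvd_eq_one[OF m(2) p(2)] by simp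
      then show "e \<in> C" using dk dC cC by simp
    qed
    have "C \<subseteq> ?E" "insert m T \<subseteq> ?E" using D \<psi> by auto
    then show ?thesis using \<psi>(1,2) EA ker by blast
  qed
qed

end

section \<open>Torsion-free abelian minimal normal subgroups\<close>

definition torsion_free :: "('g, 'm) monoid_scheme \<Rightarrow> 'g set \<Rightarrow> bool" where
  "torsion_free G M \<longleftrightarrow> (\<forall>x\<in>M. \<forall>n::nat. n > 0 \<longrightarrow> x [^]\<^bsub>G\<^esub> n = \<one>\<^bsub>G\<^esub> \<longrightarrow> x = \<one>\<^bsub>G\<^esub>)"

definition abelian_minimals :: "('g, 'm) monoid_scheme \<Rightarrow> 'g set set" where
  "abelian_minimals G = {M. minimal_normal G M \<and> torsion_free G M \<and>
     (\<forall>x\<in>M. \<forall>y\<in>M. x \<otimes>\<^bsub>G\<^esub> y = y \<otimes>\<^bsub>G\<^esub> x)}"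

context group begin

lemma torsion_free_int_pow:
  assumes "torsion_free G M" "subgroup M G" "x \<in> M" "x [^] (k::int) = \<one>" "k \<noteq> 0"
  shows "x = \<one>"
proof -
  have x: "x \<in> carrier G" using subgroup.mem_carrier[OF assms(2,3)] .
  have "x [^] nat \<bar>k\<bar> = \<one>"
  proof (cases "k \<ge> 0")
    case True
    then show ?thesis using assms(4) by (simp flip: int_pow_int)
  next
    case False
    then have "x [^] int (nat \<bar>k\<bar>) = inv (x [^] k)" using x by (simp add: int_pow_neg)
    then show ?thesis using assms(4) by (simp only: int_pow_int inv_one)
  qed
  then show ?thesis using assms(1,3,5) unfolding torsion_free_def
    by (metis zero_less_abs_iff zero_less_nat_eq)
qed

lemma exists_maximal_avoiding:
  assumes S: "subgroup S G" "S \<subseteq> M" "y \<notin> S"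
  obtains C where "subgroup C G" "S \<subseteq> C" "C \<subseteq> M" "y \<notin> C"
    "\<And>D. subgroup D G \<Longrightarrow> C \<subset> D \<Longrightarrow> D \<subseteq> M \<Longrightarrow> y \<in> D"
proof -
  define \<C> where "\<C> = {C. subgroup C G \<and> S \<subseteq> C \<and> C \<subseteq> M \<and> y \<notin> C}"
  have "S \<in> \<C>" using S by (simp add: \<C>_def)
  then have ne: "\<C> \<noteq> {}" by blast
  have "\<Union>\<K> \<in> \<C>" if ch: "\<K> \<noteq> {}" "subset.chain \<C> \<K>" for \<K>
  proof -
    have sub: "subgroup C G" "S \<subseteq> C" "C \<subseteq> M" "y \<notin> C" if "C \<in> \<K>" for C
    proof -
      have "C \<in> \<C>" using that ch(2) unfolding subset.chain_def by blast
      then show "subgroup C G" "S \<subseteq> C" "C \<subseteq> M" "y \<notin> C" by (simp_all add: \<C>_def)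
    qed
    have dir: "\<exists>C\<in>\<K>. T \<subseteq> C" if "finite T" "T \<subseteq> \<Union>\<K>" for T
      using finite_subset_Union_chain[OF that ch] by blast
    have "subgroup (\<Union>\<K>) G"
    proof (rule subgroupI)
      show "\<Union>\<K> \<subseteq> carrier G" using sub(1) subgroup.subset by blast
      show "\<Union>\<K> \<noteq> {}" using ch(1) sub(1) subgroup.one_closed by blast
      show "inv a \<in> \<Union>\<K>" if "a \<in> \<Union>\<K>" for a
        using that sub(1) subgroup.m_inv_closed by (metis Union_iff)
      show "a \<otimes> b \<in> \<Union>\<K>" if "a \<in> \<Union>\<K>" "b \<in> \<Union>\<K>" for a b
      proof -
        obtain C where "C \<in> \<K>" "{a, b} \<subseteq> C" using dir[of "{a, b}"] \<open>a \<in> \<Union>\<K>\<close> \<open>b \<in> \<Union>\<K>\<close> by auto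
        then show ?thesis using subgroup.m_closed[OF sub(1)] by auto
      qed
    qed
    moreover have "S \<subseteq> \<Union>\<K>" using sub(2) ch(1) by blast
    moreover have "\<Union>\<K> \<subseteq> M" using sub(3) by blast
    moreover have "y \<notin> \<Union>\<K>" using sub(4) by blast
    ultimately show ?thesis by (simp add: \<C>_def)
  qed
  then obtain C where C: "C \<in> \<C>" "\<And>D. D \<in> \<C> \<Longrightarrow> C \<subseteq> D \<Longrightarrow> D = C"
    using subset_Zorn_nonempty[OF ne] by meson
  show thesis
  proof (rule that[of C])
    show "y \<in> D" if "subgroup D G" "C \<subset> D" "D \<subseteq> M" for D
      using C that by (auto simp: \<C>_def)
  qed (use C(1) in \<open>auto simp: \<C>_def\<close>)
qed

text \<open>
  \<open>M/C\<close> is subdirectly irreducible with socle generated by \<open>y\<close>, hence a quasi-cyclic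
  or cyclic \<open>r\<close>-group.
\<close>

lemma maximal_avoiding_primary:
  assumes M: "subgroup M G" and comm: "\<And>a b. a \<in> M \<Longrightarrow> b \<in> M \<Longrightarrow> a \<otimes> b = b \<otimes> a"
    and C: "subgroup C G" "C \<subseteq> M" "y \<notin> C"
    and max: "\<And>D. subgroup D G \<Longrightarrow> C \<subset> D \<Longrightarrow> D \<subseteq> M \<Longrightarrow> y \<in> D"
    and y: "y \<in> M" "y [^] r \<in> C" and r: "Factorial_Ring.prime (r::nat)" and x: "x \<in> M"
  shows "\<exists>e::nat. x [^] (r ^ e) \<in> C"
proof (cases "x \<in> C")
  case True
  then show ?thesis using subgroup.mem_carrier[OF C(1)] by (intro exI[of _ 0]) simp
next
  case False
  note cM = subgroup.mem_carrier[OF M] and cC = subgroup.mem_carrier[OF C(1)]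
  have yx: "\<exists>c\<in>C. \<exists>k::int. y = c \<otimes> z [^] k" if z: "z \<in> M" "z \<notin> C" for z
  proof -
    have g: "subgroup (generate G {z}) G" "generate G {z} \<subseteq> M"
      using z cM generate_is_subgroup[of "{z}"] generate_subgroup_incl[OF _ M, of "{z}"] by simp_all
    have s: "subgroup (C <#> generate G {z}) G"
      by (rule commuting_set_mult_subgroup[OF C(1) g(1)]) (use comm C(2) g(2) in blast)
    have "z \<in> C <#> generate G {z}"
      using subset_set_mult(2)[OF C(1) g(1)] generate.incl[of z "{z}" G] by blast
    then have "C \<subset> C <#> generate G {z}" using subset_set_mult(1)[OF C(1) g(1)] z(2) by blast
    moreover have "C <#> generate G {z} \<subseteq> M"
      using C(2) g(2) by (auto simp: mem_set_mult intro!: subgroup.m_closed[OF M])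
    ultimately have "y \<in> C <#> generate G {z}" using max[OF s] by blast
    then show ?thesis unfolding mem_set_mult generate_pow[OF cM[OF z(1)]] by blast
  qed
  have pow_mem: "(z [^] k) [^] n \<in> C"
    if z: "z \<in> M" and c: "c \<in> C" "y = c \<otimes> z [^] (k::int)" "y [^] (n::nat) \<in> C" for z c k n
  proof -
    have zk: "z [^] k \<in> M" by (rule subgroup_int_pow_closed[OF M z])
    have "c \<otimes> z [^] k = z [^] k \<otimes> c" using comm[OF _ zk, of c] c(1) C(2) by blast
    then have "y [^] n = c [^] n \<otimes> (z [^] k) [^] n"
      using c cC[OF c(1)] cM[OF zk] pow_mult_distrib[of c "z [^] k" n] by simp
    then have "(z [^] k) [^] n = inv (c [^] n) \<otimes> y [^] n"
      using cC[OF c(1)] cM[OF zk] by (simp add: inv_mult_cancel)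
    moreover have "c [^] n \<in> C" using subgroup_int_pow_closed[OF C(1) c(1), of "int n"] by (simp add: int_pow_int)
    ultimately show ?thesis using c(3) C(1) by (simp add: subgroup.m_closed subgroup.m_inv_closed)
  qed
  \<comment> \<open>As \<open>y\<close> is a power of \<open>x\<close> modulo \<open>C\<close>, a
    nonzero power of \<open>x\<close> lies in \<open>C\<close>. Its exponent \<open>n\<close> is
    then split into a power of \<open>r\<close> and a factor \<open>t\<close> prime to
    \<open>r\<close>.\<close>
  obtain c k where ck: "c \<in> C" "y = c \<otimes> x [^] (k::int)" using yx[OF x False] by blast
  have k0: "k \<noteq> 0" using ck C(3) cC by auto
  have "(x [^] k) [^] r \<in> C" by (rule pow_mem[OF x ck y(2)])
  then have xkr: "x [^] (k * int r) \<in> C" using cM[OF x] by (simp add: int_pow_pow[symmetric] int_pow_int)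
  define n where "n = nat \<bar>k * int r\<bar>"
  have n: "n > 0" using k0 prime_gt_0_nat[OF r] by (simp add: n_def)
  have "x [^] n \<in> C"
  proof (cases "k * int r \<ge> 0")
    case True
    then show ?thesis using xkr by (simp add: n_def flip: int_pow_int)
  next
    case False
    then have "x [^] int n = inv (x [^] (k * int r))" using cM[OF x] by (simp add: n_def int_pow_neg[symmetric])
    then have "x [^] int n \<in> C" using xkr C(1) by (simp add: subgroup.m_inv_closed)
    then show ?thesis by (simp add: int_pow_int)
  qed
  moreover obtain t where t: "n = r ^ multiplicity r n * t" "\<not> r dvd t"
    using multiplicity_decompose'[of n r] n r by (metis not_prime_unit not_gr0)
  moreover define e where "e = multiplicity r n"
  moreover define z where "z = x [^] (r ^ e)"
  ultimately have zt: "z [^] t \<in> C" using cM[OF x] by (simp add: nat_pow_pow)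
  have zM: "z \<in> M" unfolding z_def
    using subgroup_int_pow_closed[OF M x, of "int (r ^ e)"] by (simp only: int_pow_int)
  \<comment> \<open>Otherwise \<open>y\<close> is a power of \<open>z\<close> modulo
    \<open>C\<close>, so \<open>y^t\<close> lies in \<open>C\<close>. Together with
    \<open>y^r\<close> this puts \<open>y\<close> itself into \<open>C\<close>.\<close>
  have "z \<in> C"
  proof (rule ccontr)
    assume zC: "z \<notin> C"
    obtain d l where dl: "d \<in> C" "y = d \<otimes> z [^] (l::int)" using yx[OF zM zC] by blast
    have zl: "z [^] l \<in> M" by (rule subgroup_int_pow_closed[OF M zM])
    have "(z [^] l) [^] t = (z [^] t) [^] l"
      using cM[OF zM] by (simp add: int_pow_pow mult.commute flip: int_pow_int)
    then have zlt: "(z [^] l) [^] t \<in> C" using subgroup_int_pow_closed[OF C(1) zt] by simp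
    have "d \<otimes> z [^] l = z [^] l \<otimes> d" using comm[OF _ zl, of d] dl(1) C(2) by blast
    then have "y [^] t = d [^] t \<otimes> (z [^] l) [^] t"
      using dl cC[OF dl(1)] cM[OF zl] pow_mult_distrib[of d "z [^] l" t] by simp
    moreover have "d [^] t \<in> C" using subgroup_int_pow_closed[OF C(1) dl(1), of "int t"] by (simp add: int_pow_int)
    ultimately have "y [^] t \<in> C" using zlt C(1) by (simp add: subgroup.m_closed)
    moreover have "coprime r t" using t(2) r by (simp add: prime_imp_coprime)
    ultimately have "y \<in> C" using pow_mem_coprime[OF C(1) cM[OF y(1)] y(2)] by blast
    then show False using C(3) by blast
  qed
  then show ?thesis unfolding z_def by blast
qed

lemma abelian_minimals_normal: "M \<in> abelian_minimals G \<Longrightarrow> M \<lhd> G"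
  by (simp add: abelian_minimals_def minimal_normal_normal)

lemma abelian_minimals_commute:
  assumes "M \<in> abelian_minimals G" "N \<in> abelian_minimals G" "x \<in> M" "y \<in> N"
  shows "x \<otimes> y = y \<otimes> x"
  using assms minimal_normal_commute[of M N x y] by (cases "M = N") (auto simp: abelian_minimals_def)

lemma abelian_minimals_generate_commute:
  assumes F: "F \<subseteq> abelian_minimals G" and "x \<in> generate G (\<Union>F)" "y \<in> generate G (\<Union>F)"
  shows "x \<otimes> y = y \<otimes> x"
proof -
  have U: "\<Union>F \<subseteq> carrier G" using F abelian_minimals_normal normal_subset_carrier by blast
  have "s \<otimes> t = t \<otimes> s" if "s \<in> \<Union>F" "t \<in> \<Union>F" for s t
    using that F abelian_minimals_commute by blast
  then show ?thesis by (rule generate_commute2[OF U U _ assms(2,3)])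
qed

lemma torsion_free_set_mult:
  assumes P: "torsion_free G P" "subgroup P G" and M: "torsion_free G M" "subgroup M G"
    and comm: "\<And>x y. x \<in> P \<Longrightarrow> y \<in> M \<Longrightarrow> x \<otimes> y = y \<otimes> x" and int: "P \<inter> M = {\<one>}"
  shows "torsion_free G (P <#> M)"
  unfolding torsion_free_def
proof (intro ballI allI impI)
  note c = subgroup.mem_carrier[OF P(2)] subgroup.mem_carrier[OF M(2)]
  fix x and n :: nat assume x: "x \<in> P <#> M" and n: "n > 0" "x [^] n = \<one>"
  obtain p m where pm: "p \<in> P" "m \<in> M" "x = p \<otimes> m" using x by (auto simp: mem_set_mult)
  have pn: "p [^] n \<in> P" "m [^] n \<in> M"
    using subgroup_int_pow_closed[OF P(2) pm(1), of "int n"] subgroup_int_pow_closed[OF M(2) pm(2), of "int n"]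
    by (simp_all add: int_pow_int)
  have e: "p [^] n \<otimes> m [^] n = \<one>"
    using n(2) pm c comm[OF pm(1,2)] pow_mult_distrib[of p m n] by simp
  then have "p [^] n = inv (m [^] n)" using pm c by (simp add: inv_equality)
  then have "p [^] n \<in> M" using pn M(2) by (simp add: subgroup.m_inv_closed)
  then have p1: "p [^] n = \<one>" using pn int by blast
  then have "m [^] n = \<one>" using e pm c by simp
  then have "p = \<one>" "m = \<one>" using p1 pm P(1) M(1) n(1) unfolding torsion_free_def by auto
  then show "x = \<one>" using pm(3) by simp
qed

text \<open>Each further \<open>M\<close> is contained in the previous product or meets it
  trivially. Torsion domains of other characters therefore meet these products trivially.\<close>

lemma abelian_minimals_generate_torsion_free:
  assumes "finite F" "F \<subseteq> abelian_minimals G"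
  shows "torsion_free G (generate G (\<Union>F))"
  using assms
proof (induction F)
  case empty
  then show ?case by (simp add: torsion_free_def generate_empty)
next
  case (insert M F)
  let ?P = "generate G (\<Union>F)"
  have M: "M \<in> abelian_minimals G" and Fn: "\<And>N. N \<in> F \<Longrightarrow> N \<lhd> G"
    using insert abelian_minimals_normal by auto
  have Mm: "minimal_normal G M" "torsion_free G M" using M by (auto simp: abelian_minimals_def)
  have P: "?P \<lhd> G" by (rule generate_Union_normal[OF Fn])
  have eq: "generate G (\<Union>(insert M F)) = ?P <#> M"
    by (rule generate_Union_insert[OF Fn abelian_minimals_normal[OF M]])
  show ?case
  proof (cases "M \<subseteq> ?P")
    case True
    then have "?P <#> M \<subseteq> ?P"
      using P normal_imp_subgroup subgroup.m_closed by (fastforce simp: mem_set_mult)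
    then show ?thesis using insert unfolding eq torsion_free_def by blast
  next
    case False
    then have "?P \<inter> M = {\<one>}" using minimal_normal_Int[OF Mm(1) P] by blast
    moreover have "x \<otimes> y = y \<otimes> x" if "x \<in> ?P" "y \<in> M" for x y
      using abelian_minimals_generate_commute[OF insert.prems, of x y] that
        mono_generate[of "\<Union>F" "\<Union>(insert M F)"] generate.incl[of y "\<Union>(insert M F)"] by auto
    ultimately show ?thesis
      unfolding eq using insert Mm(2) P normal_imp_subgroup abelian_minimals_normal[OF M]
      by (intro torsion_free_set_mult) auto
  qed
qed

end

context partial_hom begin

text \<open>
  The clause on \<open>R\<close> drives the induction: if a new element \<open>y\<close> is mapped to a primitive \<open>r\<close>-th root of
  unity for a prime \<open>r > R\<close>, then \<open>(q \<otimes> y) [^] (R ^ k)\<close> has a nontrivial value for every old \<open>q\<close> and some \<open>k\<close>,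
  which takes care of the minimal normal subgroups of the product that are not contained in a factor.
\<close>

definition torsion_hom :: "nat set \<Rightarrow> 'a set set \<Rightarrow> nat \<Rightarrow> 'a set \<Rightarrow> ('a \<Rightarrow> 'c) \<Rightarrow> bool" where
  "torsion_hom Pr F R D \<chi> \<longleftrightarrow> R > 0 \<and> subgroup D G \<and> D \<subseteq> generate G (\<Union>F) \<and> \<chi> \<in> hom (G\<lparr>carrier := D\<rparr>) H \<and>
    (\<forall>q\<in>generate G (\<Union>F). \<exists>k. q [^] (R ^ k) \<in> D \<and> \<chi> (q [^] (R ^ k)) = \<one>\<^bsub>H\<^esub>) \<and>
    (\<forall>M\<in>abelian_minimals G. M \<subseteq> generate G (\<Union>F) \<longrightarrow>
      (\<exists>m\<in>M \<inter> D. \<exists>r\<in>Pr. \<chi> m \<noteq> \<one>\<^bsub>H\<^esub> \<and> \<chi> m [^]\<^bsub>H\<^esub> r = \<one>\<^bsub>H\<^esub>))"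

text \<open>Each factor that enlarges the product gets its own prime. An infinite supply is needed
  because each new prime must exceed the current \<open>R\<close>, and \<open>R\<close> is
  multiplied by it.\<close>

lemma finite_torsion_free_hom:
  assumes F: "finite F" "F \<subseteq> abelian_minimals G"
    and Pr: "infinite Pr" "\<And>r. r \<in> Pr \<Longrightarrow> Factorial_Ring.prime (r::nat)"
      "\<And>r. r \<in> Pr \<Longrightarrow> \<exists>\<zeta>\<in>carrier H. \<zeta> \<noteq> \<one>\<^bsub>H\<^esub> \<and> \<zeta> [^]\<^bsub>H\<^esub> r = \<one>\<^bsub>H\<^esub>"
  shows "\<exists>R D \<chi>. torsion_hom Pr F R D \<chi>"
  using F
proof (induction F)
  case empty
  have "\<not> M \<subseteq> {\<one>}" if "M \<in> abelian_minimals G" for M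
    using that normal_one_mem[OF abelian_minimals_normal[OF that]]
    by (auto simp: abelian_minimals_def minimal_normal_def)
  moreover have "(\<lambda>x. \<one>\<^bsub>H\<^esub>) \<in> hom (G\<lparr>carrier := {\<one>}\<rparr>) H" by (auto simp: hom_def)
  ultimately show ?case
    using triv_subgroup by (intro exI[of _ 1] exI[of _ "{\<one>}"] exI[of _ "\<lambda>x. \<one>\<^bsub>H\<^esub>"]) (auto simp: torsion_hom_def generate_empty)
next
  case (insert M F)
  let ?P = "generate G (\<Union>F)" and ?Q = "generate G (\<Union>(insert M F))"
  have M: "M \<in> abelian_minimals G" and Fn: "\<And>N. N \<in> F \<Longrightarrow> N \<lhd> G"
    using insert abelian_minimals_normal by auto
  have Mm: "minimal_normal G M" "torsion_free G M" using M by (auto simp: abelian_minimals_def)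
  note Mn = abelian_minimals_normal[OF M]
  note sM = normal_imp_subgroup[OF Mn]
  have P: "?P \<lhd> G" by (rule generate_Union_normal[OF Fn])
  note sP = normal_imp_subgroup[OF P]
  have eq: "?Q = ?P <#> M" by (rule generate_Union_insert[OF Fn Mn])
  have comm: "x \<otimes> y = y \<otimes> x" if "x \<in> ?Q" "y \<in> ?Q" for x y
    by (rule abelian_minimals_generate_commute[OF insert.prems that])
  have PQ: "?P \<subseteq> ?Q" by (rule mono_generate) blast
  have MQ: "M \<subseteq> ?Q" by (auto intro: generate.incl)
  note cP = subgroup.mem_carrier[OF sP] and cM = subgroup.mem_carrier[OF sM]
  have "F \<subseteq> abelian_minimals G" using insert.prems by simp
  from insert.IH[OF this] obtain R D \<chi> where "torsion_hom Pr F R D \<chi>" by blast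
  then have R: "R > 0" and D: "subgroup D G" "D \<subseteq> ?P" "\<chi> \<in> hom (G\<lparr>carrier := D\<rparr>) H"
    and tors: "\<And>q. q \<in> ?P \<Longrightarrow> \<exists>k. q [^] (R ^ k) \<in> D \<and> \<chi> (q [^] (R ^ k)) = \<one>\<^bsub>H\<^esub>"
    and nontriv: "\<And>M. M \<in> abelian_minimals G \<Longrightarrow> M \<subseteq> ?P \<Longrightarrow>
      \<exists>m\<in>M \<inter> D. \<exists>r\<in>Pr. \<chi> m \<noteq> \<one>\<^bsub>H\<^esub> \<and> \<chi> m [^]\<^bsub>H\<^esub> r = \<one>\<^bsub>H\<^esub>"
    by (simp_all add: torsion_hom_def)
  show ?case
  proof (cases "M \<subseteq> ?P")
    case True
    have "?P <#> M \<subseteq> ?P" using True by (auto simp: mem_set_mult intro!: subgroup.m_closed[OF sP])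
    then have "?Q = ?P" using PQ eq by blast
    then show ?thesis using R D tors nontriv by (intro exI[of _ R] exI[of _ D] exI[of _ \<chi>]) (simp add: torsion_hom_def)
  next
    case False
    then have int: "M \<inter> ?P = {\<one>}" using minimal_normal_Int[OF Mm(1) P] by blast
    obtain y where y: "y \<in> M" "y \<noteq> \<one>"
      using Mm(1) subgroup.one_closed[OF sM] unfolding minimal_normal_def by blast
    have yG: "y \<in> carrier G" using y cM by blast
    have "infinite (Pr - {..R})" using Pr(1) by simp
    \<comment> \<open>A prime above \<open>R\<close> divides no power \<open>R^k\<close>, so raising
      to such a power keeps a primitive \<open>r\<close>-th root of unity nontrivial.\<close>
    then obtain r where r: "r \<in> Pr" "r > R" by (metis Diff_iff atMost_iff finite.emptyI not_le all_not_in_conv)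
    note rp = Pr(2)[OF r(1)]
    obtain \<zeta> where \<zeta>: "\<zeta> \<in> carrier H" "\<zeta> \<noteq> \<one>\<^bsub>H\<^esub>" "\<zeta> [^]\<^bsub>H\<^esub> r = \<one>\<^bsub>H\<^esub>" using Pr(3)[OF r(1)] by blast
    have yr: "y [^] r \<in> M" using subgroup_int_pow_closed[OF sM y(1), of "int r"] by (simp add: int_pow_int)
    have S: "subgroup (generate G {y [^] r}) G" "generate G {y [^] r} \<subseteq> M"
      using yG yr generate_is_subgroup[of "{y [^] r}"] generate_subgroup_incl[OF _ sM, of "{y [^] r}"] by simp_all
    have yS: "y \<notin> generate G {y [^] r}"
    proof
      assume "y \<in> generate G {y [^] r}"
      then obtain k :: int where "y = (y [^] r) [^] k" using generate_pow[of "y [^] r"] yG by auto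
      then have k: "y = y [^] (int r * k)" using yG by (simp add: int_pow_pow[symmetric] int_pow_int)
      have "y [^] (int r * k - 1) = y [^] (int r * k) \<otimes> inv y" using yG by (simp add: int_pow_diff)
      then have "y [^] (int r * k - 1) = \<one>" using k[symmetric] yG by simp
      moreover have "int r * k - 1 \<noteq> 0"
      proof
        assume "int r * k - 1 = 0"
        then have "int r dvd 1" by (metis dvd_triv_left eq_iff_diff_eq_0)
        then show False using prime_gt_1_nat[OF rp] by simp
      qed
      ultimately show False using torsion_free_int_pow[OF Mm(2) sM y(1)] y(2) by blast
    qed
    \<comment> \<open>Containing \<open>y^r\<close> and maximal without \<open>y\<close>, the
      subgroup \<open>C\<close> makes \<open>M/C\<close> an \<open>r\<close>-primary group. So every
      element of \<open>M\<close> is killed modulo \<open>C\<close> by a power of \<open>r\<close>,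
      as the clause on \<open>R\<close> requires, while \<open>y\<close> can be sent to
      \<open>\<zeta>\<close>.\<close>
    obtain C where C: "subgroup C G" "generate G {y [^] r} \<subseteq> C" "C \<subseteq> M" "y \<notin> C"
      and max: "\<And>D. subgroup D G \<Longrightarrow> C \<subset> D \<Longrightarrow> D \<subseteq> M \<Longrightarrow> y \<in> D"
      using exists_maximal_avoiding[OF S yS] by blast
    have yrC: "y [^] r \<in> C" using C(2) generate.incl[of "y [^] r" "{y [^] r}" G] by blast
    have commM: "a \<otimes> b = b \<otimes> a" if "a \<in> M" "b \<in> M" for a b using M that by (simp add: abelian_minimals_def)
    have primary: "\<exists>e::nat. x [^] (r ^ e) \<in> C" if "x \<in> M" for x
      by (rule maximal_avoiding_primary[OF sM commM C(1,3,4) max y(1) yrC rp that])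
    have triv: "(\<lambda>x. \<one>\<^bsub>H\<^esub>) \<in> hom (G\<lparr>carrier := C\<rparr>) H" by (auto simp: hom_def)
    have agree: "\<one>\<^bsub>H\<^esub> = \<zeta> [^]\<^bsub>H\<^esub> k" if "y [^] k \<in> C" for k :: int
      using H.int_pow_dvd_eq_one[OF \<zeta>(1,3) prime_power_not_mem[OF C(1) yG C(4) yrC rp that]] by simp
    have Cy: "x \<otimes> y = y \<otimes> x" if "x \<in> C" for x using commM[OF _ y(1)] that C(3) by blast
    obtain \<delta> where \<delta>: "subgroup (C <#> generate G {y}) G" "\<delta> \<in> hom (G\<lparr>carrier := C <#> generate G {y}\<rparr>) H"
      "\<And>x. x \<in> C \<Longrightarrow> \<delta> x = \<one>\<^bsub>H\<^esub>" "\<delta> y = \<zeta>" "y \<in> C <#> generate G {y}" "C \<subseteq> C <#> generate G {y}"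
      using extend_hom_cyclic[OF C(1) triv yG Cy \<zeta>(1) agree] by blast
    define D0 where "D0 = C <#> generate G {y}"
    note \<delta> = \<delta>[folded D0_def]
    have "generate G {y} \<subseteq> M" using y(1) by (intro generate_subgroup_incl[OF _ sM]) simp
    then have D0M: "D0 \<subseteq> M" unfolding D0_def using C(3)
      by (auto simp: mem_set_mult intro!: subgroup.m_closed[OF sM])
    have c1: "x \<otimes> z = z \<otimes> x" if "x \<in> D" "z \<in> D0" for x z
      using comm[of x z] that D(2) PQ D0M MQ by blast
    have "x = \<one>" if "x \<in> D" "x \<in> D0" for x using that D(2) D0M int by blast
    then have ag: "\<chi> x = \<delta> x" if "x \<in> D" "x \<in> D0" for x
      using that subgroup_hom_one[OF D(1,3)] subgroup_hom_one[OF \<delta>(1,2)] by metis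
    obtain \<psi> where \<psi>: "subgroup (D <#> D0) G" "\<psi> \<in> hom (G\<lparr>carrier := D <#> D0\<rparr>) H"
      "\<And>x. x \<in> D \<Longrightarrow> \<psi> x = \<chi> x" "\<And>x. x \<in> D0 \<Longrightarrow> \<psi> x = \<delta> x"
      using extend_hom_product[OF D(1,3) \<delta>(1,2) c1 ag] by blast
    note DD0 = subset_set_mult[OF D(1) \<delta>(1)]
    have \<psi>mult: "\<psi> (a \<otimes> b) = \<psi> a \<otimes>\<^bsub>H\<^esub> \<psi> b" if "a \<in> D <#> D0" "b \<in> D <#> D0" for a b
      using \<psi>(2) that unfolding hom_restrict_carrier_iff by blast
    have pow_closed: "a [^] (n::nat) \<in> U" if "subgroup U G" "a \<in> U" for a n U
      using subgroup_int_pow_closed[OF that, of "int n"] by (simp add: int_pow_int)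
    have 1: "\<exists>k. x [^] ((R * r) ^ k) \<in> D <#> D0 \<and> \<psi> (x [^] ((R * r) ^ k)) = \<one>\<^bsub>H\<^esub>" if x: "x \<in> ?Q" for x
    proof -
      obtain q m where qm: "q \<in> ?P" "m \<in> M" "x = q \<otimes> m" using x unfolding eq by (auto simp: mem_set_mult)
      have qmG: "q \<in> carrier G" "m \<in> carrier G" using qm cP cM by auto
      obtain k where k: "q [^] (R ^ k) \<in> D" "\<chi> (q [^] (R ^ k)) = \<one>\<^bsub>H\<^esub>" using tors[OF qm(1)] by blast
      obtain e where e: "m [^] (r ^ e) \<in> C" using primary[OF qm(2)] by blast
      \<comment> \<open>A common exponent: it is a multiple both of \<open>R^k\<close>, which
        trivialises the old factor, and of \<open>r^e\<close>, which moves the new one into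
        \<open>C\<close>.\<close>
      define N where "N = (R * r) ^ (k + e)"
      have N1: "N = R ^ k * (R ^ e * r ^ (k + e))" by (simp add: N_def power_add power_mult_distrib)
      have N2: "N = r ^ e * (r ^ k * R ^ (k + e))" by (simp add: N_def power_add power_mult_distrib)
      have qN: "q [^] N = (q [^] (R ^ k)) [^] (R ^ e * r ^ (k + e))"
        using qmG by (simp add: N1 nat_pow_pow)
      have mN: "m [^] N = (m [^] (r ^ e)) [^] (r ^ k * R ^ (k + e))"
        using qmG by (simp add: N2 nat_pow_pow)
      have q': "q [^] N \<in> D" "\<chi> (q [^] N) = \<one>\<^bsub>H\<^esub>"
        unfolding qN using pow_closed[OF D(1) k(1)] subgroup_hom_pow[OF D(1,3) k(1)] k(2) by simp_all
      have m': "m [^] N \<in> C" unfolding mN by (rule pow_closed[OF C(1) e])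
      have m'': "m [^] N \<in> D0" "\<delta> (m [^] N) = \<one>\<^bsub>H\<^esub>" using m' \<delta>(3,6) by auto
      have "x [^] N = q [^] N \<otimes> m [^] N"
        unfolding qm(3) using comm[of q m] qm PQ MQ qmG by (intro pow_mult_distrib) auto
      moreover have "q [^] N \<in> D <#> D0" "m [^] N \<in> D <#> D0" using q' m'' DD0 by auto
      ultimately have "x [^] N \<in> D <#> D0" "\<psi> (x [^] N) = \<one>\<^bsub>H\<^esub>"
        using \<psi>mult \<psi>(3)[OF q'(1)] \<psi>(4)[OF m''(1)] q' m'' subgroup.m_closed[OF \<psi>(1)] by simp_all
      then show ?thesis unfolding N_def by blast
    qed
    have 2: "\<exists>m\<in>N \<inter> (D <#> D0). \<exists>r\<in>Pr. \<psi> m \<noteq> \<one>\<^bsub>H\<^esub> \<and> \<psi> m [^]\<^bsub>H\<^esub> r = \<one>\<^bsub>H\<^esub>"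
      if N: "N \<in> abelian_minimals G" "N \<subseteq> ?Q" for N
    proof (cases "N \<subseteq> ?P")
      case True
      then obtain m r where "m \<in> N \<inter> D" "r \<in> Pr" "\<chi> m \<noteq> \<one>\<^bsub>H\<^esub>" "\<chi> m [^]\<^bsub>H\<^esub> r = \<one>\<^bsub>H\<^esub>"
        using nontriv[OF N(1)] by blast
      then show ?thesis using \<psi>(3)[of m] DD0 by (intro bexI[of _ m] bexI[of _ r]) auto
    next
      case False
      \<comment> \<open>Such an \<open>N\<close> is a diagonal subgroup and projects onto
        \<open>M\<close>, so it contains an element with \<open>M\<close>-component
        \<open>y\<close>. Its power with exponent \<open>R^k\<close> removes the contribution of
        \<open>q\<close>.\<close>
      obtain q where q: "q \<in> ?P" "q \<otimes> y \<in> N"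
        using minimal_normal_project[OF Mm(1) P abelian_minimals_normal[OF N(1)] _ False y(1)] N(2) eq by blast
      obtain k where k: "q [^] (R ^ k) \<in> D" "\<chi> (q [^] (R ^ k)) = \<one>\<^bsub>H\<^esub>" using tors[OF q(1)] by blast
      define n where "n = R ^ k"
      note k = k[folded n_def]
      have yn: "y [^] n \<in> D0" by (rule pow_closed[OF \<delta>(1,5)])
      have e: "(q \<otimes> y) [^] n = q [^] n \<otimes> y [^] n"
        using comm[of q y] q y PQ MQ yG cP by (intro pow_mult_distrib) auto
      have in1: "q [^] n \<in> D <#> D0" "y [^] n \<in> D <#> D0" using k yn DD0 by auto
      have in2: "(q \<otimes> y) [^] n \<in> N" by (rule pow_closed[OF normal_imp_subgroup[OF abelian_minimals_normal[OF N(1)]] q(2)])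
      have "\<psi> ((q \<otimes> y) [^] n) = \<zeta> [^]\<^bsub>H\<^esub> n"
        unfolding e using \<psi>mult[OF in1] \<psi>(3)[OF k(1)] k(2) \<psi>(4)[OF yn] subgroup_hom_pow[OF \<delta>(1,2,5), of n] \<delta>(4) \<zeta>(1)
        by simp
      moreover have "\<not> r dvd n"
      proof
        assume "r dvd n"
        then have "r dvd R" unfolding n_def using rp prime_dvd_power by blast
        then show False using r(2) R by (auto dest: dvd_imp_le)
      qed
      then have "\<zeta> [^]\<^bsub>H\<^esub> n \<noteq> \<one>\<^bsub>H\<^esub>"
        using H.root_of_unity_pow_eq_one[OF \<zeta>(1,3,2) rp, of "int n"] by (simp add: int_pow_int)
      moreover have "(\<zeta> [^]\<^bsub>H\<^esub> n) [^]\<^bsub>H\<^esub> r = \<one>\<^bsub>H\<^esub>"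
        using \<zeta> H.int_pow_dvd_eq_one[OF \<zeta>(1,3), of "int (n * r)"]
        by (simp add: H.nat_pow_pow int_pow_int del: of_nat_mult)
      moreover have "(q \<otimes> y) [^] n \<in> D <#> D0" unfolding e by (rule subgroup.m_closed[OF \<psi>(1) in1])
      ultimately show ?thesis using in2 r(1) by (intro bexI[of _ "(q \<otimes> y) [^] n"] bexI[of _ r]) auto
    qed
    have "D <#> D0 \<subseteq> ?Q" unfolding eq using D(2) D0M by (intro mono_set_mult) auto
    then show ?thesis
      using R prime_gt_0_nat[OF rp] \<psi>(1,2) 1 2
      by (intro exI[of _ "R * r"] exI[of _ "D <#> D0"] exI[of _ \<psi>]) (simp add: torsion_hom_def)
  qed
qed

end

section \<open>Infinite rank\<close>

lemma infinite_times_self_lepoll: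
  assumes "infinite E"
  shows "E \<times> E \<lesssim> E"
  by (rule eqpoll_imp_lepoll, unfold eqpoll_iff_card_of_ordIso)
    (rule card_of_Times_same_infinite[OF assms])

lemma infinite_times_nat_lepoll:
  assumes "infinite E"
  shows "E \<times> (UNIV :: nat set) \<lesssim> E"
proof -
  obtain \<nu> :: "nat \<Rightarrow> 'a" where \<nu>: "inj \<nu>" "range \<nu> \<subseteq> E"
    using iffD1[OF infinite_le_lepoll assms] unfolding lepoll_def by blast
  have "inj_on (\<lambda>(e, n). (e, \<nu> n)) (E \<times> UNIV)" "(\<lambda>(e, n). (e, \<nu> n)) ` (E \<times> UNIV) \<subseteq> E \<times> E"
    using \<nu> by (auto simp: inj_on_def inj_def)
  then have "E \<times> (UNIV :: nat set) \<lesssim> E \<times> E" unfolding lepoll_def by (intro exI conjI)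
  then show ?thesis by (rule lepoll_trans[OF _ infinite_times_self_lepoll[OF assms]])
qed

lemma infinite_lists_lepoll:
  assumes "infinite E"
  shows "lists E \<lesssim> E"
proof -
  obtain p where p: "inj_on p (E \<times> E)" "p ` (E \<times> E) \<subseteq> E"
    using infinite_times_self_lepoll[OF assms] unfolding lepoll_def by blast
  obtain e0 where e0: "e0 \<in> E" using assms by (metis finite.emptyI all_not_in_conv)
  \<comment> \<open>Iterated pairing separates lists of equal length; the length is recorded as a
    second component.\<close>
  define code where "code xs = foldr (\<lambda>x c. p (x, c)) xs e0" for xs
  have code: "code xs \<in> E" if "xs \<in> lists E" for xs
    using that unfolding code_def by (induction xs) (use e0 p(2) in auto)
  have inj: "xs = ys" if "xs \<in> lists E" "ys \<in> lists E" "length xs = length ys" "code xs = code ys" for xs ys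
    using that(3,1,2,4)
  proof (induction xs ys rule: list_induct2)
    case (Cons x xs y ys)
    have c: "code xs \<in> E" "code ys \<in> E" using Cons code by auto
    have "p (x, code xs) = p (y, code ys)" using Cons.prems by (simp add: code_def)
    then have "(x, code xs) = (y, code ys)"
      by (rule inj_onD[OF p(1)]) (use Cons.prems c in auto)
    then show ?case using Cons by simp
  qed simp
  have "inj_on (\<lambda>xs. (code xs, length xs)) (lists E)"
    by (intro inj_onI inj) simp_all
  moreover have "(\<lambda>xs. (code xs, length xs)) ` lists E \<subseteq> E \<times> (UNIV :: nat set)"
    by (intro image_subsetI) (simp add: code)
  ultimately have "lists E \<lesssim> E \<times> (UNIV :: nat set)" unfolding lepoll_def by (intro exI conjI)
  then show ?thesis by (rule lepoll_trans[OF _ infinite_times_nat_lepoll[OF assms]])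
qed

context group begin

text \<open>Elements of the generated group are words in \<open>E\<close> and the inverses. The
  bound leaves enough members of \<open>E\<close> to reserve some for every element of this
  group.\<close>

lemma generate_lepoll:
  assumes E: "infinite E" "E \<subseteq> carrier G"
  shows "generate G E \<lesssim> E"
proof -
  define E' where "E' = E \<union> m_inv G ` E"
  have E'G: "E' \<subseteq> carrier G" using E(2) by (auto simp: E'_def)
  have "E' \<subseteq> (\<lambda>(e, n::nat). if n = 0 then e else inv e) ` (E \<times> UNIV)"
  proof
    fix x assume "x \<in> E'"
    then consider "x \<in> E" | e where "e \<in> E" "x = inv e" by (auto simp: E'_def)
    then show "x \<in> (\<lambda>(e, n::nat). if n = 0 then e else inv e) ` (E \<times> UNIV)"
    proof cases
      case 1
      then show ?thesis by (intro image_eqI[of _ _ "(x, 0)"]) auto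
    next
      case 2
      then show ?thesis by (intro image_eqI[of _ _ "(e, 1)"]) auto
    qed
  qed
  then have "E' \<lesssim> E \<times> (UNIV :: nat set)" by (rule subset_image_lepoll)
  then have E'E: "E' \<lesssim> E" by (rule lepoll_trans[OF _ infinite_times_nat_lepoll[OF E(1)]])
  have infE': "infinite E'" using E(1) by (simp add: E'_def)
  define ev where "ev xs = foldr (\<otimes>) xs \<one>" for xs
  have evG: "ev xs \<in> carrier G" if "xs \<in> lists E'" for xs
    using that E'G unfolding ev_def by (induction xs) auto
  have ev_append: "ev (xs @ ys) = ev xs \<otimes> ev ys" if "xs \<in> lists E'" "ys \<in> lists E'" for xs ys
    using that(1)
  proof (induction xs)
    case Nil
    then show ?case using evG[OF that(2)] by (simp add: ev_def)
  next
    case (Cons x xs)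
    have "ev (x # xs @ ys) = x \<otimes> ev (xs @ ys)" "ev (x # xs) = x \<otimes> ev xs" by (simp_all add: ev_def)
    then show ?case using Cons evG[of xs] evG[OF that(2)] E'G by (simp add: m_assoc subset_iff)
  qed
  have "generate G E \<subseteq> ev ` lists E'"
  proof
    fix x assume "x \<in> generate G E"
    then show "x \<in> ev ` lists E'"
    proof induction
      case one
      then show ?case by (intro image_eqI[of _ _ "[]"]) (auto simp: ev_def)
    next
      case (incl h)
      then show ?case using E(2) by (intro image_eqI[of _ _ "[h]"]) (auto simp: ev_def E'_def)
    next
      case (inv h)
      then show ?case using E(2) by (intro image_eqI[of _ _ "[inv h]"]) (auto simp: ev_def E'_def)
    next
      case (eng a b)
      then obtain xs ys where "xs \<in> lists E'" "a = ev xs" "ys \<in> lists E'" "b = ev ys" by blast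
      then show ?case by (intro image_eqI[of _ _ "xs @ ys"]) (simp_all add: ev_append)
    qed
  qed
  then have "generate G E \<lesssim> lists E'" by (rule subset_image_lepoll)
  then show ?thesis by (rule lepoll_trans[OF _ lepoll_trans[OF infinite_lists_lepoll[OF infE'] E'E]])
qed

text \<open>For commuting elements this is linear independence over the integers; in particular all
  members have infinite order.\<close>

definition independent :: "'a set \<Rightarrow> bool" where
  "independent E \<longleftrightarrow> (\<forall>e\<in>E. \<forall>n::nat. n > 0 \<longrightarrow> e [^] n \<notin> generate G (E - {e}))"

lemma generate_insert_commuting:
  assumes S: "insert b S \<subseteq> carrier G" and comm: "\<And>s. s \<in> S \<Longrightarrow> s \<otimes> b = b \<otimes> s"
    and x: "x \<in> generate G (insert b S)"
  obtains w and k :: int where "w \<in> generate G S" "x = w \<otimes> b [^] k"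
proof -
  have sg: "subgroup (generate G S) G" "subgroup (generate G {b}) G"
    using S by (auto intro: generate_is_subgroup)
  have "subgroup (generate G S <#> generate G {b}) G"
    by (rule commuting_set_mult_subgroup[OF sg])
      (rule generate_commute2[of S "{b}"], use S comm in auto)
  moreover have "insert b S \<subseteq> generate G S <#> generate G {b}"
    using subset_set_mult[OF sg] generate.incl[of _ S G] generate.incl[of b "{b}" G] by blast
  ultimately have "x \<in> generate G S <#> generate G {b}"
    using generate_subgroup_incl x by blast
  moreover have "b \<in> carrier G" using S by simp
  ultimately show thesis using that unfolding mem_set_mult generate_pow[OF \<open>b \<in> carrier G\<close>] by blast
qed

lemma nat_abs_pow_mem:
  assumes "subgroup U G" "x \<in> carrier G" "x [^] (k::int) \<in> U"
  shows "x [^] nat \<bar>k\<bar> \<in> U"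
proof (cases "k \<ge> 0")
  case True
  then show ?thesis using assms(3) by (simp flip: int_pow_int)
next
  case False
  then have "x [^] int (nat \<bar>k\<bar>) = inv (x [^] k)" using assms(2) by (simp add: int_pow_neg[symmetric])
  then have "x [^] int (nat \<bar>k\<bar>) \<in> U" using assms by (simp add: subgroup.m_inv_closed)
  then show ?thesis by (simp only: int_pow_int)
qed

text \<open>The analogue of a basis of the rational vector space spanned by \<open>S\<close>: Zorn's
  lemma gives a maximal independent set, and an exchange argument shows that every \<open>b\<close>
  is torsion modulo its span.\<close>

lemma exists_maximal_independent:
  assumes S: "S \<subseteq> carrier G" and comm: "\<And>a b. a \<in> S \<Longrightarrow> b \<in> S \<Longrightarrow> a \<otimes> b = b \<otimes> a"
  obtains E where "E \<subseteq> S" "independent E" "\<And>b. b \<in> S \<Longrightarrow> \<exists>n::nat. n > 0 \<and> b [^] n \<in> generate G E"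
proof -
  define \<E> where "\<E> = {E. E \<subseteq> S \<and> independent E}"
  have "{} \<in> \<E>" by (simp add: \<E>_def independent_def)
  then have ne: "\<E> \<noteq> {}" by blast
  have "\<Union>\<K> \<in> \<E>" if ch: "\<K> \<noteq> {}" "subset.chain \<E> \<K>" for \<K>
  proof -
    have sub: "E \<subseteq> S" "independent E" if "E \<in> \<K>" for E
    proof -
      have "E \<in> \<E>" using that ch(2) unfolding subset.chain_def by blast
      then show "E \<subseteq> S" "independent E" by (simp_all add: \<E>_def)
    qed
    have "independent (\<Union>\<K>)" unfolding independent_def
    proof (intro ballI allI impI notI)
      fix e and n :: nat assume e: "e \<in> \<Union>\<K>" and n: "n > 0" "e [^] n \<in> generate G (\<Union>\<K> - {e})"
      obtain T where T: "finite T" "T \<subseteq> \<Union>\<K> - {e}" "e [^] n \<in> generate G T"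
        using generate_finite_support[OF n(2)] by blast
      obtain E where E: "E \<in> \<K>" "insert e T \<subseteq> E"
        using finite_subset_Union_chain[OF _ _ ch, of "insert e T"] T e by auto
      have "T \<subseteq> E - {e}" using T E by blast
      then have "e [^] n \<in> generate G (E - {e})" using T(3) mono_generate by blast
      then show False using sub(2)[OF E(1)] E n(1) by (auto simp: independent_def)
    qed
    moreover have "\<Union>\<K> \<subseteq> S" using sub(1) by blast
    ultimately show ?thesis by (simp add: \<E>_def)
  qed
  then obtain E where E: "E \<in> \<E>" "\<And>D. D \<in> \<E> \<Longrightarrow> E \<subseteq> D \<Longrightarrow> D = E"
    using subset_Zorn_nonempty[OF ne] by meson
  have ES: "E \<subseteq> S" and ind: "independent E" using E(1) by (simp_all add: \<E>_def)
  have EG: "E \<subseteq> carrier G" using ES S by blast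
  have max: "\<exists>n::nat. n > 0 \<and> b [^] n \<in> generate G E" if b: "b \<in> S" for b
  proof (cases "b \<in> E")
    case True
    then have "b [^] (1::nat) \<in> generate G E" using EG by (simp add: subset_iff generate.incl)
    then show ?thesis using zero_less_one by blast
  next
    case False
    have bG: "b \<in> carrier G" using b S by blast
    have "\<not> independent (insert b E)" using E(2)[of "insert b E"] False ES b by (auto simp: \<E>_def)
    then obtain e and n :: nat where e: "e \<in> insert b E" "n > 0" "e [^] n \<in> generate G (insert b E - {e})"
      unfolding independent_def by blast
    show ?thesis
    proof (cases "e = b")
      case True
      then show ?thesis using e False by (auto simp: insert_Diff_if)
    next
      case neq: False
      then have eE: "e \<in> E" "insert b E - {e} = insert b (E - {e})" using e by auto
      obtain w and k :: int where w: "w \<in> generate G (E - {e})" "e [^] n = w \<otimes> b [^] k"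
        using generate_insert_commuting[of b "E - {e}" "e [^] n"] e(3) eE bG EG comm ES b
        by (metis Diff_iff insert_subset subset_iff)
      have wG: "w \<in> carrier G" using w(1) generate_in_carrier[of "E - {e}"] EG by blast
      \<comment> \<open>In a dependence created by adding \<open>b\<close>, the element
        \<open>b\<close> occurs with nonzero exponent, since \<open>E\<close> itself is independent.
        Solving for that power of \<open>b\<close> puts it into the span of
        \<open>E\<close>.\<close>
      have k: "k \<noteq> 0"
      proof
        assume "k = 0"
        then have "e [^] n = w" using w wG by simp
        then show False using ind eE(1) e(2) w(1) by (auto simp: independent_def)
      qed
      have sg: "subgroup (generate G E) G" by (rule generate_is_subgroup[OF EG])
      have eG: "e \<in> carrier G" using eE EG by blast
      have "e [^] n \<in> generate G E"
        using subgroup_int_pow_closed[OF sg, of e "int n"] eE(1) by (simp add: int_pow_int generate.incl)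
      moreover have "w \<in> generate G E" using w(1) mono_generate[of "E - {e}" E] by blast
      moreover have "b [^] k = inv w \<otimes> e [^] n" using w wG bG by (simp add: inv_mult_cancel)
      ultimately have "b [^] k \<in> generate G E" using sg by (simp add: subgroup.m_closed subgroup.m_inv_closed)
      then have "b [^] nat \<bar>k\<bar> \<in> generate G E" by (rule nat_abs_pow_mem[OF sg bG])
      then show ?thesis using k by (intro exI[of _ "nat \<bar>k\<bar>"]) simp
    qed
  qed
  show thesis by (rule that[OF ES ind max])
qed

text \<open>A torsion factor from \<open>D0\<close> disappears in a suitable power, so independence
  persists modulo \<open>D0\<close>. A basis element outside \<open>S\<close> may thus be given any
  value.\<close>

lemma independent_pow_not_mem:
  assumes ind: "independent E" and EG: "E \<subseteq> carrier G" and e: "e \<in> E" "S \<subseteq> E - {e}"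
    and D0: "subgroup D0 G" "\<And>d. d \<in> D0 \<Longrightarrow> \<exists>n::nat. n > 0 \<and> d [^] n = \<one>"
    and comm: "\<And>d x. d \<in> D0 \<Longrightarrow> x \<in> E \<Longrightarrow> d \<otimes> x = x \<otimes> d"
    and k: "e [^] (k::int) \<in> D0 <#> generate G S"
  shows "k = 0"
proof (rule ccontr)
  assume k0: "k \<noteq> 0"
  obtain d w where dw: "d \<in> D0" "w \<in> generate G S" "e [^] k = d \<otimes> w" using k by (auto simp: mem_set_mult)
  obtain n :: nat where n: "n > 0" "d [^] n = \<one>" using D0(2)[OF dw(1)] by blast
  have SG: "S \<subseteq> carrier G" using e EG by blast
  have sg: "subgroup (generate G S) G" by (rule generate_is_subgroup[OF SG])
  have c: "e \<in> carrier G" "d \<in> carrier G" "w \<in> carrier G"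
    using e EG dw subgroup.mem_carrier[OF D0(1)] subgroup.mem_carrier[OF sg] by auto
  have "w \<otimes> d = d \<otimes> w"
    by (rule generate_commute[OF SG c(2) _ dw(2)]) (use comm[OF dw(1)] e in \<open>auto dest: sym\<close>)
  then have "(d \<otimes> w) [^] n = d [^] n \<otimes> w [^] n" using c by (intro pow_mult_distrib) auto
  then have "(e [^] k) [^] n = w [^] n" using dw n c by simp
  moreover have "w [^] n \<in> generate G S"
    using subgroup_int_pow_closed[OF sg dw(2), of "int n"] by (simp add: int_pow_int)
  moreover have "(e [^] k) [^] n = e [^] (k * int n)" using c by (simp add: int_pow_pow flip: int_pow_int)
  ultimately have "e [^] (k * int n) \<in> generate G S" by simp
  then have "e [^] nat \<bar>k * int n\<bar> \<in> generate G S" by (rule nat_abs_pow_mem[OF sg c(1)])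
  then have "e [^] nat \<bar>k * int n\<bar> \<in> generate G (E - {e})" using mono_generate[OF e(2)] by blast
  moreover have "nat \<bar>k * int n\<bar> > 0" using k0 n(1) by simp
  ultimately show False using ind e(1) unfolding independent_def by blast
qed

end

lemma (in field) mult_of_comm_group: "comm_group (mult_of R)"
  by (rule group.group_comm_groupI[OF field_mult_group]) (auto simp: m_comm)

context group begin

definition new_elements :: "(bool \<times> nat \<times> 'a \<Rightarrow> 'a) \<Rightarrow> (nat \<times> 'a) set \<Rightarrow> 'a set" where
  "new_elements f J = f ` (UNIV \<times> J)"

text \<open>
  For an index \<open>(n, s)\<close>, the two basis elements \<open>f (True, n, s)\<close> and \<open>f (False, n, s)\<close> are
  reserved for making \<open>s - 1\<close> invertible, provided that \<open>s\<close> is a word in basis elements of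
  level less than \<open>n\<close>: their sum becomes the inverse.
\<close>

definition level_hom ::
  "('f, 'o) ring_scheme \<Rightarrow> (bool \<times> nat \<times> 'a \<Rightarrow> 'a) \<Rightarrow> 'a set \<Rightarrow> ('a \<Rightarrow> 'f) \<Rightarrow> 'a set
    \<Rightarrow> (nat \<times> 'a) set \<Rightarrow> 'a set \<Rightarrow> ('a \<Rightarrow> 'f) \<Rightarrow> bool" where
  "level_hom F f D0 \<chi>0 T J D \<chi> \<longleftrightarrow> subgroup D G \<and> \<chi> \<in> hom (G\<lparr>carrier := D\<rparr>) (mult_of F) \<and>
     D0 \<subseteq> D \<and> D \<subseteq> D0 <#> generate G (new_elements f J) \<and> new_elements f J \<subseteq> D \<and>
     (\<forall>d\<in>D0. \<chi> d = \<chi>0 d) \<and> (\<forall>t\<in>T \<inter> D. \<chi> t \<noteq> \<one>\<^bsub>F\<^esub>) \<and>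
     (\<forall>(n, s)\<in>J. s \<in> T \<longrightarrow> s \<in> generate G (new_elements f {j \<in> J. fst j < n}) \<longrightarrow>
       (\<chi> (f (True, n, s)) \<oplus>\<^bsub>F\<^esub> \<chi> (f (False, n, s))) \<otimes>\<^bsub>F\<^esub> (\<chi> s \<ominus>\<^bsub>F\<^esub> \<one>\<^bsub>F\<^esub>) = \<one>\<^bsub>F\<^esub>)"

lemma new_elements_insert:
  "new_elements f (insert i J) = insert (f (True, i)) (insert (f (False, i)) (new_elements f J))"
  by (auto simp: new_elements_def UNIV_bool)

lemma set_mult_generate_insert:
  assumes D: "D \<subseteq> D0 <#> generate G S" and D0: "subgroup D0 G" and S: "insert x S \<subseteq> carrier G"
  shows "D <#> generate G {x} \<subseteq> D0 <#> generate G (insert x S)"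
proof
  fix e assume "e \<in> D <#> generate G {x}"
  then obtain d g where dg: "d \<in> D" "g \<in> generate G {x}" "e = d \<otimes> g" by (auto simp: mem_set_mult)
  have "d \<in> D0 <#> generate G S" using D dg(1) by (rule subsetD)
  then obtain a w where aw: "a \<in> D0" "w \<in> generate G S" "d = a \<otimes> w" unfolding mem_set_mult by blast
  have w: "w \<in> generate G (insert x S)" using mono_generate[of S "insert x S"] aw(2) by blast
  have g: "g \<in> generate G (insert x S)" using mono_generate[of "{x}" "insert x S"] dg(2) by blast
  have "e = a \<otimes> (w \<otimes> g)"
    using dg(3) aw(3) subgroup.mem_carrier[OF D0 aw(1)] generate_in_carrier[OF S w] generate_in_carrier[OF S g]
    by (simp add: m_assoc)
  then show "e \<in> D0 <#> generate G (insert x S)"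
    unfolding mem_set_mult using aw(1) generate.eng[OF w g] by blast
qed

text \<open>
  The pairs of new elements are given values in the order of their levels. If \<open>u\<close> is the prescribed sum,
  the values are \<open>c\<close> and \<open>u - c\<close>, where \<open>c\<close> avoids the finitely many solutions of the equations
  \<open>\<chi>(d) c\<^sup>a (u - c)\<^sup>b = 1\<close> which would make an element of \<open>T\<close> trivial.
\<close>

lemma exists_level_hom:
  fixes F :: "('f, 'o) ring_scheme"
  assumes F: "algebraically_closed F"
    and E: "independent E" "E \<subseteq> carrier G" "\<And>a b. a \<in> E \<Longrightarrow> b \<in> E \<Longrightarrow> a \<otimes> b = b \<otimes> a"
    and f: "inj_on f (UNIV \<times> I)" "f ` (UNIV \<times> I) \<subseteq> E"
    and D0: "subgroup D0 G" "\<chi>0 \<in> hom (G\<lparr>carrier := D0\<rparr>) (mult_of F)"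
      "\<And>d. d \<in> D0 \<Longrightarrow> \<exists>n::nat. n > 0 \<and> d [^] n = \<one>"
      "\<And>d x. d \<in> D0 \<Longrightarrow> x \<in> E \<Longrightarrow> d \<otimes> x = x \<otimes> d"
    and T: "finite T" "\<And>t n. t \<in> T \<Longrightarrow> n > 0 \<Longrightarrow> t [^] (n::nat) \<noteq> \<one>"
    and J: "finite J" "J \<subseteq> I"
  shows "\<exists>D \<chi>. level_hom F f D0 \<chi>0 T J D \<chi>"
  using J
\<comment> \<open>The index \<open>i\<close> added last has the highest level. So its values do not
  affect earlier conditions, and \<open>\<chi>\<close> is already defined at the words of lower
  level when the pair for \<open>i\<close> gets its values.\<close>
proof (induction J rule: finite_ranking_induct[where f = fst])
  case empty
  have "D0 \<inter> T = {}" using D0(3) T(2) by blast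
  moreover have "D0 \<subseteq> D0 <#> generate G {}"
    using subset_set_mult(1)[OF D0(1), of "generate G {}"] generate_is_subgroup[of "{}"] by simp
  ultimately have "level_hom F f D0 \<chi>0 T {} D0 \<chi>0"
    using D0(1,2) by (auto simp: level_hom_def new_elements_def)
  then show ?case by blast
next
  case (insert i J)
  show ?case
  proof (cases "i \<in> J")
    case True
    then show ?thesis using insert by (simp add: insert_absorb)
  next
    case iJ: False
    interpret F: algebraically_closed F by (rule F)
    interpret PH: partial_hom G "mult_of F"
      by (intro partial_hom.intro is_group F.mult_of_comm_group)
    obtain n s where i: "i = (n, s)" by (cases i)
    obtain D \<chi> where spec: "level_hom F f D0 \<chi>0 T J D \<chi>" using insert by auto
    then have D: "subgroup D G" "\<chi> \<in> hom (G\<lparr>carrier := D\<rparr>) (mult_of F)"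
      "D0 \<subseteq> D" "D \<subseteq> D0 <#> generate G (new_elements f J)" "new_elements f J \<subseteq> D"
      and \<chi>0: "\<And>d. d \<in> D0 \<Longrightarrow> \<chi> d = \<chi>0 d" and \<chi>T: "\<And>t. t \<in> T \<Longrightarrow> t \<in> D \<Longrightarrow> \<chi> t \<noteq> \<one>\<^bsub>F\<^esub>"
      and \<chi>J: "\<And>n s. (n, s) \<in> J \<Longrightarrow> s \<in> T \<Longrightarrow> s \<in> generate G (new_elements f {j \<in> J. fst j < n}) \<Longrightarrow>
       (\<chi> (f (True, n, s)) \<oplus>\<^bsub>F\<^esub> \<chi> (f (False, n, s))) \<otimes>\<^bsub>F\<^esub> (\<chi> s \<ominus>\<^bsub>F\<^esub> \<one>\<^bsub>F\<^esub>) = \<one>\<^bsub>F\<^esub>"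
      unfolding level_hom_def by auto
    note cD = subgroup.mem_carrier[OF D(1)]
    have \<chi>c: "\<chi> d \<in> carrier F" "\<chi> d \<noteq> \<zero>\<^bsub>F\<^esub>" if "d \<in> D" for d
      using D(2) that unfolding hom_restrict_carrier_iff by auto
    define x y where "x = f (True, i)" and "y = f (False, i)"
    have iI: "i \<in> I" "J \<subseteq> I" using insert.prems by auto
    have xy: "x \<in> E" "y \<in> E" using f(2) iI by (auto simp: x_def y_def)
    have xyG: "x \<in> carrier G" "y \<in> carrier G" using xy E(2) by auto
    have xney: "x \<noteq> y" using inj_onD[OF f(1), of "(True, i)" "(False, i)"] iI by (auto simp: x_def y_def)
    have VE: "new_elements f J \<subseteq> E - {x, y}"
    proof
      fix e assume "e \<in> new_elements f J"
      then obtain b j where j: "j \<in> J" "e = f (b, j)" by (auto simp: new_elements_def)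
      then have "e \<in> E" using f(2) iI by auto
      moreover have "f (b, j) \<noteq> f (b', i)" for b'
        using inj_onD[OF f(1), of "(b, j)" "(b', i)"] j iI iJ by auto
      ultimately show "e \<in> E - {x, y}" using j by (simp add: x_def y_def)
    qed
    have commE: "d \<otimes> e = e \<otimes> d" if d: "d \<in> D0 <#> generate G S" and e: "e \<in> E" and S: "S \<subseteq> E" for d e S
    proof -
      obtain a w where aw: "a \<in> D0" "w \<in> generate G S" "d = a \<otimes> w" using d by (auto simp: mem_set_mult)
      have SG: "S \<subseteq> carrier G" using S E(2) by blast
      have eG: "e \<in> carrier G" using e E(2) by blast
      have we: "w \<otimes> e = e \<otimes> w"
        by (rule generate_commute[OF SG eG _ aw(2)]) (use E(3) S e in blast)
      have wG: "w \<in> carrier G" using aw(2) generate_in_carrier[OF SG] by blast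
      have aG: "a \<in> carrier G" using subgroup.mem_carrier[OF D0(1) aw(1)] .
      have "a \<otimes> w \<otimes> e = a \<otimes> (e \<otimes> w)" using we aG wG eG by (simp add: m_assoc)
      also have "\<dots> = (a \<otimes> e) \<otimes> w" using aG wG eG by (simp add: m_assoc)
      also have "\<dots> = (e \<otimes> a) \<otimes> w" by (simp only: D0(4)[OF aw(1) e])
      also have "\<dots> = e \<otimes> (a \<otimes> w)" using aG wG eG by (simp add: m_assoc)
      finally show ?thesis using aw(3) by simp
    qed
    \<comment> \<open>The prescribed sum of the two new values. If no condition is attached to the
      index, the default 1 serves, since the sum only has to be nonzero.\<close>
    define u where "u = (if s \<in> T \<and> s \<in> generate G (new_elements f {j \<in> J. fst j < n})
      then inv\<^bsub>F\<^esub> (\<chi> s \<ominus>\<^bsub>F\<^esub> \<one>\<^bsub>F\<^esub>) else \<one>\<^bsub>F\<^esub>)"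
    have lowD: "generate G (new_elements f {j \<in> J. fst j < n}) \<subseteq> D"
      using D(5) by (intro generate_subgroup_incl[OF _ D(1)]) (auto simp: new_elements_def)
    have u_cert: "u \<otimes>\<^bsub>F\<^esub> (\<chi> s \<ominus>\<^bsub>F\<^esub> \<one>\<^bsub>F\<^esub>) = \<one>\<^bsub>F\<^esub> \<and> u \<in> carrier F \<and> u \<noteq> \<zero>\<^bsub>F\<^esub>"
      if s: "s \<in> T" "s \<in> generate G (new_elements f {j \<in> J. fst j < n})"
    proof -
      have sD: "s \<in> D" using s lowD by blast
      then have "\<chi> s \<ominus>\<^bsub>F\<^esub> \<one>\<^bsub>F\<^esub> \<in> Units F" using \<chi>T[OF s(1) sD] \<chi>c[OF sD] by (simp add: F.field_Units)
      moreover have "u = inv\<^bsub>F\<^esub> (\<chi> s \<ominus>\<^bsub>F\<^esub> \<one>\<^bsub>F\<^esub>)" using s by (simp add: u_def)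
      ultimately show ?thesis
        using F.Units_inv_Units[of "\<chi> s \<ominus>\<^bsub>F\<^esub> \<one>\<^bsub>F\<^esub>"] F.Units_l_inv[of "\<chi> s \<ominus>\<^bsub>F\<^esub> \<one>\<^bsub>F\<^esub>"] by (simp add: F.field_Units)
    qed
    have u: "u \<in> carrier F" "u \<noteq> \<zero>\<^bsub>F\<^esub>"
    proof -
      have "u \<in> carrier F \<and> u \<noteq> \<zero>\<^bsub>F\<^esub>"
      proof (cases "s \<in> T \<and> s \<in> generate G (new_elements f {j \<in> J. fst j < n})")
        case True
        then show ?thesis using u_cert by blast
      next
        case False
        then have "u = \<one>\<^bsub>F\<^esub>" unfolding u_def by (rule if_not_P)
        then show ?thesis using F.one_not_zero by simp
      qed
      then show "u \<in> carrier F" "u \<noteq> \<zero>\<^bsub>F\<^esub>" by simp_all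
    qed
    let ?E1 = "D <#> generate G {x}"
    let ?D' = "?E1 <#> generate G {y}"
    define sol where "sol d a b = {c \<in> carrier F. c \<noteq> \<zero>\<^bsub>F\<^esub> \<and> c \<noteq> u \<and>
       \<chi> d \<otimes>\<^bsub>F\<^esub> (c [^]\<^bsub>mult_of F\<^esub> a \<otimes>\<^bsub>F\<^esub> (u \<ominus>\<^bsub>F\<^esub> c) [^]\<^bsub>mult_of F\<^esub> b) = \<one>\<^bsub>F\<^esub>}"
      for d and a b :: int
    define word where "word t d a b \<longleftrightarrow> d \<in> D \<and> (a \<noteq> 0 \<or> b \<noteq> 0) \<and> t = d \<otimes> x [^] a \<otimes> y [^] b"
      for t d and a b :: int
    \<comment> \<open>The members of \<open>T\<close> that can become trivial only through the
      choice of \<open>c\<close>: a nonzero exponent of \<open>x\<close> or \<open>y\<close> occurs.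
      Those in \<open>D\<close> already have values other than 1.\<close>
    define T1 where "T1 = {t \<in> T. \<exists>d a b. word t d a b}"
    have "\<forall>t\<in>T1. \<exists>d a b. word t d a b" by (simp add: T1_def)
    then obtain dd aa bb where rep: "\<And>t. t \<in> T1 \<Longrightarrow> word t (dd t) (aa t) (bb t)" by metis
    have "finite (sol (dd t) (aa t) (bb t))" if "t \<in> T1" for t
      unfolding sol_def using rep[OF that]
      by (intro F.finite_monomial_solutions u \<chi>c) (simp_all add: word_def)
    moreover have "finite T1" using T(1) by (simp add: T1_def)
    ultimately have fin: "finite ((\<Union>t\<in>T1. sol (dd t) (aa t) (bb t)) \<union> {\<zero>\<^bsub>F\<^esub>, u})" by simp
    have "\<not> carrier F \<subseteq> (\<Union>t\<in>T1. sol (dd t) (aa t) (bb t)) \<union> {\<zero>\<^bsub>F\<^esub>, u}"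
      using F.infinite_carrier finite_subset[OF _ fin] by blast
    then obtain c where c: "c \<in> carrier F" "c \<notin> (\<Union>t\<in>T1. sol (dd t) (aa t) (bb t)) \<union> {\<zero>\<^bsub>F\<^esub>, u}"
      by blast
    have c0: "c \<noteq> \<zero>\<^bsub>F\<^esub>" "c \<noteq> u" using c by auto
    have uc: "u \<ominus>\<^bsub>F\<^esub> c \<in> carrier F" "u \<ominus>\<^bsub>F\<^esub> c \<noteq> \<zero>\<^bsub>F\<^esub>" using c0 c u by auto
    have VEx: "new_elements f J \<subseteq> E" "new_elements f J \<subseteq> E - {x}" "insert x (new_elements f J) \<subseteq> E - {y}"
      using VE xy xney by auto
    have commx: "d \<otimes> x = x \<otimes> d" if "d \<in> D" for d
      using commE[OF _ xy(1) VEx(1)] that D(4) by blast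
    \<comment> \<open>By independence no nonzero power of \<open>x\<close> lies in \<open>D\<close>,
      so the value of \<open>x\<close> is free; the same holds for \<open>y\<close> over the group
      extended by \<open>x\<close>.\<close>
    have freshx: "k = 0" if "x [^] (k::int) \<in> D" for k
      using independent_pow_not_mem[OF E(1,2) xy(1) VEx(2) D0(1,3,4)] that D(4) by blast
    have \<chi>one: "\<chi> \<one> = \<one>\<^bsub>F\<^esub>" using PH.subgroup_hom_one[OF D(1,2)] by simp
    have agx: "\<chi> (x [^] k) = c [^]\<^bsub>mult_of F\<^esub> k" if "x [^] k \<in> D" for k :: int
      using freshx[OF that] \<chi>one by simp
    have cm: "c \<in> carrier (mult_of F)" "u \<ominus>\<^bsub>F\<^esub> c \<in> carrier (mult_of F)" using c c0 uc by auto
    obtain \<psi>1 where \<psi>1: "subgroup ?E1 G" "\<psi>1 \<in> hom (G\<lparr>carrier := ?E1\<rparr>) (mult_of F)"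
      "\<And>d. d \<in> D \<Longrightarrow> \<psi>1 d = \<chi> d" "\<psi>1 x = c" "x \<in> ?E1" "D \<subseteq> ?E1"
      using PH.extend_hom_cyclic[OF D(1,2) xyG(1) commx cm(1) agx] by blast
    have VG: "insert x (new_elements f J) \<subseteq> carrier G" using VEx(1) xyG(1) E(2) by blast
    have E1sub: "?E1 \<subseteq> D0 <#> generate G (insert x (new_elements f J))"
      by (rule set_mult_generate_insert[OF D(4) D0(1) VG])
    have commy: "d \<otimes> y = y \<otimes> d" if "d \<in> ?E1" for d
      using commE[OF _ xy(2), of d "insert x (new_elements f J)"] that E1sub VEx xy by blast
    have freshy: "k = 0" if "y [^] (k::int) \<in> ?E1" for k
      using independent_pow_not_mem[OF E(1,2) xy(2) VEx(3) D0(1,3,4)] that E1sub by blast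
    have \<psi>1one: "\<psi>1 \<one> = \<one>\<^bsub>F\<^esub>" using PH.subgroup_hom_one[OF \<psi>1(1,2)] by simp
    have agy: "\<psi>1 (y [^] k) = (u \<ominus>\<^bsub>F\<^esub> c) [^]\<^bsub>mult_of F\<^esub> k" if "y [^] k \<in> ?E1" for k :: int
      using freshy[OF that] \<psi>1one by simp
    obtain \<psi> where \<psi>: "subgroup ?D' G" "\<psi> \<in> hom (G\<lparr>carrier := ?D'\<rparr>) (mult_of F)"
      "\<And>d. d \<in> ?E1 \<Longrightarrow> \<psi> d = \<psi>1 d" "\<psi> y = u \<ominus>\<^bsub>F\<^esub> c" "y \<in> ?D'" "?E1 \<subseteq> ?D'"
      using PH.extend_hom_cyclic[OF \<psi>1(1,2) xyG(2) commy cm(2) agy] by blast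
    have \<psi>D: "\<psi> d = \<chi> d" if "d \<in> D" for d using \<psi>(3)[of d] \<psi>1(3,6) that by auto
    have DD': "D \<subseteq> ?D'" using \<psi>1(6) \<psi>(6) by blast
    have xD': "x \<in> ?D'" "\<psi> x = c" using \<psi>1(4,5) \<psi>(3,6) by auto
    have \<psi>mult: "\<psi> (a \<otimes> b) = \<psi> a \<otimes>\<^bsub>F\<^esub> \<psi> b" if "a \<in> ?D'" "b \<in> ?D'" for a b
      using \<psi>(2) that unfolding hom_restrict_carrier_iff by auto
    have V': "new_elements f (insert i J) = insert y (insert x (new_elements f J))"
      by (auto simp: new_elements_insert x_def y_def)
    have D'sub: "?D' \<subseteq> D0 <#> generate G (new_elements f (insert i J))"
      unfolding V' using VG xyG(2) by (intro set_mult_generate_insert[OF E1sub D0(1)]) simp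
    have \<psi>T: "\<psi> t \<noteq> \<one>\<^bsub>F\<^esub>" if t: "t \<in> T" "t \<in> ?D'" for t
    proof (cases "t \<in> D")
      case True
      then show ?thesis using \<psi>D \<chi>T t by simp
    next
      case tD: False
      obtain d1 g where dg: "d1 \<in> ?E1" "g \<in> generate G {y}" "t = d1 \<otimes> g" using t(2) by (auto simp: mem_set_mult)
      obtain d2 g2 where dg2: "d2 \<in> D" "g2 \<in> generate G {x}" "d1 = d2 \<otimes> g2" using dg(1) by (auto simp: mem_set_mult)
      obtain a b :: int where g: "g = y [^] b" "g2 = x [^] a"
        using dg(2) dg2(2) unfolding generate_pow[OF xyG(1)] generate_pow[OF xyG(2)] by blast
      then have td2: "t = d2 \<otimes> x [^] a \<otimes> y [^] b" using dg dg2 by simp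
      then have "a \<noteq> 0 \<or> b \<noteq> 0" using tD dg2(1) cD by auto
      then have "word t d2 a b" using td2 dg2(1) by (simp add: word_def)
      then have tT1: "t \<in> T1" using t(1) unfolding T1_def by blast
      \<comment> \<open>The representation just found is replaced by the one chosen for
        \<open>t\<close> beforehand, because \<open>c\<close> was only made to avoid the solutions
        belonging to the chosen one.\<close>
      define d a b where "d = dd t" and "a = aa t" and "b = bb t"
      have td: "d \<in> D" "t = d \<otimes> x [^] a \<otimes> y [^] b"
        using rep[OF tT1] unfolding d_def a_def b_def word_def by blast+
      have "c \<notin> sol d a b" using c(2) tT1 unfolding d_def a_def b_def by blast
      then have ne: "\<chi> d \<otimes>\<^bsub>F\<^esub> (c [^]\<^bsub>mult_of F\<^esub> a \<otimes>\<^bsub>F\<^esub> (u \<ominus>\<^bsub>F\<^esub> c) [^]\<^bsub>mult_of F\<^esub> b) \<noteq> \<one>\<^bsub>F\<^esub>"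
        using c(1) c0 by (simp add: sol_def)
      have xa: "x [^] a \<in> ?D'" "y [^] b \<in> ?D'"
        using subgroup_int_pow_closed[OF \<psi>(1) xD'(1)] subgroup_int_pow_closed[OF \<psi>(1,5)] by auto
      have dx: "d \<otimes> x [^] a \<in> ?D'" using xa(1) td(1) DD' \<psi>(1) by (simp add: subgroup.m_closed subset_iff)
      have dD': "d \<in> ?D'" using td(1) DD' by blast
      have "\<psi> t = \<psi> d \<otimes>\<^bsub>F\<^esub> \<psi> (x [^] a) \<otimes>\<^bsub>F\<^esub> \<psi> (y [^] b)"
        unfolding td(2) by (simp only: \<psi>mult[OF dx xa(2)] \<psi>mult[OF dD' xa(1)])
      also have "\<dots> = \<chi> d \<otimes>\<^bsub>F\<^esub> c [^]\<^bsub>mult_of F\<^esub> a \<otimes>\<^bsub>F\<^esub> (u \<ominus>\<^bsub>F\<^esub> c) [^]\<^bsub>mult_of F\<^esub> b"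
        using PH.subgroup_hom_int_pow[OF \<psi>(1,2) xD'(1), of a] PH.subgroup_hom_int_pow[OF \<psi>(1,2,5), of b]
        by (simp add: xD'(2) \<psi>(4) \<psi>D[OF td(1)])
      also have "\<dots> = \<chi> d \<otimes>\<^bsub>F\<^esub> (c [^]\<^bsub>mult_of F\<^esub> a \<otimes>\<^bsub>F\<^esub> (u \<ominus>\<^bsub>F\<^esub> c) [^]\<^bsub>mult_of F\<^esub> b)"
        using \<chi>c(1)[OF td(1)] PH.H.int_pow_closed[OF cm(1), of a] PH.H.int_pow_closed[OF cm(2), of b]
        by (intro F.m_assoc) auto
      finally show ?thesis using ne by simp
    qed
    \<comment> \<open>Adding \<open>i\<close>, of level \<open>n\<close>, does not change the part
      of \<open>J\<close> below any level up to \<open>n\<close>, so the earlier conditions keep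
      their meaning.\<close>
    have lower: "{j \<in> insert i J. fst j < k} = {j \<in> J. fst j < k}" if "k \<le> n" for k
      using that i by auto
    have cert: "(\<psi> (f (True, k, r)) \<oplus>\<^bsub>F\<^esub> \<psi> (f (False, k, r))) \<otimes>\<^bsub>F\<^esub> (\<psi> r \<ominus>\<^bsub>F\<^esub> \<one>\<^bsub>F\<^esub>) = \<one>\<^bsub>F\<^esub>"
      if kr: "(k, r) \<in> insert i J" "r \<in> T"
        "r \<in> generate G (new_elements f {j \<in> insert i J. fst j < k})" for k r
    proof (cases "(k, r) = i")
      case True
      then have ks: "k = n" "r = s" using i by auto
      have s: "s \<in> T" "s \<in> generate G (new_elements f {j \<in> J. fst j < n})" using kr ks lower by auto
      have "\<psi> (f (True, k, r)) \<oplus>\<^bsub>F\<^esub> \<psi> (f (False, k, r)) = u"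
        using xD'(2) \<psi>(4) c(1) u(1) F.minus_plus_minus[of c "\<zero>\<^bsub>F\<^esub>" u] uc
        by (simp add: ks x_def y_def i F.minus_zero_right F.a_comm)
      then show ?thesis using u_cert[OF s] \<psi>D[of s] lowD s ks by auto
    next
      case False
      then have krJ: "(k, r) \<in> J" using kr by simp
      then have "k \<le> n" using insert.hyps(2) i by force
      then have rg: "r \<in> generate G (new_elements f {j \<in> J. fst j < k})" using kr lower by simp
      have "generate G (new_elements f {j \<in> J. fst j < k}) \<subseteq> D"
        using D(5) by (intro generate_subgroup_incl[OF _ D(1)]) (auto simp: new_elements_def)
      then have rD: "r \<in> D" using rg by blast
      have "f (b, k, r) \<in> D" for b using krJ D(5) by (auto simp: new_elements_def)
      then show ?thesis using \<chi>J[OF krJ kr(2) rg] \<psi>D rD by simp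
    qed
    have "level_hom F f D0 \<chi>0 T (insert i J) ?D' \<psi>"
      unfolding level_hom_def
    proof (intro conjI)
      show "D0 \<subseteq> ?D'" using D(3) DD' by blast
      show "new_elements f (insert i J) \<subseteq> ?D'"
        using D(5) DD' xD'(1) \<psi>(5) by (auto simp: new_elements_insert x_def y_def)
      show "\<forall>d\<in>D0. \<psi> d = \<chi>0 d" using D(3) \<psi>D \<chi>0 by auto
      show "\<forall>t\<in>T \<inter> ?D'. \<psi> t \<noteq> \<one>\<^bsub>F\<^esub>" using \<psi>T by blast
    qed (use \<psi>(1,2) D'sub cert in auto)
    then show ?thesis by blast
  qed
qed

end

section \<open>Certificates for minimal normal subgroups\<close>

text \<open>\<open>\<Sum>i<r. (\<zeta>\<^sup>i - 1) = - r\<close> for every \<open>r\<close>-th root of unity \<open>\<zeta> \<noteq> 1\<close>.\<close>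

definition root_cert :: "('g, 'm) monoid_scheme \<Rightarrow> 'g \<Rightarrow> nat \<Rightarrow> ('g \<times> 'g) list" where
  "root_cert G m r = map (\<lambda>i. (\<one>\<^bsub>G\<^esub>, m [^]\<^bsub>G\<^esub> i)) (rev [0..<r])"

lemma ring_hom_add_pow_one:
  assumes "ring K" "ring F" "h \<in> ring_hom K F"
  shows "h (add_pow K (n::nat) \<one>\<^bsub>K\<^esub>) = add_pow F n \<one>\<^bsub>F\<^esub>"
proof -
  interpret K: ring K by fact
  interpret F: ring F by fact
  show ?thesis
    using ring_hom_zero[OF assms(3,1,2)] ring_hom_one[OF assms(3)]
    by (induction n) (simp_all add: ring_hom_add[OF assms(3)])
qed

lemma ring_hom_uminus:
  assumes "ring K" "ring F" "h \<in> ring_hom K F" "a \<in> carrier K"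
  shows "h (\<ominus>\<^bsub>K\<^esub> a) = \<ominus>\<^bsub>F\<^esub> h a"
proof -
  interpret ring_hom_ring K F h using assms by (intro ring_hom_ringI2)
  show ?thesis using assms(4) by simp
qed

lemma field_hom_nonzero:
  assumes "field K" "field F" "h \<in> ring_hom K F" "a \<in> carrier K" "a \<noteq> \<zero>\<^bsub>K\<^esub>"
  shows "h a \<noteq> \<zero>\<^bsub>F\<^esub>"
proof
  interpret K: field K by fact
  interpret F: field F by fact
  assume "h a = \<zero>\<^bsub>F\<^esub>"
  moreover have a: "a \<in> Units K" using assms(4,5) by (simp add: K.field_Units)
  then have "h (inv\<^bsub>K\<^esub> a) \<otimes>\<^bsub>F\<^esub> h a = \<one>\<^bsub>F\<^esub>"
    using ring_hom_mult[OF assms(3), of "inv\<^bsub>K\<^esub> a" a] ring_hom_one[OF assms(3)] assms(4)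
    by (simp add: K.Units_l_inv)
  ultimately show False
    using ring_hom_closed[OF assms(3) K.Units_inv_closed[OF a]] F.one_not_zero by simp
qed

locale cert_setup = group G + K: field K + F: algebraically_closed F
  for G :: "('g, 'm) monoid_scheme" (structure) and K :: "('k, 'l) ring_scheme"
    and F :: "('f, 'o) ring_scheme" and h +
  assumes h: "h \<in> ring_hom K F"
begin

sublocale partial_hom G "mult_of F"
  by (intro partial_hom.intro is_group F.mult_of_comm_group)

definition good_primes :: "nat set" where
  "good_primes = {r. Factorial_Ring.prime r \<and> r \<noteq> ring_char K}"

lemma infinite_good_primes: "infinite good_primes"
proof -
  have "good_primes = {r. Factorial_Ring.prime r} - {ring_char K}" by (auto simp: good_primes_def)
  then show ?thesis using primes_infinite by simp
qed

lemma good_prime_nonzero: "r \<in> good_primes \<Longrightarrow> add_pow K r \<one>\<^bsub>K\<^esub> \<noteq> \<zero>\<^bsub>K\<^esub>"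
  using K.prime_multiple_nonzero by (auto simp: good_primes_def)

lemma good_prime_root:
  assumes "r \<in> good_primes"
  shows "\<exists>\<zeta>\<in>carrier (mult_of F). \<zeta> \<noteq> \<one>\<^bsub>mult_of F\<^esub> \<and> \<zeta> [^]\<^bsub>mult_of F\<^esub> r = \<one>\<^bsub>mult_of F\<^esub>"
proof -
  have "h (add_pow K r \<one>\<^bsub>K\<^esub>) \<noteq> \<zero>\<^bsub>F\<^esub>"
    using good_prime_nonzero[OF assms] by (intro field_hom_nonzero[OF K.field_axioms F.field_axioms h]) simp_all
  then have "add_pow F r \<one>\<^bsub>F\<^esub> \<noteq> \<zero>\<^bsub>F\<^esub>"
    using ring_hom_add_pow_one[OF K.ring_axioms F.ring_axioms h] by simp
  then obtain \<zeta> where "\<zeta> \<in> carrier F" "\<zeta> \<noteq> \<zero>\<^bsub>F\<^esub>" "\<zeta> \<noteq> \<one>\<^bsub>F\<^esub>" "\<zeta> [^]\<^bsub>F\<^esub> r = \<one>\<^bsub>F\<^esub>"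
    using F.exists_primitive_root_of_unity assms unfolding good_primes_def by blast
  then show ?thesis by (intro bexI[of _ \<zeta>]) (auto simp: Multiplicative_Group.nat_pow_mult_of)
qed

text \<open>The first components are mere multipliers and may lie anywhere in G; it is a second
  component that is shown to act nontrivially, hence the restriction to \<open>M\<close>.\<close>

definition cert_for :: "'g set \<Rightarrow> ('g \<times> 'g) list \<times> 'k \<Rightarrow> bool" where
  "cert_for M \<kappa> \<longleftrightarrow> set (fst \<kappa>) \<subseteq> carrier G \<times> M \<and> snd \<kappa> \<in> carrier K - {\<zero>\<^bsub>K\<^esub>}"

abbreviation sat :: "'g set \<Rightarrow> ('g \<Rightarrow> 'f) \<Rightarrow> ('g \<times> 'g) list \<times> 'k \<Rightarrow> bool" where
  "sat \<equiv> satisfies G F h"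

text \<open>A satisfied certificate survives every extension of the character, which allows the
  types of minimal normal subgroups to be treated in succession.\<close>

lemma sat_mono:
  assumes "sat D \<chi> \<kappa>" "D \<subseteq> D'" "subgroup D' G" "\<chi>' \<in> hom (G\<lparr>carrier := D'\<rparr>) (mult_of F)"
    and eq: "\<And>d. d \<in> D \<Longrightarrow> \<chi>' d = \<chi> d"
  shows "sat D' \<chi>' \<kappa>"
proof -
  have "cert_sum F \<chi>' l = cert_sum F \<chi> l" if "set l \<subseteq> D \<times> D" for l
    using that
  proof (induction l)
    case (Cons gm l)
    then show ?case using eq by (cases gm) auto
  qed simp
  then show ?thesis using assms(1-4) by (auto simp: satisfies_def)
qed

definition root_certificate where
  "root_certificate m r = (root_cert G m r, \<ominus>\<^bsub>K\<^esub> add_pow K r \<one>\<^bsub>K\<^esub>)"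

lemma cert_for_root_certificate:
  assumes "subgroup M G" "m \<in> M" "r \<in> good_primes"
  shows "cert_for M (root_certificate m r)"
proof -
  have "m [^] (i::nat) \<in> M" for i
    using subgroup_int_pow_closed[OF assms(1,2), of "int i"] by (simp add: int_pow_int)
  moreover have "\<ominus>\<^bsub>K\<^esub> add_pow K r \<one>\<^bsub>K\<^esub> \<noteq> \<zero>\<^bsub>K\<^esub>"
  proof
    assume "\<ominus>\<^bsub>K\<^esub> add_pow K r \<one>\<^bsub>K\<^esub> = \<zero>\<^bsub>K\<^esub>"
    then have "add_pow K r \<one>\<^bsub>K\<^esub> \<oplus>\<^bsub>K\<^esub> \<ominus>\<^bsub>K\<^esub> add_pow K r \<one>\<^bsub>K\<^esub> = add_pow K r \<one>\<^bsub>K\<^esub>" by simp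
    then show False using good_prime_nonzero[OF assms(3)] by (simp add: K.r_neg)
  qed
  ultimately show ?thesis by (auto simp: cert_for_def root_certificate_def root_cert_def)
qed

lemma sat_root_certificate:
  assumes D: "subgroup D G" "\<chi> \<in> hom (G\<lparr>carrier := D\<rparr>) (mult_of F)"
    and m: "m \<in> D" "\<chi> m \<noteq> \<one>\<^bsub>F\<^esub>" "\<chi> m [^]\<^bsub>mult_of F\<^esub> r = \<one>\<^bsub>F\<^esub>"
  shows "sat D \<chi> (root_certificate m r)"
proof -
  define \<zeta> where "\<zeta> = \<chi> m"
  have \<zeta>: "\<zeta> \<in> carrier F" "\<zeta> \<noteq> \<one>\<^bsub>F\<^esub>" "\<zeta> [^]\<^bsub>F\<^esub> r = \<one>\<^bsub>F\<^esub>"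
    using m D(2) unfolding \<zeta>_def hom_restrict_carrier_iff by (auto simp: Multiplicative_Group.nat_pow_mult_of)
  have \<chi>pow: "\<chi> (m [^] (i::nat)) = \<zeta> [^]\<^bsub>F\<^esub> i" for i
    using subgroup_hom_pow[OF D m(1), of i] by (simp add: \<zeta>_def Multiplicative_Group.nat_pow_mult_of)
  have \<chi>1: "\<chi> \<one> = \<one>\<^bsub>F\<^esub>" using subgroup_hom_one[OF D] by simp
  define S where "S n = cert_sum F \<chi> (root_cert G m n)" for n
  \<comment> \<open>The reversal in \<open>root_cert\<close> puts the highest exponent at the head,
    so the recursion of \<open>cert_sum\<close> is the step from \<open>n\<close> to
    \<open>Suc n\<close>.\<close>
  have S_Suc: "S (Suc n) = (\<zeta> [^]\<^bsub>F\<^esub> n \<ominus>\<^bsub>F\<^esub> \<one>\<^bsub>F\<^esub>) \<oplus>\<^bsub>F\<^esub> S n" for n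
    using \<zeta>(1) by (simp add: S_def root_cert_def \<chi>pow \<chi>1)
  have S_0: "S 0 = \<zero>\<^bsub>F\<^esub>" by (simp add: S_def root_cert_def)
  have SF: "S n \<in> carrier F" for n
    using \<zeta>(1) by (induction n) (simp_all add: S_0 S_Suc)
  \<comment> \<open>Adding \<open>n\<close> turns the sum of the terms \<open>\<zeta>^i - 1\<close>
    into a geometric sum. At \<open>n = r\<close> the right side is zero, and the factor
    \<open>\<zeta> - 1\<close> can be cancelled.\<close>
  have tel: "(\<zeta> \<ominus>\<^bsub>F\<^esub> \<one>\<^bsub>F\<^esub>) \<otimes>\<^bsub>F\<^esub> (S n \<oplus>\<^bsub>F\<^esub> add_pow F n \<one>\<^bsub>F\<^esub>) = \<zeta> [^]\<^bsub>F\<^esub> n \<ominus>\<^bsub>F\<^esub> \<one>\<^bsub>F\<^esub>" for n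
  proof (induction n)
    case 0
    then show ?case using \<zeta>(1) by (simp add: S_0 a_minus_def F.r_neg)
  next
    case (Suc n)
    define Z N where "Z = \<zeta> [^]\<^bsub>F\<^esub> n" and "N = add_pow F n \<one>\<^bsub>F\<^esub>"
    have ZN: "Z \<in> carrier F" "N \<in> carrier F" using \<zeta>(1) by (simp_all add: Z_def N_def)
    have "S (Suc n) \<oplus>\<^bsub>F\<^esub> add_pow F (Suc n) \<one>\<^bsub>F\<^esub> = ((Z \<ominus>\<^bsub>F\<^esub> \<one>\<^bsub>F\<^esub>) \<oplus>\<^bsub>F\<^esub> S n) \<oplus>\<^bsub>F\<^esub> (N \<oplus>\<^bsub>F\<^esub> \<one>\<^bsub>F\<^esub>)"
      by (simp add: S_Suc Z_def N_def)
    also have "\<dots> = Z \<oplus>\<^bsub>F\<^esub> (S n \<oplus>\<^bsub>F\<^esub> N)"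
    proof -
      have "(Z \<ominus>\<^bsub>F\<^esub> \<one>\<^bsub>F\<^esub>) \<oplus>\<^bsub>F\<^esub> S n \<oplus>\<^bsub>F\<^esub> (N \<oplus>\<^bsub>F\<^esub> \<one>\<^bsub>F\<^esub>)
        = (Z \<ominus>\<^bsub>F\<^esub> \<one>\<^bsub>F\<^esub>) \<oplus>\<^bsub>F\<^esub> (\<one>\<^bsub>F\<^esub> \<ominus>\<^bsub>F\<^esub> \<zero>\<^bsub>F\<^esub>) \<oplus>\<^bsub>F\<^esub> (S n \<oplus>\<^bsub>F\<^esub> N)"
        using ZN SF[of n] by (simp add: F.minus_zero_right F.a_ac)
      also have "(Z \<ominus>\<^bsub>F\<^esub> \<one>\<^bsub>F\<^esub>) \<oplus>\<^bsub>F\<^esub> (\<one>\<^bsub>F\<^esub> \<ominus>\<^bsub>F\<^esub> \<zero>\<^bsub>F\<^esub>) = Z"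
        using ZN F.minus_plus_minus[of "\<one>\<^bsub>F\<^esub>" "\<zero>\<^bsub>F\<^esub>" Z] by (simp add: F.minus_zero_right)
      finally show ?thesis .
    qed
    finally have "(\<zeta> \<ominus>\<^bsub>F\<^esub> \<one>\<^bsub>F\<^esub>) \<otimes>\<^bsub>F\<^esub> (S (Suc n) \<oplus>\<^bsub>F\<^esub> add_pow F (Suc n) \<one>\<^bsub>F\<^esub>)
      = (\<zeta> \<ominus>\<^bsub>F\<^esub> \<one>\<^bsub>F\<^esub>) \<otimes>\<^bsub>F\<^esub> Z \<oplus>\<^bsub>F\<^esub> (\<zeta> \<ominus>\<^bsub>F\<^esub> \<one>\<^bsub>F\<^esub>) \<otimes>\<^bsub>F\<^esub> (S n \<oplus>\<^bsub>F\<^esub> N)"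
      using \<zeta>(1) ZN SF[of n] by (simp add: F.r_distr)
    also have "(\<zeta> \<ominus>\<^bsub>F\<^esub> \<one>\<^bsub>F\<^esub>) \<otimes>\<^bsub>F\<^esub> (S n \<oplus>\<^bsub>F\<^esub> N) = Z \<ominus>\<^bsub>F\<^esub> \<one>\<^bsub>F\<^esub>" using Suc by (simp add: Z_def N_def)
    also have "(\<zeta> \<ominus>\<^bsub>F\<^esub> \<one>\<^bsub>F\<^esub>) \<otimes>\<^bsub>F\<^esub> Z \<oplus>\<^bsub>F\<^esub> (Z \<ominus>\<^bsub>F\<^esub> \<one>\<^bsub>F\<^esub>) = Z \<otimes>\<^bsub>F\<^esub> \<zeta> \<ominus>\<^bsub>F\<^esub> \<one>\<^bsub>F\<^esub>"
    proof -
      have "(\<zeta> \<ominus>\<^bsub>F\<^esub> \<one>\<^bsub>F\<^esub>) \<otimes>\<^bsub>F\<^esub> Z = Z \<otimes>\<^bsub>F\<^esub> \<zeta> \<ominus>\<^bsub>F\<^esub> Z"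
        using \<zeta>(1) ZN by (simp add: a_minus_def F.r_distr F.r_minus F.m_comm[of _ Z] F.m_comm[of "\<zeta> \<oplus>\<^bsub>F\<^esub> \<ominus>\<^bsub>F\<^esub> \<one>\<^bsub>F\<^esub>" Z])
      then show ?thesis using \<zeta>(1) ZN by (simp add: F.minus_plus_minus)
    qed
    finally show ?case by (simp add: Z_def)
  qed
  have "(\<zeta> \<ominus>\<^bsub>F\<^esub> \<one>\<^bsub>F\<^esub>) \<otimes>\<^bsub>F\<^esub> (S r \<oplus>\<^bsub>F\<^esub> add_pow F r \<one>\<^bsub>F\<^esub>) = \<zero>\<^bsub>F\<^esub>"
    using tel[of r] \<zeta> by simp
  then have "S r \<oplus>\<^bsub>F\<^esub> add_pow F r \<one>\<^bsub>F\<^esub> = \<zero>\<^bsub>F\<^esub>"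
    using \<zeta> SF[of r] by (simp add: F.integral_iff)
  then have "S r = \<ominus>\<^bsub>F\<^esub> add_pow F r \<one>\<^bsub>F\<^esub>" using SF[of r] by (simp add: F.minus_equality)
  also have "\<dots> = h (\<ominus>\<^bsub>K\<^esub> add_pow K r \<one>\<^bsub>K\<^esub>)"
    using ring_hom_uminus[OF K.ring_axioms F.ring_axioms h] ring_hom_add_pow_one[OF K.ring_axioms F.ring_axioms h]
    by simp
  finally have "cert_sum F \<chi> (root_cert G m r) = h (\<ominus>\<^bsub>K\<^esub> add_pow K r \<one>\<^bsub>K\<^esub>)" by (simp add: S_def)
  moreover have "set (root_cert G m r) \<subseteq> D \<times> D"
    using subgroup_int_pow_closed[OF D(1) m(1)] subgroup.one_closed[OF D(1)]
    by (auto simp: root_cert_def simp flip: int_pow_int)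
  ultimately show ?thesis using D by (simp add: satisfies_def root_certificate_def)
qed

definition unit_certificate where
  "unit_certificate x y s = ([(x, s), (y, s)], \<one>\<^bsub>K\<^esub>)"

lemma sat_unit_certificate:
  assumes D: "subgroup D G" "\<chi> \<in> hom (G\<lparr>carrier := D\<rparr>) (mult_of F)"
    and "x \<in> D" "y \<in> D" "s \<in> D" "(\<chi> x \<oplus>\<^bsub>F\<^esub> \<chi> y) \<otimes>\<^bsub>F\<^esub> (\<chi> s \<ominus>\<^bsub>F\<^esub> \<one>\<^bsub>F\<^esub>) = \<one>\<^bsub>F\<^esub>"
  shows "sat D \<chi> (unit_certificate x y s)"
proof -
  have "\<chi> d \<in> carrier F" if "d \<in> D" for d using D(2) that unfolding hom_restrict_carrier_iff by auto
  then show ?thesis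
    using assms ring_hom_one[OF h] by (simp add: satisfies_def unit_certificate_def F.l_distr)
qed

text \<open>The certificates are chosen before the finite set \<open>S\<close> and before the
  character to be extended. The bound on \<open>D\<close> is recorded so that the new domain still
  commutes with the nonabelian minimal normal subgroups.\<close>

lemma exists_abelian_minimals_certs:
  obtains \<kappa> where "\<And>M. M \<in> abelian_minimals G \<Longrightarrow> cert_for M (\<kappa> M)"
    "\<And>S D0 \<chi>0. finite S \<Longrightarrow> S \<subseteq> abelian_minimals G \<Longrightarrow> subgroup D0 G \<Longrightarrow>
      \<chi>0 \<in> hom (G\<lparr>carrier := D0\<rparr>) (mult_of F) \<Longrightarrow> (\<And>d. d \<in> D0 \<Longrightarrow> \<exists>n::nat. n > 0 \<and> d [^] n = \<one>) \<Longrightarrow>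
      (\<And>d x. d \<in> D0 \<Longrightarrow> x \<in> generate G (\<Union>(abelian_minimals G)) \<Longrightarrow> d \<otimes> x = x \<otimes> d) \<Longrightarrow>
      \<exists>D \<chi>. subgroup D G \<and> \<chi> \<in> hom (G\<lparr>carrier := D\<rparr>) (mult_of F) \<and> D0 \<subseteq> D \<and>
        D \<subseteq> D0 <#> generate G (\<Union>(abelian_minimals G)) \<and> (\<forall>d\<in>D0. \<chi> d = \<chi>0 d) \<and> (\<forall>M\<in>S. sat D \<chi> (\<kappa> M))"
proof -
  let ?U = "\<Union>(abelian_minimals G)"
  have UG: "?U \<subseteq> carrier G" using abelian_minimals_normal normal_subset_carrier by blast
  have Ucomm: "a \<otimes> b = b \<otimes> a" if "a \<in> ?U" "b \<in> ?U" for a b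
    using that abelian_minimals_commute by blast
  have tf: "x [^] (n::nat) \<noteq> \<one>" if "M \<in> abelian_minimals G" "x \<in> M" "x \<noteq> \<one>" "n > 0" for M x n
    using that by (auto simp: abelian_minimals_def torsion_free_def)
  have nontriv: "\<exists>b\<in>M. b \<noteq> \<one>" if "M \<in> abelian_minimals G" for M
    using that normal_one_mem[OF abelian_minimals_normal[OF that]]
    by (auto simp: abelian_minimals_def minimal_normal_def)
  obtain E where E: "E \<subseteq> ?U" "independent E" "\<And>b. b \<in> ?U \<Longrightarrow> \<exists>n::nat. n > 0 \<and> b [^] n \<in> generate G E"
    using exists_maximal_independent[OF UG Ucomm] by blast
  have EG: "E \<subseteq> carrier G" using E(1) UG by blast
  have meet: "\<exists>s\<in>M. s \<in> generate G E \<and> s \<noteq> \<one>" if M: "M \<in> abelian_minimals G" for M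
  proof -
    obtain b where b: "b \<in> M" "b \<noteq> \<one>" using nontriv[OF M] by blast
    then obtain n :: nat where n: "n > 0" "b [^] n \<in> generate G E" using E(3)[of b] M by blast
    have "b [^] int n \<in> M"
      by (rule subgroup_int_pow_closed[OF normal_imp_subgroup[OF abelian_minimals_normal[OF M]] b(1)])
    then show ?thesis using n tf[OF M b n(1)] by (auto simp: int_pow_int)
  qed
  show thesis
  proof (cases "finite E")
    case True
    have "\<forall>e\<in>E. \<exists>M. M \<in> abelian_minimals G \<and> e \<in> M" using E(1) by blast
    then obtain Me where Me: "\<And>e. e \<in> E \<Longrightarrow> Me e \<in> abelian_minimals G \<and> e \<in> Me e" by metis
    define \<F> where "\<F> = Me ` E"
    have \<F>: "finite \<F>" "\<F> \<subseteq> abelian_minimals G" using True Me by (auto simp: \<F>_def)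
    have P: "generate G (\<Union>\<F>) \<lhd> G" using \<F>(2) abelian_minimals_normal by (intro generate_Union_normal) blast
    have "E \<subseteq> \<Union>\<F>" using Me by (auto simp: \<F>_def)
    then have EP: "generate G E \<subseteq> generate G (\<Union>\<F>)" by (rule mono_generate)
    \<comment> \<open>Every \<open>M\<close> has a nontrivial element in the span of the finite set
      \<open>E\<close>, hence meets the product of the finitely many members of \<open>\<F>\<close>
      and lies in it by minimality. One character of that product serves all
      \<open>M\<close>.\<close>
    have MP: "M \<subseteq> generate G (\<Union>\<F>)" if M: "M \<in> abelian_minimals G" for M
    proof -
      obtain s where "s \<in> M" "s \<in> generate G E" "s \<noteq> \<one>" using meet[OF M] by blast
      then have "M \<inter> generate G (\<Union>\<F>) \<noteq> {\<one>}" using EP by blast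
      moreover have "minimal_normal G M" using M by (simp add: abelian_minimals_def)
      ultimately show ?thesis using minimal_normal_Int P by blast
    qed
    obtain R B \<beta> where "torsion_hom good_primes \<F> R B \<beta>"
      using finite_torsion_free_hom[OF \<F> infinite_good_primes _ good_prime_root]
      unfolding good_primes_def by blast
    then have B: "subgroup B G" "B \<subseteq> generate G (\<Union>\<F>)" "\<beta> \<in> hom (G\<lparr>carrier := B\<rparr>) (mult_of F)"
      and B4: "\<forall>M\<in>abelian_minimals G. M \<subseteq> generate G (\<Union>\<F>) \<longrightarrow>
        (\<exists>m\<in>M \<inter> B. \<exists>r\<in>good_primes. \<beta> m \<noteq> \<one>\<^bsub>mult_of F\<^esub> \<and> \<beta> m [^]\<^bsub>mult_of F\<^esub> r = \<one>\<^bsub>mult_of F\<^esub>)"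
      unfolding torsion_hom_def by simp_all
    have "\<forall>M\<in>abelian_minimals G. \<exists>mr. fst mr \<in> M \<and> fst mr \<in> B \<and> snd mr \<in> good_primes \<and>
        \<beta> (fst mr) \<noteq> \<one>\<^bsub>F\<^esub> \<and> \<beta> (fst mr) [^]\<^bsub>mult_of F\<^esub> snd mr = \<one>\<^bsub>F\<^esub>"
    proof
      fix M assume "M \<in> abelian_minimals G"
      then obtain m r where "m \<in> M \<inter> B" "r \<in> good_primes" "\<beta> m \<noteq> \<one>\<^bsub>mult_of F\<^esub>"
        "\<beta> m [^]\<^bsub>mult_of F\<^esub> r = \<one>\<^bsub>mult_of F\<^esub>"
        using B4 MP by meson
      then show "\<exists>mr. fst mr \<in> M \<and> fst mr \<in> B \<and> snd mr \<in> good_primes \<and>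
        \<beta> (fst mr) \<noteq> \<one>\<^bsub>F\<^esub> \<and> \<beta> (fst mr) [^]\<^bsub>mult_of F\<^esub> snd mr = \<one>\<^bsub>F\<^esub>"
        by (intro exI[of _ "(m, r)"]) simp
    qed
    then obtain mr where "\<forall>M\<in>abelian_minimals G. fst (mr M) \<in> M \<and> fst (mr M) \<in> B \<and> snd (mr M) \<in> good_primes \<and>
        \<beta> (fst (mr M)) \<noteq> \<one>\<^bsub>F\<^esub> \<and> \<beta> (fst (mr M)) [^]\<^bsub>mult_of F\<^esub> snd (mr M) = \<one>\<^bsub>F\<^esub>"
      unfolding bchoice_iff by (rule exE)
    moreover define mm rr where "mm M = fst (mr M)" and "rr M = snd (mr M)" for M
    ultimately have mr: "mm M \<in> M \<and> mm M \<in> B \<and> rr M \<in> good_primes \<and>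
        \<beta> (mm M) \<noteq> \<one>\<^bsub>F\<^esub> \<and> \<beta> (mm M) [^]\<^bsub>mult_of F\<^esub> rr M = \<one>\<^bsub>F\<^esub>" if "M \<in> abelian_minimals G" for M
      using that by simp
    have PU: "generate G (\<Union>\<F>) \<subseteq> generate G ?U" using \<F>(2) by (intro mono_generate) blast
    have Ptf: "torsion_free G (generate G (\<Union>\<F>))" by (rule abelian_minimals_generate_torsion_free[OF \<F>])
    show thesis
    proof (rule that[of "\<lambda>M. root_certificate (mm M) (rr M)"])
      show "cert_for M (root_certificate (mm M) (rr M))" if "M \<in> abelian_minimals G" for M
        using mr[OF that] by (intro cert_for_root_certificate normal_imp_subgroup abelian_minimals_normal that) auto
      fix S D0 \<chi>0
      assume S: "finite S" "S \<subseteq> abelian_minimals G" and D0: "subgroup D0 G"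
        "\<chi>0 \<in> hom (G\<lparr>carrier := D0\<rparr>) (mult_of F)"
        and tors: "\<And>d. d \<in> D0 \<Longrightarrow> \<exists>n::nat. n > 0 \<and> d [^] n = \<one>"
        and comm: "\<And>d x. d \<in> D0 \<Longrightarrow> x \<in> generate G ?U \<Longrightarrow> d \<otimes> x = x \<otimes> d"
      have c: "d \<otimes> x = x \<otimes> d" if "d \<in> D0" "x \<in> B" for d x using comm that B(2) PU by blast
      have "d = \<one>" if "d \<in> D0" "d \<in> B" for d
        using tors[OF that(1)] that(2) B(2) Ptf unfolding torsion_free_def by blast
      then have ag: "\<chi>0 d = \<beta> d" if "d \<in> D0" "d \<in> B" for d
        using that subgroup_hom_one[OF D0] subgroup_hom_one[OF B(1,3)] by metis
      obtain \<psi> where \<psi>: "subgroup (D0 <#> B) G" "\<psi> \<in> hom (G\<lparr>carrier := D0 <#> B\<rparr>) (mult_of F)"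
        "\<And>d. d \<in> D0 \<Longrightarrow> \<psi> d = \<chi>0 d" "\<And>d. d \<in> B \<Longrightarrow> \<psi> d = \<beta> d"
        using extend_hom_product[OF D0 B(1,3) c ag] by blast
      note sub = subset_set_mult[OF D0(1) B(1)]
      have "sat (D0 <#> B) \<psi> (root_certificate (mm M) (rr M))" if "M \<in> S" for M
      proof -
        have "M \<in> abelian_minimals G" using S(2) that by blast
        note m = mr[OF this]
        show ?thesis using m sub(2) \<psi>(4)[of "mm M"] by (intro sat_root_certificate[OF \<psi>(1,2)]) auto
      qed
      moreover have "D0 <#> B \<subseteq> D0 <#> generate G ?U" using B(2) PU by (intro mono_set_mult) auto
      ultimately show "\<exists>D \<chi>. subgroup D G \<and> \<chi> \<in> hom (G\<lparr>carrier := D\<rparr>) (mult_of F) \<and> D0 \<subseteq> D \<and>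
        D \<subseteq> D0 <#> generate G ?U \<and> (\<forall>d\<in>D0. \<chi> d = \<chi>0 d) \<and>
        (\<forall>M\<in>S. sat D \<chi> (root_certificate (mm M) (rr M)))"
        using \<psi> sub(1) by (intro exI[of _ "D0 <#> B"] exI[of _ \<psi>]) simp
    qed
  next
    case inf: False
    define I where "I = (UNIV :: nat set) \<times> generate G E"
    \<comment> \<open>Injectivity keeps the reserved pairs independent of one another. Surjectivity
      gives every basis element a level, so that each word in the basis has one.\<close>
    have "\<exists>f. bij_betw f ((UNIV :: bool set) \<times> I) E"
    proof -
      have EL: "E \<subseteq> generate G E" by (auto intro: generate.incl)
      have "generate G E \<times> (UNIV :: nat set) \<lesssim> generate G E"
        using inf EL finite_subset by (intro infinite_times_nat_lepoll) blast
      moreover have 1: "(UNIV :: bool set) \<times> I \<lesssim> (generate G E \<times> (UNIV :: nat set)) \<times> (UNIV :: nat set)"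
        unfolding lepoll_def
        by (intro exI[of _ "\<lambda>(b, n, s). ((s, n), if b then 1 else 0)"] conjI inj_onI)
          (auto simp: I_def split: if_splits)
      moreover have 2: "(generate G E \<times> (UNIV :: nat set)) \<times> (UNIV :: nat set) \<lesssim> generate G E \<times> (UNIV :: nat set)"
        using inf EL finite_subset finite_cartesian_productD1[of "generate G E" "UNIV :: nat set"]
        by (intro infinite_times_nat_lepoll) blast
      moreover have 3: "generate G E \<lesssim> E" by (rule generate_lepoll[OF inf EG])
      ultimately have "(UNIV :: bool set) \<times> I \<lesssim> E" by (meson lepoll_trans)
      moreover have "E \<lesssim> (UNIV :: bool set) \<times> I"
        unfolding lepoll_def using EL
        by (intro exI[of _ "\<lambda>e. (True, 0, e)"] conjI inj_onI) (auto simp: I_def)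
      ultimately show ?thesis using lepoll_antisym unfolding eqpoll_def by blast
    qed
    then obtain f where f: "bij_betw f ((UNIV :: bool set) \<times> I) E" by blast
    have fi: "inj_on f (UNIV \<times> I)" "f ` (UNIV \<times> I) = E" using f by (auto simp: bij_betw_def)
    \<comment> \<open>A word uses finitely many reserved elements, so some \<open>n\<close> exceeds
      all their levels. The pair attached to \<open>(n, s)\<close> is then valued after
      \<open>s\<close>.\<close>
    have level: "\<exists>J n. finite J \<and> J \<subseteq> I \<and> (\<forall>j\<in>J. fst j < n) \<and> s \<in> generate G (new_elements f J)"
      if s: "s \<in> generate G E" for s
    proof -
      obtain T where T: "finite T" "T \<subseteq> f ` (UNIV \<times> I)" "s \<in> generate G T"
        using generate_finite_support[OF s] fi(2) by auto
      obtain A where A: "A \<subseteq> UNIV \<times> I" "finite A" "T = f ` A" using finite_subset_image[OF T(1,2)] by blast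
      define J where "J = snd ` A"
      have "T \<subseteq> new_elements f J" using A(3) unfolding new_elements_def J_def by force
      then have "s \<in> generate G (new_elements f J)" using T(3) mono_generate by blast
      moreover have "finite J" "J \<subseteq> I" using A by (auto simp: J_def)
      moreover have "fst j < Suc (Max (fst ` J))" if "j \<in> J" for j
        using that \<open>finite J\<close> by (simp add: less_Suc_eq_le)
      ultimately show ?thesis by blast
    qed
    have "\<forall>M\<in>abelian_minimals G. \<exists>s J n. s \<in> M \<and> s \<noteq> \<one> \<and> s \<in> generate G E \<and> finite J \<and> J \<subseteq> I \<and>
      (\<forall>j\<in>J. fst j < n) \<and> s \<in> generate G (new_elements f J)"
      using meet level by meson
    then obtain ss JJ nn where ch: "\<And>M. M \<in> abelian_minimals G \<Longrightarrow> ss M \<in> M \<and> ss M \<noteq> \<one> \<and> ss M \<in> generate G E \<and>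
      finite (JJ M) \<and> JJ M \<subseteq> I \<and> (\<forall>j\<in>JJ M. fst j < nn M) \<and> ss M \<in> generate G (new_elements f (JJ M))"
      unfolding bchoice_iff by blast
    define \<kappa> where "\<kappa> M = unit_certificate (f (True, nn M, ss M)) (f (False, nn M, ss M)) (ss M)" for M
    have idx: "(nn M, ss M) \<in> I" if "M \<in> abelian_minimals G" for M using ch[OF that] by (simp add: I_def)
    have fE: "f (b, i) \<in> E" if "i \<in> I" for b i using fi(2) that by blast
    show thesis
    proof (rule that[of \<kappa>])
      show "cert_for M (\<kappa> M)" if M: "M \<in> abelian_minimals G" for M
        using fE[OF idx[OF M]] EG ch[OF M] by (auto simp: cert_for_def \<kappa>_def unit_certificate_def)
      fix S D0 \<chi>0
      assume S: "finite S" "S \<subseteq> abelian_minimals G" and D0: "subgroup D0 G"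
        "\<chi>0 \<in> hom (G\<lparr>carrier := D0\<rparr>) (mult_of F)"
        and tors: "\<And>d. d \<in> D0 \<Longrightarrow> \<exists>n::nat. n > 0 \<and> d [^] n = \<one>"
        and comm: "\<And>d x. d \<in> D0 \<Longrightarrow> x \<in> generate G ?U \<Longrightarrow> d \<otimes> x = x \<otimes> d"
      have EU: "x \<in> generate G ?U" if "x \<in> E" for x using that E(1) by (auto intro: generate.incl)
      define T where "T = ss ` S"
      \<comment> \<open>Besides the indices of the certificates, \<open>J\<close> contains the
        indices of all basis elements in the words \<open>ss M\<close>. Only then is each
        \<open>ss M\<close> a word in lower levels of \<open>J\<close>, as the condition in
        \<open>level_hom\<close> demands.\<close>
      define J where "J = (\<Union>M\<in>S. insert (nn M, ss M) (JJ M))"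
      have T: "finite T" using S(1) by (simp add: T_def)
      have Ttf: "t [^] (n::nat) \<noteq> \<one>" if "t \<in> T" "n > 0" for t n
        using that S(2) tf ch unfolding T_def by blast
      have J: "finite J" "J \<subseteq> I" using S ch idx unfolding J_def by blast+
      have Ec: "a \<otimes> b = b \<otimes> a" if "a \<in> E" "b \<in> E" for a b using that Ucomm E(1) by blast
      have fsub: "f ` (UNIV \<times> I) \<subseteq> E" using fi(2) by simp
      obtain D \<chi> where lh: "level_hom F f D0 \<chi>0 T J D \<chi>"
        using exists_level_hom[OF F.algebraically_closed_axioms E(2) EG Ec fi(1) fsub D0 tors comm[OF _ EU] T Ttf J]
        by blast
      then have D: "subgroup D G" "\<chi> \<in> hom (G\<lparr>carrier := D\<rparr>) (mult_of F)"
        "D0 \<subseteq> D" "D \<subseteq> D0 <#> generate G (new_elements f J)" "new_elements f J \<subseteq> D"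
        "\<forall>d\<in>D0. \<chi> d = \<chi>0 d"
        and cert: "\<And>n s. (n, s) \<in> J \<Longrightarrow> s \<in> T \<Longrightarrow> s \<in> generate G (new_elements f {j \<in> J. fst j < n}) \<Longrightarrow>
         (\<chi> (f (True, n, s)) \<oplus>\<^bsub>F\<^esub> \<chi> (f (False, n, s))) \<otimes>\<^bsub>F\<^esub> (\<chi> s \<ominus>\<^bsub>F\<^esub> \<one>\<^bsub>F\<^esub>) = \<one>\<^bsub>F\<^esub>"
        unfolding level_hom_def by auto
      have "sat D \<chi> (\<kappa> M)" if M: "M \<in> S" for M
        unfolding \<kappa>_def
      proof (rule sat_unit_certificate[OF D(1,2)])
        have MA: "M \<in> abelian_minimals G" using M S(2) by blast
        note m = ch[OF MA]
        have iJ: "(nn M, ss M) \<in> J" using M by (auto simp: J_def)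
        show "f (True, nn M, ss M) \<in> D" "f (False, nn M, ss M) \<in> D"
          using D(5) iJ by (auto simp: new_elements_def)
        have "new_elements f (JJ M) \<subseteq> new_elements f {j \<in> J. fst j < nn M}"
          using m M unfolding new_elements_def J_def by blast
        then have sg: "ss M \<in> generate G (new_elements f {j \<in> J. fst j < nn M})"
          using m mono_generate by blast
        then show "(\<chi> (f (True, nn M, ss M)) \<oplus>\<^bsub>F\<^esub> \<chi> (f (False, nn M, ss M))) \<otimes>\<^bsub>F\<^esub>
            (\<chi> (ss M) \<ominus>\<^bsub>F\<^esub> \<one>\<^bsub>F\<^esub>) = \<one>\<^bsub>F\<^esub>"
          using M by (intro cert[OF iJ]) (auto simp: T_def)
        have "generate G (new_elements f {j \<in> J. fst j < nn M}) \<subseteq> D"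
          using D(5) by (intro generate_subgroup_incl[OF _ D(1)]) (auto simp: new_elements_def)
        then show "ss M \<in> D" using sg by blast
      qed
      moreover have "D \<subseteq> D0 <#> generate G ?U"
      proof -
        have "new_elements f J \<subseteq> f ` (UNIV \<times> I)" unfolding new_elements_def
          by (intro image_mono Sigma_mono J(2) order_refl)
        then have "new_elements f J \<subseteq> ?U" by (rule order_trans[OF _ order_trans[OF fsub E(1)]])
        then have "D0 <#> generate G (new_elements f J) \<subseteq> D0 <#> generate G ?U"
          by (intro mono_set_mult mono_generate) auto
        then show ?thesis using D(4) by blast
      qed
      ultimately show "\<exists>D \<chi>. subgroup D G \<and> \<chi> \<in> hom (G\<lparr>carrier := D\<rparr>) (mult_of F) \<and> D0 \<subseteq> D \<and>
        D \<subseteq> D0 <#> generate G ?U \<and> (\<forall>d\<in>D0. \<chi> d = \<chi>0 d) \<and> (\<forall>M\<in>S. sat D \<chi> (\<kappa> M))"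
        using D(1-3,6) by (intro exI[of _ D] exI[of _ \<chi>]) simp
    qed
  qed
qed

end

section \<open>Classification of minimal normal subgroups and assembly of the characters\<close>

context group begin

text \<open>The torsion elements of an abelian normal subgroup form a normal subgroup of G, so by
  minimality they are trivial or everything.\<close>

lemma minimal_normal_cases:
  assumes M: "minimal_normal G M" and comm: "\<And>x y. x \<in> M \<Longrightarrow> y \<in> M \<Longrightarrow> x \<otimes> y = y \<otimes> x"
  shows "torsion_abelian (G\<lparr>carrier := M\<rparr>) \<or> M \<in> abelian_minimals G"
proof -
  note sM = normal_imp_subgroup[OF minimal_normal_normal[OF M]]
  note cM = subgroup.mem_carrier[OF sM]
  define N where "N = {z \<in> M. \<exists>n::nat. n > 0 \<and> z [^] n = \<one>}"
  have "N \<lhd> G"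
  proof (rule normal_invI)
    show "subgroup N G"
    proof
      show "inv a \<in> N" if "a \<in> N" for a
        using that cM sM by (auto simp: N_def nat_pow_inv subgroup.m_inv_closed)
      show "a \<otimes> b \<in> N" if ab: "a \<in> N" "b \<in> N" for a b
      proof -
        obtain n m :: nat where nm: "n > 0" "a [^] n = \<one>" "m > 0" "b [^] m = \<one>"
          using ab by (auto simp: N_def)
        have M': "a \<in> M" "b \<in> M" using ab by (auto simp: N_def)
        have "(a \<otimes> b) [^] (n * m) = (a [^] n) [^] m \<otimes> (b [^] m) [^] n"
          using cM[OF M'(1)] cM[OF M'(2)] pow_mult_distrib[OF comm[OF M'], of "n * m"]
          by (simp add: nat_pow_pow mult.commute[of m n])
        then show ?thesis using nm subgroup.m_closed[OF sM M'] by (auto simp: N_def intro!: exI[of _ "n * m"])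
      qed
    qed (use cM sM in \<open>auto simp: N_def subgroup.one_closed\<close>)
    show "g \<otimes> h \<otimes> inv g \<in> N" if g: "g \<in> carrier G" and h: "h \<in> N" for g h
      using g h cM normal_conj_closed[OF minimal_normal_normal[OF M]] by (auto simp: N_def nat_pow_conj)
  qed
  moreover have "N \<subseteq> M" by (auto simp: N_def)
  ultimately have "N = {\<one>} \<or> N = M" using M unfolding minimal_normal_def by blast
  then show ?thesis
  proof
    assume N1: "N = {\<one>}"
    have "torsion_free G M"
      unfolding torsion_free_def
    proof (intro ballI allI impI)
      fix x and n :: nat assume "x \<in> M" "n > 0" "x [^] n = \<one>"
      then have "x \<in> N" by (auto simp: N_def)
      then show "x = \<one>" using N1 by simp
    qed
    then show ?thesis using M comm by (simp add: abelian_minimals_def)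
  next
    assume "N = M"
    then have "\<exists>n::nat. n > 0 \<and> x [^] n = \<one>" if "x \<in> M" for x using that by (auto simp: N_def)
    moreover have "comm_group (G\<lparr>carrier := M\<rparr>)"
      using subgroup.subgroup_is_group[OF sM is_group] comm by (intro group.group_comm_groupI) auto
    ultimately show ?thesis by (simp add: torsion_abelian_def nat_pow_consistent[symmetric])
  qed
qed

text \<open>The center of \<open>M\<close> is normal in G, and a proper subgroup of
  \<open>M\<close>.\<close>

lemma nonabelian_minimal_center:
  assumes M: "minimal_normal G M" and nc: "\<not> (\<forall>x\<in>M. \<forall>y\<in>M. x \<otimes> y = y \<otimes> x)"
    and z: "z \<in> M" "\<And>y. y \<in> M \<Longrightarrow> z \<otimes> y = y \<otimes> z"
  shows "z = \<one>"
proof -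
  note nM = minimal_normal_normal[OF M]
  note sM = normal_imp_subgroup[OF nM]
  note cM = subgroup.mem_carrier[OF sM]
  define Z where "Z = {z \<in> M. \<forall>y\<in>M. z \<otimes> y = y \<otimes> z}"
  have ZM: "a \<in> M" "a \<otimes> y = y \<otimes> a" if "a \<in> Z" "y \<in> M" for a y using that by (simp_all add: Z_def)
  have "Z \<lhd> G"
  proof (rule normal_invI)
    show "subgroup Z G"
    proof
      show "Z \<subseteq> carrier G" using cM by (auto simp: Z_def)
      show "\<one> \<in> Z" using cM subgroup.one_closed[OF sM] by (simp add: Z_def)
      show "inv a \<in> Z" if a: "a \<in> Z" for a
      proof -
        have "inv a \<otimes> y = y \<otimes> inv a" if y: "y \<in> M" for y
        proof -
          have c: "a \<in> carrier G" "y \<in> carrier G" using ZM(1)[OF a y] y cM by blast+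
          have "inv a \<otimes> (a \<otimes> y) \<otimes> inv a = inv a \<otimes> (y \<otimes> a) \<otimes> inv a" using ZM(2)[OF a y] by simp
          then show ?thesis using c by (simp add: m_assoc inv_mult_cancel)
        qed
        moreover have "inv a \<in> M" using a subgroup.m_inv_closed[OF sM, of a] unfolding Z_def by blast
        ultimately show ?thesis unfolding Z_def by blast
      qed
      show "a \<otimes> b \<in> Z" if ab: "a \<in> Z" "b \<in> Z" for a b
      proof -
        have "a \<otimes> b \<otimes> y = y \<otimes> (a \<otimes> b)" if y: "y \<in> M" for y
        proof -
          have c: "a \<in> carrier G" "b \<in> carrier G" "y \<in> carrier G"
            using ZM(1)[OF ab(1) y] ZM(1)[OF ab(2) y] y cM by blast+
          have "a \<otimes> b \<otimes> y = a \<otimes> (y \<otimes> b)" using c ZM(2)[OF ab(2) y] by (simp add: m_assoc)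
          also have "\<dots> = y \<otimes> a \<otimes> b" using c ZM(2)[OF ab(1) y] by (simp add: m_assoc[symmetric])
          finally show ?thesis using c by (simp add: m_assoc)
        qed
        moreover have "a \<otimes> b \<in> M" using ab subgroup.m_closed[OF sM, of a b] unfolding Z_def by blast
        ultimately show ?thesis unfolding Z_def by blast
      qed
    qed
    show "g \<otimes> a \<otimes> inv g \<in> Z" if g: "g \<in> carrier G" and a: "a \<in> Z" for g a
    proof -
      have "g \<otimes> a \<otimes> inv g \<otimes> y = y \<otimes> (g \<otimes> a \<otimes> inv g)" if y: "y \<in> M" for y
      proof -
        define y' where "y' = inv g \<otimes> y \<otimes> g"
        have y': "y' \<in> M" using normal_conj_closed[OF nM y inv_closed[OF g]] g by (simp add: y'_def)
        have c: "a \<in> carrier G" "y \<in> carrier G" using cM[OF ZM(1)[OF a y]] cM[OF y] by simp_all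
        have "g \<otimes> a \<otimes> inv g \<otimes> y = g \<otimes> (a \<otimes> y') \<otimes> inv g"
          using c g by (simp add: y'_def m_assoc)
        also have "\<dots> = g \<otimes> (y' \<otimes> a) \<otimes> inv g" using ZM(2)[OF a y'] by simp
        also have "\<dots> = y \<otimes> (g \<otimes> a \<otimes> inv g)"
          using c g by (simp add: y'_def m_assoc inv_mult_cancel)
        finally show ?thesis .
      qed
      moreover have "a \<in> M" using a by (simp add: Z_def)
      ultimately show ?thesis using normal_conj_closed[OF nM _ g] unfolding Z_def by blast
    qed
  qed
  moreover have "Z \<subseteq> M" by (auto simp: Z_def)
  moreover have "Z \<noteq> M" using nc by (auto simp: Z_def)
  ultimately have "Z = {\<one>}" using M unfolding minimal_normal_def by blast
  moreover have "z \<in> Z" using z by (simp add: Z_def)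
  ultimately show ?thesis by simp
qed

end

context cert_setup begin

text \<open>A power of \<open>x M\<close> lying in the domain commutes with \<open>M\<close>, so it
  is central in \<open>M\<close> and hence trivial. Then \<open>r M\<close> divides the exponent,
  and sending \<open>x M\<close> to an \<open>r M\<close>-th root of unity is compatible. The
  enlarged domain still commutes with the other members of \<open>S\<close>, since distinct minimal
  normal subgroups commute.\<close>

lemma exists_nonabelian_certs:
  assumes "finite S" "\<And>M. M \<in> S \<Longrightarrow> minimal_normal G M \<and> \<not> (\<forall>x\<in>M. \<forall>y\<in>M. x \<otimes> y = y \<otimes> x)"
    and xr: "\<And>M. M \<in> S \<Longrightarrow> x M \<in> M \<and> r M \<in> good_primes \<and> (\<forall>k::int. x M [^] k = \<one> \<longrightarrow> int (r M) dvd k)"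
    and D0: "subgroup D0 G" "\<chi>0 \<in> hom (G\<lparr>carrier := D0\<rparr>) (mult_of F)"
    and comm: "\<And>d M y. d \<in> D0 \<Longrightarrow> M \<in> S \<Longrightarrow> y \<in> M \<Longrightarrow> d \<otimes> y = y \<otimes> d"
  shows "\<exists>D \<chi>. subgroup D G \<and> \<chi> \<in> hom (G\<lparr>carrier := D\<rparr>) (mult_of F) \<and> D0 \<subseteq> D \<and>
    (\<forall>d\<in>D0. \<chi> d = \<chi>0 d) \<and> (\<forall>M\<in>S. sat D \<chi> (root_certificate (x M) (r M)))"
  using assms
proof (induction S arbitrary: D0 \<chi>0)
  case empty
  then show ?case by blast
next
  case (insert M S)
  have M: "minimal_normal G M" "\<not> (\<forall>x\<in>M. \<forall>y\<in>M. x \<otimes> y = y \<otimes> x)" using insert.prems(1)[of M] by simp_all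
  have xM: "x M \<in> M" and rM: "r M \<in> good_primes" and ord: "\<And>k::int. x M [^] k = \<one> \<Longrightarrow> int (r M) dvd k"
    using insert.prems(2)[of M] by simp_all
  note D0 = insert.prems(3,4)
  note nM = minimal_normal_normal[OF M(1)]
  have xG: "x M \<in> carrier G" using normal_subset_carrier[OF nM] xM by blast
  obtain \<zeta> where \<zeta>: "\<zeta> \<in> carrier (mult_of F)" "\<zeta> \<noteq> \<one>\<^bsub>mult_of F\<^esub>" "\<zeta> [^]\<^bsub>mult_of F\<^esub> r M = \<one>\<^bsub>mult_of F\<^esub>"
    using good_prime_root[OF rM] by blast
  have c0: "d \<otimes> x M = x M \<otimes> d" if "d \<in> D0" for d using insert.prems(5)[OF that, of M] xM by simp
  have agree: "\<chi>0 (x M [^] k) = \<zeta> [^]\<^bsub>mult_of F\<^esub> k" if k: "x M [^] (k::int) \<in> D0" for k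
  proof -
    have "x M [^] k \<in> M" by (rule subgroup_int_pow_closed[OF normal_imp_subgroup[OF nM] xM])
    moreover have "x M [^] k \<otimes> y = y \<otimes> x M [^] k" if "y \<in> M" for y
      using insert.prems(5)[OF k, of M] that by simp
    ultimately have 1: "x M [^] k = \<one>" by (rule nonabelian_minimal_center[OF M])
    then have "\<zeta> [^]\<^bsub>mult_of F\<^esub> k = \<one>\<^bsub>mult_of F\<^esub>" using ord by (intro H.int_pow_dvd_eq_one[OF \<zeta>(1,3)])
    then show ?thesis using 1 subgroup_hom_one[OF D0] by simp
  qed
  let ?D = "D0 <#> generate G {x M}"
  obtain \<psi> where \<psi>: "subgroup ?D G" "\<psi> \<in> hom (G\<lparr>carrier := ?D\<rparr>) (mult_of F)"
    "\<And>d. d \<in> D0 \<Longrightarrow> \<psi> d = \<chi>0 d" "\<psi> (x M) = \<zeta>" "x M \<in> ?D" "D0 \<subseteq> ?D"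
    using extend_hom_cyclic[OF D0 xG c0 \<zeta>(1) agree] by blast
  have "\<exists>D \<chi>. subgroup D G \<and> \<chi> \<in> hom (G\<lparr>carrier := D\<rparr>) (mult_of F) \<and> ?D \<subseteq> D \<and>
    (\<forall>d\<in>?D. \<chi> d = \<psi> d) \<and> (\<forall>N\<in>S. sat D \<chi> (root_certificate (x N) (r N)))"
  proof (rule insert.IH)
    show "d \<otimes> y = y \<otimes> d" if d: "d \<in> ?D" and N: "N \<in> S" "y \<in> N" for d N y
    proof -
      obtain a g where ag: "a \<in> D0" "g \<in> generate G {x M}" "d = a \<otimes> g" using d by (auto simp: mem_set_mult)
      have N': "minimal_normal G N" "M \<noteq> N" using insert.prems(1)[of N] N(1) insert.hyps(2) by auto
      have yG: "y \<in> carrier G"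
        using normal_subset_carrier[OF minimal_normal_normal[OF N'(1)]] N(2) by blast
      have "x M \<otimes> y = y \<otimes> x M" by (rule minimal_normal_commute[OF M(1) N' xM N(2)])
      then have gy: "g \<otimes> y = y \<otimes> g" using generate_commute[of "{x M}" y g] xG yG ag(2) by blast
      have ay: "a \<otimes> y = y \<otimes> a" using insert.prems(5)[OF ag(1), of N] N by simp
      have c: "a \<in> carrier G" "g \<in> carrier G"
        using subgroup.mem_carrier[OF D0(1) ag(1)] generate_in_carrier[OF _ ag(2)] xG by auto
      have "d \<otimes> y = a \<otimes> (y \<otimes> g)" using c yG gy ag(3) by (simp add: m_assoc)
      also have "\<dots> = y \<otimes> a \<otimes> g" using c yG ay by (simp add: m_assoc[symmetric])
      finally show ?thesis using c yG ag(3) by (simp add: m_assoc)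
    qed
  qed (use insert.prems(1,2) \<psi>(1,2) in auto)
  then obtain D \<chi> where D: "subgroup D G" "\<chi> \<in> hom (G\<lparr>carrier := D\<rparr>) (mult_of F)" "?D \<subseteq> D"
    "\<forall>d\<in>?D. \<chi> d = \<psi> d" "\<forall>N\<in>S. sat D \<chi> (root_certificate (x N) (r N))" by blast
  have "sat D \<chi> (root_certificate (x M) (r M))"
    using D(3,4) \<psi>(4,5) \<zeta> by (intro sat_root_certificate[OF D(1,2)]) auto
  then show ?case using D \<psi>(3,6) by (intro exI[of _ D] exI[of _ \<chi>]) auto
qed

text \<open>The order of the extensions matters. The torsion abelian part comes first, where
  \<open>C\<close> is imposed as kernel; its domain is torsion, as the torsion-free part requires.
  The nonabelian subgroups come last and only need a domain commuting with them.\<close>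

lemma exists_minimal_certs:
  assumes char: "ring_char K \<notin> torsion_primes (G\<lparr>carrier := soc G\<rparr>)"
    and C': "subgroup C (G\<lparr>carrier := A_sub G\<rparr>)"
    and cyc: "locally_cyclic ((G\<lparr>carrier := A_sub G\<rparr>) Mod C)"
    and core: "core G C = {\<one>}"
  obtains \<kappa> where "\<And>M. minimal_normal G M \<Longrightarrow> cert_for M (\<kappa> M)"
    "\<And>S. finite S \<Longrightarrow> S \<subseteq> {M. minimal_normal G M} \<Longrightarrow>
      \<exists>D \<chi>. subgroup D G \<and> \<chi> \<in> hom (G\<lparr>carrier := D\<rparr>) (mult_of F) \<and> (\<forall>M\<in>S. sat D \<chi> (\<kappa> M))"
proof -
  define A where "A = A_sub G"
  define TA where "TA = torsion_minimals"
  define NA where "NA = {M. minimal_normal G M \<and> \<not> (\<forall>x\<in>M. \<forall>y\<in>M. x \<otimes> y = y \<otimes> x)}"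
  let ?AB = "abelian_minimals G"
  have A: "subgroup A G" unfolding A_def by (rule normal_imp_subgroup[OF A_sub_normal])
  have AT: "A = generate G (\<Union>TA)" by (simp add: A_def A_sub_def TA_def)
  note Acomm = A_sub_commute[folded A_def] and Ators = A_sub_torsion[folded A_def]
  have C: "subgroup C G" using incl_subgroup[OF A] C' by (simp add: A_def)
  have CA: "C \<subseteq> A" using subgroup.subset[OF C'] by (simp add: A_def)
  have mn: "minimal_normal G M" if "M \<in> TA \<or> M \<in> ?AB \<or> M \<in> NA" for M
    using that by (auto simp: TA_def NA_def abelian_minimals_def)
  have UG: "\<Union>TA \<subseteq> carrier G" "\<Union>?AB \<subseteq> carrier G" "\<Union>NA \<subseteq> carrier G"
    using mn minimal_normal_normal normal_subset_carrier by blast+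
  have one: "\<one> \<in> M" if "minimal_normal G M" for M using normal_one_mem[OF minimal_normal_normal[OF that]] .
  \<comment> \<open>The characteristic hypothesis enters here: an element of prime order in a
    minimal normal subgroup shows that its order is a good prime.\<close>
  have good: "p \<in> good_primes" if "M \<in> TA \<or> M \<in> ?AB \<or> M \<in> NA" "t \<in> M" "t \<noteq> \<one>" "t [^] p = \<one>" "Factorial_Ring.prime p" for M t p
  proof -
    have "t \<in> soc G" unfolding soc_def using mn[OF that(1)] that(2) by (auto intro: generate.incl)
    then have "p \<in> torsion_primes (G\<lparr>carrier := soc G\<rparr>)"
      using that(3-5) by (auto simp: torsion_primes_def nat_pow_consistent[symmetric])
    then show ?thesis using char that(5) by (auto simp: good_primes_def)
  qed

  \<comment> \<open>As \<open>C\<close> has trivial core, it contains no \<open>M\<close>. An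
    element of \<open>M\<close> outside \<open>C\<close> has a nontrivial value under any character
    with kernel \<open>C\<close>.\<close>
  have "\<forall>M\<in>TA. \<exists>tp. fst tp \<in> M \<and> fst tp \<notin> C \<and> fst tp [^] (snd tp :: nat) = \<one> \<and> Factorial_Ring.prime (snd tp)"
  proof
    fix M assume M: "M \<in> TA"
    then have m: "minimal_normal G M" "torsion_abelian (G\<lparr>carrier := M\<rparr>)" by (simp_all add: TA_def)
    have "\<not> M \<subseteq> C"
    proof
      assume "M \<subseteq> C"
      then have "M \<subseteq> {\<one>}"
        using normal_subset_core[OF subgroup.subset[OF C] minimal_normal_normal[OF m(1)]] core by simp
      then show False using m(1) one[OF m(1)] by (auto simp: minimal_normal_def)
    qed
    then obtain t where "t \<in> M" "t \<notin> C" by blast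
    moreover obtain p where "Factorial_Ring.prime p" "\<forall>x\<in>M. x [^] (p::nat) = \<one>"
      using torsion_abelian_minimal_normal(2)[OF m] by blast
    ultimately show "\<exists>tp. fst tp \<in> M \<and> fst tp \<notin> C \<and> fst tp [^] (snd tp :: nat) = \<one> \<and> Factorial_Ring.prime (snd tp)"
      by (intro exI[of _ "(t, p)"]) simp
  qed
  then obtain tp where "\<forall>M\<in>TA. fst (tp M) \<in> M \<and> fst (tp M) \<notin> C \<and> fst (tp M) [^] (snd (tp M) :: nat) = \<one> \<and>
    Factorial_Ring.prime (snd (tp M))" unfolding bchoice_iff by (rule exE)
  moreover define tt pp where "tt M = fst (tp M)" and "pp M = snd (tp M)" for M
  ultimately have tp: "tt M \<in> M" "tt M \<notin> C" "tt M [^] pp M = \<one>" "Factorial_Ring.prime (pp M)" if "M \<in> TA" for M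
    using that by simp_all
  have ppg: "pp M \<in> good_primes" if "M \<in> TA" for M
    using good[OF disjI1[OF that] tp(1)[OF that] _ tp(3,4)[OF that]] tp(2)[OF that] subgroup.one_closed[OF C] by metis

  obtain \<kappa>2 where \<kappa>2: "\<And>M. M \<in> ?AB \<Longrightarrow> cert_for M (\<kappa>2 M)"
    and \<kappa>2ext: "\<And>S D0 \<chi>0. finite S \<Longrightarrow> S \<subseteq> ?AB \<Longrightarrow> subgroup D0 G \<Longrightarrow>
      \<chi>0 \<in> hom (G\<lparr>carrier := D0\<rparr>) (mult_of F) \<Longrightarrow> (\<And>d. d \<in> D0 \<Longrightarrow> \<exists>n::nat. n > 0 \<and> d [^] n = \<one>) \<Longrightarrow>
      (\<And>d x. d \<in> D0 \<Longrightarrow> x \<in> generate G (\<Union>?AB) \<Longrightarrow> d \<otimes> x = x \<otimes> d) \<Longrightarrow>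
      \<exists>D \<chi>. subgroup D G \<and> \<chi> \<in> hom (G\<lparr>carrier := D\<rparr>) (mult_of F) \<and> D0 \<subseteq> D \<and>
        D \<subseteq> D0 <#> generate G (\<Union>?AB) \<and> (\<forall>d\<in>D0. \<chi> d = \<chi>0 d) \<and> (\<forall>M\<in>S. sat D \<chi> (\<kappa>2 M))"
    using exists_abelian_minimals_certs by blast

  have "\<forall>M\<in>NA. \<exists>xr. fst xr \<in> M \<and> snd xr \<in> good_primes \<and> (\<forall>k::int. fst xr [^] k = \<one> \<longrightarrow> int (snd xr) dvd k)"
  proof
    fix M assume M: "M \<in> NA"
    have m: "minimal_normal G M" using mn M by blast
    obtain y where y: "y \<in> M" "y \<noteq> \<one>" using m one[OF m] by (auto simp: minimal_normal_def)
    have yG: "y \<in> carrier G" using y(1) M UG(3) by blast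
    show "\<exists>xr. fst xr \<in> M \<and> snd xr \<in> good_primes \<and> (\<forall>k::int. fst xr [^] k = \<one> \<longrightarrow> int (snd xr) dvd k)"
    proof (cases "ord y = 0")
      \<comment> \<open>For \<open>y\<close> of infinite order only the exponent 0 gives the
        identity, so every good prime works.\<close>
      case True
      obtain r where "r \<in> good_primes" using infinite_good_primes by (metis ex_in_conv finite.emptyI)
      then show ?thesis using y(1) yG True by (intro exI[of _ "(y, r)"]) (simp add: int_pow_eq_id)
    next
      case False
      obtain p k :: nat where p: "Factorial_Ring.prime p" and yk: "y [^] k \<noteq> \<one>" "(y [^] k) [^] p = \<one>"
        by (rule exists_prime_order_pow[OF yG y(2) False])
      have "y [^] int k \<in> M"
        by (rule subgroup_int_pow_closed[OF normal_imp_subgroup[OF minimal_normal_normal[OF m]] y(1)])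
      then have ykM: "y [^] k \<in> M" by (simp add: int_pow_int)
      have "p \<in> good_primes" by (rule good[OF _ ykM yk p]) (use M in blast)
      then show ?thesis
        using ykM root_of_unity_pow_eq_one[OF nat_pow_closed[OF yG] yk(2,1) p] by (intro exI[of _ "(y [^] k, p)"]) simp
    qed
  qed
  then obtain xr where "\<forall>M\<in>NA. fst (xr M) \<in> M \<and> snd (xr M) \<in> good_primes \<and>
    (\<forall>k::int. fst (xr M) [^] k = \<one> \<longrightarrow> int (snd (xr M)) dvd k)" unfolding bchoice_iff by (rule exE)
  moreover define xx rr where "xx M = fst (xr M)" and "rr M = snd (xr M)" for M
  ultimately have xr: "xx M \<in> M \<and> rr M \<in> good_primes \<and> (\<forall>k::int. xx M [^] k = \<one> \<longrightarrow> int (rr M) dvd k)"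
    if "M \<in> NA" for M
    using that by simp

  define \<kappa> where "\<kappa> M = (if M \<in> NA then root_certificate (xx M) (rr M) else
    if M \<in> ?AB then \<kappa>2 M else root_certificate (tt M) (pp M))" for M
  have ABNA: "M \<notin> NA" if "M \<in> ?AB" for M using that by (auto simp: NA_def abelian_minimals_def)
  have TANA: "M \<notin> NA" if "M \<in> TA" for M
    using that torsion_abelian_minimal_normal(1)[of M] unfolding NA_def TA_def by blast
  have TAAB: "M \<notin> ?AB" if M: "M \<in> TA" for M
  proof
    assume "M \<in> ?AB"
    moreover have "tt M \<noteq> \<one>" using tp(2)[OF M] subgroup.one_closed[OF C] by metis
    ultimately show False
      using tp(1,3)[OF M] prime_gt_0_nat[OF tp(4)[OF M]] by (auto simp: abelian_minimals_def torsion_free_def)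
  qed
  have classes: "M \<in> TA \<or> M \<in> ?AB \<or> M \<in> NA" if "minimal_normal G M" for M
    using minimal_normal_cases[OF that] that by (auto simp: TA_def NA_def)
  have comm: "x \<otimes> y = y \<otimes> x" if "M \<in> TA \<and> N \<in> ?AB \<or> M \<in> TA \<and> N \<in> NA \<or> M \<in> ?AB \<and> N \<in> NA" "x \<in> M" "y \<in> N" for M N x y
    using that ABNA TANA TAAB mn by (intro minimal_normal_commute[of M N]) auto
  have AAB: "x \<otimes> y = y \<otimes> x" if "x \<in> A" "y \<in> generate G (\<Union>?AB)" for x y
    by (rule generate_commute2[OF UG(1,2) _ that(1)[unfolded AT] that(2)]) (use comm in blast)
  show thesis
  proof (rule that[of \<kappa>])
    show "cert_for M (\<kappa> M)" if m: "minimal_normal G M" for M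
    proof -
      note s = normal_imp_subgroup[OF minimal_normal_normal[OF m]]
      consider "M \<in> NA" | "M \<in> ?AB" | "M \<in> TA" using classes[OF m] by blast
      then show ?thesis
      proof cases
        case 1
        then show ?thesis using xr[OF 1] by (auto simp: \<kappa>_def intro!: cert_for_root_certificate[OF s])
      next
        case 2
        then show ?thesis using \<kappa>2[OF 2] ABNA[OF 2] by (simp add: \<kappa>_def)
      next
        case 3
        then show ?thesis using tp(1)[OF 3] ppg[OF 3] TANA[OF 3] TAAB[OF 3]
          by (auto simp: \<kappa>_def intro!: cert_for_root_certificate[OF s])
      qed
    qed
    fix S assume S: "finite S" "S \<subseteq> {M. minimal_normal G M}"
    have "\<exists>D \<chi>. subgroup D G \<and> C \<subseteq> D \<and> D \<subseteq> A \<and> tt ` (S \<inter> TA) \<subseteq> D \<and>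
      \<chi> \<in> hom (G\<lparr>carrier := D\<rparr>) (mult_of F) \<and> (\<forall>d\<in>D. \<chi> d = \<one>\<^bsub>mult_of F\<^esub> \<longleftrightarrow> d \<in> C)"
    proof (rule exists_hom_with_kernel[OF A Acomm C CA])
      fix x m assume xm: "x \<in> A" "m \<in> A"
      interpret A: comm_group "G\<lparr>carrier := A\<rparr>" using A_sub_comm_group by (simp add: A_def)
      have "\<exists>z\<in>A. \<forall>s\<in>{x, m}. \<exists>c\<in>C. \<exists>k::int. s = c \<otimes> z [^]\<^bsub>G\<lparr>carrier := A\<rparr>\<^esub> k"
        using A.locally_cyclic_Mod_iff[OF C'[folded A_def], THEN iffD1, OF cyc[folded A_def], rule_format, of "{x, m}"] xm
        by simp
      then obtain z where z: "z \<in> A" "\<forall>s\<in>{x, m}. \<exists>c\<in>C. \<exists>k::int. s = c \<otimes> z [^] k"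
        using int_pow_consistent[OF A] by metis
      then show "\<exists>z\<in>A. (\<exists>c\<in>C. \<exists>k::int. x = c \<otimes> z [^] k) \<and> (\<exists>c\<in>C. \<exists>k::int. m = c \<otimes> z [^] k)" by blast
    next
      show "finite (tt ` (S \<inter> TA))" using S(1) by simp
      show "tt ` (S \<inter> TA) \<subseteq> A" using tp(1) by (auto simp: AT intro!: generate.incl)
    next
      fix t assume "t \<in> tt ` (S \<inter> TA)"
      then obtain M where M: "M \<in> TA" "t = tt M" by blast
      show "\<exists>p. Factorial_Ring.prime (p::nat) \<and> t [^] p = \<one> \<and>
         (\<exists>\<zeta>\<in>carrier (mult_of F). \<zeta> \<noteq> \<one>\<^bsub>mult_of F\<^esub> \<and> \<zeta> [^]\<^bsub>mult_of F\<^esub> p = \<one>\<^bsub>mult_of F\<^esub>)"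
        using tp(3,4)[OF M(1)] good_prime_root[OF ppg[OF M(1)]] M(2) by blast
    qed
    then obtain D1 \<chi>1 where D1: "subgroup D1 G" "\<chi>1 \<in> hom (G\<lparr>carrier := D1\<rparr>) (mult_of F)"
      and D1A: "D1 \<subseteq> A" and tD1: "tt ` (S \<inter> TA) \<subseteq> D1"
      and ker: "\<forall>d\<in>D1. \<chi>1 d = \<one>\<^bsub>mult_of F\<^esub> \<longleftrightarrow> d \<in> C" by blast
    have "\<exists>D \<chi>. subgroup D G \<and> \<chi> \<in> hom (G\<lparr>carrier := D\<rparr>) (mult_of F) \<and> D1 \<subseteq> D \<and>
        D \<subseteq> D1 <#> generate G (\<Union>?AB) \<and> (\<forall>d\<in>D1. \<chi> d = \<chi>1 d) \<and> (\<forall>M\<in>S \<inter> ?AB. sat D \<chi> (\<kappa>2 M))"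
      using S(1) D1 D1A Ators AAB by (intro \<kappa>2ext) auto
    then obtain D2 \<chi>2 where D2: "subgroup D2 G" "\<chi>2 \<in> hom (G\<lparr>carrier := D2\<rparr>) (mult_of F)"
      and D12: "D1 \<subseteq> D2" and D2sub: "D2 \<subseteq> D1 <#> generate G (\<Union>?AB)" and \<chi>12: "\<forall>d\<in>D1. \<chi>2 d = \<chi>1 d"
      and sat2: "\<forall>M\<in>S \<inter> ?AB. sat D2 \<chi>2 (\<kappa>2 M)" by blast
    have c2: "d \<otimes> y = y \<otimes> d" if d: "d \<in> D2" and M: "M \<in> NA" "y \<in> M" for d M y
    proof -
      have yG: "y \<in> carrier G" using M UG(3) by blast
      have "d \<in> D1 <#> generate G (\<Union>?AB)" by (rule subsetD[OF D2sub d])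
      then obtain a b where ab: "a \<in> D1" "b \<in> generate G (\<Union>?AB)" "d = a \<otimes> b"
        unfolding mem_set_mult by blast
      have "a \<in> generate G (\<Union>TA)" using ab(1) D1A AT by blast
      then have ay: "a \<otimes> y = y \<otimes> a" by (rule generate_commute[OF UG(1) yG, rotated]) (use comm M in blast)
      have "b \<otimes> y = y \<otimes> b" by (rule generate_commute[OF UG(2) yG _ ab(2)]) (use comm M in blast)
      moreover have c: "a \<in> carrier G" "b \<in> carrier G"
        using subgroup.mem_carrier[OF D1(1) ab(1)] generate_in_carrier[OF UG(2) ab(2)] by auto
      ultimately have "d \<otimes> y = a \<otimes> (y \<otimes> b)" using yG ab(3) by (simp add: m_assoc)
      also have "\<dots> = y \<otimes> a \<otimes> b" using c yG ay by (simp add: m_assoc[symmetric])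
      finally show ?thesis using c yG ab(3) by (simp add: m_assoc)
    qed
    have "\<exists>D \<chi>. subgroup D G \<and> \<chi> \<in> hom (G\<lparr>carrier := D\<rparr>) (mult_of F) \<and> D2 \<subseteq> D \<and>
      (\<forall>d\<in>D2. \<chi> d = \<chi>2 d) \<and> (\<forall>M\<in>S \<inter> NA. sat D \<chi> (root_certificate (xx M) (rr M)))"
    proof (rule exists_nonabelian_certs[OF _ _ _ D2])
      show "minimal_normal G M \<and> \<not> (\<forall>x\<in>M. \<forall>y\<in>M. x \<otimes> y = y \<otimes> x)" if "M \<in> S \<inter> NA" for M
        using that by (simp add: NA_def)
    qed (use S(1) xr c2 in auto)
    then obtain D \<chi> where D: "subgroup D G" "\<chi> \<in> hom (G\<lparr>carrier := D\<rparr>) (mult_of F)" and D2D: "D2 \<subseteq> D"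
      and \<chi>2: "\<forall>d\<in>D2. \<chi> d = \<chi>2 d" and sat3: "\<forall>M\<in>S \<inter> NA. sat D \<chi> (root_certificate (xx M) (rr M))" by blast
    have "sat D \<chi> (\<kappa> M)" if M: "M \<in> S" for M
    proof -
      consider "M \<in> NA" | "M \<in> ?AB" | "M \<in> TA" using classes M S(2) by blast
      then show ?thesis
      proof cases
        case 1
        then show ?thesis using sat3 M by (simp add: \<kappa>_def)
      next
        case 2
        then have "sat D2 \<chi>2 (\<kappa>2 M)" using sat2 M by blast
        then show ?thesis using sat_mono[OF _ D2D D] \<chi>2 2 ABNA[OF 2] by (simp add: \<kappa>_def)
      next
        case 3
        have t1: "tt M \<in> D1" using tD1 M 3 by blast
        have G: "tt M \<in> carrier G" using tp(1)[OF 3] 3 UG(1) by blast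
        have v: "\<chi> (tt M) = \<chi>1 (tt M)" using t1 D12 \<chi>2 \<chi>12 by (metis subsetD)
        have tD: "tt M \<in> D" using t1 D12 D2D by blast
        have "\<chi> (tt M) \<noteq> \<one>\<^bsub>F\<^esub>" using ker t1 tp(2)[OF 3] v by simp
        moreover have "\<chi> (tt M) [^]\<^bsub>mult_of F\<^esub> pp M = \<one>\<^bsub>F\<^esub>"
          using subgroup_hom_pow[OF D tD, of "pp M"] tp(3)[OF 3] subgroup_hom_one[OF D] by simp
        ultimately have "sat D \<chi> (root_certificate (tt M) (pp M))" by (rule sat_root_certificate[OF D tD])
        then show ?thesis using TANA[OF 3] TAAB[OF 3] by (simp add: \<kappa>_def)
      qed
    qed
    then show "\<exists>D \<chi>. subgroup D G \<and> \<chi> \<in> hom (G\<lparr>carrier := D\<rparr>) (mult_of F) \<and> (\<forall>M\<in>S. sat D \<chi> (\<kappa> M))"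
      using D by blast
  qed
qed

end

section \<open>The equivalence\<close>

lemma (in group_representation) kernel_normal: "{g \<in> carrier G. \<forall>x\<in>carrier V. \<rho> g x = x} \<lhd> G"
proof -
  interpret G: group G using group_hom group_hom.axioms(1) by blast
  let ?N = "{g \<in> carrier G. \<forall>x\<in>carrier V. \<rho> g x = x}"
  have one: "\<rho> \<one>\<^bsub>G\<^esub> x = x" if "x \<in> carrier V" for x using id_eq_one that by (metis restrict_apply')
  have mul: "\<rho> (g \<otimes>\<^bsub>G\<^esub> h) x = \<rho> g (\<rho> h x)" if "g \<in> carrier G" "h \<in> carrier G" "x \<in> carrier V" for g h x
    using composition_rule that by blast
  have inv: "\<rho> (inv\<^bsub>G\<^esub> g) (\<rho> g x) = x" if "g \<in> carrier G" "x \<in> carrier V" for g x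
    using mul[of "inv\<^bsub>G\<^esub> g" g x] one that by simp
  have inv': "\<rho> g (\<rho> (inv\<^bsub>G\<^esub> g) x) = x" if "g \<in> carrier G" "x \<in> carrier V" for g x
    using mul[of g "inv\<^bsub>G\<^esub> g" x] one that by simp
  show ?thesis
  proof (rule G.normal_invI)
    show "subgroup ?N G"
    proof
      show "inv\<^bsub>G\<^esub> g \<in> ?N" if "g \<in> ?N" for g
        using that inv[of g] by auto
    qed (use one mul in auto)
    show "g \<otimes>\<^bsub>G\<^esub> n \<otimes>\<^bsub>G\<^esub> inv\<^bsub>G\<^esub> g \<in> ?N" if "g \<in> carrier G" "n \<in> ?N" for g n
      using that inv' by (simp add: mul action_closed)
  qed
qed

theorem locally_cyclic_imp_faithful_irreducible:
  fixes G :: "('g, 'm) monoid_scheme" and K :: "('k, 'l) ring_scheme"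
  assumes "group G" and "field K" and ess: "essential G (soc G)"
    and char: "ring_char K \<notin> torsion_primes (G\<lparr>carrier := soc G\<rparr>)"
    and C: "subgroup C (G\<lparr>carrier := A_sub G\<rparr>)" "locally_cyclic ((G\<lparr>carrier := A_sub G\<rparr>) Mod C)"
      "core G C = {\<one>\<^bsub>G\<^esub>}"
  shows "has_faithful_irreducible_rep G K"
proof -
  interpret group G by fact
  interpret K: field K by fact
  \<comment> \<open>The closure only supplies values for the characters. The representation below
    remains one over \<open>K\<close>.\<close>
  let ?F = "field.alg_closure K"
  interpret F: algebraic_closure ?F "ring.indexed_const K ` carrier K" by (rule K.alg_closureE(1))
  interpret cert_setup G K ?F "ring.indexed_const K"
    by unfold_locales (rule K.alg_closureE(2))
  obtain \<kappa> where \<kappa>: "\<And>M. minimal_normal G M \<Longrightarrow> cert_for M (\<kappa> M)"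
    and sat: "\<And>S. finite S \<Longrightarrow> S \<subseteq> {M. minimal_normal G M} \<Longrightarrow>
      \<exists>D \<chi>. subgroup D G \<and> \<chi> \<in> hom (G\<lparr>carrier := D\<rparr>) (mult_of ?F) \<and> (\<forall>M\<in>S. sat D \<chi> (\<kappa> M))"
    using exists_minimal_certs[OF char C] by blast
  have mG: "M \<subseteq> carrier G" if "minimal_normal G M" for M
    using normal_subset_carrier[OF minimal_normal_normal[OF that]] .
  have 1: "set (fst (\<kappa> M)) \<subseteq> carrier G \<times> carrier G \<and> snd (\<kappa> M) \<in> carrier K - {\<zero>\<^bsub>K\<^esub>}"
    if "M \<in> {M. minimal_normal G M}" for M
    using \<kappa>[of M] mG[of M] that by (auto simp: cert_for_def)
  have "\<exists>(V :: ('k, ('g set set \<times> 'g \<Rightarrow> (('k list \<times> nat) multiset \<Rightarrow> 'k)) set) module) \<rho>.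
    group_representation G K V \<rho> \<and> irreducible_rep G K V \<rho> \<and>
    (\<forall>M\<in>{M. minimal_normal G M}. \<exists>(g, m)\<in>set (fst (\<kappa> M)). \<exists>x\<in>carrier V. \<rho> m x \<noteq> x)"
    by (rule certificates_imp_representation[OF \<open>group G\<close> \<open>field K\<close> F.field_axioms
          K.alg_closureE(2) 1 sat]) blast+
  then obtain V :: "('k, ('g set set \<times> 'g \<Rightarrow> (('k list \<times> nat) multiset \<Rightarrow> 'k)) set) module" and \<rho>
    where V: "group_representation G K V \<rho>" "irreducible_rep G K V \<rho>"
      "\<And>M. M \<in> {M. minimal_normal G M} \<Longrightarrow> \<exists>(g, m)\<in>set (fst (\<kappa> M)). \<exists>x\<in>carrier V. \<rho> m x \<noteq> x"
    by blast
  interpret V: group_representation G K V \<rho> by (rule V(1))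
  define N where "N = {g \<in> carrier G. \<forall>x\<in>carrier V. \<rho> g x = x}"
  have N: "N \<lhd> G" unfolding N_def by (rule V.kernel_normal)
  have "N = {\<one>\<^bsub>G\<^esub>}"
  proof (rule ccontr)
    assume "N \<noteq> {\<one>\<^bsub>G\<^esub>}"
    \<comment> \<open>A nontrivial kernel meets the essential socle in a nontrivial normal subgroup,
      which contains some minimal normal \<open>M\<close>; the certificate of \<open>M\<close>
      yields an element of \<open>M\<close> that moves a vector.\<close>
    then have "N \<inter> soc G \<noteq> {\<one>\<^bsub>G\<^esub>}" using ess N unfolding essential_def by blast
    moreover have "N \<inter> soc G \<lhd> G" using ess N normal_subgroup_intersect unfolding essential_def by blast
    ultimately obtain M where M: "minimal_normal G M" "M \<subseteq> N"
      using normal_subset_soc_contains_minimal[of "N \<inter> soc G"] by blast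
    obtain g m x where gm: "(g, m) \<in> set (fst (\<kappa> M))" and x: "x \<in> carrier V" "\<rho> m x \<noteq> x"
      using V(3)[of M] M(1) by blast
    have "m \<in> M" using \<kappa>[OF M(1)] gm by (auto simp: cert_for_def)
    then show False using M(2) x by (auto simp: N_def)
  qed
  then have "faithful_rep G V \<rho>" by (auto simp: faithful_rep_def N_def)
  \<comment> \<open>The vectors of \<open>V\<close> are cosets of functions on another type. The
    lemma on independence of the type of vectors transports the structure.\<close>
  then show ?thesis using V(2) by (rule V.has_faithful_irreducible_repI)
qed

theorem theorem1p1:
  fixes G :: "('g, 'm) monoid_scheme" and K :: "('k, 'l) ring_scheme"
  assumes "group G" and "field K"
    and "essential G (soc G)"
    and "ring_char K \<notin> torsion_primes (G\<lparr>carrier := soc G\<rparr>)"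
  shows "has_faithful_irreducible_rep G K \<longleftrightarrow>
    (\<exists>C. subgroup C (G\<lparr>carrier := A_sub G\<rparr>) \<and>
         locally_cyclic ((G\<lparr>carrier := A_sub G\<rparr>) Mod C) \<and>
         core G C = {\<one>\<^bsub>G\<^esub>})"
proof
  assume "has_faithful_irreducible_rep G K"
  then show "\<exists>C. subgroup C (G\<lparr>carrier := A_sub G\<rparr>) \<and>
      locally_cyclic ((G\<lparr>carrier := A_sub G\<rparr>) Mod C) \<and> core G C = {\<one>\<^bsub>G\<^esub>}"
    unfolding has_faithful_irreducible_rep_def
    using group_representation.faithful_irreducible_imp_locally_cyclic assms(4) by blast
next
  assume "\<exists>C. subgroup C (G\<lparr>carrier := A_sub G\<rparr>) \<and>
      locally_cyclic ((G\<lparr>carrier := A_sub G\<rparr>) Mod C) \<and> core G C = {\<one>\<^bsub>G\<^esub>}"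
  then show "has_faithful_irreducible_rep G K"
    using locally_cyclic_imp_faithful_irreducible[OF assms] by blast
qed

end
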